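(* Let $\mathcal{U}_1=(u_{11},u_{12},u_{13})$ and $\mathcal{U}_2=(u_{21},u_{22},u_{23})$ be the solutions of the coupled semilinear system, for $j=1,2$, \begin{align*} &\partial_t^2u_{ji}-c_{i,j}^2(x)\Delta u_{ji}=|\mathcal{U}_j|^2+f_i(t,x)\quad\text{in }(0,T)\times\Omega',\quad i=1,2,3,\\ &\mathcal{U}_j(0,x)=b_0(x),\quad \partial_t\mathcal{U}_j(0,x)=b_1(x)\quad\text{in }\Omega',\qquad \mathcal{U}_j|_{(0,T)\times\partial\Omega'}=0, \end{align*} with distinct sound speed coefficients $c_{i,1}$ and $c_{i,2}$, where $c_{i,1}^2,c_{i,2}^2\in\mathcal{A}_0^3$ for $i=1,2,3$. Let $\Lambda_1,\Lambda_2$ be the associated nonlinear source-to-solution maps, defined on the data $F=\epsilon F_1$ with $\epsilon\in(0,\epsilon_1)$, $\|F_1\|_*\le 1$, and $F_1$ independent of $\epsilon$. Let $\Lambda_1^{lin},\Lambda_2^{lin}$ be the associated linear source-to-solution maps, defined on the data $F_1$ with $\|F_1\|_*\le 1$. If $\Lambda_1=\Lambda_2$ on $[0,T]\times\partial\Omega$ (that is, $\Lambda_1(\epsilon F_1)=\Lambda_2(\epsilon F_1)$ for all such $\epsilon$ and $F_1$), then $\Lambda_1^{lin}=\Lambda_2^{lin}$ on $[0,T]\times\partial\Omega$ (that is, $\Lambda_1^{lin}(F_1)=\Lambda_2^{lin}(F_1)$ for all such $F_1$).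
   Context: Domains: $\Omega\subset\mathbb{R}^3$ is a bounded Lipschitz domain with boundary $\partial\Omega$, and $\Omega'\subset\mathbb{R}^3$ is a larger (bounded) domain containing $\overline{\Omega}$. The surface $\partial\Omega$ is only the place where solutions are measured; it is not a boundary for the waves. Sobolev norms: for $m\in\mathbb{N}$, $\|f\|_{H^m}^2=\sum_{|i|=1}^m\int(|\nabla^i f|^2+|f|^2)\,dx$ ($i$ a multi-index), an equivalent form of the usual Sobolev norm. $H^m(\Omega')^3$ denotes $\mathbb{R}^3$-valued functions. Sound speeds: fix nonzero constants $m_1\ge m_0$ ($m_0>0$). For an integer $s$ with $s-1>3/2$, $$\mathcal{A}_0^s=\{c^2(x):\ m_1\ge c^2(x)\ge m_0\ \ \forall x\in\overline{\Omega},\ c^2\in C^s(\overline{\Omega})\}.$$ Each sound speed is assumed extended smoothly outside $\overline\Omega$ so that it is $\equiv 1$ outside some ball $B_R(0)\supset\overline\Omega$. Data: $F=(b_0,b_1,f)$ with $b_0,b_1,f(t,\cdot)$ $\mathbb{R}^3$-valued on $\Omega'$. Only data of the form $F=\epsilon F_1=\epsilon(b_0',b_1',f_1)$ are used, with $F_1$ independent of $\epsilon$ and $$\|F_1\|_*=\|b_0'\|_{H^3(\Omega')^3}+\|b_1'\|_{H^2(\Omega')^3}+\|f_1\|_{L^2([0,T];H^2(\Omega')^3)}\le 1.$$ Nonlinear map: for given sound speeds $c_1,c_2,c_3$, $\Lambda(b_0,b_1,f)=(u_1,u_2,u_3)|_{[0,T]\times\partial\Omega}\in L^2([0,T];L^2(\partial\Omega)^3)$,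 where $u=(u_1,u_2,u_3)\in C([0,T];H^3(\Omega')^3)\cap C^1([0,T];H^2(\Omega')^3)$ is the solution of $\partial_t^2u_i-c_i^2\Delta u_i=|u|^2+f_i$ in $(0,T)\times\Omega'$ ($i=1,2,3$), $u(0,\cdot)=b_0$, $\partial_tu(0,\cdot)=b_1$, $u=0$ on $(0,T)\times\partial\Omega'$; here $|u|^2=u_1^2+u_2^2+u_3^2$. Linear map: $\Lambda^{lin}(b_0,b_1,f)=(u_1,u_2,u_3)|_{[0,T]\times\partial\Omega}$, where $u$ solves the same problem with the nonlinear term $|u|^2$ replaced by $0$. Time scale: $T_0(\epsilon)$ is the maximal time for which the nonlinear problem is well posed (unique solution in $C([0,T];H^3(\Omega')^3)\cap C^1([0,T];H^2(\Omega')^3)$) for all data $\epsilon F_1$ with $\|F_1\|_*\le1$. Some $\epsilon_1\in(0,1)$ is fixed, and $T$ is a fixed finite time, independent of $\epsilon$, with $T<T_0(\epsilon_1)$ (for both systems). *)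

theory Defs
  imports "HOL-Analysis.Analysis"
begin

type_synonym space = "real^3"

section \<open>Classical differentiability\<close>

definition partial :: "'a::euclidean_space \<Rightarrow> ('a \<Rightarrow> real) \<Rightarrow> 'a \<Rightarrow> real" where
  "partial b f x = frechet_derivative f (at x) b"

text \<open>Meant for open sets.\<close>

fun C_k_on :: "nat \<Rightarrow> 'a::euclidean_space set \<Rightarrow> ('a \<Rightarrow> real) \<Rightarrow> bool" where
  "C_k_on 0 S f \<longleftrightarrow> continuous_on S f"
| "C_k_on (Suc k) S f \<longleftrightarrow> f differentiable_on S \<and> (\<forall>b\<in>Basis. C_k_on k S (partial b f))"

definition test_function :: "'a::euclidean_space set \<Rightarrow> ('a \<Rightarrow> real) \<Rightarrow> bool" where
  "test_function S \<phi> \<longleftrightarrow>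
     (\<forall>k. C_k_on k UNIV \<phi>) \<and> compact (closure {x. \<phi> x \<noteq> 0}) \<and> closure {x. \<phi> x \<noteq> 0} \<subseteq> S"

type_synonym multiindex = "3 \<Rightarrow> nat"

definition mi_order :: "multiindex \<Rightarrow> nat" where
  "mi_order \<alpha> = (\<Sum>k\<in>UNIV. \<alpha> k)"

definition partials :: "multiindex \<Rightarrow> (space \<Rightarrow> real) \<Rightarrow> space \<Rightarrow> real" where
  "partials \<alpha> f =
     (partial (axis 1 1) ^^ \<alpha> 1) ((partial (axis 2 1) ^^ \<alpha> 2) ((partial (axis 3 1) ^^ \<alpha> 3) f))"

text \<open>\<open>C\<^sup>k\<close> up to the boundary of a bounded open set: the derivatives of order at most \<open>k\<close>
  extend continuously to the closure, i.e. they are uniformly continuous on \<open>S\<close>.\<close>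

definition C_k_closure :: "nat \<Rightarrow> space set \<Rightarrow> (space \<Rightarrow> real) \<Rightarrow> bool" where
  "C_k_closure k S f \<longleftrightarrow> C_k_on k S f \<and> continuous_on (closure S) f \<and>
     (\<forall>\<alpha>. mi_order \<alpha> \<le> k \<longrightarrow> uniformly_continuous_on S (partials \<alpha> f))"

section \<open>Domains\<close>

definition bounded_domain :: "space set \<Rightarrow> bool" where
  "bounded_domain S \<longleftrightarrow> open S \<and> connected S \<and> S \<noteq> {} \<and> bounded S"

text \<open>Near each boundary point, in suitable orthogonal coordinates, the set is the part of a ball
  lying above a Lipschitz graph. Translations are absorbed in \<open>\<gamma>\<close>.\<close>

definition lipschitz_boundary :: "space set \<Rightarrow> bool" where
  "lipschitz_boundary S \<longleftrightarrow>
     (\<forall>p\<in>frontier S. \<exists>(Q :: space \<Rightarrow> space) (\<gamma> :: real^2 \<Rightarrow> real) L r.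
        orthogonal_transformation Q \<and> L-lipschitz_on UNIV \<gamma> \<and> 0 < r \<and>
        S \<inter> ball p r = {x \<in> ball p r. \<gamma> (vector [Q x $ 1, Q x $ 2]) < Q x $ 3})"

section \<open>Sobolev spaces\<close>

definition locally_integrable :: "space set \<Rightarrow> (space \<Rightarrow> real) \<Rightarrow> bool" where
  "locally_integrable S f \<longleftrightarrow> (\<forall>K. compact K \<and> K \<subseteq> S \<longrightarrow> f absolutely_integrable_on K)"

definition is_weak_deriv ::
    "space set \<Rightarrow> multiindex \<Rightarrow> (space \<Rightarrow> real) \<Rightarrow> (space \<Rightarrow> real) \<Rightarrow> bool" where
  "is_weak_deriv S \<alpha> f g \<longleftrightarrow> locally_integrable S f \<and> locally_integrable S g \<and>
     (\<forall>\<phi>. test_function S \<phi> \<longrightarrow>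
        (LINT x|lebesgue_on S. f x * partials \<alpha> \<phi> x) =
        (-1) ^ mi_order \<alpha> * (LINT x|lebesgue_on S. g x * \<phi> x))"

text \<open>Weak derivatives are unique up to null sets; \<open>weak_deriv\<close> picks a representative.\<close>

definition weak_deriv :: "space set \<Rightarrow> multiindex \<Rightarrow> (space \<Rightarrow> real) \<Rightarrow> space \<Rightarrow> real" where
  "weak_deriv S \<alpha> f = (SOME g. is_weak_deriv S \<alpha> f g)"

definition square_integrable :: "space set \<Rightarrow> (space \<Rightarrow> real) \<Rightarrow> bool" where
  "square_integrable S f \<longleftrightarrow>
     f \<in> borel_measurable (lebesgue_on S) \<and> integrable (lebesgue_on S) (\<lambda>x. (f x)\<^sup>2)"

definition sobolev :: "nat \<Rightarrow> space set \<Rightarrow> (space \<Rightarrow> real) set" where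
  "sobolev m S = {f. square_integrable S f \<and>
     (\<forall>\<alpha>. mi_order \<alpha> \<le> m \<longrightarrow> (\<exists>g. is_weak_deriv S \<alpha> f g \<and> square_integrable S g))}"

text \<open>A form of the \<open>H\<^sup>m\<close> norm, for \<open>m \<ge> 1\<close>, in which \<open>|f|\<^sup>2\<close> is repeated for every multi-index
  of order between 1 and \<open>m\<close>; it is equivalent to the usual one.\<close>

definition sobolev_norm_sq :: "nat \<Rightarrow> space set \<Rightarrow> (space \<Rightarrow> real) \<Rightarrow> real" where
  "sobolev_norm_sq m S f =
     (\<Sum>\<alpha> | 1 \<le> mi_order \<alpha> \<and> mi_order \<alpha> \<le> m.
        LINT x|lebesgue_on S. (weak_deriv S \<alpha> f x)\<^sup>2 + (f x)\<^sup>2)"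

definition vsobolev :: "nat \<Rightarrow> space set \<Rightarrow> (space \<Rightarrow> real^3) set" where
  "vsobolev m S = {f. \<forall>i. (\<lambda>x. f x $ i) \<in> sobolev m S}"

definition vsobolev_norm :: "nat \<Rightarrow> space set \<Rightarrow> (space \<Rightarrow> real^3) \<Rightarrow> real" where
  "vsobolev_norm m S f = sqrt (\<Sum>i\<in>UNIV. sobolev_norm_sq m S (\<lambda>x. f x $ i))"

text \<open>\<open>H\<^sup>1\<^sub>0(S)\<^sup>3\<close>, the meaning of a zero boundary value on an arbitrary bounded domain.\<close>

definition vsobolev_zero :: "space set \<Rightarrow> (space \<Rightarrow> real^3) set" where
  "vsobolev_zero S = {f \<in> vsobolev 1 S. \<exists>\<phi>.
     (\<forall>n i. test_function S (\<lambda>x. \<phi> n x $ i)) \<and>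
     (\<lambda>n::nat. vsobolev_norm 1 S (\<lambda>x. \<phi> n x - f x)) \<longlonglongrightarrow> 0}"

definition weak_laplacian :: "space set \<Rightarrow> (space \<Rightarrow> real) \<Rightarrow> space \<Rightarrow> real" where
  "weak_laplacian S f x = (\<Sum>k\<in>UNIV. weak_deriv S (\<lambda>l. if l = k then 2 else 0) f x)"

section \<open>Functions of time with values in a Sobolev space\<close>

definition continuous_in_time ::
    "nat \<Rightarrow> space set \<Rightarrow> real \<Rightarrow> (real \<Rightarrow> space \<Rightarrow> real^3) \<Rightarrow> bool" where
  "continuous_in_time m S T u \<longleftrightarrow>
     (\<forall>t\<in>{0..T}. u t \<in> vsobolev m S \<and>
        ((\<lambda>s. vsobolev_norm m S (\<lambda>x. u s x - u t x)) \<longlongrightarrow> 0) (at t within {0..T}))"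

definition is_time_derivative ::
    "nat \<Rightarrow> space set \<Rightarrow> real \<Rightarrow> (real \<Rightarrow> space \<Rightarrow> real^3) \<Rightarrow> (real \<Rightarrow> space \<Rightarrow> real^3) \<Rightarrow> bool" where
  "is_time_derivative m S T u u' \<longleftrightarrow>
     (\<forall>t\<in>{0..T}. ((\<lambda>s. vsobolev_norm m S (\<lambda>x. (u s x - u t x) /\<^sub>R (s - t) - u' t x)) \<longlongrightarrow> 0)
        (at t within {0..T}))"

definition simple_in_time ::
    "nat \<Rightarrow> space set \<Rightarrow> real \<Rightarrow> (real \<Rightarrow> space \<Rightarrow> real^3) \<Rightarrow> bool" where
  "simple_in_time m S T s \<longleftrightarrow> finite (s ` {0..T}) \<and>
     (\<forall>t\<in>{0..T}. s t \<in> vsobolev m S) \<and> (\<forall>g. {t\<in>{0..T}. s t = g} \<in> sets lebesgue)"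

text \<open>\<open>L\<^sup>2([0,T]; H\<^sup>m(S)\<^sup>3)\<close> in the sense of Bochner: strong measurability and square integrability
  of the norm.\<close>

definition L2_in_time ::
    "nat \<Rightarrow> space set \<Rightarrow> real \<Rightarrow> (real \<Rightarrow> space \<Rightarrow> real^3) \<Rightarrow> bool" where
  "L2_in_time m S T f \<longleftrightarrow>
     (AE t in lebesgue_on {0..T}. f t \<in> vsobolev m S) \<and>
     (\<exists>s. (\<forall>n::nat. simple_in_time m S T (s n)) \<and>
        (AE t in lebesgue_on {0..T}. (\<lambda>n. vsobolev_norm m S (\<lambda>x. s n t x - f t x)) \<longlonglongrightarrow> 0)) \<and>
     integrable (lebesgue_on {0..T}) (\<lambda>t. (vsobolev_norm m S (f t))\<^sup>2)"

definition L2_in_time_norm ::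
    "nat \<Rightarrow> space set \<Rightarrow> real \<Rightarrow> (real \<Rightarrow> space \<Rightarrow> real^3) \<Rightarrow> real" where
  "L2_in_time_norm m S T f = sqrt (LINT t|lebesgue_on {0..T}. (vsobolev_norm m S (f t))\<^sup>2)"

section \<open>Sound speeds\<close>

definition sound_speed_class :: "nat \<Rightarrow> real \<Rightarrow> real \<Rightarrow> space set \<Rightarrow> (space \<Rightarrow> real) set" where
  "sound_speed_class s m0 m1 \<Omega> =
     {q. (\<forall>x\<in>closure \<Omega>. m0 \<le> q x \<and> q x \<le> m1) \<and> C_k_closure s \<Omega> q}"

text \<open>A (positive) sound speed \<open>c\<close>, already extended to the whole space.\<close>

definition extended_sound_speed ::
    "nat \<Rightarrow> real \<Rightarrow> real \<Rightarrow> space set \<Rightarrow> (space \<Rightarrow> real) \<Rightarrow> bool" where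
  "extended_sound_speed s m0 m1 \<Omega> c \<longleftrightarrow>
     (\<lambda>x. (c x)\<^sup>2) \<in> sound_speed_class s m0 m1 \<Omega> \<and>
     (\<forall>x. 0 < c x) \<and> C_k_on s UNIV (\<lambda>x. (c x)\<^sup>2) \<and>
     (\<exists>R. closure \<Omega> \<subseteq> ball 0 R \<and> (\<forall>x. x \<notin> ball 0 R \<longrightarrow> c x = 1))"

section \<open>Data, solutions and source-to-solution maps\<close>

type_synonym data = "(space \<Rightarrow> real^3) \<times> (space \<Rightarrow> real^3) \<times> (real \<Rightarrow> space \<Rightarrow> real^3)"

definition scale_data :: "real \<Rightarrow> data \<Rightarrow> data" where
  "scale_data a = (\<lambda>(b0, b1, f). (\<lambda>x. a *\<^sub>R b0 x, \<lambda>x. a *\<^sub>R b1 x, \<lambda>t x. a *\<^sub>R f t x))"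

definition data_norm :: "space set \<Rightarrow> real \<Rightarrow> data \<Rightarrow> real" where
  "data_norm \<Omega>' T = (\<lambda>(b0, b1, f).
     vsobolev_norm 3 \<Omega>' b0 + vsobolev_norm 2 \<Omega>' b1 + L2_in_time_norm 2 \<Omega>' T f)"

definition data_ball :: "space set \<Rightarrow> real \<Rightarrow> data set" where
  "data_ball \<Omega>' T = {(b0, b1, f). b0 \<in> vsobolev 3 \<Omega>' \<and> b1 \<in> vsobolev 2 \<Omega>' \<and>
     L2_in_time 2 \<Omega>' T f \<and> data_norm \<Omega>' T (b0, b1, f) \<le> 1}"

text \<open>\<open>u \<in> C([0,T]; H\<^sup>3) \<inter> C\<^sup>1([0,T]; H\<^sup>2)\<close> solves
  \<open>\<partial>\<^sub>t\<^sup>2 u\<^sub>i - c\<^sub>i\<^sup>2 \<Delta> u\<^sub>i = N u + f\<^sub>i\<close> in the sense of distributions on \<open>(0,T) \<times> \<Omega>'\<close>, with the given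
  initial data and zero boundary values. Since \<open>H\<^sup>3 \<subseteq> C\<close> in dimension three, \<open>u t\<close> is taken to
  be the continuous representative, so that it has values on surfaces inside \<open>\<Omega>'\<close>. Integrals are
  iterated because \<open>f\<close> and \<open>weak_laplacian\<close> are determined only up to a null set for each time.\<close>

definition is_solution ::
    "(real^3 \<Rightarrow> real) \<Rightarrow> (3 \<Rightarrow> space \<Rightarrow> real) \<Rightarrow> space set \<Rightarrow> real \<Rightarrow> data
      \<Rightarrow> (real \<Rightarrow> space \<Rightarrow> real^3) \<Rightarrow> bool" where
  "is_solution N c \<Omega>' T = (\<lambda>(b0, b1, f) u.
     continuous_in_time 3 \<Omega>' T u \<and>
     (\<forall>t\<in>{0..T}. continuous_on \<Omega>' (u t)) \<and>
     (\<exists>u'. is_time_derivative 2 \<Omega>' T u u' \<and> continuous_in_time 2 \<Omega>' T u' \<and>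
           (AE x in lebesgue_on \<Omega>'. u' 0 x = b1 x)) \<and>
     (AE x in lebesgue_on \<Omega>'. u 0 x = b0 x) \<and>
     (\<forall>t\<in>{0<..<T}. u t \<in> vsobolev_zero \<Omega>') \<and>
     (\<forall>i \<phi>. test_function ({0<..<T} \<times> \<Omega>') \<phi> \<longrightarrow>
        (LINT t|lebesgue_on {0..T}. LINT x|lebesgue_on \<Omega>'.
           u t x $ i * partial (1, 0) (partial (1, 0) \<phi>) (t, x)
           - (c i x)\<^sup>2 * weak_laplacian \<Omega>' (\<lambda>y. u t y $ i) x * \<phi> (t, x)) =
        (LINT t|lebesgue_on {0..T}. LINT x|lebesgue_on \<Omega>'.
           (N (u t x) + f t x $ i) * \<phi> (t, x))))"

definition quadratic :: "real^3 \<Rightarrow> real" where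
  "quadratic v = (norm v)\<^sup>2"

definition no_nonlinearity :: "real^3 \<Rightarrow> real" where
  "no_nonlinearity v = 0"

definition uniquely_solvable ::
    "(real^3 \<Rightarrow> real) \<Rightarrow> (3 \<Rightarrow> space \<Rightarrow> real) \<Rightarrow> space set \<Rightarrow> real \<Rightarrow> data \<Rightarrow> bool" where
  "uniquely_solvable N c \<Omega>' T F \<longleftrightarrow>
     (\<exists>u. is_solution N c \<Omega>' T F u \<and>
        (\<forall>v. is_solution N c \<Omega>' T F v \<longrightarrow> (\<forall>t\<in>{0..T}. \<forall>x\<in>\<Omega>'. v t x = u t x)))"

text \<open>Well-posedness for all data \<open>\<epsilon> F\<^sub>1\<close> with \<open>F\<^sub>1\<close> in the unit ball. Solutions with zero boundary
  values exist only for data compatible with the boundary condition (a nonzero constant \<open>b\<^sub>0\<close>, say,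
  is excluded), so the data are taken from a class \<open>D\<close>; \<open>D = UNIV\<close> imposes no restriction.\<close>

definition well_posed ::
    "(real^3 \<Rightarrow> real) \<Rightarrow> (3 \<Rightarrow> space \<Rightarrow> real) \<Rightarrow> space set \<Rightarrow> data set \<Rightarrow> real \<Rightarrow> real \<Rightarrow> bool" where
  "well_posed N c \<Omega>' D \<epsilon> T \<longleftrightarrow>
     (\<forall>F\<in>D \<inter> data_ball \<Omega>' T. uniquely_solvable N c \<Omega>' T (scale_data \<epsilon> F))"

definition existence_time ::
    "(3 \<Rightarrow> space \<Rightarrow> real) \<Rightarrow> space set \<Rightarrow> data set \<Rightarrow> real \<Rightarrow> ereal" where
  "existence_time c \<Omega>' D \<epsilon> =
     Sup {ereal \<tau> |\<tau>. 0 < \<tau> \<and> (\<forall>T. 0 < T \<and> T \<le> \<tau> \<longrightarrow> well_posed quadratic c \<Omega>' D \<epsilon> T)}"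

definition source_to_solution ::
    "(real^3 \<Rightarrow> real) \<Rightarrow> (3 \<Rightarrow> space \<Rightarrow> real) \<Rightarrow> space set \<Rightarrow> space set \<Rightarrow> real \<Rightarrow> data
      \<Rightarrow> real \<times> space \<Rightarrow> real^3" where
  "source_to_solution N c \<Omega> \<Omega>' T F =
     restrict (\<lambda>(t, x). (SOME u. is_solution N c \<Omega>' T F u) t x) ({0..T} \<times> frontier \<Omega>)"

abbreviation "nonlinear_map \<equiv> source_to_solution quadratic"

abbreviation "linear_map \<equiv> source_to_solution no_nonlinearity"

end

theory Submission
  imports Defs
begin

text \<open>
  Fix data of unit size and let \<open>U\<^sub>\<epsilon>\<close> be the nonlinear solution with data scaled by \<open>\<epsilon>\<close> and \<open>u\<close> the linear one.
  The remainder \<open>w = U\<^sub>\<epsilon> - \<epsilon> u\<close> vanishes initially and solves the wave equation with source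
  \<open>|U\<^sub>\<epsilon>|\<^sup>2\<close>.  The energy identity and the Sobolev inequality bounding the \<open>L\<^sup>2\<close> norm of \<open>z\<^sup>2\<close> by the
  square of the \<open>H\<^sup>1\<close> norm of \<open>z\<close>, for \<open>z\<close> vanishing on the outer boundary, give a differential inequality
  for the energy \<open>E\<close> of \<open>w\<close>, and a continuity argument yields \<open>E = O(\<epsilon>\<^sup>4)\<close>.
  If the traces of the two nonlinear solutions agree, then the difference of the two linear solutions
  coincides on the boundary of \<open>\<Omega>\<close> with the difference of the two functions \<open>- w / \<epsilon>\<close>, which is
  \<open>O(\<epsilon>)\<close> in \<open>H\<^sup>1\<close> at every time.  Since the \<open>H\<^sup>1\<close> norm controls the trace on a Lipschitz boundary,
  the linear traces agree.
\<close>

section \<open>Smooth functions and test functions\<close>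

text \<open>Well-posedness supplies no bound on the nonlinear solutions that is uniform in the
  amplitude, so the estimate has to close on the remainder alone: the L2 norm of the quadratic
  source is bounded by the H1 sizes of \<open>w\<close> and of the scaled linear solution, and H1
  sizes are what the wave energy sees. Subtracting also cancels the source \<open>f\<close>, which
  is only square integrable in time; the right side that remains is continuous in time with values
  in L2, so the tested velocity can be differentiated at every interior time. A second obstacle is
  that solutions have only one time derivative, the second one being distributional. The kinetic
  energy is therefore differentiated through difference quotients tested against directions that
  vary with time, which calls for an increment estimate uniform in the direction. Finally, no trace
  operator is built: a continuous boundary value shared by continuous functions that tend to zero in
  H1 is shown to vanish, by an inequality on strips whose constants do not depend on the strip
  thickness.\<close>

lemma partial_eq: "(f has_derivative f') (at x) \<Longrightarrow> partial b f x = f' b"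
  unfolding partial_def using frechet_derivative_at by metis

lemma partial_add:
  "f differentiable (at x) \<Longrightarrow> g differentiable (at x) \<Longrightarrow>
    partial b (\<lambda>x. f x + g x) x = partial b f x + partial b g x"
  unfolding frechet_derivative_works partial_def
  by (rule partial_eq[unfolded partial_def]) (rule has_derivative_add)

lemma partial_mult:
  "f differentiable (at x) \<Longrightarrow> g differentiable (at x) \<Longrightarrow>
    partial b (\<lambda>x. f x * g x) x = f x * partial b g x + partial b f x * g x"
  unfolding frechet_derivative_works partial_def
  by (rule partial_eq[unfolded partial_def]) (rule has_derivative_mult)

definition smooth :: "('a::euclidean_space \<Rightarrow> real) \<Rightarrow> bool" where
  "smooth f \<longleftrightarrow> (\<forall>k. C_k_on k UNIV f)"

lemma differentiable_on_UNIV: "f differentiable_on UNIV \<longleftrightarrow> (\<forall>x. f differentiable (at x))"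
  by (simp add: differentiable_on_def)

lemma C_k_on_mono: "C_k_on (Suc k) UNIV f \<Longrightarrow> C_k_on k UNIV f"
proof (induction k arbitrary: f)
  case 0 then show ?case by (simp add: differentiable_imp_continuous_on)
qed auto

lemma smooth_partial: "smooth f \<Longrightarrow> b \<in> Basis \<Longrightarrow> smooth (partial b f)"
  unfolding smooth_def by (metis C_k_on.simps(2))

lemma smooth_differentiable: "smooth f \<Longrightarrow> f differentiable (at x)"
  unfolding smooth_def by (metis C_k_on.simps(2) differentiable_on_UNIV)

lemma smooth_continuous: "smooth f \<Longrightarrow> continuous_on S f"
  unfolding smooth_def by (metis C_k_on.simps(1) continuous_on_subset subset_UNIV)

lemma C_k_on_add:
  "C_k_on k UNIV f \<Longrightarrow> C_k_on k UNIV g \<Longrightarrow> C_k_on k UNIV (\<lambda>x. f x + g x)"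
proof (induction k arbitrary: f g)
  case 0 then show ?case by (simp add: continuous_on_add)
next
  case (Suc k)
  have "partial b (\<lambda>x. f x + g x) = (\<lambda>x. partial b f x + partial b g x)" for b
    using Suc.prems by (auto simp: differentiable_on_UNIV partial_add)
  then show ?case using Suc by (auto simp: differentiable_on_UNIV)
qed

lemma C_k_on_mult:
  "C_k_on k UNIV f \<Longrightarrow> C_k_on k UNIV g \<Longrightarrow> C_k_on k UNIV (\<lambda>x. f x * g x)"
proof (induction k arbitrary: f g)
  case 0 then show ?case by (simp add: continuous_on_mult)
next
  case (Suc k)
  have eq: "partial b (\<lambda>x. f x * g x) = (\<lambda>x. f x * partial b g x + partial b f x * g x)" for b
    using Suc.prems by (auto simp: differentiable_on_UNIV partial_mult)
  \<comment> \<open>The product rule leaves one factor undifferentiated, so each factor is also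
    needed at the lower order \<open>k\<close>.\<close>
  have "C_k_on k UNIV f" "C_k_on k UNIV g" using Suc.prems C_k_on_mono by blast+
  then show ?case using Suc by (auto simp: differentiable_on_UNIV eq intro!: C_k_on_add)
qed

lemma C_k_on_const: "C_k_on k UNIV (\<lambda>x. c)"
proof (induction k arbitrary: c)
  case (Suc k)
  have "partial b (\<lambda>x. c) = (\<lambda>x. 0)" for b :: 'a by (auto simp: partial_def)
  then show ?case using Suc by simp
qed simp

lemma smooth_add: "smooth f \<Longrightarrow> smooth g \<Longrightarrow> smooth (\<lambda>x. f x + g x)"
  and smooth_mult: "smooth f \<Longrightarrow> smooth g \<Longrightarrow> smooth (\<lambda>x. f x * g x)"
  and smooth_const: "smooth (\<lambda>x. c)"
  by (simp_all add: smooth_def C_k_on_add C_k_on_mult C_k_on_const)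

lemma C_k_on_sum:
  "(\<And>i. i \<in> I \<Longrightarrow> C_k_on k UNIV (f i)) \<Longrightarrow> C_k_on k UNIV (\<lambda>x. \<Sum>i\<in>I. f i x)"
  by (induction I rule: infinite_finite_induct) (auto intro: C_k_on_const C_k_on_add)

lemma smooth_prod:
  "(\<And>i. i \<in> I \<Longrightarrow> smooth (f i)) \<Longrightarrow> smooth (\<lambda>x. \<Prod>i\<in>I. f i x)"
  by (induction I rule: infinite_finite_induct) (auto intro: smooth_const smooth_mult)

lemma frechet_derivative_eq_sum_partial:
  assumes "f differentiable (at x)"
  shows "frechet_derivative f (at x) v = (\<Sum>b\<in>Basis. (v \<bullet> b) * partial b f x)"
proof -
  interpret bounded_linear "frechet_derivative f (at x)"
    using assms frechet_derivative_works has_derivative_bounded_linear by blast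
  have "frechet_derivative f (at x) v = frechet_derivative f (at x) (\<Sum>b\<in>Basis. (v \<bullet> b) *\<^sub>R b)"
    by (simp add: euclidean_representation)
  then show ?thesis by (simp add: sum scaleR partial_def)
qed

lemma affine_has_derivative:
  "bounded_linear L \<Longrightarrow> ((\<lambda>x. L x + d) has_derivative L) (at x)"
  by (auto intro!: derivative_eq_intros bounded_linear_imp_has_derivative)

lemma partial_affine:
  assumes "f differentiable (at (L x + d))" "bounded_linear L"
  shows "partial b (\<lambda>x. f (L x + d)) x = (\<Sum>b'\<in>Basis. (L b \<bullet> b') * partial b' f (L x + d))"
proof -
  have "((\<lambda>x. f (L x + d)) has_derivative (\<lambda>v. frechet_derivative f (at (L x + d)) (L v))) (at x)"
    using diff_chain_at[OF affine_has_derivative[OF assms(2), of d x]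
        assms(1)[unfolded frechet_derivative_works]] by (simp add: o_def)
  then show ?thesis
    by (simp add: partial_eq frechet_derivative_eq_sum_partial[OF assms(1)])
qed

lemma differentiable_affine:
  assumes "f differentiable (at (L x + d))" "bounded_linear L"
  shows "(\<lambda>x. f (L x + d)) differentiable (at x)"
  using differentiable_chain_at[of "\<lambda>x. L x + d" x f] assms affine_has_derivative[OF assms(2)]
  unfolding differentiable_def o_def by blast

text \<open>The chain rule expresses a derivative as a linear combination of functions of the same
  composed form, which closes the induction. Source and target spaces may differ, so that functions
  can be pulled back along \<open>fst\<close> and \<open>snd\<close>.\<close>

lemma C_k_on_affine:
  fixes f :: "'a::euclidean_space \<Rightarrow> real" and L :: "'b::euclidean_space \<Rightarrow> 'a"
  assumes "bounded_linear L"
  shows "C_k_on k UNIV f \<Longrightarrow> C_k_on k UNIV (\<lambda>x. f (L x + d))"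
proof (induction k arbitrary: f)
  case 0
  then show ?case
    using continuous_on_compose2[of UNIV f UNIV "\<lambda>x. L x + d"]
      continuous_on_add[OF linear_continuous_on[OF assms, of UNIV] continuous_on_const[of UNIV d]]
    by simp
next
  case (Suc k)
  have d: "f differentiable (at x)" for x using Suc.prems by (auto simp: differentiable_on_UNIV)
  have eq: "partial b (\<lambda>x. f (L x + d)) =
      (\<lambda>x. \<Sum>b'\<in>Basis. (L b \<bullet> b') * partial b' f (L x + d))" for b
    using partial_affine[OF d assms] by auto
  show ?case using Suc d
    by (auto simp: differentiable_on_UNIV eq intro!: differentiable_affine assms C_k_on_sum
        C_k_on_mult C_k_on_const)
qed

lemma smooth_affine:
  "smooth f \<Longrightarrow> bounded_linear L \<Longrightarrow> smooth (\<lambda>x. f (L x + d))"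
  by (simp add: smooth_def C_k_on_affine)

lemma smooth_linear: "bounded_linear L \<Longrightarrow> smooth f \<Longrightarrow> smooth (\<lambda>x. f (L x))"
  using smooth_affine[of f L 0] by simp

lemma smooth_shift: "smooth f \<Longrightarrow> smooth (\<lambda>x. f (x + d))"
  using smooth_affine[OF _ bounded_linear_ident] .

subsection \<open>A smooth step\<close>

text \<open>The standard flat function exp(-1/x), divided by a power of x. The extra index makes the
  family closed under differentiation, so smoothness is proved for all \<open>n\<close> at
  once.\<close>

definition exp_step :: "nat \<Rightarrow> real \<Rightarrow> real" where
  "exp_step n x = (if x \<le> 0 then 0 else exp (- (1 / x)) / x ^ n)"

lemma exp_step_lim: "((\<lambda>x. exp_step n x) \<longlongrightarrow> 0) (at_right 0)"
proof -
  have "((\<lambda>x::real. (1/x) ^ n / exp (1/x)) \<longlongrightarrow> 0) (at_right 0)"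
    by (rule filterlim_compose[OF tendsto_power_div_exp_0])
      (simp add: filterlim_inverse_at_top_right flip: inverse_eq_divide)
  then show ?thesis
    by (rule Lim_transform_eventually)
      (auto simp: eventually_at_right_field exp_step_def exp_minus field_simps intro!: exI[of _ 1])
qed

lemma exp_step_has_derivative:
  "(exp_step n has_real_derivative exp_step (n + 2) x - real n * exp_step (n + 1) x) (at x)"
proof -
  consider "x < 0" | "x > 0" | "x = 0" by linarith
  then show ?thesis
  proof cases
    case 1
    have "((\<lambda>x. 0) has_real_derivative 0) (at x)" by simp
    then have "(exp_step n has_real_derivative 0) (at x)"
      by (rule has_field_derivative_transform_within_open[of _ _ _ "{..<0}"])
        (use 1 in \<open>auto simp: exp_step_def\<close>)
    then show ?thesis using 1 by (simp add: exp_step_def)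
  next
    case 2
    have "((\<lambda>x. exp (- (1 / x)) / x ^ n) has_real_derivative
        exp (- (1 / x)) / x ^ (n + 2) - real n * (exp (- (1 / x)) / x ^ (n + 1))) (at x)"
    proof -
      have e: "((\<lambda>x. exp (- (1 / x))) has_real_derivative exp (- (1 / x)) * (1 / x\<^sup>2)) (at x)"
        using 2 by (auto intro!: derivative_eq_intros simp: field_simps power2_eq_square)
      have p: "((\<lambda>x. x ^ n) has_real_derivative real n * x ^ (n - 1)) (at x)"
        using DERIV_pow[of n x UNIV] by simp
      have "(exp (- (1 / x)) * (1 / x\<^sup>2) * x ^ n - exp (- (1 / x)) * (real n * x ^ (n - 1))) / (x ^ n * x ^ n)
        = exp (- (1 / x)) / x ^ (n + 2) - real n * (exp (- (1 / x)) / x ^ (n + 1))"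
        using 2 by (cases n) (simp_all add: divide_simps power2_eq_square, simp add: algebra_simps)
      then show ?thesis using DERIV_divide[OF e p] 2 by simp
    qed
    then have "(exp_step n has_real_derivative
        exp (- (1 / x)) / x ^ (n + 2) - real n * (exp (- (1 / x)) / x ^ (n + 1))) (at x)"
      by (rule has_field_derivative_transform_within_open[of _ _ _ "{0<..}"])
        (use 2 in \<open>auto simp: exp_step_def\<close>)
    then show ?thesis using 2 by (simp add: exp_step_def)
  next
    case 3
    \<comment> \<open>For h > 0 the difference quotient at 0 is \<open>exp_step (Suc n) h\<close>,
      so the limit already known for every index applies.\<close>
    have "((\<lambda>h. exp_step n h / h) \<longlongrightarrow> 0) (at_right 0)"
      by (rule Lim_transform_eventually[OF exp_step_lim[of "Suc n"]])
        (auto simp: exp_step_def eventually_at_right_field intro!: exI[of _ 1])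
    moreover have "((\<lambda>h. exp_step n h / h) \<longlongrightarrow> 0) (at_left 0)"
      by (rule Lim_transform_eventually[OF tendsto_const])
        (auto simp: exp_step_def eventually_at_left_field intro!: exI[of _ "-1"])
    ultimately have "((\<lambda>h. exp_step n h / h) \<longlongrightarrow> 0) (at 0)"
      by (simp add: filterlim_split_at_real)
    then show ?thesis
      using DERIV_def[of "exp_step n" 0 0] unfolding 3 by (simp add: exp_step_def[of _ 0])
  qed
qed

lemma partial_real: "(f has_real_derivative D) (at x) \<Longrightarrow> partial 1 f x = D"
  using partial_eq[of f "(*) D" x 1] by (simp add: has_field_derivative_def)

lemma smooth_exp_step: "smooth (exp_step n)"
proof -
  have "C_k_on k UNIV (exp_step n)" for k
  proof (induction k arbitrary: n)
    case 0
    show ?case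
      by (simp, intro continuous_at_imp_continuous_on ballI DERIV_isCont)
        (rule exp_step_has_derivative)
  next
    case (Suc k)
    have "partial 1 (exp_step n) = (\<lambda>x. exp_step (n + 2) x + (- real n) * exp_step (n + 1) x)"
      using partial_real[OF exp_step_has_derivative] by (simp add: fun_eq_iff)
    moreover have "exp_step n differentiable (at x)" for x
      using exp_step_has_derivative unfolding has_field_derivative_def differentiable_def by blast
    ultimately show ?case using Suc
      unfolding C_k_on.simps
      by (auto simp only: differentiable_on_UNIV Basis_real_def singleton_iff
          intro!: C_k_on_add C_k_on_mult C_k_on_const)
  qed
  then show ?thesis by (simp add: smooth_def)
qed

subsection \<open>Test functions\<close>

text \<open>The closed support may be replaced by any compact set off which the function vanishes.
  This form passes through sums, products, derivatives and translations without computing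
  closures.\<close>

lemma test_function_iff:
  "test_function S \<phi> \<longleftrightarrow> smooth \<phi> \<and> (\<exists>K. compact K \<and> K \<subseteq> S \<and> (\<forall>x. x \<notin> K \<longrightarrow> \<phi> x = 0))"
proof
  assume "test_function S \<phi>"
  then show "smooth \<phi> \<and> (\<exists>K. compact K \<and> K \<subseteq> S \<and> (\<forall>x. x \<notin> K \<longrightarrow> \<phi> x = 0))"
    unfolding test_function_def smooth_def
    by (metis (mono_tags, lifting) closure_subset mem_Collect_eq subsetD)
next
  assume "smooth \<phi> \<and> (\<exists>K. compact K \<and> K \<subseteq> S \<and> (\<forall>x. x \<notin> K \<longrightarrow> \<phi> x = 0))"
  then obtain K where s: "smooth \<phi>" and K: "compact K" "K \<subseteq> S" "\<forall>x. x \<notin> K \<longrightarrow> \<phi> x = 0" by blast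
  have "closure {x. \<phi> x \<noteq> 0} \<subseteq> K"
    by (rule closure_minimal) (use K in \<open>auto simp: compact_imp_closed\<close>)
  then show "test_function S \<phi>"
    using s K compact_Int_closed[OF K(1) closed_closure] unfolding test_function_def smooth_def
    by (metis inf.absorb_iff2 subset_trans)
qed

lemma test_functionE:
  assumes "test_function S \<phi>"
  obtains K where "smooth \<phi>" "compact K" "K \<subseteq> S" "\<And>x. x \<notin> K \<Longrightarrow> \<phi> x = 0"
  using assms unfolding test_function_iff by blast

lemma test_functionI:
  "smooth \<phi> \<Longrightarrow> compact K \<Longrightarrow> K \<subseteq> S \<Longrightarrow> (\<And>x. x \<notin> K \<Longrightarrow> \<phi> x = 0) \<Longrightarrow> test_function S \<phi>"
  unfolding test_function_iff by blast

lemma test_function_smooth: "test_function S \<phi> \<Longrightarrow> smooth \<phi>"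
  by (simp add: test_function_iff)

lemma test_function_mono: "test_function S \<phi> \<Longrightarrow> S \<subseteq> S' \<Longrightarrow> test_function S' \<phi>"
  unfolding test_function_iff by blast

lemma test_function_add:
  assumes "test_function S f" "test_function S g" shows "test_function S (\<lambda>x. f x + g x)"
proof -
  from assms obtain K K' where "smooth f" "compact K" "K \<subseteq> S" "\<And>x. x \<notin> K \<Longrightarrow> f x = 0"
    "smooth g" "compact K'" "K' \<subseteq> S" "\<And>x. x \<notin> K' \<Longrightarrow> g x = 0"
    by (metis test_functionE)
  then show ?thesis by (intro test_functionI[of _ "K \<union> K'"]) (auto simp: smooth_add)
qed

lemma test_function_mult:
  "test_function S f \<Longrightarrow> smooth g \<Longrightarrow> test_function S (\<lambda>x. g x * f x)"
  unfolding test_function_iff by (auto simp: smooth_mult)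

lemma test_function_partial:
  assumes "test_function S f" "b \<in> Basis" shows "test_function S (partial b f)"
proof -
  from assms obtain K where K: "smooth f" "compact K" "K \<subseteq> S" "\<And>x. x \<notin> K \<Longrightarrow> f x = 0"
    by (metis test_functionE)
  have "partial b f x = 0" if "x \<notin> K" for x
  proof -
    have "(f has_derivative (\<lambda>v. 0)) (at x)"
      by (rule has_derivative_transform_within_open[of "\<lambda>x. 0" _ _ _ "- K"])
        (use K that in \<open>auto simp: compact_imp_closed open_Compl\<close>)
    then show ?thesis by (rule partial_eq)
  qed
  then show ?thesis using K smooth_partial[OF _ assms(2)] by (intro test_functionI)
qed

lemma test_function_shift:
  assumes "test_function S f" "(\<lambda>x. x - d) ` S \<subseteq> S'" shows "test_function S' (\<lambda>x. f (x + d))"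
proof -
  from assms obtain K where K: "smooth f" "compact K" "K \<subseteq> S" "\<And>x. x \<notin> K \<Longrightarrow> f x = 0"
    by (metis test_functionE)
  have "x \<in> (\<lambda>x. x - d) ` K" if "f (x + d) \<noteq> 0" for x
    using that K(4)[of "x + d"] by (force simp: image_iff)
  moreover have "compact ((\<lambda>x. x - d) ` K)"
    by (intro compact_continuous_image continuous_intros K)
  ultimately show ?thesis using K(1,3) assms(2)
    by (intro test_functionI[of _ "(\<lambda>x. x - d) ` K"]) (auto intro: smooth_shift)
qed

lemma test_function_times:
  assumes "test_function S f" "test_function S' g"
  shows "test_function (S \<times> S') (\<lambda>z. f (fst z) * g (snd z))"
proof -
  from assms obtain K K' where K: "smooth f" "compact K" "K \<subseteq> S" "smooth g" "compact K'" "K' \<subseteq> S'"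
    and 0: "\<And>x. x \<notin> K \<Longrightarrow> f x = 0" "\<And>x. x \<notin> K' \<Longrightarrow> g x = 0"
    by (metis test_functionE)
  have "f (fst z) * g (snd z) = 0" if "z \<notin> K \<times> K'" for z
    using that 0 by (cases z) auto
  with K show ?thesis
    by (intro test_functionI[of _ "K \<times> K'"])
      (auto intro!: smooth_mult smooth_linear[OF bounded_linear_fst] smooth_linear[OF bounded_linear_snd]
        compact_Times)
qed

text \<open>Needed for the Weierstrass approximation of continuous weights: a smooth multiplier
  keeps test functions among the test functions.\<close>

lemma polynomial_smooth:
  fixes p :: "'a::euclidean_space \<Rightarrow> real"
  assumes "real_polynomial_function p" shows "smooth p"
  using assms
proof induction
  case (linear f)
  have id: "smooth (\<lambda>x::real. x)" 
  proof -
    have p1: "partial 1 (\<lambda>x::real. x) = (\<lambda>x. 1)"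
      by (rule ext, rule partial_real) (auto intro!: derivative_eq_intros)
    have "C_k_on k UNIV (\<lambda>x::real. x)" for k
      by (cases k) (auto simp: p1 differentiable_on_UNIV C_k_on_const)
    then show ?thesis by (simp add: smooth_def)
  qed
  show ?case using smooth_linear[OF linear id] .
qed (auto intro: smooth_const smooth_add smooth_mult)

lemma exp_step_0_lim: "((\<lambda>n. exp_step 0 (real n * r - 1)) \<longlonglongrightarrow> 1)" if "r > 0"
proof -
  have "((\<lambda>x::real. exp (- inverse x)) \<longlongrightarrow> exp (- 0)) at_top"
    by (intro tendsto_intros tendsto_inverse_0_at_top filterlim_ident)
  then have "((\<lambda>x::real. exp (- (1 / x))) \<longlongrightarrow> 1) at_top" by (simp add: inverse_eq_divide)
  moreover have lim: "filterlim (\<lambda>n. - 1 + r * real n) at_top sequentially" using that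
    by (intro filterlim_tendsto_add_at_top[OF tendsto_const]
        filterlim_tendsto_pos_mult_at_top[OF tendsto_const] filterlim_real_sequentially)
  then have "filterlim (\<lambda>n. real n * r - 1) at_top sequentially" by (simp add: algebra_simps)
  ultimately have "(\<lambda>n. exp (- (1 / (real n * r - 1)))) \<longlonglongrightarrow> 1" by (rule filterlim_compose)
  moreover have "\<forall>\<^sub>F n in sequentially. real n * r - 1 > 0"
    using lim unfolding filterlim_at_top_dense by (auto simp: algebra_simps dest: spec[of _ 0])
  ultimately show ?thesis
    by (elim Lim_transform_eventually) (auto simp: exp_step_def elim!: eventually_mono)
qed

lemma exp_step_0_bounds: "0 \<le> exp_step 0 x" "exp_step 0 x \<le> 1"
  by (auto simp: exp_step_def)

lemma cbox_subset_box_shrink: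
  fixes a b :: "'a::euclidean_space"
  assumes "d > 0" shows "cbox (a + d *\<^sub>R One) (b - d *\<^sub>R One) \<subseteq> box a b"
proof
  fix x assume "x \<in> cbox (a + d *\<^sub>R One) (b - d *\<^sub>R One)"
  then have "a \<bullet> i + d \<le> x \<bullet> i" "x \<bullet> i \<le> b \<bullet> i - d" if "i \<in> Basis" for i
    using that by (auto simp: mem_box inner_simps)
  then show "x \<in> box a b" using assms by (fastforce simp: mem_box)
qed

text \<open>A product over the coordinates of smooth steps, two for each coordinate, one for each
  face of the box.\<close>

lemma box_test_approx:
  fixes a b :: "'a::euclidean_space"
  obtains \<phi> :: "nat \<Rightarrow> 'a \<Rightarrow> real" where
    "\<And>n. test_function (box a b) (\<phi> n)" "\<And>n x. \<bar>\<phi> n x\<bar> \<le> 1"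
    "\<And>x. (\<lambda>n. \<phi> n x) \<longlonglongrightarrow> indicator (box a b) x"
proof
  \<comment> \<open>The shift by -1 makes each factor vanish within distance 1/n of its face, so the
    support is compact inside the open box; the factor \<open>n\<close> drives every step to 1 at a
    fixed interior point.\<close>
  define \<phi> where "\<phi> = (\<lambda>n x. \<Prod>i\<in>Basis. exp_step 0 (real n * (x \<bullet> i - a \<bullet> i) - 1) *
      exp_step 0 (real n * (b \<bullet> i - x \<bullet> i) - 1))"
  have nz: "x \<in> cbox (a + (1/n) *\<^sub>R One) (b - (1/n) *\<^sub>R One) \<and> n > 0" if "\<phi> n x \<noteq> 0" for n x
  proof -
    have *: "real n * (x \<bullet> i - a \<bullet> i) > 1" "real n * (b \<bullet> i - x \<bullet> i) > 1" if "i \<in> Basis" for i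
      using \<open>\<phi> n x \<noteq> 0\<close> that by (fastforce simp: \<phi>_def exp_step_def split: if_splits)+
    have n: "n > 0" using *(1)[OF SOME_Basis] by (cases n) auto
    then show ?thesis using * by (fastforce simp: mem_box inner_simps field_simps)
  qed
  show "test_function (box a b) (\<phi> n)" for n
  proof (rule test_functionI)
    show "smooth (\<phi> n)" unfolding \<phi>_def
    proof (intro smooth_prod smooth_mult)
      fix i :: 'a
      have 1: "bounded_linear (\<lambda>x::'a. real n * (x \<bullet> i))" "bounded_linear (\<lambda>x::'a. - real n * (x \<bullet> i))"
        by (intro bounded_linear_const_mult bounded_linear_inner_left)+
      show "smooth (\<lambda>x. exp_step 0 (real n * (x \<bullet> i - a \<bullet> i) - 1))"
        using smooth_affine[OF smooth_exp_step 1(1), of 0 "- real n * (a \<bullet> i) - 1"]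
        by (simp add: algebra_simps)
      show "smooth (\<lambda>x. exp_step 0 (real n * (b \<bullet> i - x \<bullet> i) - 1))"
        using smooth_affine[OF smooth_exp_step 1(2), of 0 "real n * (b \<bullet> i) - 1"]
        by (simp add: algebra_simps)
    qed
    \<comment> \<open>For \<open>n = 0\<close> the convention 1/0 = 0 would give the full closed
      box. All steps are then evaluated at -1, hence the function is zero and the empty set will
      do.\<close>
    show "compact (if n = 0 then {} else cbox (a + (1/n) *\<^sub>R One) (b - (1/n) *\<^sub>R One))" by simp
    show "(if n = 0 then {} else cbox (a + (1/n) *\<^sub>R One) (b - (1/n) *\<^sub>R One)) \<subseteq> box a b"
      using cbox_subset_box_shrink[of "1/n" a b] by auto
    show "\<phi> n x = 0" if "x \<notin> (if n = 0 then {} else cbox (a + (1/n) *\<^sub>R One) (b - (1/n) *\<^sub>R One))" for x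
      using nz[of n x] that by (auto split: if_splits)
  qed
  show "\<bar>\<phi> n x\<bar> \<le> 1" for n x
    unfolding \<phi>_def abs_prod
    by (intro prod_le_1) (auto simp: abs_mult exp_step_0_bounds intro!: mult_le_one)
  show "(\<lambda>n. \<phi> n x) \<longlonglongrightarrow> indicator (box a b) x" for x
  proof (cases "x \<in> box a b")
    case True
    then have "(\<lambda>n. \<phi> n x) \<longlonglongrightarrow> (\<Prod>i\<in>(Basis::'a set). 1 * 1)"
      unfolding \<phi>_def by (intro tendsto_prod tendsto_mult exp_step_0_lim) (auto simp: mem_box)
    then show ?thesis using True by simp
  next
    case False
    then have "\<phi> n x = 0" for n
      using nz[of n x] cbox_subset_box_shrink[of "1/n" a b] by auto
    then show ?thesis using False by simp
  qed
qed

section \<open>The fundamental lemma of the calculus of variations\<close>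

lemma integrable_bounded_mult:
  fixes f g :: "'a \<Rightarrow> real"
  assumes "integrable M f" "g \<in> borel_measurable M" "\<And>x. \<bar>g x\<bar> \<le> B"
  shows "integrable M (\<lambda>x. f x * g x)"
proof (rule Bochner_Integration.integrable_bound)
  show "integrable M (\<lambda>x. B * f x)" using assms(1) by simp
  have "\<bar>f x\<bar> * \<bar>g x\<bar> \<le> \<bar>B\<bar> * \<bar>f x\<bar>" for x
    using mult_left_mono[OF assms(3)[of x], of "\<bar>f x\<bar>"]
    by (smt (verit) abs_ge_zero mult.commute mult_left_mono)
  then show "AE x in M. norm (f x * g x) \<le> norm (B * f x)" by (simp add: abs_mult)
qed (use assms in measurable)

lemma smooth_measurable [measurable_dest]: "smooth f \<Longrightarrow> f \<in> borel_measurable borel"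
  by (simp add: borel_measurable_continuous_onI smooth_continuous)

lemma test_function_bounded:
  assumes "test_function S \<phi>" obtains B where "\<And>x. \<bar>\<phi> x\<bar> \<le> B"
proof -
  obtain K where K: "smooth \<phi>" "compact K" "\<And>x. x \<notin> K \<Longrightarrow> \<phi> x = 0"
    using assms by (metis test_functionE)
  have "bounded (\<phi> ` K)"
    by (intro compact_imp_bounded compact_continuous_image smooth_continuous K)
  then obtain B where "\<And>x. x \<in> K \<Longrightarrow> \<bar>\<phi> x\<bar> \<le> B" by (auto simp: bounded_iff)
  then have "\<bar>\<phi> x\<bar> \<le> \<bar>B\<bar>" for x using K(3)[of x] by (cases "x \<in> K") (auto intro: order_trans[OF _ abs_ge_self])
  then show ?thesis by (rule that)
qed

lemma test_function_integrable:
  assumes "test_function S \<phi>" shows "integrable lborel \<phi>"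
proof -
  obtain K where K: "smooth \<phi>" "compact K" "\<And>x. x \<notin> K \<Longrightarrow> \<phi> x = 0"
    using assms by (metis test_functionE)
  have "integrable lborel (\<lambda>x. indicator K x *\<^sub>R \<phi> x)"
    by (rule borel_integrable_compact[OF K(2) smooth_continuous[OF K(1)]])
  moreover have "(\<lambda>x. indicator K x *\<^sub>R \<phi> x) = \<phi>"
    using K(3) by (auto simp: fun_eq_iff indicator_def)
  ultimately show ?thesis by simp
qed

text \<open>Dominated convergence along the box approximations shows that \<open>D\<close>
  integrates to zero over every box in \<open>V\<close>. Thus the positive and negative parts of
  \<open>D\<close>, taken as densities, define measures that agree on boxes; boxes generate the
  Borel sets, so the two densities coincide almost everywhere.\<close>

lemma fundamental_lemma:
  fixes D :: "'a::euclidean_space \<Rightarrow> real"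
  assumes D: "integrable lborel D" and V: "open V"
    and 0: "\<And>\<phi>. test_function V \<phi> \<Longrightarrow> (LINT x|lborel. D x * \<phi> x) = 0"
  shows "AE x in lborel. x \<in> V \<longrightarrow> D x = 0"
proof -
  have [measurable]: "D \<in> borel_measurable borel" using D by auto
  have box0: "(LINT x|lborel. D x * indicator (box a b) x) = 0" if ab: "box a b \<subseteq> V" for a b
  proof -
    obtain \<phi> :: "nat \<Rightarrow> 'a \<Rightarrow> real" where \<phi>: "\<And>n. test_function (box a b) (\<phi> n)" "\<And>n x. \<bar>\<phi> n x\<bar> \<le> 1"
      "\<And>x. (\<lambda>n. \<phi> n x) \<longlonglongrightarrow> indicator (box a b) x"
      using box_test_approx[of a b] by metis
    have [measurable]: "\<phi> n \<in> borel_measurable borel" for n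
      using test_function_smooth[OF \<phi>(1)] by (rule smooth_measurable)
    have "(\<lambda>n. LINT x|lborel. D x * \<phi> n x) \<longlonglongrightarrow> (LINT x|lborel. D x * indicator (box a b) x)"
    proof (rule integral_dominated_convergence)
      show "integrable lborel (\<lambda>x. \<bar>D x\<bar>)" using D by simp
      show "AE x in lborel. (\<lambda>n. D x * \<phi> n x) \<longlonglongrightarrow> D x * indicator (box a b) x"
        by (intro AE_I2 tendsto_mult_left \<phi>(3))
      show "AE x in lborel. norm (D x * \<phi> n x) \<le> \<bar>D x\<bar>" for n
        by (intro AE_I2) (auto simp: abs_mult intro!: mult_left_le \<phi>(2))
    qed measurable
    moreover have "(LINT x|lborel. D x * \<phi> n x) = 0" for n
      using 0 test_function_mono[OF \<phi>(1) ab] by blast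
    ultimately show ?thesis by (simp add: LIMSEQ_const_iff)
  qed
  have main: "AE x in lborel. x \<in> box a b \<longrightarrow> D x = 0" if ab: "box a b \<subseteq> V" for a b
  proof -
    \<comment> \<open>Both densities are cut off at one fixed box inside \<open>V\<close>, so the
      measures are finite on all generating boxes, not only on those contained in \<open>V\<close>.
      Intersections of boxes being boxes, the values reduce to \<open>box0\<close>.\<close>
    define P where "P = (\<lambda>x. ennreal (max 0 (D x)) * indicator (box a b) x)"
    define N where "N = (\<lambda>x. ennreal (max 0 (- D x)) * indicator (box a b) x)"
    have [measurable]: "P \<in> borel_measurable borel" "N \<in> borel_measurable borel"
      by (auto simp: P_def N_def)
    have eq: "(\<integral>\<^sup>+x. P x * indicator (box c d) x \<partial>lborel) = (\<integral>\<^sup>+x. N x * indicator (box c d) x \<partial>lborel)"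
        "(\<integral>\<^sup>+x. N x * indicator (box c d) x \<partial>lborel) \<noteq> \<infinity>" for c d
    proof -
      obtain c' d' where e: "box a b \<inter> box c d = box c' d'"
        by (rule that[OF box_Int_box])
      have iP: "integrable lborel (\<lambda>x. max 0 (D x) * indicator (box c' d') x)"
        and iN: "integrable lborel (\<lambda>x. max 0 (- D x) * indicator (box c' d') x)"
        by (intro integrable_mult_indicator[where 'b=real, simplified mult.commute[of "indicator _ _"]]
            integrable_real_mult_indicator integrable_max D; use D in simp)+
      have "box c' d' \<subseteq> V" using e ab by blast
      then have "(LINT x|lborel. max 0 (D x) * indicator (box c' d') x - max 0 (- D x) * indicator (box c' d') x) = 0"
        using box0[of c' d'] by (simp add: left_diff_distrib[symmetric] max_def cong: if_cong)
          (smt (verit, best) Bochner_Integration.integral_cong)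
      then have "(LINT x|lborel. max 0 (D x) * indicator (box c' d') x) = (LINT x|lborel. max 0 (- D x) * indicator (box c' d') x)"
        using iP iN by simp
      moreover have "(\<integral>\<^sup>+x. P x * indicator (box c d) x \<partial>lborel) = (\<integral>\<^sup>+x. ennreal (max 0 (D x) * indicator (box c' d') x) \<partial>lborel)"
        "(\<integral>\<^sup>+x. N x * indicator (box c d) x \<partial>lborel) = (\<integral>\<^sup>+x. ennreal (max 0 (- D x) * indicator (box c' d') x) \<partial>lborel)"
        unfolding e[symmetric] P_def N_def
        by (auto intro!: nn_integral_cong simp: indicator_def)
      ultimately show "(\<integral>\<^sup>+x. P x * indicator (box c d) x \<partial>lborel) = (\<integral>\<^sup>+x. N x * indicator (box c d) x \<partial>lborel)"
        "(\<integral>\<^sup>+x. N x * indicator (box c d) x \<partial>lborel) \<noteq> \<infinity>"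
        using iP iN by (simp_all add: nn_integral_eq_integral)
    qed
    have "density lborel P = density lborel N"
    proof (rule measure_eqI_generator_eq[where E="range (\<lambda>(a, b). box a b)" and \<Omega>=UNIV
          and A="\<lambda>n::nat. box (- (real n *\<^sub>R One)) (real n *\<^sub>R One)"])
      show "Int_stable (range (\<lambda>(a, b). box a b :: 'a set))"
        by (force simp: Int_stable_def box_Int_box)
      show "sets (density lborel P) = sigma_sets UNIV (range (\<lambda>(a, b). box a b))"
        "sets (density lborel N) = sigma_sets UNIV (range (\<lambda>(a, b). box a b))"
        by (simp_all add: borel_eq_box)
      show "(\<Union>n. box (- (real n *\<^sub>R One)) (real n *\<^sub>R One)) = (UNIV :: 'a set)"
        using UN_box_eq_UNIV by auto
    qed (use eq in \<open>auto simp: emeasure_density eq\<close>)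
    then have "AE x in lborel. P x = N x"
      by (subst (asm) sigma_finite_measure.density_unique_iff[OF sigma_finite_lborel]) auto
    then show ?thesis
      by eventually_elim (auto simp: P_def N_def max_def split: if_splits)
  qed
  obtain \<D> where "countable \<D>" "\<D> \<subseteq> Pow V" "\<And>X. X \<in> \<D> \<Longrightarrow> \<exists>a b. X = box a b" "\<Union>\<D> = V"
    using open_countable_Union_open_box[OF V] by metis
  note 1 = this
  have "AE x in lborel. \<forall>X\<in>\<D>. x \<in> X \<longrightarrow> D x = 0"
    unfolding AE_ball_countable[OF 1(1)] using main 1 by (metis PowD subsetD)
  then show ?thesis by eventually_elim (use 1 in auto)
qed

section \<open>Directional derivatives, translations and integration by parts\<close>

lemma has_derivative_smooth: "smooth f \<Longrightarrow> (f has_derivative frechet_derivative f (at x)) (at x)"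
  using smooth_differentiable frechet_derivative_works by blast

lemma smooth_frechet:
  assumes "smooth f" shows "smooth (\<lambda>x. frechet_derivative f (at x) e)"
proof -
  have "C_k_on k UNIV (\<lambda>x. \<Sum>b\<in>Basis. (e \<bullet> b) * partial b f x)" for k
    using smooth_partial[OF assms] by (auto simp: smooth_def intro!: C_k_on_sum C_k_on_mult C_k_on_const)
  then show ?thesis
    by (simp add: smooth_def frechet_derivative_eq_sum_partial smooth_differentiable[OF assms])
qed

lemma test_function_frechet:
  assumes "test_function S f" shows "test_function S (\<lambda>x. frechet_derivative f (at x) e)"
proof -
  have "test_function S (\<lambda>x. \<Sum>b\<in>B. (e \<bullet> b) * partial b f x)" if "B \<subseteq> Basis" for B
    using finite_subset[OF that finite_Basis] that
  proof (induction B rule: finite_induct)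
    case empty
    show ?case by (intro test_functionI[of _ "{}"]) (auto simp: smooth_const)
  next
    case (insert b B)
    then show ?case
      by (auto intro!: test_function_add test_function_mult test_function_partial assms smooth_const)
  qed
  then show ?thesis
    by (simp add: frechet_derivative_eq_sum_partial smooth_differentiable[OF test_function_smooth[OF assms]])
qed

lemma smooth_ftc:
  assumes "smooth f" "0 \<le> h"
  shows "f z - f (z - h *\<^sub>R e) =
    (LINT r|lborel. indicator {0..h} r * frechet_derivative f (at (z - r *\<^sub>R e)) e)"
proof -
  have "((\<lambda>r. - f (z - r *\<^sub>R e)) has_vector_derivative frechet_derivative f (at (z - r *\<^sub>R e)) e)
      (at r within {0..h})" for r
  proof -
    have 1: "((\<lambda>r. z - r *\<^sub>R e) has_derivative (\<lambda>r. - (r *\<^sub>R e))) (at r within {0..h})"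
      by (auto intro!: derivative_eq_intros)
    interpret bounded_linear "frechet_derivative f (at (z - r *\<^sub>R e))"
      using has_derivative_smooth[OF assms(1)] has_derivative_bounded_linear by blast
    show ?thesis
      using has_derivative_minus[OF has_derivative_compose[OF 1 has_derivative_smooth[OF assms(1)]]]
      by (simp add: has_vector_derivative_def neg scaleR)
  qed
  moreover have "continuous_on {0..h} (\<lambda>r. frechet_derivative f (at (z - r *\<^sub>R e)) e)"
    by (intro continuous_on_compose2[OF smooth_continuous[OF smooth_frechet[OF assms(1)], of UNIV]]
        continuous_intros) auto
  ultimately have "(LBINT r. indicator {0..h} r *\<^sub>R frechet_derivative f (at (z - r *\<^sub>R e)) e) =
      - f (z - h *\<^sub>R e) - - f (z - 0 *\<^sub>R e)"
    by (intro integral_FTC_atLeastAtMost assms(2))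
  then show ?thesis by simp
qed

text \<open>No measurability is assumed: translation preserves non-measurability, and then both
  integrals take the default value 0.\<close>

lemma lborel_integral_shift:
  fixes f :: "'a::euclidean_space \<Rightarrow> real"
  shows "(LINT x|lborel. f (x + c)) = (LINT x|lborel. f x)"
proof -
  have 1: "(\<lambda>x. x + c) \<in> borel_measurable borel" by simp
  have "(LINT x|lborel. f x) = (LINT x|distr lborel borel ((+) c). f x)"
    by (simp add: lborel_distr_plus)
  show ?thesis
  proof (cases "f \<in> borel_measurable borel")
    case True
    have "(LINT x|distr lborel borel ((+) c). f x) = (LINT x|lborel. f (c + x))"
      using True by (intro integral_distr) auto
    then show ?thesis by (simp add: lborel_distr_plus add.commute)
  next
    case False
    have "(\<lambda>x. f (x + c)) \<notin> borel_measurable borel"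
    proof
      assume "(\<lambda>x. f (x + c)) \<in> borel_measurable borel"
      then have "(\<lambda>x. f ((x - c) + c)) \<in> borel_measurable borel"
        by (rule measurable_compose[rotated]) simp
      with False show False by simp
    qed
    then have "\<not> integrable lborel (\<lambda>x. f (x + c))" "\<not> integrable lborel f"
      using False by (auto dest!: borel_measurable_integrable)
    then show ?thesis by (simp add: not_integrable_integral_eq)
  qed
qed

lemma lborel_nn_integral_shift:
  fixes f :: "'a::euclidean_space \<Rightarrow> ennreal"
  assumes [measurable]: "f \<in> borel_measurable borel"
  shows "(\<integral>\<^sup>+x. f (x + c) \<partial>lborel) = (\<integral>\<^sup>+x. f x \<partial>lborel)"
proof -
  have "(\<integral>\<^sup>+x. f x \<partial>distr lborel borel ((+) c)) = (\<integral>\<^sup>+x. f (c + x) \<partial>lborel)"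
    by (intro nn_integral_distr) auto
  then show ?thesis by (simp add: lborel_distr_plus add.commute)
qed

lemma lborel_integrable_shift:
  fixes f :: "'a::euclidean_space \<Rightarrow> real"
  assumes "integrable lborel f" shows "integrable lborel (\<lambda>x. f (x + c))"
proof -
  have [measurable]: "f \<in> borel_measurable borel" using assms by auto
  have "integrable (distr lborel borel ((+) c)) f" using assms by (simp add: lborel_distr_plus)
  then show ?thesis by (subst (asm) integrable_distr_eq) (auto simp: add.commute)
qed

text \<open>Joint integrability for the exchanges of the translation parameter with the space
  variable. By Tonelli and translation invariance the double integral of |H| is \<open>h\<close>
  times its L1 norm.\<close>

lemma integrable_pair_shift:
  fixes H :: "'a::euclidean_space \<Rightarrow> real"
  assumes H: "integrable lborel H" and g[measurable]: "g \<in> borel_measurable (lborel \<Otimes>\<^sub>M lborel)"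
    and B: "\<And>z. \<bar>g z\<bar> \<le> B"
  shows "integrable (lborel \<Otimes>\<^sub>M lborel) (\<lambda>(r::real, x). indicator {0..h} r * (H (x + r *\<^sub>R e) * g (r, x)))"
proof -
  have [measurable]: "H \<in> borel_measurable borel" using H by auto
  have "integrable (lborel \<Otimes>\<^sub>M lborel) (\<lambda>(r::real, x). indicator {0..h} r * H (x + r *\<^sub>R e))"
  proof (rule integrableI_bounded)
    have "(\<integral>\<^sup>+z. ennreal (norm (case z of (r::real, x) \<Rightarrow> indicator {0..h} r * H (x + r *\<^sub>R e))) \<partial>(lborel \<Otimes>\<^sub>M lborel))
       = (\<integral>\<^sup>+r. \<integral>\<^sup>+x. indicator {0..h} r * ennreal \<bar>H (x + r *\<^sub>R e)\<bar> \<partial>lborel \<partial>lborel)"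
      by (subst lborel.nn_integral_fst[symmetric])
        (auto intro!: nn_integral_cong simp: abs_mult ennreal_mult split: split_indicator)
    also have "\<dots> = (\<integral>\<^sup>+r. indicator {0..h} r * (\<integral>\<^sup>+x. ennreal \<bar>H x\<bar> \<partial>lborel) \<partial>lborel)"
      using lborel_nn_integral_shift[of "\<lambda>x. ennreal \<bar>H x\<bar>"]
      by (auto intro!: nn_integral_cong simp: nn_integral_cmult)
    also have "\<dots> = emeasure lborel {0..h} * (\<integral>\<^sup>+x. ennreal \<bar>H x\<bar> \<partial>lborel)"
      by (simp add: nn_integral_multc)
    also have "\<dots> < \<infinity>"
      using H unfolding integrable_iff_bounded by (auto simp: ennreal_mult_less_top emeasure_lborel_Icc_eq)
    finally show "(\<integral>\<^sup>+z. ennreal (norm (case z of (r::real, x) \<Rightarrow> indicator {0..h} r * H (x + r *\<^sub>R e))) \<partial>(lborel \<Otimes>\<^sub>M lborel)) < \<infinity>" .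
  qed measurable
  from integrable_bounded_mult[OF this g B] show ?thesis
    by (simp add: case_prod_unfold mult.assoc)
qed

text \<open>Testing \<open>G(\<cdot> + h e) - G\<close> amounts to testing the weak derivative of \<open>G\<close> against all translates
  of the test function by \<open>r e\<close>, \<open>0 \<le> r \<le> h\<close>.\<close>

lemma weak_ftc:
  fixes G H :: "'a::euclidean_space \<Rightarrow> real"
  assumes G: "integrable lborel G" and H: "integrable lborel H"
    and weak: "\<And>\<psi>. test_function S \<psi> \<Longrightarrow>
      (LINT x|lborel. G x * frechet_derivative \<psi> (at x) e) = - (LINT x|lborel. H x * \<psi> x)"
    and V: "open V" and h: "0 \<le> h" and sub: "\<And>x r. x \<in> V \<Longrightarrow> r \<in> {0..h} \<Longrightarrow> x + r *\<^sub>R e \<in> S"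
  shows "AE x in lborel. x \<in> V \<longrightarrow>
    G (x + h *\<^sub>R e) - G x = (LINT r|lborel. indicator {0..h} r * H (x + r *\<^sub>R e))"
proof -
  have [measurable]: "G \<in> borel_measurable borel" "H \<in> borel_measurable borel" using G H by auto
  define I where "I = (\<lambda>x. LINT r|lborel. indicator {0..h} r * H (x + r *\<^sub>R e))"
  have iI: "integrable lborel I"
    using lborel_pair.integrable_snd[OF integrable_pair_shift[OF H, of "\<lambda>_. 1" 1 h e]]
    by (simp add: I_def)
  have "AE x in lborel. x \<in> V \<longrightarrow> G (x + h *\<^sub>R e) - G x - I x = 0"
  proof (rule fundamental_lemma[OF _ V])
    show "integrable lborel (\<lambda>x. G (x + h *\<^sub>R e) - G x - I x)"
      using G iI lborel_integrable_shift[OF G] by auto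
    fix \<psi> assume \<psi>: "test_function V \<psi>"
    have sm: "smooth \<psi>" by (rule test_function_smooth[OF \<psi>])
    note [measurable] = smooth_measurable[OF sm] smooth_measurable[OF smooth_frechet[OF sm]]
    obtain B where B: "\<And>x. \<bar>\<psi> x\<bar> \<le> B" using test_function_bounded[OF \<psi>] by metis
    obtain B' where B': "\<And>x. \<bar>frechet_derivative \<psi> (at x) e\<bar> \<le> B'"
      using test_function_bounded[OF test_function_frechet[OF \<psi>]] by metis
    have fr: "frechet_derivative (\<lambda>z. \<psi> (z - r *\<^sub>R e)) (at z) e = frechet_derivative \<psi> (at (z - r *\<^sub>R e)) e" for r z
    proof -
      have "((\<lambda>z. z - r *\<^sub>R e) has_derivative (\<lambda>v. v)) (at z)" by (auto intro!: derivative_eq_intros)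
      from has_derivative_compose[OF this has_derivative_smooth[OF sm]]
      show ?thesis by (metis frechet_derivative_at)
    qed
    \<comment> \<open>By \<open>sub\<close>, segments of length \<open>h\<close> in direction
      \<open>e\<close> that start in \<open>V\<close> stay in \<open>S\<close>, so each translate is
      an admissible test function in \<open>weak\<close>.\<close>
    have tr: "test_function S (\<lambda>z. \<psi> (z - r *\<^sub>R e))" if "r \<in> {0..h}" for r
      using test_function_shift[OF \<psi>, of "- (r *\<^sub>R e)" S] sub that by auto
    have i1: "integrable lborel (\<lambda>x. G (x + h *\<^sub>R e) * \<psi> x)"
      by (rule integrable_bounded_mult[OF lborel_integrable_shift[OF G] _ B]) measurable
    have i1': "integrable lborel (\<lambda>x. G x * \<psi> (x - h *\<^sub>R e))"
      by (rule integrable_bounded_mult[OF G _ B]) measurable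
    have i2: "integrable lborel (\<lambda>x. G x * \<psi> x)" by (rule integrable_bounded_mult[OF G _ B]) measurable
    have i3: "integrable lborel (\<lambda>x. I x * \<psi> x)" by (rule integrable_bounded_mult[OF iI _ B]) measurable
    have P1: "integrable (lborel \<Otimes>\<^sub>M lborel)
        (\<lambda>(r, x). indicator {0..h} r * (G x * frechet_derivative \<psi> (at (x - r *\<^sub>R e)) e))"
      using integrable_pair_shift[OF G, of "\<lambda>(r, x). frechet_derivative \<psi> (at (x - r *\<^sub>R e)) e" B' h 0] B'
      by (auto simp: case_prod_beta)
    have P2: "integrable (lborel \<Otimes>\<^sub>M lborel)
        (\<lambda>(r, x). indicator {0..h} r * (H (x + r *\<^sub>R e) * \<psi> x))"
      using integrable_pair_shift[OF H, of "\<lambda>(r, x). \<psi> x" B h e] B by (auto simp: case_prod_beta)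
    have "(LINT x|lborel. G (x + h *\<^sub>R e) * \<psi> x) = (LINT x|lborel. G x * \<psi> (x - h *\<^sub>R e))"
      using lborel_integral_shift[of "\<lambda>x. G x * \<psi> (x - h *\<^sub>R e)" "h *\<^sub>R e"] by simp
    then have "(LINT x|lborel. G (x + h *\<^sub>R e) * \<psi> x) - (LINT x|lborel. G x * \<psi> x)
        = - (LINT x|lborel. G x * (\<psi> x - \<psi> (x - h *\<^sub>R e)))"
      using i1' i2 by (simp add: right_diff_distrib)
    also have "(LINT x|lborel. G x * (\<psi> x - \<psi> (x - h *\<^sub>R e))) =
        (LINT x|lborel. LINT r|lborel. indicator {0..h} r * (G x * frechet_derivative \<psi> (at (x - r *\<^sub>R e)) e))"
      unfolding smooth_ftc[OF sm h] by (simp add: mult.left_commute)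
    also have "\<dots> = (LINT r|lborel. LINT x|lborel. indicator {0..h} r * (G x * frechet_derivative \<psi> (at (x - r *\<^sub>R e)) e))"
      using lborel_pair.Fubini_integral[OF P1] .
    also have "\<dots> = (LINT r|lborel. - (LINT x|lborel. indicator {0..h} r * (H (x + r *\<^sub>R e) * \<psi> x)))"
    proof (rule Bochner_Integration.integral_cong[OF refl])
      fix r :: real
      show "(LINT x|lborel. indicator {0..h} r * (G x * frechet_derivative \<psi> (at (x - r *\<^sub>R e)) e)) =
          - (LINT x|lborel. indicator {0..h} r * (H (x + r *\<^sub>R e) * \<psi> x))"
        using weak[OF tr, of r] lborel_integral_shift[of "\<lambda>x. H x * \<psi> (x - r *\<^sub>R e)" "r *\<^sub>R e"]
        by (auto simp: fr indicator_def)
    qed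
    also have "\<dots> = - (LINT x|lborel. LINT r|lborel. indicator {0..h} r * (H (x + r *\<^sub>R e) * \<psi> x))"
      using lborel_pair.Fubini_integral[OF P2] by simp
    also have "(LINT x|lborel. LINT r|lborel. indicator {0..h} r * (H (x + r *\<^sub>R e) * \<psi> x)) = (LINT x|lborel. I x * \<psi> x)"
      unfolding I_def by (simp flip: mult.assoc)
    finally show "(LINT x|lborel. (G (x + h *\<^sub>R e) - G x - I x) * \<psi> x) = 0"
      using i1 i2 i3 by (simp add: left_diff_distrib)
  qed
  then show ?thesis by (simp add: I_def)
qed

text \<open>The integral of \<open>\<psi> x - \<psi> (x - e)\<close> vanishes by translation
  invariance. Writing the difference as an average of directional derivatives along the segment and
  exchanging integrals turns it into the integral of the derivative.\<close>

lemma integral_partial_eq_0: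
  assumes "test_function UNIV \<psi>"
  shows "(LINT x|lborel. frechet_derivative \<psi> (at x) e) = 0"
proof -
  have sm: "smooth \<psi>" by (rule test_function_smooth[OF assms])
  note [measurable] = smooth_measurable[OF smooth_frechet[OF sm]]
  have i: "integrable lborel \<psi>" "integrable lborel (\<lambda>x. frechet_derivative \<psi> (at x) e)"
    using test_function_integrable assms test_function_frechet by blast+
  have P: "integrable (lborel \<Otimes>\<^sub>M lborel)
      (\<lambda>(r, x). indicator {0..1} r * frechet_derivative \<psi> (at (x - r *\<^sub>R e)) e)"
    using integrable_pair_shift[OF i(2), of "\<lambda>_. 1" 1 1 "- e"] by simp
  have "0 = (LINT x|lborel. \<psi> x - \<psi> (x - 1 *\<^sub>R e))"
    using i(1) lborel_integrable_shift[OF i(1), of "- e"] lborel_integral_shift[of \<psi> "- e"] by simp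
  also have "\<dots> = (LINT x|lborel. LINT r|lborel. indicator {0..1} r * frechet_derivative \<psi> (at (x - r *\<^sub>R e)) e)"
    by (subst smooth_ftc[OF sm]) auto
  also have "\<dots> = (LINT r|lborel. LINT x|lborel. indicator {0..1} r * frechet_derivative \<psi> (at (x - r *\<^sub>R e)) e)"
    using lborel_pair.Fubini_integral[OF P] .
  also have "\<dots> = (LINT r|lborel. indicator {0..1::real} r * (LINT x|lborel. frechet_derivative \<psi> (at x) e))"
    using lborel_integral_shift[of "\<lambda>x. frechet_derivative \<psi> (at x) e" "- (r *\<^sub>R e)" for r] by simp
  also have "\<dots> = (LINT x|lborel. frechet_derivative \<psi> (at x) e)"
    by simp
  finally show ?thesis by simp
qed

lemma test_function_by_parts:
  assumes f: "test_function S f" and g: "smooth g" and b: "b \<in> Basis"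
  shows "(LINT x|lborel. f x * partial b g x) = - (LINT x|lborel. partial b f x * g x)"
proof -
  have fs: "smooth f" by (rule test_function_smooth[OF f])
  have t: "test_function UNIV (\<lambda>x. f x * g x)"
    using test_function_mult[OF test_function_mono[OF f] g, of UNIV] by (simp add: mult.commute)
  have "partial b (\<lambda>x. f x * g x) x = f x * partial b g x + partial b f x * g x" for x
    by (intro partial_mult smooth_differentiable fs g)
  then have "(LINT x|lborel. f x * partial b g x + partial b f x * g x) = 0"
    using integral_partial_eq_0[OF t, of b] by (simp add: partial_def)
  moreover have "integrable lborel (\<lambda>x. f x * partial b g x)" "integrable lborel (\<lambda>x. partial b f x * g x)"
    using test_function_integrable[OF test_function_mult[OF f smooth_partial[OF g b]]]
      test_function_integrable[OF test_function_mult[OF test_function_partial[OF f b] g]]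
    by (simp_all add: mult.commute)
  ultimately show ?thesis by simp
qed

section \<open>Square integrable functions\<close>

text \<open>Functions are kept instead of classes, so \<open>l2\<close> is only a seminorm and
  identities up to null sets appear as explicit \<open>AE\<close> statements.\<close>

definition L2_on :: "'a measure \<Rightarrow> ('a \<Rightarrow> real) \<Rightarrow> bool" where
  "L2_on M f \<longleftrightarrow> f \<in> borel_measurable M \<and> integrable M (\<lambda>x. (f x)\<^sup>2)"

definition ip :: "'a measure \<Rightarrow> ('a \<Rightarrow> real) \<Rightarrow> ('a \<Rightarrow> real) \<Rightarrow> real" where
  "ip M f g = (LINT x|M. f x * g x)"

definition l2 :: "'a measure \<Rightarrow> ('a \<Rightarrow> real) \<Rightarrow> real" where
  "l2 M f = sqrt (LINT x|M. (f x)\<^sup>2)"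

lemma square_integrable_L2_on: "square_integrable S f \<longleftrightarrow> L2_on (lebesgue_on S) f"
  by (simp add: square_integrable_def L2_on_def)

lemma L2_on_mult:
  assumes "L2_on M f" "L2_on M g" shows "integrable M (\<lambda>x. f x * g x)"
proof (rule Bochner_Integration.integrable_bound)
  show "integrable M (\<lambda>x. (f x)\<^sup>2 + (g x)\<^sup>2)" using assms by (simp add: L2_on_def)
  have "\<bar>a * b\<bar> \<le> a\<^sup>2 + b\<^sup>2" for a b :: real
  proof -
    have "2 * (\<bar>a\<bar> * \<bar>b\<bar>) \<le> \<bar>a\<bar>\<^sup>2 + \<bar>b\<bar>\<^sup>2" using sum_squares_bound[of "\<bar>a\<bar>" "\<bar>b\<bar>"] by simp
    moreover have "0 \<le> a\<^sup>2 + b\<^sup>2" by simp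
    ultimately show ?thesis unfolding abs_mult power2_abs by linarith
  qed
  then show "AE x in M. norm (f x * g x) \<le> norm ((f x)\<^sup>2 + (g x)\<^sup>2)" by simp
qed (use assms in \<open>auto simp: L2_on_def\<close>)

lemma L2_on_scale: "L2_on M f \<Longrightarrow> L2_on M (\<lambda>x. a * f x)"
  by (auto simp: L2_on_def power_mult_distrib)

lemma L2_on_add:
  assumes "L2_on M f" "L2_on M g" shows "L2_on M (\<lambda>x. f x + g x)"
  using assms L2_on_mult[OF assms] by (auto simp: L2_on_def power2_sum mult.assoc)

lemma L2_on_diff: "L2_on M f \<Longrightarrow> L2_on M g \<Longrightarrow> L2_on M (\<lambda>x. f x - g x)"
  using L2_on_add[OF _ L2_on_scale[of M g "-1"]] by simp

lemma L2_on_0: "L2_on M (\<lambda>x. 0)" by (simp add: L2_on_def)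

lemma L2_on_sum: "(\<And>i. i \<in> I \<Longrightarrow> L2_on M (f i)) \<Longrightarrow> L2_on M (\<lambda>x. \<Sum>i\<in>I. f i x)"
  by (induction I rule: infinite_finite_induct) (auto simp: L2_on_0 L2_on_add)

lemma L2_on_bounded_mult:
  assumes "L2_on M f" and [measurable]: "g \<in> borel_measurable M" and B: "\<And>x. x \<in> space M \<Longrightarrow> \<bar>g x\<bar> \<le> B"
  shows "L2_on M (\<lambda>x. g x * f x)"
proof -
  have [measurable]: "f \<in> borel_measurable M" using assms by (simp add: L2_on_def)
  have "integrable M (\<lambda>x. (g x * f x)\<^sup>2)"
  proof (rule Bochner_Integration.integrable_bound)
    show "integrable M (\<lambda>x. B\<^sup>2 * (f x)\<^sup>2)" using assms by (simp add: L2_on_def)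
    have "(g x)\<^sup>2 \<le> B\<^sup>2" if "x \<in> space M" for x
      using B[OF that] by (metis abs_ge_zero power2_abs power_mono)
    then show "AE x in M. norm ((g x * f x)\<^sup>2) \<le> norm (B\<^sup>2 * (f x)\<^sup>2)"
      by (intro AE_I2) (auto simp: power_mult_distrib intro!: mult_right_mono)
  qed measurable
  then show ?thesis using assms by (auto simp: L2_on_def)
qed

lemma l2_nonneg [simp]: "0 \<le> l2 M f" by (simp add: l2_def)

lemma l2_sq: "(l2 M f)\<^sup>2 = (LINT x|M. (f x)\<^sup>2)" by (simp add: l2_def)

lemma ip_self: "ip M f f = (l2 M f)\<^sup>2"
  unfolding l2_sq ip_def by (simp only: power2_eq_square)

lemma ip_commute: "ip M f g = ip M g f" by (simp add: ip_def mult.commute)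

lemma ip_add:
  assumes "L2_on M f" "L2_on M g" "L2_on M h"
  shows "ip M (\<lambda>x. f x + g x) h = ip M f h + ip M g h"
  using L2_on_mult[OF assms(1,3)] L2_on_mult[OF assms(2,3)] by (simp add: ip_def distrib_right)

lemma ip_scale: "ip M (\<lambda>x. a * f x) h = a * ip M f h" by (simp add: ip_def mult.assoc)

lemma ip_diff:
  assumes "L2_on M f" "L2_on M g" "L2_on M h"
  shows "ip M (\<lambda>x. f x - g x) h = ip M f h - ip M g h"
  using L2_on_mult[OF assms(1,3)] L2_on_mult[OF assms(2,3)] by (simp add: ip_def left_diff_distrib)

lemma ip_cong:
  assumes "AE x in M. f x = f' x" "AE x in M. g x = g' x"
    "L2_on M f" "L2_on M f'" "L2_on M g" "L2_on M g'"
  shows "ip M f g = ip M f' g'"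
  unfolding ip_def
proof (rule integral_cong_AE)
  show "AE x in M. f x * g x = f' x * g' x" using assms(1,2) by eventually_elim simp
qed (use assms in \<open>auto simp: L2_on_def\<close>)

lemma l2_cong:
  assumes "AE x in M. f x = f' x" "L2_on M f" "L2_on M f'" shows "l2 M f = l2 M f'"
proof -
  have "ip M f f = ip M f' f'" by (rule ip_cong) (use assms in auto)
  then have "(l2 M f)\<^sup>2 = (l2 M f')\<^sup>2" by (simp add: ip_self)
  then show ?thesis by simp
qed

lemma l2_scale: "l2 M (\<lambda>x. a * f x) = \<bar>a\<bar> * l2 M f"
  by (simp add: l2_def power_mult_distrib real_sqrt_mult)

text \<open>Cauchy-Schwarz from the nonnegative quadratic polynomial in t given by the squared norm
  of \<open>f - t g\<close>, taken at its minimiser. If \<open>g\<close> has norm zero the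
  polynomial is affine and is treated apart.\<close>

lemma ip_le:
  assumes f: "L2_on M f" and g: "L2_on M g" shows "\<bar>ip M f g\<bar> \<le> l2 M f * l2 M g"
proof -
  have quad: "0 \<le> (l2 M f)\<^sup>2 - 2 * t * ip M f g + t\<^sup>2 * (l2 M g)\<^sup>2" for t
  proof -
    have "0 \<le> (LINT x|M. (f x - t * g x)\<^sup>2)" by simp
    also have "\<dots> = (LINT x|M. (f x)\<^sup>2 - 2 * t * (f x * g x) + t\<^sup>2 * (g x)\<^sup>2)"
      by (intro Bochner_Integration.integral_cong) (auto simp: power2_eq_square algebra_simps)
    also have "\<dots> = (l2 M f)\<^sup>2 - 2 * t * ip M f g + t\<^sup>2 * (l2 M g)\<^sup>2"
      using f g L2_on_mult[OF f g] by (simp add: L2_on_def l2_sq ip_def)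
    finally show ?thesis .
  qed
  have "(ip M f g)\<^sup>2 \<le> (l2 M f)\<^sup>2 * (l2 M g)\<^sup>2"
  proof (cases "l2 M g = 0")
    case True
    have "ip M f g = 0"
    proof (rule ccontr)
      assume "ip M f g \<noteq> 0"
      \<comment> \<open>At this value of t the affine polynomial equals -1.\<close>
      then show False using quad[of "((l2 M f)\<^sup>2 + 1) / (2 * ip M f g)"] True by (simp add: field_simps)
    qed
    then show ?thesis by simp
  next
    case False
    then have pos: "0 < (l2 M g)\<^sup>2" by simp
    have "0 \<le> (l2 M f)\<^sup>2 - (ip M f g)\<^sup>2 / (l2 M g)\<^sup>2"
      using quad[of "ip M f g / (l2 M g)\<^sup>2"] False by (simp add: power2_eq_square)
    then show ?thesis using pos by (simp add: pos_divide_le_eq)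
  qed
  then show ?thesis
    by (metis abs_ge_zero l2_nonneg mult_nonneg_nonneg power2_abs power2_le_imp_le power_mult_distrib)
qed

lemma l2_triangle:
  assumes f: "L2_on M f" and g: "L2_on M g"
  shows "l2 M (\<lambda>x. f x + g x) \<le> l2 M f + l2 M g"
proof (rule power2_le_imp_le)
  have "(l2 M (\<lambda>x. f x + g x))\<^sup>2 = (LINT x|M. (f x)\<^sup>2 + 2 * (f x * g x) + (g x)\<^sup>2)"
    unfolding l2_sq by (intro Bochner_Integration.integral_cong) (auto simp: power2_eq_square algebra_simps)
  also have "\<dots> = (l2 M f)\<^sup>2 + 2 * ip M f g + (l2 M g)\<^sup>2"
    using f g L2_on_mult[OF f g] by (simp add: L2_on_def l2_sq ip_def)
  also have "\<dots> \<le> (l2 M f + l2 M g)\<^sup>2"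
    using ip_le[OF f g] by (simp add: power2_sum)
  finally show "(l2 M (\<lambda>x. f x + g x))\<^sup>2 \<le> (l2 M f + l2 M g)\<^sup>2" .
qed simp

lemma l2_diff_commute: "l2 M (\<lambda>x. f x - g x) = l2 M (\<lambda>x. g x - f x)"
  by (simp add: l2_def power2_commute)

lemma l2_dist:
  assumes f: "L2_on M f" and g: "L2_on M g"
  shows "\<bar>l2 M f - l2 M g\<bar> \<le> l2 M (\<lambda>x. f x - g x)"
  using l2_triangle[OF L2_on_diff[OF f g] g] l2_triangle[OF L2_on_diff[OF g f] f]
  by (simp add: l2_diff_commute[of M g f])

lemma l2_sum:
  "(\<And>i. i \<in> I \<Longrightarrow> L2_on M (f i)) \<Longrightarrow> l2 M (\<lambda>x. \<Sum>i\<in>I. f i x) \<le> (\<Sum>i\<in>I. l2 M (f i))"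
proof (induction I rule: infinite_finite_induct)
  case (insert i I)
  have "l2 M (\<lambda>x. f i x + (\<Sum>i\<in>I. f i x)) \<le> l2 M (f i) + l2 M (\<lambda>x. \<Sum>i\<in>I. f i x)"
    by (intro l2_triangle L2_on_sum) (use insert in auto)
  then show ?case using insert by fastforce
qed (auto simp: l2_def)

lemma l2_mono:
  assumes "L2_on M f" "L2_on M g" "AE x in M. \<bar>f x\<bar> \<le> \<bar>g x\<bar>" shows "l2 M f \<le> l2 M g"
  unfolding l2_def
  by (intro real_sqrt_le_mono integral_mono_AE) (use assms in \<open>auto simp: L2_on_def abs_le_square_iff\<close>)

lemma l2_bounded_mult:
  assumes "L2_on M f" "g \<in> borel_measurable M" "\<And>x. x \<in> space M \<Longrightarrow> \<bar>g x\<bar> \<le> B" "0 \<le> B"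
  shows "l2 M (\<lambda>x. g x * f x) \<le> B * l2 M f"
proof -
  have "l2 M (\<lambda>x. g x * f x) \<le> l2 M (\<lambda>x. B * f x)"
    by (intro l2_mono L2_on_bounded_mult L2_on_scale AE_I2)
      (use assms in \<open>auto simp: abs_mult intro!: mult_right_mono\<close>)
  then show ?thesis using assms(4) by (simp add: l2_scale)
qed

text \<open>Stated for an arbitrary filter, since it serves both sequences of test functions and
  difference quotients in time. The difference of inner products is split into three terms, each
  containing a small factor.\<close>

lemma tendsto_ip:
  assumes "L2_on M f" "L2_on M g" "\<forall>\<^sub>F s in F. L2_on M (fs s)" "\<forall>\<^sub>F s in F. L2_on M (gs s)"
    "((\<lambda>s. l2 M (\<lambda>x. fs s x - f x)) \<longlongrightarrow> 0) F" "((\<lambda>s. l2 M (\<lambda>x. gs s x - g x)) \<longlongrightarrow> 0) F"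
  shows "((\<lambda>s. ip M (fs s) (gs s)) \<longlongrightarrow> ip M f g) F"
proof (rule LIM_zero_cancel, rule Lim_null_comparison)
  let ?df = "\<lambda>s x. fs s x - f x" and ?dg = "\<lambda>s x. gs s x - g x"
  show "\<forall>\<^sub>F s in F. norm (ip M (fs s) (gs s) - ip M f g) \<le>
    l2 M (?df s) * l2 M (?dg s) + l2 M (?df s) * l2 M g + l2 M f * l2 M (?dg s)"
    using assms(3,4)
  proof eventually_elim
    case (elim s)
    note L = assms(1,2) elim
    have "ip M (fs s) (gs s) = ip M (\<lambda>x. ?df s x + f x) (gs s)" by simp
    also have "\<dots> = ip M (?df s) (gs s) + ip M f (gs s)" by (intro ip_add L2_on_diff L)
    also have "ip M (?df s) (gs s) = ip M (\<lambda>x. ?dg s x + g x) (?df s)" by (simp add: ip_commute)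
    also have "\<dots> = ip M (?dg s) (?df s) + ip M g (?df s)" by (intro ip_add L2_on_diff L)
    also have "ip M f (gs s) = ip M (\<lambda>x. ?dg s x + g x) f" by (simp add: ip_commute)
    also have "\<dots> = ip M (?dg s) f + ip M g f" by (intro ip_add L2_on_diff L)
    finally have "ip M (fs s) (gs s) - ip M f g = ip M (?df s) (?dg s) + ip M (?df s) g + ip M f (?dg s)"
      by (simp add: ip_commute)
    moreover have "\<bar>ip M (?df s) (?dg s)\<bar> \<le> l2 M (?df s) * l2 M (?dg s)"
      "\<bar>ip M (?df s) g\<bar> \<le> l2 M (?df s) * l2 M g" "\<bar>ip M f (?dg s)\<bar> \<le> l2 M f * l2 M (?dg s)"
      by (intro ip_le L2_on_diff L)+
    ultimately show ?case by simp
  qed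
  show "((\<lambda>s. l2 M (?df s) * l2 M (?dg s) + l2 M (?df s) * l2 M g + l2 M f * l2 M (?dg s)) \<longlongrightarrow> 0) F"
    using tendsto_add[OF tendsto_add[OF tendsto_mult[OF assms(5,6)] tendsto_mult_right[OF assms(5)]]
        tendsto_mult_left[OF assms(6)]] by simp
qed

section \<open>Weak derivatives\<close>

text \<open>Completeness of Lebesgue measure. It makes arbitrarily chosen representatives of weak
  derivatives measurable, and likewise functions of time known only almost everywhere.\<close>

lemma measurable_lebesgue_on_AE:
  fixes f g :: "'a::euclidean_space \<Rightarrow> real"
  assumes S: "S \<in> sets lebesgue" and g: "g \<in> borel_measurable (lebesgue_on S)"
    and ae: "AE x in lebesgue_on S. f x = g x"
  shows "f \<in> borel_measurable (lebesgue_on S)"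
proof -
  let ?f = "\<lambda>x. if x \<in> S then f x else 0" and ?g = "\<lambda>x. if x \<in> S then g x else 0"
  have g': "?g \<in> borel_measurable lebesgue" using g borel_measurable_if[OF S] by blast
  have ae': "AE x in lebesgue. ?f x = ?g x"
    using ae S by (auto simp: AE_restrict_space_iff elim: eventually_mono)
  have "?f \<in> borel_measurable lebesgue"
  proof (rule measurableI)
    fix A :: "real set" assume "A \<in> sets borel"
    then have 1: "?g -` A \<inter> space lebesgue \<in> sets lebesgue" using g' by (rule measurable_sets[rotated])
    show "?f -` A \<inter> space lebesgue \<in> sets lebesgue"
    proof (rule complete_measure.in_sets_AE[OF completion.complete_measure_axioms _ 1])
      show "AE x in lebesgue. (x \<in> ?g -` A \<inter> space lebesgue) = (x \<in> ?f -` A \<inter> space lebesgue)"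
        using ae' by eventually_elim auto
    qed auto
  qed auto
  then show ?thesis using borel_measurable_if[OF S] by blast
qed

lemma borel_representative:
  fixes f :: "'a::euclidean_space \<Rightarrow> real"
  assumes S: "S \<in> sets borel" and f: "f \<in> borel_measurable (lebesgue_on S)"
  obtains g where "g \<in> borel_measurable borel" "\<And>x. x \<notin> S \<Longrightarrow> g x = 0" "AE x in lebesgue_on S. f x = g x"
proof -
  have SL: "S \<in> sets lebesgue" using S by simp
  have "(\<lambda>x. if x \<in> S then f x else 0) \<in> borel_measurable (completion lborel)"
    using f borel_measurable_if[OF SL] by blast
  then obtain g where g: "g \<in> borel_measurable lborel" "AE x in lborel. (if x \<in> S then f x else 0) = g x"
    using completion_ex_borel_measurable_real by blast
  have [measurable]: "S \<in> sets borel" "g \<in> borel_measurable borel" using S g by auto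
  show ?thesis
  proof (rule that)
    show "(\<lambda>x. indicator S x * g x) \<in> borel_measurable borel" by measurable
    show "AE x in lebesgue_on S. f x = indicator S x * g x"
      using AE_completion[OF g(2)] SL by (simp add: AE_restrict_space_iff) (auto elim: eventually_mono)
  qed auto
qed

lemma borel_measurable_lebesgue_onI:
  "f \<in> borel_measurable borel \<Longrightarrow> f \<in> borel_measurable (lebesgue_on S)"
  by (simp add: measurable_completion measurable_restrict_space1)

text \<open>Bridge between the two settings: the Sobolev definitions integrate over
  \<open>lebesgue_on S\<close>, while translations and Fubini are used for Borel functions on the
  whole space.\<close>

lemma lebesgue_on_lborel:
  fixes g :: "'a::euclidean_space \<Rightarrow> real"
  assumes S: "S \<in> sets borel" and g: "g \<in> borel_measurable borel" and 0: "\<And>x. x \<notin> S \<Longrightarrow> g x = 0"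
  shows "integrable (lebesgue_on S) g \<longleftrightarrow> integrable lborel g"
    and "integral\<^sup>L (lebesgue_on S) g = integral\<^sup>L lborel g"
proof -
  have SL: "S \<inter> space lebesgue \<in> sets lebesgue" using S by simp
  have e: "(\<lambda>x. indicator S x *\<^sub>R g x) = g" using 0 by (auto simp: fun_eq_iff indicator_def)
  show "integrable (lebesgue_on S) g \<longleftrightarrow> integrable lborel g"
    using integrable_restrict_space[OF SL, of g] g by (simp add: e[simplified] integrable_completion)
  show "integral\<^sup>L (lebesgue_on S) g = integral\<^sup>L lborel g"
    using integral_restrict_space[OF SL, of g] g by (simp add: e[simplified] integral_completion)
qed

lemma test_function_mult_integrable:
  assumes S: "open S" and f: "locally_integrable S f" and \<phi>: "test_function S \<phi>"
  shows "integrable (lebesgue_on S) (\<lambda>x. f x * \<phi> x)"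
proof -
  obtain K where K: "smooth \<phi>" "compact K" "K \<subseteq> S" "\<And>x. x \<notin> K \<Longrightarrow> \<phi> x = 0"
    using \<phi> by (metis test_functionE)
  obtain B where B: "\<And>x. \<bar>\<phi> x\<bar> \<le> B" using test_function_bounded[OF \<phi>] by metis
  have "integrable lebesgue (\<lambda>x. indicator K x *\<^sub>R f x)"
    using f K by (auto simp: locally_integrable_def set_integrable_def)
  then have "integrable lebesgue (\<lambda>x. indicator K x *\<^sub>R f x * \<phi> x)"
    by (rule integrable_bounded_mult[OF _ _ B])
      (use smooth_measurable[OF K(1)] in \<open>simp add: measurable_completion\<close>)
  moreover have "(\<lambda>x. indicator K x *\<^sub>R f x * \<phi> x) = (\<lambda>x. indicator S x *\<^sub>R (f x * \<phi> x))"
    using K(3,4) by (fastforce simp: fun_eq_iff indicator_def)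
  ultimately show ?thesis
    using S by (simp add: integrable_restrict_space)
qed

lemma locally_integrable_add:
  "locally_integrable S f \<Longrightarrow> locally_integrable S g \<Longrightarrow> locally_integrable S (\<lambda>x. f x + g x)"
  by (simp add: locally_integrable_def)

lemma locally_integrable_scale:
  "locally_integrable S f \<Longrightarrow> locally_integrable S (\<lambda>x. a * f x)"
  by (simp add: locally_integrable_def)

text \<open>The difference is only locally integrable, so the fundamental lemma is applied on closed
  boxes inside \<open>S\<close>, to a Borel representative extended by zero. Box frontiers are
  negligible, and countably many boxes exhaust \<open>S\<close>.\<close>

lemma AE_eq_if_weakly_eq:
  assumes S: "open S" and f: "locally_integrable S f" and g: "locally_integrable S g"
    and eq: "\<And>\<phi>. test_function S \<phi> \<Longrightarrow>
      (LINT x|lebesgue_on S. f x * \<phi> x) = (LINT x|lebesgue_on S. g x * \<phi> x)"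
  shows "AE x in lebesgue_on S. f x = g x"
proof -
  have box: "AE x in lebesgue. x \<in> cbox a b \<longrightarrow> f x = g x" if ab: "cbox a b \<subseteq> S" for a b
  proof -
    let ?C = "cbox a b"
    define D where "D = (\<lambda>x. f x - g x)"
    have D: "integrable (lebesgue_on ?C) D"
      using ab f g unfolding D_def locally_integrable_def
      by (intro Bochner_Integration.integrable_diff)
        (auto simp: integrable_restrict_space set_integrable_def)
    obtain E where E: "E \<in> borel_measurable borel" "\<And>x. x \<notin> ?C \<Longrightarrow> E x = 0"
      "AE x in lebesgue_on ?C. D x = E x"
    proof -
      have C: "?C \<in> sets borel" by simp
      show ?thesis by (rule borel_representative[OF C borel_measurable_integrable[OF D]], rule that)
    qed
    have iE: "integrable lborel E"
      using integrable_cong_AE_imp[OF D borel_measurable_lebesgue_onI[OF E(1)] E(3)]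
        lebesgue_on_lborel(1)[OF _ E(1), of ?C] E(2) by simp
    have "AE x in lborel. x \<in> box a b \<longrightarrow> E x = 0"
    proof (rule fundamental_lemma[OF iE open_box])
      fix \<phi> assume \<phi>: "test_function (box a b) \<phi>"
      have bS: "box a b \<subseteq> S" using ab box_subset_cbox by blast
      have "\<phi> x = 0" if "x \<notin> ?C" for x
        using \<phi> that box_subset_cbox[of a b] by (meson subsetD test_functionE)
      note phi0 = this
      note [measurable] = smooth_measurable[OF test_function_smooth[OF \<phi>]] E(1)
      have "(LINT x|lborel. E x * \<phi> x) = (LINT x|lebesgue_on ?C. E x * \<phi> x)"
        by (rule lebesgue_on_lborel(2)[symmetric]) (use E in auto)
      also have "\<dots> = (LINT x|lebesgue_on ?C. D x * \<phi> x)"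
      proof (rule integral_cong_AE)
        show "AE x in lebesgue_on ?C. E x * \<phi> x = D x * \<phi> x" using E(3) by eventually_elim simp
        have "\<phi> \<in> borel_measurable (lebesgue_on ?C)" "E \<in> borel_measurable (lebesgue_on ?C)"
          by (auto intro!: borel_measurable_lebesgue_onI)
        then show "(\<lambda>x. E x * \<phi> x) \<in> borel_measurable (lebesgue_on ?C)"
          "(\<lambda>x. D x * \<phi> x) \<in> borel_measurable (lebesgue_on ?C)" using D by auto
      qed
      also have "\<dots> = (LINT x|lebesgue_on S. D x * \<phi> x)"
        using S ab phi0 by (simp add: integral_restrict_space)
          (intro Bochner_Integration.integral_cong, auto simp: indicator_def)
      also have "\<dots> = 0"
        using eq[OF test_function_mono[OF \<phi> bS]] test_function_mult_integrable[OF S f test_function_mono[OF \<phi> bS]]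
          test_function_mult_integrable[OF S g test_function_mono[OF \<phi> bS]]
        by (simp add: D_def left_diff_distrib)
      finally show "(LINT x|lborel. E x * \<phi> x) = 0" .
    qed
    then have 1: "AE x in lebesgue. x \<in> box a b \<longrightarrow> E x = 0" by (rule AE_completion)
    have 2: "AE x in lebesgue. x \<in> ?C \<longrightarrow> D x = E x"
      using E(3) by (simp add: AE_restrict_space_iff)
    have 3: "AE x in lebesgue. x \<notin> cbox a b - box a b"
      using negligible_frontier_interval[of a b] by (intro AE_not_in) (simp add: negligible_iff_null_sets)
    show ?thesis using 1 2 3 by eventually_elim (auto simp: D_def)
  qed
  obtain \<D> where 1: "countable \<D>" "\<D> \<subseteq> Pow S" "\<And>X. X \<in> \<D> \<Longrightarrow> \<exists>a b. X = cbox a b" "\<Union>\<D> = S"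
    using open_countable_Union_open_cbox[OF S] by metis
  have "AE x in lebesgue. x \<in> X \<longrightarrow> f x = g x" if X: "X \<in> \<D>" for X
  proof -
    obtain a b where "X = cbox a b" using 1(3)[OF X] by blast
    then show ?thesis using box[of a b] X 1(2) by blast
  qed
  then have "AE x in lebesgue. \<forall>X\<in>\<D>. x \<in> X \<longrightarrow> f x = g x"
    unfolding AE_ball_countable[OF 1(1)] by blast
  then have "AE x in lebesgue. x \<in> S \<longrightarrow> f x = g x" by eventually_elim (use 1 in auto)
  then show ?thesis using S by (simp add: AE_restrict_space_iff)
qed

lemma is_weak_deriv_unique:
  assumes S: "open S" and "is_weak_deriv S \<alpha> f g" "is_weak_deriv S \<alpha> f h"
  shows "AE x in lebesgue_on S. g x = h x"
  by (rule AE_eq_if_weakly_eq[OF S]) (use assms in \<open>auto simp: is_weak_deriv_def\<close>)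

lemma is_weak_deriv_weak_deriv: "is_weak_deriv S \<alpha> f g \<Longrightarrow> is_weak_deriv S \<alpha> f (weak_deriv S \<alpha> f)"
  unfolding weak_deriv_def by (rule someI[where P="is_weak_deriv S \<alpha> f"])

lemma weak_deriv_AE:
  "open S \<Longrightarrow> is_weak_deriv S \<alpha> f g \<Longrightarrow> AE x in lebesgue_on S. weak_deriv S \<alpha> f x = g x"
  by (rule is_weak_deriv_unique[OF _ is_weak_deriv_weak_deriv])

lemma test_function_partials:
  assumes "test_function S f" shows "test_function S (partials \<alpha> f)"
proof -
  have *: "test_function S ((partial b ^^ n) f)" if "b \<in> Basis" "test_function S f" for b n f
    using that by (induction n) (auto intro: test_function_partial)
  show ?thesis unfolding partials_def by (intro * assms) (auto simp: axis_in_Basis_iff)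
qed

lemma is_weak_deriv_lincomb:
  assumes S: "open S" and fg: "is_weak_deriv S \<alpha> f g" "is_weak_deriv S \<alpha> f' g'"
  shows "is_weak_deriv S \<alpha> (\<lambda>x. a * f x + b * f' x) (\<lambda>x. a * g x + b * g' x)"
  unfolding is_weak_deriv_def
proof (intro conjI allI impI)
  note l = fg[unfolded is_weak_deriv_def]
  show "locally_integrable S (\<lambda>x. a * f x + b * f' x)" "locally_integrable S (\<lambda>x. a * g x + b * g' x)"
    using l by (auto intro!: locally_integrable_add locally_integrable_scale)
  fix \<phi> assume \<phi>: "test_function S \<phi>"
  have i: "integrable (lebesgue_on S) (\<lambda>x. f x * partials \<alpha> \<phi> x)"
    "integrable (lebesgue_on S) (\<lambda>x. f' x * partials \<alpha> \<phi> x)"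
    "integrable (lebesgue_on S) (\<lambda>x. g x * \<phi> x)" "integrable (lebesgue_on S) (\<lambda>x. g' x * \<phi> x)"
    using l \<phi> test_function_partials[OF \<phi>] by (auto intro!: test_function_mult_integrable[OF S])
  have e: "(a * u + b * v) * w = a * (u * w) + b * (v * w)" for u v w by (simp add: algebra_simps)
  show "(LINT x|lebesgue_on S. (a * f x + b * f' x) * partials \<alpha> \<phi> x) =
    (-1) ^ mi_order \<alpha> * (LINT x|lebesgue_on S. (a * g x + b * g' x) * \<phi> x)"
    unfolding e using i l \<phi> by (simp add: algebra_simps)
qed

section \<open>Multi-indices and the linear structure of Sobolev spaces\<close>

abbreviation mi :: "3 \<Rightarrow> nat \<Rightarrow> multiindex" where "mi k n \<equiv> (\<lambda>l. if l = k then n else 0)"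

lemma mi_order_mi [simp]: "mi_order (mi k n) = n"
  by (simp add: mi_order_def)

lemma partials_mi: "partials (mi k n) f = (partial (axis k 1) ^^ n) f"
  using exhaust_3[of k] by (auto simp: partials_def)

lemma sobolev_L2: "f \<in> sobolev m S \<Longrightarrow> L2_on (lebesgue_on S) f"
  by (simp add: sobolev_def square_integrable_L2_on)

text \<open>The choice behind \<open>weak_deriv\<close> ranges over all weak derivatives, not just
  the square integrable ones. Uniqueness up to null sets transfers measurability and square
  integrability from the witness to the chosen representative.\<close>

lemma sobolev_weak_deriv:
  assumes S: "open S" and f: "f \<in> sobolev m S" and \<alpha>: "mi_order \<alpha> \<le> m"
  shows "is_weak_deriv S \<alpha> f (weak_deriv S \<alpha> f)" "L2_on (lebesgue_on S) (weak_deriv S \<alpha> f)"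
proof -
  obtain g where g: "is_weak_deriv S \<alpha> f g" "L2_on (lebesgue_on S) g"
    using f \<alpha> by (auto simp: sobolev_def square_integrable_L2_on)
  show "is_weak_deriv S \<alpha> f (weak_deriv S \<alpha> f)" by (rule is_weak_deriv_weak_deriv[OF g(1)])
  note ae = weak_deriv_AE[OF S g(1)]
  have m: "weak_deriv S \<alpha> f \<in> borel_measurable (lebesgue_on S)"
    by (rule measurable_lebesgue_on_AE[OF _ _ ae]) (use S g in \<open>auto simp: L2_on_def\<close>)
  moreover have ae2: "AE x in lebesgue_on S. (g x)\<^sup>2 = (weak_deriv S \<alpha> f x)\<^sup>2"
    using ae by eventually_elim simp
  have "integrable (lebesgue_on S) (\<lambda>x. (weak_deriv S \<alpha> f x)\<^sup>2)"
    by (rule integrable_cong_AE_imp[OF _ borel_measurable_power[OF m] ae2]) (use g in \<open>simp add: L2_on_def\<close>)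
  ultimately show "L2_on (lebesgue_on S) (weak_deriv S \<alpha> f)" by (simp add: L2_on_def)
qed

lemma sobolev_mono: "f \<in> sobolev m S \<Longrightarrow> n \<le> m \<Longrightarrow> f \<in> sobolev n S"
  by (auto simp: sobolev_def)

lemma sobolev_lincomb:
  assumes S: "open S" and f: "f \<in> sobolev m S" and g: "g \<in> sobolev m S"
  shows "(\<lambda>x. a * f x + b * g x) \<in> sobolev m S"
proof -
  have "\<exists>h. is_weak_deriv S \<alpha> (\<lambda>x. a * f x + b * g x) h \<and> square_integrable S h" if "mi_order \<alpha> \<le> m" for \<alpha>
    using is_weak_deriv_lincomb[OF S sobolev_weak_deriv(1)[OF S f that] sobolev_weak_deriv(1)[OF S g that], of a b]
      L2_on_add[OF L2_on_scale[OF sobolev_weak_deriv(2)[OF S f that], of a]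
        L2_on_scale[OF sobolev_weak_deriv(2)[OF S g that], of b]]
    unfolding square_integrable_L2_on by blast
  then show ?thesis using sobolev_L2[OF f] sobolev_L2[OF g]
    by (auto simp: sobolev_def square_integrable_L2_on intro!: L2_on_add L2_on_scale)
qed

text \<open>Linearity can hold only almost everywhere, because the representatives for the three
  functions are chosen independently of each other.\<close>

lemma weak_deriv_lincomb:
  assumes S: "open S" and f: "f \<in> sobolev m S" and g: "g \<in> sobolev m S" and \<alpha>: "mi_order \<alpha> \<le> m"
  shows "AE x in lebesgue_on S. weak_deriv S \<alpha> (\<lambda>x. a * f x + b * g x) x =
    a * weak_deriv S \<alpha> f x + b * weak_deriv S \<alpha> g x"
  by (intro weak_deriv_AE is_weak_deriv_lincomb sobolev_weak_deriv(1)[OF S f \<alpha>]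
      sobolev_weak_deriv(1)[OF S g \<alpha>] S)

lemma sobolev_scale: "open S \<Longrightarrow> f \<in> sobolev m S \<Longrightarrow> (\<lambda>x. a * f x) \<in> sobolev m S"
  using sobolev_lincomb[of S f m f a 0] by simp

lemma sobolev_diff: "open S \<Longrightarrow> f \<in> sobolev m S \<Longrightarrow> g \<in> sobolev m S \<Longrightarrow> (\<lambda>x. f x - g x) \<in> sobolev m S"
  using sobolev_lincomb[of S f m g 1 "-1"] by simp

lemma weak_deriv_scale:
  "open S \<Longrightarrow> f \<in> sobolev m S \<Longrightarrow> mi_order \<alpha> \<le> m \<Longrightarrow>
    AE x in lebesgue_on S. weak_deriv S \<alpha> (\<lambda>x. a * f x) x = a * weak_deriv S \<alpha> f x"
  using weak_deriv_lincomb[of S f m f \<alpha> a 0] by simp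

lemma weak_deriv_diff:
  "open S \<Longrightarrow> f \<in> sobolev m S \<Longrightarrow> g \<in> sobolev m S \<Longrightarrow> mi_order \<alpha> \<le> m \<Longrightarrow>
    AE x in lebesgue_on S. weak_deriv S \<alpha> (\<lambda>x. f x - g x) x = weak_deriv S \<alpha> f x - weak_deriv S \<alpha> g x"
  using weak_deriv_lincomb[of S f m g \<alpha> 1 "-1"] by simp

text \<open>Guards \<open>sobolev_norm_sq\<close> against the default value 0 of a sum over an
  infinite set; without it a single summand could not be bounded by the norm.\<close>

lemma finite_multiindices: "finite {\<alpha>. 1 \<le> mi_order \<alpha> \<and> mi_order \<alpha> \<le> m}"
proof (rule finite_subset)
  have "\<alpha> k \<le> mi_order \<alpha>" for \<alpha> and k :: 3 unfolding mi_order_def by (rule member_le_sum) auto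
  then show "{\<alpha>. 1 \<le> mi_order \<alpha> \<and> mi_order \<alpha> \<le> m} \<subseteq> {\<alpha>. \<forall>k. \<alpha> k \<in> {..m}}"
    by (auto intro: order_trans)
  show "finite {\<alpha>::multiindex. \<forall>k. \<alpha> k \<in> {..m}}"
    using finite_set_of_finite_funs[of "UNIV :: 3 set" "{..m}" 0] by simp
qed

lemma sobolev_norm_sq_nonneg: "0 \<le> sobolev_norm_sq m S f"
  unfolding sobolev_norm_sq_def by (intro sum_nonneg) simp

lemma sobolev_norm_sq_ge:
  assumes S: "open S" and f: "f \<in> sobolev m S" and \<alpha>: "1 \<le> mi_order \<alpha>" "mi_order \<alpha> \<le> m"
  shows "(l2 (lebesgue_on S) (weak_deriv S \<alpha> f))\<^sup>2 + (l2 (lebesgue_on S) f)\<^sup>2 \<le> sobolev_norm_sq m S f"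
proof -
  have "(l2 (lebesgue_on S) (weak_deriv S \<alpha> f))\<^sup>2 + (l2 (lebesgue_on S) f)\<^sup>2 =
      (LINT x|lebesgue_on S. (weak_deriv S \<alpha> f x)\<^sup>2 + (f x)\<^sup>2)"
    using sobolev_weak_deriv(2)[OF S f \<alpha>(2)] sobolev_L2[OF f] by (simp add: l2_sq L2_on_def)
  also have "\<dots> \<le> sobolev_norm_sq m S f"
    unfolding sobolev_norm_sq_def
    by (rule member_le_sum) (use \<alpha> finite_multiindices in auto)
  finally show ?thesis .
qed

lemma vsobolevD: "F \<in> vsobolev m S \<Longrightarrow> (\<lambda>x. F x $ i) \<in> sobolev m S"
  by (simp add: vsobolev_def)

lemma sobolev_norm_sq_le_vsobolev_norm: "sobolev_norm_sq m S (\<lambda>x. F x $ i) \<le> (vsobolev_norm m S F)\<^sup>2"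
  unfolding vsobolev_norm_def
  by (subst real_sqrt_pow2) (auto intro!: sum_nonneg sobolev_norm_sq_nonneg member_le_sum)

lemma vsobolev_norm_nonneg [simp]: "0 \<le> vsobolev_norm m S F"
  by (simp add: vsobolev_norm_def sum_nonneg sobolev_norm_sq_nonneg)

lemma l2_weak_deriv_le:
  assumes S: "open S" and F: "F \<in> vsobolev m S" and \<alpha>: "1 \<le> mi_order \<alpha>" "mi_order \<alpha> \<le> m"
  shows "l2 (lebesgue_on S) (weak_deriv S \<alpha> (\<lambda>x. F x $ i)) \<le> vsobolev_norm m S F"
proof (rule power2_le_imp_le)
  show "(l2 (lebesgue_on S) (weak_deriv S \<alpha> (\<lambda>x. F x $ i)))\<^sup>2 \<le> (vsobolev_norm m S F)\<^sup>2"
    using sobolev_norm_sq_ge[OF S vsobolevD[OF F, of i] \<alpha>] sobolev_norm_sq_le_vsobolev_norm[of m S F i]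
      zero_le_power2[of "l2 (lebesgue_on S) (\<lambda>x. F x $ i)"] by linarith
qed simp

lemma l2_le_vsobolev_norm:
  assumes S: "open S" and F: "F \<in> vsobolev m S" and m: "1 \<le> m"
  shows "l2 (lebesgue_on S) (\<lambda>x. F x $ i) \<le> vsobolev_norm m S F"
proof (rule power2_le_imp_le)
  \<comment> \<open>The norm contains the square of the function only together with a derivative of
    order at least 1, so some first-order index must be available, hence
    \<open>1 \<le> m\<close>.\<close>
  have "(l2 (lebesgue_on S) (weak_deriv S (mi 1 1) (\<lambda>x. F x $ i)))\<^sup>2 +
      (l2 (lebesgue_on S) (\<lambda>x. F x $ i))\<^sup>2 \<le> sobolev_norm_sq m S (\<lambda>x. F x $ i)"
    by (rule sobolev_norm_sq_ge[OF S vsobolevD[OF F]]) (use m in auto)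
  then show "(l2 (lebesgue_on S) (\<lambda>x. F x $ i))\<^sup>2 \<le> (vsobolev_norm m S F)\<^sup>2"
    using sobolev_norm_sq_le_vsobolev_norm[of m S F i]
      zero_le_power2[of "l2 (lebesgue_on S) (weak_deriv S (mi 1 1) (\<lambda>x. F x $ i))"] by linarith
qed simp

lemma vsobolev_lincomb:
  "open S \<Longrightarrow> F \<in> vsobolev m S \<Longrightarrow> G \<in> vsobolev m S \<Longrightarrow> (\<lambda>x. a *\<^sub>R F x + b *\<^sub>R G x) \<in> vsobolev m S"
  by (auto simp: vsobolev_def intro!: sobolev_lincomb)

lemma vsobolev_diff:
  "open S \<Longrightarrow> F \<in> vsobolev m S \<Longrightarrow> G \<in> vsobolev m S \<Longrightarrow> (\<lambda>x. F x - G x) \<in> vsobolev m S"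
  using vsobolev_lincomb[of S F m G 1 "-1"] by simp

lemma vsobolev_scale:
  "open S \<Longrightarrow> F \<in> vsobolev m S \<Longrightarrow> (\<lambda>x. a *\<^sub>R F x) \<in> vsobolev m S"
  using vsobolev_lincomb[of S F m F a 0] by simp

section \<open>Limits of test functions in \<open>H\<^sup>1\<close>\<close>

lemma L2_on_test_function:
  assumes "open S" "test_function S \<phi>" shows "L2_on (lebesgue_on S) \<phi>"
proof -
  obtain B where B: "\<And>x. \<bar>\<phi> x\<bar> \<le> B" using test_function_bounded[OF assms(2)] by metis
  have sm: "smooth \<phi>" by (rule test_function_smooth[OF assms(2)])
  note [measurable] = smooth_measurable[OF sm]
  have z: "\<phi> x = 0" if "x \<notin> S" for x using assms(2) that by (meson subsetD test_functionE)
  have "integrable lborel (\<lambda>x. (\<phi> x)\<^sup>2)"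
    using test_function_integrable[OF test_function_mult[OF assms(2) sm]] by (simp add: power2_eq_square)
  then have "integrable (lebesgue_on S) (\<lambda>x. (\<phi> x)\<^sup>2)"
    using assms(1) z by (subst lebesgue_on_lborel(1)) auto
  then show ?thesis by (auto simp: L2_on_def intro!: borel_measurable_lebesgue_onI)
qed


lemma is_weak_deriv_test_function:
  assumes S: "open S" and \<phi>: "test_function S \<phi>"
  shows "is_weak_deriv S (mi k 1) \<phi> (partial (axis k 1) \<phi>)"
  unfolding is_weak_deriv_def
proof (intro conjI allI impI)
  have sm: "smooth \<phi>" by (rule test_function_smooth[OF \<phi>])
  have b: "axis k 1 \<in> (Basis :: space set)" by (simp add: axis_in_Basis_iff)
  have "locally_integrable S f" if "smooth f" for f
  proof -
    have "f absolutely_integrable_on K" if "compact K" for K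
    proof -
      have "integrable lborel (\<lambda>x. indicator K x *\<^sub>R f x)"
        by (rule borel_integrable_compact[OF that smooth_continuous[OF \<open>smooth f\<close>]])
      moreover note [measurable] = smooth_measurable[OF \<open>smooth f\<close>] borel_compact[OF that]
      have "(\<lambda>x. indicator K x *\<^sub>R f x) \<in> borel_measurable borel" by measurable
      ultimately show ?thesis unfolding set_integrable_def by (simp add: integrable_completion)
    qed
    then show ?thesis by (simp add: locally_integrable_def)
  qed
  then show "locally_integrable S \<phi>" "locally_integrable S (partial (axis k 1) \<phi>)"
    using sm smooth_partial[OF sm b] by auto
  fix \<psi> assume \<psi>: "test_function S \<psi>"
  have z: "\<phi> x = 0" "partial (axis k 1) \<phi> x = 0" if "x \<notin> S" for x
    using \<phi> test_function_partial[OF \<phi> b] that by (meson subsetD test_functionE)+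
  note m[measurable] = smooth_measurable[OF sm] smooth_measurable[OF test_function_smooth[OF \<psi>]]
    smooth_measurable[OF smooth_partial[OF sm b]]
    smooth_measurable[OF smooth_partial[OF test_function_smooth[OF \<psi>] b]]
  show "(LINT x|lebesgue_on S. \<phi> x * partials (mi k 1) \<psi> x) =
      (-1) ^ mi_order (mi k 1) * (LINT x|lebesgue_on S. partial (axis k 1) \<phi> x * \<psi> x)"
    using test_function_by_parts[OF \<phi> test_function_smooth[OF \<psi>] b] S z
    by (simp add: partials_mi lebesgue_on_lborel(2))
qed


text \<open>The componentwise form of \<open>vsobolev_zero\<close>: convergence is spelled out in
  \<open>l2\<close>, with classical derivatives of the test functions, which is what the limit
  passages consume.\<close>

definition H10 :: "space set \<Rightarrow> (space \<Rightarrow> real) set" where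
  "H10 S = {z \<in> sobolev 1 S. \<exists>\<phi>. (\<forall>n::nat. test_function S (\<phi> n)) \<and>
     (\<lambda>n. l2 (lebesgue_on S) (\<lambda>x. \<phi> n x - z x)) \<longlonglongrightarrow> 0 \<and>
     (\<forall>k. (\<lambda>n. l2 (lebesgue_on S) (\<lambda>x. partial (axis k 1) (\<phi> n) x - weak_deriv S (mi k 1) z x)) \<longlonglongrightarrow> 0)}"

lemma mi_order_le_1: "mi_order \<alpha> \<le> 1 \<Longrightarrow> \<alpha> = (\<lambda>_. 0) \<or> (\<exists>k. \<alpha> = mi k 1)"
proof (cases "mi_order \<alpha> = 0")
  case False
  assume "mi_order \<alpha> \<le> 1"
  with False have "mi_order \<alpha> = 1" by linarith
  then have s: "sum \<alpha> UNIV = 1" unfolding mi_order_def .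
  then obtain k where k: "\<alpha> k \<noteq> 0" by (metis sum.neutral zero_neq_one)
  have "sum \<alpha> UNIV = \<alpha> k + sum \<alpha> (UNIV - {k})" by (simp add: sum.remove)
  with s k have "\<alpha> k = 1" "sum \<alpha> (UNIV - {k}) = 0" by linarith+
  then have "\<alpha> = mi k 1" by (auto simp: fun_eq_iff)
  then show ?thesis by blast
qed (auto simp: mi_order_def fun_eq_iff)

lemma test_function_sobolev_1:
  assumes S: "open S" and \<phi>: "test_function S \<phi>" shows "\<phi> \<in> sobolev 1 S"
proof -
  have L: "L2_on (lebesgue_on S) \<phi>" "L2_on (lebesgue_on S) (partial (axis k 1) \<phi>)" for k
    by (intro L2_on_test_function S \<phi> test_function_partial; simp add: axis_in_Basis_iff)+
  have "is_weak_deriv S (\<lambda>_. 0) \<phi> \<phi>"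
    using is_weak_deriv_test_function[OF S \<phi>, of 1]
    by (auto simp: is_weak_deriv_def partials_def mi_order_def)
  then show ?thesis
    using L is_weak_deriv_test_function[OF S \<phi>] mi_order_le_1
    unfolding sobolev_def square_integrable_L2_on by blast
qed

lemma vsobolev_zero_H10:
  assumes S: "open S" and F: "F \<in> vsobolev_zero S" shows "(\<lambda>x. F x $ i) \<in> H10 S"
proof -
  let ?M = "lebesgue_on S"
  obtain \<phi> where \<phi>: "\<And>n i. test_function S (\<lambda>x. \<phi> n x $ i)"
    "(\<lambda>n::nat. vsobolev_norm 1 S (\<lambda>x. \<phi> n x - F x)) \<longlonglongrightarrow> 0" and F1: "F \<in> vsobolev 1 S"
    using F by (auto simp: vsobolev_zero_def)
  have ph1: "\<phi> n \<in> vsobolev 1 S" for n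
    using test_function_sobolev_1[OF S \<phi>(1)] by (simp add: vsobolev_def)
  have d: "(\<lambda>x. \<phi> n x - F x) \<in> vsobolev 1 S" for n by (intro vsobolev_diff S ph1 F1)
  have 1: "(\<lambda>n. l2 ?M (\<lambda>x. \<phi> n x $ i - F x $ i)) \<longlonglongrightarrow> 0"
    by (rule tendsto_sandwich[OF _ _ tendsto_const \<phi>(2)])
      (use l2_le_vsobolev_norm[OF S d, where i=i] in auto)
  \<comment> \<open>The classical derivative of a test function and the representative chosen by
    \<open>weak_deriv\<close> agree only almost everywhere, a difference that \<open>l2\<close> does
    not see.\<close>
  have e: "l2 ?M (\<lambda>x. partial (axis k 1) (\<lambda>x. \<phi> n x $ i) x - weak_deriv S (mi k 1) (\<lambda>x. F x $ i) x)
      = l2 ?M (weak_deriv S (mi k 1) (\<lambda>x. (\<phi> n x - F x) $ i))" for k n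
  proof (rule l2_cong)
    have L: "L2_on ?M (weak_deriv S (mi k 1) (\<lambda>x. F x $ i))"
      "L2_on ?M (weak_deriv S (mi k 1) (\<lambda>x. (\<phi> n x - F x) $ i))"
      using sobolev_weak_deriv(2)[OF S vsobolevD[OF F1]] sobolev_weak_deriv(2)[OF S vsobolevD[OF d]] by auto
    then show "L2_on ?M (weak_deriv S (mi k 1) (\<lambda>x. (\<phi> n x - F x) $ i))" by simp
    show "L2_on ?M (\<lambda>x. partial (axis k 1) (\<lambda>x. \<phi> n x $ i) x - weak_deriv S (mi k 1) (\<lambda>x. F x $ i) x)"
      by (intro L2_on_diff L L2_on_test_function S test_function_partial \<phi>(1)) (simp add: axis_in_Basis_iff)
    show "AE x in ?M. partial (axis k 1) (\<lambda>x. \<phi> n x $ i) x - weak_deriv S (mi k 1) (\<lambda>x. F x $ i) x =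
        weak_deriv S (mi k 1) (\<lambda>x. (\<phi> n x - F x) $ i) x"
    proof -
      have "AE x in ?M. weak_deriv S (mi k 1) (\<lambda>x. \<phi> n x $ i - F x $ i) x =
          weak_deriv S (mi k 1) (\<lambda>x. \<phi> n x $ i) x - weak_deriv S (mi k 1) (\<lambda>x. F x $ i) x"
        using weak_deriv_diff[OF S vsobolevD[OF ph1[of n], of i] vsobolevD[OF F1, of i], of "mi k 1"]
        by simp
      with weak_deriv_AE[OF S is_weak_deriv_test_function[OF S \<phi>(1)[of n i], of k]]
      show ?thesis unfolding vector_minus_component by eventually_elim simp
    qed
  qed
  have 2: "(\<lambda>n. l2 ?M (\<lambda>x. partial (axis k 1) (\<lambda>x. \<phi> n x $ i) x - weak_deriv S (mi k 1) (\<lambda>x. F x $ i) x)) \<longlonglongrightarrow> 0" for k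
    unfolding e
    by (rule tendsto_sandwich[OF _ _ tendsto_const \<phi>(2)])
      (use l2_weak_deriv_le[OF S d, where \<alpha>="mi k 1" and i=i] in auto)
  show ?thesis unfolding H10_def using 1 2 \<phi>(1) vsobolevD[OF F1, of i]
    by (auto intro!: exI[of _ "\<lambda>n x. \<phi> n x $ i"])
qed

lemma H10_sobolev: "z \<in> H10 S \<Longrightarrow> z \<in> sobolev 1 S" by (simp add: H10_def)

lemma H10_lincomb:
  assumes S: "open S" and f: "f \<in> H10 S" and g: "g \<in> H10 S"
  shows "(\<lambda>x. a * f x + b * g x) \<in> H10 S"
proof -
  let ?M = "lebesgue_on S"
  obtain \<phi> where \<phi>: "\<And>n::nat. test_function S (\<phi> n)" "(\<lambda>n. l2 ?M (\<lambda>x. \<phi> n x - f x)) \<longlonglongrightarrow> 0"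
     "\<And>k. (\<lambda>n. l2 ?M (\<lambda>x. partial (axis k 1) (\<phi> n) x - weak_deriv S (mi k 1) f x)) \<longlonglongrightarrow> 0"
    using f by (auto simp: H10_def)
  obtain \<psi> where \<psi>: "\<And>n::nat. test_function S (\<psi> n)" "(\<lambda>n. l2 ?M (\<lambda>x. \<psi> n x - g x)) \<longlonglongrightarrow> 0"
     "\<And>k. (\<lambda>n. l2 ?M (\<lambda>x. partial (axis k 1) (\<psi> n) x - weak_deriv S (mi k 1) g x)) \<longlonglongrightarrow> 0"
    using g by (auto simp: H10_def)
  have ax: "axis k 1 \<in> (Basis :: space set)" for k by (simp add: axis_in_Basis_iff)
  \<comment> \<open>One estimate for both the functions and their derivatives. The decomposition is
    required almost everywhere only, as chosen weak derivatives are linear only up to null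
    sets.\<close>
  have lim: "(\<lambda>n. l2 ?M (h n)) \<longlonglongrightarrow> 0"
    if "\<And>n. AE x in ?M. h n x = a * (p n x - u x) + b * (q n x - v x)" "\<And>n. L2_on ?M (h n)"
      "(\<lambda>n. l2 ?M (\<lambda>x. p n x - u x)) \<longlonglongrightarrow> 0" "(\<lambda>n. l2 ?M (\<lambda>x. q n x - v x)) \<longlonglongrightarrow> 0"
      "\<And>n. L2_on ?M (p n)" "\<And>n. L2_on ?M (q n)" "L2_on ?M u" "L2_on ?M v" for h p q :: "nat \<Rightarrow> space \<Rightarrow> real" and u v
  proof (rule tendsto_sandwich[OF _ _ tendsto_const])
    show "(\<lambda>n. \<bar>a\<bar> * l2 ?M (\<lambda>x. p n x - u x) + \<bar>b\<bar> * l2 ?M (\<lambda>x. q n x - v x)) \<longlonglongrightarrow> 0"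
      using tendsto_add[OF tendsto_mult_left[OF that(3), of "\<bar>a\<bar>"] tendsto_mult_left[OF that(4), of "\<bar>b\<bar>"]] by simp
    have "l2 ?M (h n) \<le> \<bar>a\<bar> * l2 ?M (\<lambda>x. p n x - u x) + \<bar>b\<bar> * l2 ?M (\<lambda>x. q n x - v x)" for n
    proof -
      have L: "L2_on ?M (\<lambda>x. a * (p n x - u x))" "L2_on ?M (\<lambda>x. b * (q n x - v x))"
        by (intro L2_on_scale L2_on_diff that)+
      have "l2 ?M (h n) = l2 ?M (\<lambda>x. a * (p n x - u x) + b * (q n x - v x))"
        by (intro l2_cong that L2_on_add L)
      also have "\<dots> \<le> l2 ?M (\<lambda>x. a * (p n x - u x)) + l2 ?M (\<lambda>x. b * (q n x - v x))"
        by (rule l2_triangle[OF L])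
      finally show ?thesis by (simp add: l2_scale)
    qed
    then show "\<forall>\<^sub>F n in sequentially. l2 ?M (h n) \<le> \<bar>a\<bar> * l2 ?M (\<lambda>x. p n x - u x) + \<bar>b\<bar> * l2 ?M (\<lambda>x. q n x - v x)"
      by simp
  qed simp
  let ?\<chi> = "\<lambda>n x. a * \<phi> n x + b * \<psi> n x"
  have t: "test_function S (?\<chi> n)" for n
    by (intro test_function_add test_function_mult smooth_const \<phi> \<psi>)
  have s: "(\<lambda>x. a * f x + b * g x) \<in> sobolev 1 S" by (intro sobolev_lincomb S H10_sobolev f g)
  note L = sobolev_L2[OF s] sobolev_L2[OF H10_sobolev[OF f]] sobolev_L2[OF H10_sobolev[OF g]]
  have "(\<lambda>n. l2 ?M (\<lambda>x. ?\<chi> n x - (a * f x + b * g x))) \<longlonglongrightarrow> 0"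
    by (rule lim[OF _ _ \<phi>(2) \<psi>(2)])
      (use L L2_on_test_function[OF S t] L2_on_test_function[OF S \<phi>(1)] L2_on_test_function[OF S \<psi>(1)]
        in \<open>auto intro: L2_on_diff simp: algebra_simps\<close>)
  moreover have "(\<lambda>n. l2 ?M (\<lambda>x. partial (axis k 1) (?\<chi> n) x -
      weak_deriv S (mi k 1) (\<lambda>x. a * f x + b * g x) x)) \<longlonglongrightarrow> 0" for k
  proof (rule lim[OF _ _ \<phi>(3) \<psi>(3)])
    fix n
    have sm: "smooth (\<phi> n)" "smooth (\<psi> n)" using \<phi>(1) \<psi>(1) test_function_smooth by blast+
    have p: "partial (axis k 1) (?\<chi> n) x = a * partial (axis k 1) (\<phi> n) x + b * partial (axis k 1) (\<psi> n) x" for x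
    proof -
      have "((?\<chi> n) has_derivative (\<lambda>v. a * frechet_derivative (\<phi> n) (at x) v + b * frechet_derivative (\<psi> n) (at x) v)) (at x)"
        by (intro has_derivative_add has_derivative_mult_right has_derivative_smooth sm)
      then show ?thesis by (simp add: partial_eq) (simp add: partial_def)
    qed
    show "AE x in ?M. partial (axis k 1) (?\<chi> n) x - weak_deriv S (mi k 1) (\<lambda>x. a * f x + b * g x) x =
        a * (partial (axis k 1) (\<phi> n) x - weak_deriv S (mi k 1) f x) +
        b * (partial (axis k 1) (\<psi> n) x - weak_deriv S (mi k 1) g x)"
      using weak_deriv_lincomb[OF S H10_sobolev[OF f] H10_sobolev[OF g], of "mi k 1" a b]
      by (auto simp: p algebra_simps)
    show "L2_on ?M (\<lambda>x. partial (axis k 1) (?\<chi> n) x - weak_deriv S (mi k 1) (\<lambda>x. a * f x + b * g x) x)"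
      by (intro L2_on_diff L2_on_test_function[OF S test_function_partial[OF t ax]]
          sobolev_weak_deriv(2)[OF S s]) simp
    show "L2_on ?M (partial (axis k 1) (\<phi> n))" "L2_on ?M (partial (axis k 1) (\<psi> n))"
      using L2_on_test_function[OF S test_function_partial[OF \<phi>(1) ax]]
        L2_on_test_function[OF S test_function_partial[OF \<psi>(1) ax]] by auto
  qed (use sobolev_weak_deriv(2)[OF S H10_sobolev[OF f]] sobolev_weak_deriv(2)[OF S H10_sobolev[OF g]] in auto)
  ultimately show ?thesis unfolding H10_def using t s
    by (auto intro!: exI[of _ "\<lambda>n x. a * \<phi> n x + b * \<psi> n x"])
qed

text \<open>For a test function in place of \<open>z\<close> this is the definition of weak
  derivatives read twice: the derivative of a test function is again a test function, so the
  first-order rule for it and the second-order rule for the original evaluate the same integral.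
  Both sides are continuous along the approximating sequence of \<open>z\<close>.\<close>

lemma green:
  assumes S: "open S" and v: "v \<in> sobolev 2 S" and z: "z \<in> H10 S"
  shows "ip (lebesgue_on S) (weak_deriv S (mi k 1) v) (weak_deriv S (mi k 1) z) =
    - ip (lebesgue_on S) (weak_deriv S (mi k 2) v) z"
proof -
  let ?M = "lebesgue_on S"
  obtain \<phi> where \<phi>: "\<And>n::nat. test_function S (\<phi> n)" "(\<lambda>n. l2 ?M (\<lambda>x. \<phi> n x - z x)) \<longlonglongrightarrow> 0"
     "\<And>k. (\<lambda>n. l2 ?M (\<lambda>x. partial (axis k 1) (\<phi> n) x - weak_deriv S (mi k 1) z x)) \<longlonglongrightarrow> 0"
    using z by (auto simp: H10_def)
  have ax: "axis k 1 \<in> (Basis :: space set)" for k by (simp add: axis_in_Basis_iff)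
  have w1: "is_weak_deriv S (mi k 1) v (weak_deriv S (mi k 1) v)" "L2_on ?M (weak_deriv S (mi k 1) v)"
    and w2: "is_weak_deriv S (mi k 2) v (weak_deriv S (mi k 2) v)" "L2_on ?M (weak_deriv S (mi k 2) v)"
    using sobolev_weak_deriv[OF S v] by simp_all
  have eq: "ip ?M (weak_deriv S (mi k 1) v) (partial (axis k 1) (\<phi> n)) = - ip ?M (weak_deriv S (mi k 2) v) (\<phi> n)" for n
  proof -
    have "(LINT x|?M. v x * partials (mi k 1) (partial (axis k 1) (\<phi> n)) x) = - ip ?M (weak_deriv S (mi k 1) v) (partial (axis k 1) (\<phi> n))"
      using w1(1) test_function_partial[OF \<phi>(1) ax] by (simp add: is_weak_deriv_def ip_def)
    moreover have "(LINT x|?M. v x * partials (mi k 2) (\<phi> n) x) = ip ?M (weak_deriv S (mi k 2) v) (\<phi> n)"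
      using w2(1) \<phi>(1) by (simp add: is_weak_deriv_def ip_def)
    moreover have "partials (mi k 1) (partial (axis k 1) (\<phi> n)) = partials (mi k 2) (\<phi> n)"
      by (simp add: partials_mi numeral_2_eq_2)
    ultimately show ?thesis by simp
  qed
  have zero: "(\<lambda>n. l2 ?M (\<lambda>x. f x - f x)) \<longlonglongrightarrow> 0" for f :: "space \<Rightarrow> real" by (simp add: l2_def)
  have 1: "(\<lambda>n. ip ?M (weak_deriv S (mi k 1) v) (partial (axis k 1) (\<phi> n))) \<longlonglongrightarrow>
      ip ?M (weak_deriv S (mi k 1) v) (weak_deriv S (mi k 1) z)"
    by (rule tendsto_ip[OF _ _ _ _ zero \<phi>(3)])
      (use w1 sobolev_weak_deriv(2)[OF S H10_sobolev[OF z], of "mi k 1"]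
        L2_on_test_function[OF S test_function_partial[OF \<phi>(1) ax]] in auto)
  have 2: "(\<lambda>n. ip ?M (weak_deriv S (mi k 2) v) (\<phi> n)) \<longlonglongrightarrow> ip ?M (weak_deriv S (mi k 2) v) z"
    by (rule tendsto_ip[OF _ _ _ _ zero \<phi>(2)])
      (use w2 sobolev_L2[OF H10_sobolev[OF z]] L2_on_test_function[OF S \<phi>(1)] in auto)
  have 3: "(\<lambda>n. ip ?M (weak_deriv S (mi k 1) v) (partial (axis k 1) (\<phi> n))) \<longlonglongrightarrow>
      - ip ?M (weak_deriv S (mi k 2) v) z"
    unfolding eq by (rule tendsto_minus[OF 2])
  show ?thesis by (rule LIMSEQ_unique[OF 1 3])
qed

section \<open>The Sobolev inequality\<close>

definition tri :: "real \<Rightarrow> real \<Rightarrow> real \<Rightarrow> space" where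
  "tri x y z = x *\<^sub>R axis 1 1 + y *\<^sub>R axis 2 1 + z *\<^sub>R axis 3 1"

lemma tri_nth [simp]: "tri x y z $ 1 = x" "tri x y z $ 2 = y" "tri x y z $ 3 = z"
  by (simp_all add: tri_def axis_def)

lemma tri_measurable [measurable]:
  "(\<lambda>p. tri (fst p) (fst (snd p)) (snd (snd p))) \<in> borel_measurable borel"
  unfolding tri_def by (intro borel_measurable_continuous_onI continuous_intros)

lemma tri_measurable' [measurable (raw)]:
  assumes [measurable]: "f \<in> borel_measurable M" "g \<in> borel_measurable M" "h \<in> borel_measurable M"
  shows "(\<lambda>p. tri (f p) (g p) (h p)) \<in> borel_measurable M"
  unfolding tri_def by measurable

lemma prod_UNIV_3: "(\<Prod>k\<in>(UNIV :: 3 set). f k) = f 1 * f 2 * (f 3 :: real)"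
proof -
  have "(1::3) \<noteq> 2" "(1::3) \<noteq> 3" "(2::3) \<noteq> 3" by simp_all
  then show ?thesis unfolding UNIV_3 by (simp only: prod.insert prod.empty finite.intros insert_iff
        empty_iff simp_thms mult_1_right mult.assoc)
qed

lemma prod_Basis_space: "(\<Prod>b\<in>(Basis::space set). (v \<bullet> b)) = v $ 1 * v $ 2 * v $ 3"
proof -
  have b: "(Basis::space set) = (\<lambda>i. axis i 1) ` UNIV" unfolding Basis_vec_def Basis_real_def by blast
  have "inj (\<lambda>i::3. axis i (1::real))" by (simp add: inj_def axis_eq_axis)
  then show ?thesis unfolding b by (simp add: prod.reindex prod_UNIV_3 inner_axis)
qed

lemma emeasure_lborel_Times:
  assumes "A \<in> sets borel" "B \<in> sets borel"
  shows "emeasure (lborel :: ('a::euclidean_space \<times> 'b::euclidean_space) measure) (A \<times> B) =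
    emeasure lborel A * emeasure lborel B"
  using assms by (subst lborel_prod[symmetric]) (simp add: lborel.emeasure_pair_measure_Times)

lemma nn_integral_lborel_pair:
  fixes f :: "'a::euclidean_space \<times> 'b::euclidean_space \<Rightarrow> ennreal"
  assumes "f \<in> borel_measurable borel"
  shows "(\<integral>\<^sup>+p. f p \<partial>lborel) = (\<integral>\<^sup>+x. \<integral>\<^sup>+y. f (x, y) \<partial>lborel \<partial>lborel)"
  using assms lborel.nn_integral_fst[of f lborel] by (simp add: lborel_prod)

text \<open>The measure on \<open>real^3\<close> is identified with the image of the product measure
  by comparing volumes of boxes; iterated integrals then follow from Tonelli.\<close>

lemma nn_integral_space:
  fixes f :: "space \<Rightarrow> ennreal"
  assumes [measurable]: "f \<in> borel_measurable borel"
  shows "(\<integral>\<^sup>+v. f v \<partial>lborel) = (\<integral>\<^sup>+x. \<integral>\<^sup>+y. \<integral>\<^sup>+z. f (tri x y z) \<partial>lborel \<partial>lborel \<partial>lborel)"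
proof -
  let ?T = "\<lambda>p. tri (fst p) (fst (snd p)) (snd (snd p))"
  have "lborel = distr lborel borel ?T"
  proof (rule lborel_eqI)
    fix l u :: space assume le: "\<And>b. b \<in> Basis \<Longrightarrow> l \<bullet> b \<le> u \<bullet> b"
    have le': "l $ i \<le> u $ i" for i
      using le[of "axis i 1"] by (simp add: axis_in_Basis_iff inner_axis)
    have "emeasure (distr lborel borel ?T) (box l u) = emeasure lborel (?T -` box l u)"
      by (subst emeasure_distr) auto
    also have "?T -` box l u = {l$1<..<u$1} \<times> {l$2<..<u$2} \<times> {l$3<..<u$3}"
      by (auto simp: mem_box_cart forall_3)
    also have "emeasure lborel \<dots> = ennreal (u$1 - l$1) * (ennreal (u$2 - l$2) * ennreal (u$3 - l$3))"
      using le' by (simp add: emeasure_lborel_Times borel_open open_Times)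
    also have "\<dots> = ennreal (\<Prod>b\<in>Basis. (u - l) \<bullet> b)"
      using le' unfolding prod_Basis_space by (simp add: ennreal_mult mult.assoc)
    finally show "emeasure (distr lborel borel ?T) (box l u) = (\<Prod>b\<in>Basis. (u - l) \<bullet> b)" .
  qed simp
  then have "(\<integral>\<^sup>+v. f v \<partial>lborel) = (\<integral>\<^sup>+v. f v \<partial>distr lborel borel ?T)" by simp
  also have "\<dots> = (\<integral>\<^sup>+p. f (?T p) \<partial>lborel)" by (intro nn_integral_distr) auto
  also have "\<dots> = (\<integral>\<^sup>+x. \<integral>\<^sup>+q. f (?T (x, q)) \<partial>lborel \<partial>lborel)"
    by (subst nn_integral_lborel_pair) auto
  also have "\<dots> = (\<integral>\<^sup>+x. \<integral>\<^sup>+y. \<integral>\<^sup>+z. f (?T (x, (y, z))) \<partial>lborel \<partial>lborel \<partial>lborel)"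
  proof (rule nn_integral_cong)
    fix x
    have "(\<lambda>q. tri x (fst q) (snd q)) \<in> borel_measurable borel"
      unfolding tri_def by (intro borel_measurable_continuous_onI continuous_intros)
    then show "(\<integral>\<^sup>+q. f (?T (x, q)) \<partial>lborel) = (\<integral>\<^sup>+y. \<integral>\<^sup>+z. f (?T (x, (y, z))) \<partial>lborel \<partial>lborel)"
      by (subst nn_integral_lborel_pair) auto
  qed
  finally show ?thesis by simp
qed

text \<open>Cauchy-Schwarz twice: in \<open>z\<close> for the product of \<open>A\<close> and
  \<open>B\<close>, then in the pair (x, y) against \<open>C\<close>. The intermediate squared
  integral factorises into a function of \<open>y\<close> times a function of
  \<open>x\<close>.\<close>

lemma loomis_whitney:
  fixes A B C :: "real \<times> real \<Rightarrow> ennreal"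
  assumes [measurable]: "A \<in> borel_measurable borel" "B \<in> borel_measurable borel" "C \<in> borel_measurable borel"
  shows "(\<integral>\<^sup>+x. \<integral>\<^sup>+y. \<integral>\<^sup>+z. A (y, z) * B (x, z) * C (x, y) \<partial>lborel \<partial>lborel \<partial>lborel)\<^sup>2 \<le>
    (\<integral>\<^sup>+y. \<integral>\<^sup>+z. (A (y, z))\<^sup>2 \<partial>lborel \<partial>lborel) * (\<integral>\<^sup>+x. \<integral>\<^sup>+z. (B (x, z))\<^sup>2 \<partial>lborel \<partial>lborel) *
    (\<integral>\<^sup>+x. \<integral>\<^sup>+y. (C (x, y))\<^sup>2 \<partial>lborel \<partial>lborel)"
proof -
  have [measurable]: "A \<in> borel_measurable (borel \<Otimes>\<^sub>M borel)" "B \<in> borel_measurable (borel \<Otimes>\<^sub>M borel)"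
    "C \<in> borel_measurable (borel \<Otimes>\<^sub>M borel)" using assms by (simp_all add: borel_prod)
  define D where "D = (\<lambda>(x, y). \<integral>\<^sup>+z. A (y, z) * B (x, z) \<partial>lborel)"
  define \<alpha> where "\<alpha> = (\<lambda>y. \<integral>\<^sup>+z. (A (y, z))\<^sup>2 \<partial>lborel)"
  define \<beta> where "\<beta> = (\<lambda>x. \<integral>\<^sup>+z. (B (x, z))\<^sup>2 \<partial>lborel)"
  have [measurable]: "D \<in> borel_measurable (lborel \<Otimes>\<^sub>M lborel)" "\<alpha> \<in> borel_measurable borel" "\<beta> \<in> borel_measurable borel"
    unfolding D_def \<alpha>_def \<beta>_def by measurable
  have D: "(D (x, y))\<^sup>2 \<le> \<alpha> y * \<beta> x" for x y
    unfolding D_def \<alpha>_def \<beta>_def using Cauchy_Schwarz_nn_integral[of "\<lambda>z. A (y, z)" lborel "\<lambda>z. B (x, z)"] by simp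
  have "(\<integral>\<^sup>+x. \<integral>\<^sup>+y. \<integral>\<^sup>+z. A (y, z) * B (x, z) * C (x, y) \<partial>lborel \<partial>lborel \<partial>lborel) =
      (\<integral>\<^sup>+x. \<integral>\<^sup>+y. D (x, y) * C (x, y) \<partial>lborel \<partial>lborel)"
    unfolding D_def by (simp add: nn_integral_multc)
  also have "\<dots> = (\<integral>\<^sup>+p. D p * C p \<partial>(lborel \<Otimes>\<^sub>M lborel))"
    by (subst lborel.nn_integral_fst) auto
  also have "(\<dots>)\<^sup>2 \<le> (\<integral>\<^sup>+p. (D p)\<^sup>2 \<partial>(lborel \<Otimes>\<^sub>M lborel)) * (\<integral>\<^sup>+p. (C p)\<^sup>2 \<partial>(lborel \<Otimes>\<^sub>M lborel))"
    by (rule Cauchy_Schwarz_nn_integral) auto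
  also have "(\<integral>\<^sup>+p. (D p)\<^sup>2 \<partial>(lborel \<Otimes>\<^sub>M lborel)) = (\<integral>\<^sup>+x. \<integral>\<^sup>+y. (D (x, y))\<^sup>2 \<partial>lborel \<partial>lborel)"
    by (subst lborel.nn_integral_fst[symmetric]) auto
  also have "\<dots> \<le> (\<integral>\<^sup>+x. \<integral>\<^sup>+y. \<alpha> y * \<beta> x \<partial>lborel \<partial>lborel)"
    by (intro nn_integral_mono D)
  also have "\<dots> = (\<integral>\<^sup>+y. \<alpha> y \<partial>lborel) * (\<integral>\<^sup>+x. \<beta> x \<partial>lborel)"
    by (simp add: nn_integral_multc nn_integral_cmult)
  also have "(\<integral>\<^sup>+p. (C p)\<^sup>2 \<partial>(lborel \<Otimes>\<^sub>M lborel)) = (\<integral>\<^sup>+x. \<integral>\<^sup>+y. (C (x, y))\<^sup>2 \<partial>lborel \<partial>lborel)"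
    by (subst lborel.nn_integral_fst[symmetric]) auto
  finally show ?thesis unfolding \<alpha>_def \<beta>_def by (simp add: mult_right_mono)
qed

lemma line_bound:
  fixes f :: "'a::euclidean_space \<Rightarrow> real"
  assumes f: "test_function UNIV f" and e: "e \<noteq> 0"
  shows "ennreal \<bar>f v\<bar> \<le> (\<integral>\<^sup>+s. ennreal \<bar>frechet_derivative f (at (v + s *\<^sub>R e)) e\<bar> \<partial>lborel)"
proof -
  obtain K where K: "smooth f" "compact K" "\<And>x. x \<notin> K \<Longrightarrow> f x = 0" using f by (metis test_functionE)
  obtain R where R: "\<And>x. x \<in> K \<Longrightarrow> norm x \<le> R" "R > 0"
    using compact_imp_bounded[OF K(2)] bounded_pos by metis
  \<comment> \<open>Far enough to leave the support: \<open>h e\<close> has norm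
    \<open>R + norm v + 1\<close>, so \<open>v - h e\<close> has norm greater than
    \<open>R\<close>.\<close>
  define h where "h = (R + norm v + 1) / norm e"
  have h: "h \<ge> 0" using R(2) by (simp add: h_def)
  have "norm (h *\<^sub>R e) \<le> norm v + norm (v - h *\<^sub>R e)"
    using norm_triangle_ineq4[of v "v - h *\<^sub>R e"] by simp
  moreover have "norm (h *\<^sub>R e) = R + norm v + 1" using e R(2) by (simp add: h_def)
  ultimately have "v - h *\<^sub>R e \<notin> K" using R(1) by fastforce
  note z = K(3)[OF this]
  let ?d = "\<lambda>r. frechet_derivative f (at (v - r *\<^sub>R e)) e"
  note [measurable] = smooth_measurable[OF smooth_frechet[OF K(1)]]
  have "continuous_on {0..h} ?d"
    by (intro continuous_on_compose2[OF smooth_continuous[OF smooth_frechet[OF K(1)], of UNIV]]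
        continuous_intros) auto
  then have "integrable lborel (\<lambda>r. indicator {0..h} r *\<^sub>R ?d r)"
    by (intro borel_integrable_compact) auto
  then have i: "integrable lborel (\<lambda>r. indicator {0..h} r * ?d r)" by simp
  have "ennreal \<bar>f v\<bar> = ennreal (norm (LINT r|lborel. indicator {0..h} r * ?d r))"
    using smooth_ftc[OF K(1) h, of v e] z by simp
  also have "\<dots> \<le> (\<integral>\<^sup>+r. ennreal (norm (indicator {0..h} r * ?d r)) \<partial>lborel)"
    by (rule integral_norm_bound_ennreal[OF i])
  also have "\<dots> \<le> (\<integral>\<^sup>+r. ennreal \<bar>?d r\<bar> \<partial>lborel)"
    by (intro nn_integral_mono) (auto simp: indicator_def)
  also have "\<dots> = (\<integral>\<^sup>+s. ennreal \<bar>frechet_derivative f (at (v + s *\<^sub>R e)) e\<bar> \<partial>lborel)"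
    by (subst nn_integral_real_affine[of _ "-1" 0]) auto
  finally show ?thesis .
qed

lemma frechet_power4:
  assumes "smooth f"
  shows "frechet_derivative (\<lambda>x. f x ^ 4) (at x) e = 4 * f x ^ 3 * frechet_derivative f (at x) e"
proof -
  have "((\<lambda>x. f x ^ 4) has_derivative (\<lambda>v. 4 * frechet_derivative f (at x) v * f x ^ 3)) (at x)"
    using has_derivative_power[OF has_derivative_smooth[OF assms, of x], of 4] by simp
  from frechet_derivative_at[OF this, symmetric] show ?thesis by simp
qed

lemma test_function_power:
  "test_function S f \<Longrightarrow> n > 0 \<Longrightarrow> test_function S (\<lambda>x. f x ^ n)"
proof (induction n)
  case (Suc n)
  then show ?case
    using test_function_mult[of S f "\<lambda>x. f x ^ n"] test_function_smooth[of S f] test_function_smooth[of S "\<lambda>x. f x ^ n"]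
    by (cases n) (auto simp: mult.commute)
qed simp

text \<open>The Gagliardo-Nirenberg argument. \<open>\<phi> ^ 4\<close> is bounded by line integrals
  of \<open>g k\<close> in the three coordinate directions, and \<open>\<phi> ^ 6\<close> by the
  product of their square roots, to which \<open>loomis_whitney\<close> applies. With J the integral
  of \<open>\<phi> ^ 6\<close>, Cauchy-Schwarz bounds each squared integral of \<open>g k\<close> by
  16 J P_k, so J^4 is at most 16^3 J^3 P_1 P_2 P_3; 4096 is 16^3.\<close>

lemma sobolev_inequality_6:
  assumes \<phi>: "test_function UNIV (\<phi> :: space \<Rightarrow> real)"
  shows "(LINT v|lborel. \<phi> v ^ 6) \<le> 4096 * (\<Prod>k\<in>UNIV. LINT v|lborel. (partial (axis k 1) \<phi> v)\<^sup>2)"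
proof -
  have sm: "smooth \<phi>" by (rule test_function_smooth[OF \<phi>])
  have ax: "axis k 1 \<in> (Basis :: space set)" for k by (simp add: axis_in_Basis_iff)
  have ax0: "axis k 1 \<noteq> (0 :: space)" for k by (simp add: axis_eq_0_iff)
  define g where "g = (\<lambda>k v. 4 * \<bar>\<phi> v\<bar> ^ 3 * \<bar>partial (axis k 1) \<phi> v\<bar>)"
  note [measurable] = smooth_measurable[OF sm] smooth_measurable[OF smooth_partial[OF sm ax]]
  have [measurable]: "g k \<in> borel_measurable borel" for k unfolding g_def by measurable
  have [measurable]: "(\<lambda>p. g k (tri (fst p) (fst (snd p)) (snd (snd p)))) \<in> borel_measurable borel" for k
    by measurable
  have line: "ennreal (\<phi> v ^ 4) \<le> (\<integral>\<^sup>+s. ennreal (g k (v + s *\<^sub>R axis k 1)) \<partial>lborel)" for v k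
    using line_bound[OF test_function_power[OF \<phi>, of 4] ax0[of k], of v]
    by (simp add: frechet_power4[OF sm] g_def partial_def abs_mult power_abs)
  obtain K where K: "compact K" "\<And>x. x \<notin> K \<Longrightarrow> \<phi> x = 0" using \<phi> by (metis test_functionE)
  obtain R where R: "\<And>x. x \<in> K \<Longrightarrow> norm x \<le> R"
    using compact_imp_bounded[OF K(1)] bounded_iff by metis
  obtain B where B: "\<And>k v. g k v \<le> B"
  proof -
    obtain b where b: "\<And>v. \<bar>\<phi> v\<bar> \<le> b" using test_function_bounded[OF \<phi>] by metis
    have "\<exists>c. \<forall>v. \<bar>partial (axis k 1) \<phi> v\<bar> \<le> c" for k
      using test_function_bounded[OF test_function_partial[OF \<phi> ax]] by metis
    then obtain c where c: "\<And>k v. \<bar>partial (axis k 1) \<phi> v\<bar> \<le> c k" by metis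
    have "g k v \<le> 4 * b ^ 3 * (\<Sum>k\<in>UNIV. c k)" for k v
      unfolding g_def
    proof (intro mult_mono power_mono b)
      have "0 \<le> c k" for k using c[of k 0] by linarith
      then show "\<bar>partial (axis k 1) \<phi> v\<bar> \<le> sum c UNIV"
        using c[of k v] member_le_sum[of k UNIV c] by fastforce
    qed (use b[of 0] in auto)
    then show thesis by (rule that)
  qed
  \<comment> \<open>A line on which the norm dominates the parameter meets the support only for |s|
    at most \<open>R\<close>, and \<open>g k\<close> is bounded. Finiteness is what makes the square
    root \<open>rt\<close> faithful, because \<open>enn2real\<close> sends infinity to 0.\<close>
  have finl: "(\<integral>\<^sup>+s. ennreal (g k (w s)) \<partial>lborel) < \<infinity>" if "\<And>s. \<bar>s\<bar> \<le> norm (w s)" for k w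
  proof -
    have "(\<integral>\<^sup>+s. ennreal (g k (w s)) \<partial>lborel) \<le> (\<integral>\<^sup>+s. ennreal B * indicator {-R..R} s \<partial>lborel)"
    proof (intro nn_integral_mono)
      fix s
      show "ennreal (g k (w s)) \<le> ennreal B * indicator {-R..R} s"
      proof (cases "w s \<in> K")
        case True
        then have "\<bar>s\<bar> \<le> R" using that[of s] R by force
        then have "indicator {-R..R} s = (1::ennreal)" by (auto simp: indicator_def)
        then show ?thesis using B[of k "w s"] by (simp add: ennreal_leI)
      next
        case False
        then show ?thesis using K(2) by (simp add: g_def)
      qed
    qed
    also have "\<dots> < \<infinity>" by (simp add: nn_integral_cmult ennreal_mult_less_top emeasure_lborel_Icc_eq)
    finally show ?thesis .
  qed
  have comp: "\<bar>s\<bar> \<le> norm (tri s y z)" "\<bar>s\<bar> \<le> norm (tri y s z)" "\<bar>s\<bar> \<le> norm (tri y z s)" for s y z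
    using component_le_norm_cart[of "tri s y z" 1] component_le_norm_cart[of "tri y s z" 2]
      component_le_norm_cart[of "tri y z s" 3] by simp_all
  define a where "a = (\<lambda>(y, z). \<integral>\<^sup>+s. ennreal (g 1 (tri s y z)) \<partial>lborel)"
  define b where "b = (\<lambda>(x, z). \<integral>\<^sup>+s. ennreal (g 2 (tri x s z)) \<partial>lborel)"
  define c where "c = (\<lambda>(x, y). \<integral>\<^sup>+s. ennreal (g 3 (tri x y s)) \<partial>lborel)"
  have m[measurable]: "a \<in> borel_measurable borel" "b \<in> borel_measurable borel" "c \<in> borel_measurable borel"
    unfolding a_def b_def c_def borel_prod[symmetric] by measurable
  have fin: "a p < \<infinity>" "b p < \<infinity>" "c p < \<infinity>" for p
    unfolding a_def b_def c_def by (cases p; simp only: prod.case; intro finl comp)+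
  define rt where "rt = (\<lambda>t::ennreal. ennreal (sqrt (enn2real t)))"
  have rt: "(rt t)\<^sup>2 = t" if "t < \<infinity>" for t
    using that by (cases t) (auto simp: rt_def ennreal_power)
  have [measurable]: "rt \<in> borel_measurable borel" unfolding rt_def by measurable
  have rt_ge: "ennreal (\<phi> v ^ 2) \<le> rt t" if "ennreal (\<phi> v ^ 4) \<le> t" "t < \<infinity>" for v t
  proof (cases t)
    case (real r)
    then have "\<phi> v ^ 4 \<le> r" using that by simp
    then have "\<phi> v ^ 2 \<le> sqrt r" by (intro real_le_rsqrt) (simp flip: power_mult)
    then show ?thesis using real by (simp add: rt_def ennreal_leI)
  qed (use that in simp)
  have ge: "ennreal (\<phi> (tri x y z) ^ 4) \<le> a (y, z)" "ennreal (\<phi> (tri x y z) ^ 4) \<le> b (x, z)"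
      "ennreal (\<phi> (tri x y z) ^ 4) \<le> c (x, y)" for x y z
  proof -
    have e: "tri x y z + s *\<^sub>R axis 1 1 = tri (s + x) y z" "tri x y z + s *\<^sub>R axis 2 1 = tri x (s + y) z"
      "tri x y z + s *\<^sub>R axis 3 1 = tri x y (s + z)" for s
      by (simp_all add: tri_def algebra_simps)
    show "ennreal (\<phi> (tri x y z) ^ 4) \<le> a (y, z)"
      using line[of "tri x y z" 1] lborel_nn_integral_shift[of "\<lambda>s. ennreal (g 1 (tri s y z))" x]
      by (simp add: e a_def)
    show "ennreal (\<phi> (tri x y z) ^ 4) \<le> b (x, z)"
      using line[of "tri x y z" 2] lborel_nn_integral_shift[of "\<lambda>s. ennreal (g 2 (tri x s z))" y]
      by (simp add: e b_def)
    show "ennreal (\<phi> (tri x y z) ^ 4) \<le> c (x, y)"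
      using line[of "tri x y z" 3] lborel_nn_integral_shift[of "\<lambda>s. ennreal (g 3 (tri x y s))" z]
      by (simp add: e c_def)
  qed
  have pt: "ennreal (\<phi> (tri x y z) ^ 6) \<le> rt (a (y, z)) * rt (b (x, z)) * rt (c (x, y))" for x y z
  proof -
    have "ennreal (\<phi> (tri x y z) ^ 6) = ennreal (\<phi> (tri x y z) ^ 2) * ennreal (\<phi> (tri x y z) ^ 2) * ennreal (\<phi> (tri x y z) ^ 2)"
      by (simp add: ennreal_mult[symmetric] flip: power_add)
    also have "\<dots> \<le> rt (a (y, z)) * rt (b (x, z)) * rt (c (x, y))"
      by (intro mult_mono rt_ge ge fin) auto
    finally show ?thesis .
  qed
  let ?J = "\<integral>\<^sup>+v. ennreal (\<phi> v ^ 6) \<partial>lborel" and ?I = "\<lambda>k. \<integral>\<^sup>+v. ennreal (g k v) \<partial>lborel"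
  have "?J \<le> (\<integral>\<^sup>+x. \<integral>\<^sup>+y. \<integral>\<^sup>+z. rt (a (y, z)) * rt (b (x, z)) * rt (c (x, y)) \<partial>lborel \<partial>lborel \<partial>lborel)"
    by (subst nn_integral_space) (auto intro!: nn_integral_mono pt)
  then have "?J\<^sup>2 \<le> (\<integral>\<^sup>+x. \<integral>\<^sup>+y. \<integral>\<^sup>+z. rt (a (y, z)) * rt (b (x, z)) * rt (c (x, y)) \<partial>lborel \<partial>lborel \<partial>lborel)\<^sup>2"
    by (intro power_mono) auto
  also have "\<dots> \<le> (\<integral>\<^sup>+y. \<integral>\<^sup>+z. (rt (a (y, z)))\<^sup>2 \<partial>lborel \<partial>lborel) * (\<integral>\<^sup>+x. \<integral>\<^sup>+z. (rt (b (x, z)))\<^sup>2 \<partial>lborel \<partial>lborel) *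
    (\<integral>\<^sup>+x. \<integral>\<^sup>+y. (rt (c (x, y)))\<^sup>2 \<partial>lborel \<partial>lborel)"
    by (rule loomis_whitney[of "\<lambda>p. rt (a p)" "\<lambda>p. rt (b p)" "\<lambda>p. rt (c p)"]) measurable
  also have "\<dots> = (\<integral>\<^sup>+y. \<integral>\<^sup>+z. a (y, z) \<partial>lborel \<partial>lborel) * (\<integral>\<^sup>+x. \<integral>\<^sup>+z. b (x, z) \<partial>lborel \<partial>lborel) *
    (\<integral>\<^sup>+x. \<integral>\<^sup>+y. c (x, y) \<partial>lborel \<partial>lborel)"
    using fin by (simp add: rt)
  also have "(\<integral>\<^sup>+x. \<integral>\<^sup>+y. c (x, y) \<partial>lborel \<partial>lborel) = ?I 3"
    by (subst nn_integral_space) (auto simp: c_def)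
  also have "(\<integral>\<^sup>+x. \<integral>\<^sup>+z. b (x, z) \<partial>lborel \<partial>lborel) = ?I 2"
  proof -
    have "(\<integral>\<^sup>+z. \<integral>\<^sup>+y. ennreal (g 2 (tri x y z)) \<partial>lborel \<partial>lborel) = (\<integral>\<^sup>+y. \<integral>\<^sup>+z. ennreal (g 2 (tri x y z)) \<partial>lborel \<partial>lborel)" for x
      using lborel_pair.Fubini[of "\<lambda>(y, z). ennreal (g 2 (tri x y z))"] by simp
    then show ?thesis by (subst nn_integral_space) (auto simp: b_def)
  qed
  also have "(\<integral>\<^sup>+y. \<integral>\<^sup>+z. a (y, z) \<partial>lborel \<partial>lborel) = ?I 1"
  proof -
    have "(\<integral>\<^sup>+y. \<integral>\<^sup>+z. \<integral>\<^sup>+x. ennreal (g 1 (tri x y z)) \<partial>lborel \<partial>lborel \<partial>lborel)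
        = (\<integral>\<^sup>+y. \<integral>\<^sup>+x. \<integral>\<^sup>+z. ennreal (g 1 (tri x y z)) \<partial>lborel \<partial>lborel \<partial>lborel)"
    proof (rule nn_integral_cong)
      fix y
      show "(\<integral>\<^sup>+z. \<integral>\<^sup>+x. ennreal (g 1 (tri x y z)) \<partial>lborel \<partial>lborel)
        = (\<integral>\<^sup>+x. \<integral>\<^sup>+z. ennreal (g 1 (tri x y z)) \<partial>lborel \<partial>lborel)"
        using lborel_pair.Fubini[of "\<lambda>(x, z). ennreal (g 1 (tri x y z))"] by simp
    qed
    also have "\<dots> = (\<integral>\<^sup>+x. \<integral>\<^sup>+y. \<integral>\<^sup>+z. ennreal (g 1 (tri x y z)) \<partial>lborel \<partial>lborel \<partial>lborel)"
      using lborel_pair.Fubini[of "\<lambda>(x, y). \<integral>\<^sup>+z. ennreal (g 1 (tri x y z)) \<partial>lborel"] by simp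
    finally show ?thesis by (subst nn_integral_space) (auto simp: a_def)
  qed
  finally have LW: "?J\<^sup>2 \<le> ?I 1 * ?I 2 * ?I 3" .
  define J where "J = (LINT v|lborel. \<phi> v ^ 6)"
  define P where "P = (\<lambda>k. LINT v|lborel. (partial (axis k 1) \<phi> v)\<^sup>2)"
  define I where "I = (\<lambda>k. LINT v|lborel. g k v)"
  have J0: "J \<ge> 0" "P k \<ge> 0" "I k \<ge> 0" for k by (simp_all add: J_def P_def I_def g_def)
  have iJ: "integrable lborel (\<lambda>v. \<phi> v ^ 6)"
    by (rule test_function_integrable[OF test_function_power[OF \<phi>]]) simp
  have iP: "integrable lborel (\<lambda>v. (partial (axis k 1) \<phi> v)\<^sup>2)" for k
    by (rule test_function_integrable[OF test_function_power[OF test_function_partial[OF \<phi> ax]]]) simp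
  have L1: "L2_on lborel (\<lambda>v. \<bar>\<phi> v\<bar> ^ 3)"
    using iJ by (simp add: L2_on_def power_even_abs flip: power_mult)
  have L2: "L2_on lborel (\<lambda>v. 4 * \<bar>partial (axis k 1) \<phi> v\<bar>)" for k
    using iP by (simp add: L2_on_def power_mult_distrib)
  have ig: "integrable lborel (g k)" for k
    using L2_on_mult[OF L1 L2] by (simp add: g_def mult.left_commute mult.assoc)
  have "(I k)\<^sup>2 \<le> 16 * J * P k" for k
  proof -
    have "\<bar>I k\<bar> \<le> l2 lborel (\<lambda>v. \<bar>\<phi> v\<bar> ^ 3) * l2 lborel (\<lambda>v. 4 * \<bar>partial (axis k 1) \<phi> v\<bar>)"
      using ip_le[OF L1 L2[of k]] by (simp add: I_def g_def ip_def mult.left_commute mult.assoc)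
    then have "(I k)\<^sup>2 \<le> (l2 lborel (\<lambda>v. \<bar>\<phi> v\<bar> ^ 3))\<^sup>2 * (l2 lborel (\<lambda>v. 4 * \<bar>partial (axis k 1) \<phi> v\<bar>))\<^sup>2"
      unfolding power_mult_distrib[symmetric] by (metis abs_ge_zero power2_abs power_mono)
    also have "\<dots> = J * (16 * P k)"
      by (simp add: l2_sq J_def P_def power_mult_distrib power_even_abs flip: power_mult)
    finally show ?thesis by simp
  qed
  note I2 = this
  have g0: "0 \<le> g k v" for k v by (simp add: g_def)
  have "?J = ennreal J" "?I k = ennreal (I k)" for k
    using iJ ig g0 by (simp_all add: nn_integral_eq_integral J_def I_def)
  then have "ennreal (J\<^sup>2) \<le> ennreal (I 1 * I 2 * I 3)"
    using LW J0 by (simp add: ennreal_mult ennreal_power)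
  then have "J\<^sup>2 \<le> I 1 * I 2 * I 3" using J0 by (simp add: ennreal_le_iff)
  then have "(J\<^sup>2)\<^sup>2 \<le> (I 1 * I 2 * I 3)\<^sup>2" by (intro power_mono) auto
  also have "\<dots> = (I 1)\<^sup>2 * (I 2)\<^sup>2 * (I 3)\<^sup>2" by (simp add: power_mult_distrib)
  also have "\<dots> \<le> (16 * J * P 1) * (16 * J * P 2) * (16 * J * P 3)"
    by (intro mult_mono I2 mult_nonneg_nonneg) (use J0 in auto)
  finally have "J ^ 3 * J \<le> J ^ 3 * (4096 * (P 1 * P 2 * P 3))"
    by (simp add: power2_eq_square power3_eq_cube mult_ac)
  \<comment> \<open>The factor J^3 can be cancelled because J is finite, as \<open>\<phi>\<close> is
    a test function; J = 0 is trivial.\<close>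
  then have "J \<le> 4096 * (P 1 * P 2 * P 3)"
  proof (cases "J = 0")
    case True
    then show ?thesis using J0 by simp
  next
    case False
    then have "0 < J ^ 3" using J0 by simp
    with \<open>J ^ 3 * J \<le> _\<close> show ?thesis by (simp only: mult_le_cancel_left_pos)
  qed
  then show ?thesis by (simp add: J_def P_def prod_UNIV_3)
qed

text \<open>The plain squared H1 norm, counting the function once, unlike
  \<open>sobolev_norm_sq\<close>. It is exactly the potential part of the energy.\<close>

definition h1_sq :: "space set \<Rightarrow> (space \<Rightarrow> real) \<Rightarrow> real" where
  "h1_sq S z = (l2 (lebesgue_on S) z)\<^sup>2 + (\<Sum>k\<in>UNIV. (l2 (lebesgue_on S) (weak_deriv S (mi k 1) z))\<^sup>2)"

lemma h1_sq_nonneg: "0 \<le> h1_sq S z"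
  by (simp add: h1_sq_def sum_nonneg)

text \<open>Interpolation by Cauchy-Schwarz, writing the fourth power as \<open>\<phi>\<close> times
  \<open>\<phi> ^ 3\<close>; 64 is the square root of the constant 4096 in the sixth-power
  bound.\<close>

lemma test_function_L4:
  assumes S: "open S" and \<phi>: "test_function S (\<phi> :: space \<Rightarrow> real)"
  shows "(LINT x|lebesgue_on S. \<phi> x ^ 4) \<le> 64 * ((l2 (lebesgue_on S) \<phi>)\<^sup>2 +
      (\<Sum>k\<in>UNIV. (l2 (lebesgue_on S) (partial (axis k 1) \<phi>))\<^sup>2))\<^sup>2"
proof -
  have ax: "axis k 1 \<in> (Basis :: space set)" for k by (simp add: axis_in_Basis_iff)
  have t: "test_function UNIV \<phi>" using test_function_mono[OF \<phi>] by simp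
  have tr: "(LINT x|lebesgue_on S. \<psi> x ^ n) = (LINT x|lborel. \<psi> x ^ n)" if "test_function S \<psi>" "n > 0" for \<psi> n
  proof (rule lebesgue_on_lborel(2))
    show "(\<lambda>x. \<psi> x ^ n) \<in> borel_measurable borel"
      using smooth_measurable[OF test_function_smooth[OF that(1)]] by measurable
    show "\<psi> x ^ n = 0" if "x \<notin> S" for x
    proof -
      have "\<psi> x = 0" using \<open>test_function S \<psi>\<close> that by (meson subsetD test_functionE)
      then show ?thesis using \<open>n > 0\<close> by simp
    qed
  qed (use S in simp)
  define q where "q = (\<lambda>k. (l2 (lebesgue_on S) (partial (axis k 1) \<phi>))\<^sup>2)"
  define p where "p = (l2 (lebesgue_on S) \<phi>)\<^sup>2"
  define H where "H = p + sum q UNIV"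
  have pq: "0 \<le> p" "0 \<le> q k" "q k \<le> H" "p \<le> H" "0 \<le> H" for k
  proof -
    show 0: "0 \<le> p" "0 \<le> q k" for k by (simp_all add: p_def q_def)
    then have "0 \<le> sum q UNIV" "q k \<le> sum q UNIV" by (auto intro: sum_nonneg member_le_sum)
    then show "q k \<le> H" "p \<le> H" "0 \<le> H" using 0(1) by (simp_all add: H_def)
  qed
  have L: "L2_on lborel \<phi>" "L2_on lborel (\<lambda>x. \<phi> x ^ 3)"
    using test_function_integrable[OF test_function_power[OF t, of 2]] test_function_integrable[OF test_function_power[OF t, of 6]]
      smooth_measurable[OF test_function_smooth[OF t]]
    by (auto simp: L2_on_def simp flip: power_mult)
  have "(LINT x|lborel. \<phi> x ^ 6) \<le> 4096 * (\<Prod>k\<in>UNIV. q k)"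
    using sobolev_inequality_6[OF t] tr[OF test_function_partial[OF \<phi> ax], of 2] by (simp add: q_def l2_sq)
  also have "(\<Prod>k\<in>UNIV. q k) \<le> (\<Prod>k\<in>(UNIV::3 set). H)" by (intro prod_mono) (use pq in auto)
  finally have 6: "(l2 lborel (\<lambda>x. \<phi> x ^ 3))\<^sup>2 \<le> 4096 * H ^ 3" by (simp add: l2_sq flip: power_mult)
  have p2: "(l2 lborel \<phi>)\<^sup>2 = p" using tr[OF \<phi>, of 2] by (simp add: l2_sq p_def)
  have "(LINT x|lebesgue_on S. \<phi> x ^ 4) = ip lborel \<phi> (\<lambda>x. \<phi> x ^ 3)"
    using tr[OF \<phi>, of 4] by (simp add: ip_def power_numeral_reduce)
  also have "\<dots> \<le> l2 lborel \<phi> * l2 lborel (\<lambda>x. \<phi> x ^ 3)" using ip_le[OF L] by simp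
  also have "\<dots> \<le> 64 * H\<^sup>2"
  proof (rule power2_le_imp_le)
    have "(l2 lborel \<phi> * l2 lborel (\<lambda>x. \<phi> x ^ 3))\<^sup>2 \<le> H * (4096 * H ^ 3)"
      unfolding power_mult_distrib by (intro mult_mono 6) (use p2 pq in auto)
    then show "(l2 lborel \<phi> * l2 lborel (\<lambda>x. \<phi> x ^ 3))\<^sup>2 \<le> (64 * H\<^sup>2)\<^sup>2"
      by (simp add: power_mult_distrib power_numeral_reduce)
  qed simp
  finally show ?thesis by (simp add: H_def p_def q_def)
qed

text \<open>The bound for test functions passes to the limit by Fatou's lemma along a subsequence
  converging almost everywhere; this also yields integrability of the fourth power. The constant 8
  is the square root of 64.\<close>

lemma H10_L4:
  assumes S: "open S" and z: "z \<in> H10 S"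
  shows "L2_on (lebesgue_on S) (\<lambda>x. (z x)\<^sup>2)" "l2 (lebesgue_on S) (\<lambda>x. (z x)\<^sup>2) \<le> 8 * h1_sq S z"
proof -
  let ?M = "lebesgue_on S"
  have ax: "axis k 1 \<in> (Basis :: space set)" for k by (simp add: axis_in_Basis_iff)
  obtain \<phi> where \<phi>: "\<And>n::nat. test_function S (\<phi> n)" "(\<lambda>n. l2 ?M (\<lambda>x. \<phi> n x - z x)) \<longlonglongrightarrow> 0"
     "\<And>k. (\<lambda>n. l2 ?M (\<lambda>x. partial (axis k 1) (\<phi> n) x - weak_deriv S (mi k 1) z x)) \<longlonglongrightarrow> 0"
    using z by (auto simp: H10_def)
  have Lz: "L2_on ?M z" by (rule sobolev_L2[OF H10_sobolev[OF z]])
  have Ldz: "L2_on ?M (weak_deriv S (mi k 1) z)" for k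
    by (rule sobolev_weak_deriv(2)[OF S H10_sobolev[OF z]]) simp
  have L\<phi>: "L2_on ?M (\<phi> n)" for n by (rule L2_on_test_function[OF S \<phi>(1)])
  have Ld\<phi>: "L2_on ?M (partial (axis k 1) (\<phi> n))" for k n
    by (rule L2_on_test_function[OF S test_function_partial[OF \<phi>(1) ax]])
  have lim: "(\<lambda>n. l2 ?M (f n)) \<longlonglongrightarrow> l2 ?M g"
    if "(\<lambda>n. l2 ?M (\<lambda>x. f n x - g x)) \<longlonglongrightarrow> 0" "\<And>n. L2_on ?M (f n)" "L2_on ?M g" for f g
    by (rule LIM_zero_cancel, rule Lim_null_comparison[OF _ that(1)])
      (use l2_dist[OF that(2,3)] in auto)
  define H where "H = (\<lambda>n. (l2 ?M (\<phi> n))\<^sup>2 + (\<Sum>k\<in>UNIV. (l2 ?M (partial (axis k 1) (\<phi> n)))\<^sup>2))"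
  have H: "H \<longlonglongrightarrow> h1_sq S z"
    unfolding H_def h1_sq_def
    by (intro tendsto_add tendsto_sum tendsto_power lim \<phi>(2,3) L\<phi> Ld\<phi> Lz Ldz)
  have i: "integrable ?M (\<lambda>x. (\<phi> n x - z x)\<^sup>2)" for n
    using L2_on_diff[OF L\<phi> Lz] by (simp add: L2_on_def)
  have "(\<lambda>n. LINT x|?M. norm ((\<phi> n x - z x)\<^sup>2)) \<longlonglongrightarrow> 0"
    using tendsto_power[OF \<phi>(2), of 2] by (simp add: l2_sq)
  from tendsto_L1_AE_subseq[OF i this] obtain r :: "nat \<Rightarrow> nat"
    where r: "strict_mono r" "AE x in ?M. (\<lambda>n. (\<phi> (r n) x - z x)\<^sup>2) \<longlonglongrightarrow> 0" by blast
  have [measurable]: "z \<in> borel_measurable ?M" "\<phi> n \<in> borel_measurable ?M" for n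
    using Lz L\<phi> by (auto simp: L2_on_def)
  have "(\<integral>\<^sup>+x. ennreal (z x ^ 4) \<partial>?M) = (\<integral>\<^sup>+x. liminf (\<lambda>n. ennreal (\<phi> (r n) x ^ 4)) \<partial>?M)"
  proof (rule nn_integral_cong_AE)
    show "AE x in ?M. ennreal (z x ^ 4) = liminf (\<lambda>n. ennreal (\<phi> (r n) x ^ 4))"
      using r(2)
    proof eventually_elim
      case (elim x)
      have "(\<lambda>n. \<bar>\<phi> (r n) x - z x\<bar>) \<longlonglongrightarrow> 0" using tendsto_real_sqrt[OF elim] by simp
      then have "(\<lambda>n. \<phi> (r n) x) \<longlonglongrightarrow> z x" by (simp add: tendsto_rabs_zero_iff LIM_zero_iff)
      then have "(\<lambda>n. ennreal (\<phi> (r n) x ^ 4)) \<longlonglongrightarrow> ennreal (z x ^ 4)"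
        by (intro tendsto_ennrealI tendsto_power)
      then show ?case using lim_imp_Liminf[OF sequentially_bot] by metis
    qed
  qed
  also have "\<dots> \<le> liminf (\<lambda>n. \<integral>\<^sup>+x. ennreal (\<phi> (r n) x ^ 4) \<partial>?M)"
    by (rule nn_integral_liminf) measurable
  also have "\<dots> \<le> liminf (\<lambda>n. ennreal (64 * (H (r n))\<^sup>2))"
  proof (rule Liminf_mono, rule always_eventually, rule allI)
    fix n
    have "L2_on ?M (\<lambda>x. (\<phi> (r n) x)\<^sup>2)"
      using L2_on_test_function[OF S test_function_power[OF \<phi>(1), of 2]] by simp
    then have "integrable ?M (\<lambda>x. \<phi> (r n) x ^ 4)" by (simp add: L2_on_def flip: power_mult)
    then have "(\<integral>\<^sup>+x. ennreal (\<phi> (r n) x ^ 4) \<partial>?M) = ennreal (LINT x|?M. \<phi> (r n) x ^ 4)"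
      by (simp add: nn_integral_eq_integral)
    also have "\<dots> \<le> ennreal (64 * (H (r n))\<^sup>2)"
      unfolding H_def by (intro ennreal_leI test_function_L4 S \<phi>)
    finally show "(\<integral>\<^sup>+x. ennreal (\<phi> (r n) x ^ 4) \<partial>?M) \<le> ennreal (64 * (H (r n))\<^sup>2)" .
  qed
  also have "\<dots> = ennreal (64 * (h1_sq S z)\<^sup>2)"
  proof (rule lim_imp_Liminf)
    have "(\<lambda>n. H (r n)) \<longlonglongrightarrow> h1_sq S z" using LIMSEQ_subseq_LIMSEQ[OF H r(1)] by (simp add: o_def)
    then show "(\<lambda>n. ennreal (64 * (H (r n))\<^sup>2)) \<longlonglongrightarrow> ennreal (64 * (h1_sq S z)\<^sup>2)"
      by (intro tendsto_ennrealI tendsto_mult_left tendsto_power)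
  qed simp
  finally have le: "(\<integral>\<^sup>+x. ennreal (z x ^ 4) \<partial>?M) \<le> ennreal (64 * (h1_sq S z)\<^sup>2)" .
  have i4: "integrable ?M (\<lambda>x. z x ^ 4)"
    by (rule integrableI_nonneg) (use le in \<open>auto intro: le_less_trans\<close>)
  then show L4: "L2_on ?M (\<lambda>x. (z x)\<^sup>2)" by (simp add: L2_on_def flip: power_mult)
  have "ennreal (LINT x|?M. z x ^ 4) \<le> ennreal (64 * (h1_sq S z)\<^sup>2)"
    using le i4 by (simp add: nn_integral_eq_integral)
  then have "(LINT x|?M. z x ^ 4) \<le> 64 * (h1_sq S z)\<^sup>2" by (simp add: ennreal_le_iff)
  then have "(l2 ?M (\<lambda>x. (z x)\<^sup>2))\<^sup>2 \<le> (8 * h1_sq S z)\<^sup>2"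
    by (simp add: l2_sq power_mult_distrib flip: power_mult)
  then show "l2 ?M (\<lambda>x. (z x)\<^sup>2) \<le> 8 * h1_sq S z"
    by (rule power2_le_imp_le) (simp add: h1_sq_nonneg)
qed

section \<open>Traces on a Lipschitz graph\<close>

text \<open>Holds without integrability, a non-integrable function having integral 0. This spares a
  check of integrability along each individual segment.\<close>

lemma norm_integral_le_nn_integral:
  fixes f :: "'a \<Rightarrow> real"
  shows "ennreal \<bar>integral\<^sup>L M f\<bar> \<le> (\<integral>\<^sup>+x. ennreal \<bar>f x\<bar> \<partial>M)"
proof (cases "integrable M f")
  case True
  then show ?thesis using integral_norm_bound_ennreal[OF True] by simp
qed (simp add: not_integrable_integral_eq)

text \<open>Every point of the thin strip \<open>0 < \<sigma> < \<eta>\<close> is compared with its translates by \<open>h e\<close>,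
  \<open>0 \<le> h \<le> \<delta>\<close>; averaging over \<open>h\<close> loses exactly the factor \<open>\<eta>\<close>, which is the size of the strip.\<close>

lemma strip_inequality:
  fixes G H \<sigma> :: "'a::euclidean_space \<Rightarrow> real" and e :: 'a and Z :: "'a set"
  assumes G: "integrable lborel G" and H: "integrable lborel H"
    and weak: "\<And>\<psi>. test_function S \<psi> \<Longrightarrow>
      (LINT x|lborel. G x * frechet_derivative \<psi> (at x) e) = - (LINT x|lborel. H x * \<psi> x)"
    and \<sigma>: "continuous_on UNIV \<sigma>" "\<And>x h. \<sigma> (x + h *\<^sub>R e) = \<sigma> x + h"
    and Z: "open Z" "\<And>x h. x + h *\<^sub>R e \<in> Z \<longleftrightarrow> x \<in> Z"
    and W: "{x\<in>Z. 0 < \<sigma> x \<and> \<sigma> x < 2 * \<delta>} \<subseteq> S"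
    and \<eta>: "0 < \<eta>" "\<eta> \<le> \<delta> / 2"
    and \<kappa>: "\<And>x. x \<in> Z \<Longrightarrow> 0 < \<sigma> x \<Longrightarrow> \<sigma> x < \<eta> \<Longrightarrow> \<kappa> \<le> \<bar>G x\<bar>" "0 \<le> \<kappa>"
  shows "ennreal \<kappa> * emeasure lborel {x\<in>Z. \<delta> / 2 \<le> \<sigma> x \<and> \<sigma> x \<le> \<delta>} \<le>
    (\<integral>\<^sup>+x. ennreal \<bar>G x\<bar> \<partial>lborel) + ennreal \<delta> * (\<integral>\<^sup>+x. ennreal \<bar>H x\<bar> \<partial>lborel)"
proof -
  have \<delta>: "0 < \<delta>" using \<eta> by simp
  define A where "A = {x\<in>Z. 0 < \<sigma> x \<and> \<sigma> x < \<eta>}"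
  define Q where "Q = {x\<in>Z. \<delta> / 2 \<le> \<sigma> x \<and> \<sigma> x \<le> \<delta>}"
  have [measurable]: "G \<in> borel_measurable borel" "H \<in> borel_measurable borel" "\<sigma> \<in> borel_measurable borel"
    "Z \<in> sets borel" using G H \<sigma>(1) Z(1) by (auto intro: borel_measurable_continuous_onI)
  have [measurable]: "A \<in> sets borel" "Q \<in> sets borel" unfolding A_def Q_def by measurable
  have oA: "open A"
  proof -
    have "A = Z \<inter> \<sigma> -` {0<..<\<eta>}" by (auto simp: A_def)
    moreover have "open (\<sigma> -` {0<..<\<eta>})" by (rule open_vimage[OF _ \<sigma>(1)]) simp
    ultimately show ?thesis using Z(1) by auto
  qed
  define I where "I = (\<lambda>h. indicator {0..\<delta>} h :: ennreal)"
  have [measurable]: "I \<in> borel_measurable borel" unfolding I_def by measurable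
  \<comment> \<open>Integral of F over all translates of the strip. By Tonelli it equals the
    integral of F against \<open>l\<close>, where \<open>l z\<close> is the length of the set of
    admissible \<open>h\<close> that carry a strip point to \<open>z\<close>.\<close>
  define \<Theta> where "\<Theta> = (\<lambda>F. \<integral>\<^sup>+h. I h * (\<integral>\<^sup>+x. indicator A x * F (x + h *\<^sub>R e) \<partial>lborel) \<partial>lborel)"
  define l where "l = (\<lambda>z. \<integral>\<^sup>+h. I h * indicator A (z - h *\<^sub>R e) \<partial>lborel)"
  have \<Theta>: "\<Theta> F = (\<integral>\<^sup>+z. F z * l z \<partial>lborel)" if [measurable]: "F \<in> borel_measurable borel" for F
  proof -
    have "\<Theta> F = (\<integral>\<^sup>+h. \<integral>\<^sup>+z. F z * (I h * indicator A (z - h *\<^sub>R e)) \<partial>lborel \<partial>lborel)"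
      unfolding \<Theta>_def
    proof (rule nn_integral_cong)
      fix h
      have "(\<integral>\<^sup>+x. indicator A x * F (x + h *\<^sub>R e) \<partial>lborel) = (\<integral>\<^sup>+z. indicator A (z - h *\<^sub>R e) * F z \<partial>lborel)"
        using lborel_nn_integral_shift[of "\<lambda>z. indicator A (z - h *\<^sub>R e) * F z" "h *\<^sub>R e"] by simp
      then show "I h * (\<integral>\<^sup>+x. indicator A x * F (x + h *\<^sub>R e) \<partial>lborel) =
          (\<integral>\<^sup>+z. F z * (I h * indicator A (z - h *\<^sub>R e)) \<partial>lborel)"
        by (simp add: nn_integral_cmult[symmetric] mult_ac)
    qed
    also have "\<dots> = (\<integral>\<^sup>+z. \<integral>\<^sup>+h. F z * (I h * indicator A (z - h *\<^sub>R e)) \<partial>lborel \<partial>lborel)"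
      using lborel_pair.Fubini[of "\<lambda>(z, h). F z * (I h * indicator A (z - h *\<^sub>R e))"] by simp
    also have "\<dots> = (\<integral>\<^sup>+z. F z * l z \<partial>lborel)"
      unfolding l_def by (simp add: nn_integral_cmult)
    finally show ?thesis .
  qed
  have inA: "z - h *\<^sub>R e \<in> A \<longleftrightarrow> z \<in> Z \<and> h < \<sigma> z \<and> \<sigma> z - \<eta> < h" for z h
    using \<sigma>(2)[of z "- h"] Z(2)[of z "- h"] by (auto simp: A_def)
  have lup: "l z \<le> ennreal \<eta>" for z
  proof -
    have "l z \<le> (\<integral>\<^sup>+h. indicator {\<sigma> z - \<eta>..\<sigma> z} h \<partial>lborel)"
      unfolding l_def I_def by (intro nn_integral_mono) (auto simp: indicator_def inA)
    then show ?thesis using \<eta> by simp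
  qed
  \<comment> \<open>For \<open>z\<close> in \<open>Q\<close> the admissible parameters fill the
    whole interval between \<open>\<sigma> z - \<eta>\<close> and \<open>\<sigma> z\<close>: it lies
    in [0, \<open>\<delta>\<close>] because \<open>\<eta>\<close> is at most
    \<open>\<delta> / 2\<close>.\<close>
  have llow: "ennreal \<eta> * indicator Q z \<le> l z" for z
  proof (cases "z \<in> Q")
    case True
    have "(\<integral>\<^sup>+h. indicator {\<sigma> z - \<eta><..<\<sigma> z} h \<partial>lborel) \<le> l z"
      unfolding l_def I_def using True \<eta>
      by (intro nn_integral_mono) (auto simp: indicator_def inA Q_def)
    then show ?thesis using \<eta> True by simp
  qed simp
  have upper: "\<Theta> F \<le> ennreal \<eta> * (\<integral>\<^sup>+z. F z \<partial>lborel)" if [measurable]: "F \<in> borel_measurable borel" for F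
  proof -
    have "\<Theta> F \<le> (\<integral>\<^sup>+z. F z * ennreal \<eta> \<partial>lborel)"
      unfolding \<Theta>[OF that] by (intro nn_integral_mono mult_left_mono lup) simp
    also have "\<dots> = (\<integral>\<^sup>+z. F z \<partial>lborel) * ennreal \<eta>" by (rule nn_integral_multc) simp
    finally show ?thesis by (simp add: mult.commute)
  qed
  have "ennreal \<eta> * emeasure lborel Q = (\<integral>\<^sup>+z. 1 * (ennreal \<eta> * indicator Q z) \<partial>lborel)"
    by (simp add: nn_integral_cmult)
  also have "\<dots> \<le> (\<integral>\<^sup>+z. 1 * l z \<partial>lborel)" by (intro nn_integral_mono mult_left_mono llow) simp
  also have "\<dots> = \<Theta> (\<lambda>_. 1)" by (subst \<Theta>) auto
  finally have lower: "ennreal \<eta> * emeasure lborel Q \<le> \<Theta> (\<lambda>_. 1)" .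
  \<comment> \<open>The segment integral is enlarged to the full range up to
    \<open>\<delta>\<close>, so that it no longer depends on \<open>h\<close> and becomes
    \<open>\<Theta>\<close> of |H| after integration over the strip.\<close>
  let ?gH = "\<lambda>x. \<integral>\<^sup>+r. I r * ennreal \<bar>H (x + r *\<^sub>R e)\<bar> \<partial>lborel"
  have step: "ennreal \<kappa> * (\<integral>\<^sup>+x. indicator A x * 1 \<partial>lborel) \<le>
      (\<integral>\<^sup>+x. indicator A x * ennreal \<bar>G (x + h *\<^sub>R e)\<bar> \<partial>lborel) + (\<integral>\<^sup>+x. indicator A x * ?gH x \<partial>lborel)"
    if h: "h \<in> {0..\<delta>}" for h
  proof -
    have sub: "x + r *\<^sub>R e \<in> S" if "x \<in> A" "r \<in> {0..h}" for x r
    proof -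
      have "x + r *\<^sub>R e \<in> {x\<in>Z. 0 < \<sigma> x \<and> \<sigma> x < 2 * \<delta>}"
        using that h \<eta> Z(2)[of x r] by (auto simp: A_def \<sigma>(2))
      then show ?thesis using W by blast
    qed
    have "AE x in lborel. x \<in> A \<longrightarrow> G (x + h *\<^sub>R e) - G x = (LINT r|lborel. indicator {0..h} r * H (x + r *\<^sub>R e))"
      by (rule weak_ftc[OF G H weak oA _ sub]) (use h in auto)
    then have "AE x in lborel. ennreal \<kappa> * (indicator A x * 1) \<le>
        indicator A x * ennreal \<bar>G (x + h *\<^sub>R e)\<bar> + indicator A x * ?gH x"
    proof eventually_elim
      case (elim x)
      show ?case
      proof (cases "x \<in> A")
        case True
        let ?L = "LINT r|lborel. indicator {0..h} r * H (x + r *\<^sub>R e)"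
        have "\<kappa> \<le> \<bar>G x\<bar>" using True \<kappa> by (auto simp: A_def)
        also have "\<dots> \<le> \<bar>G (x + h *\<^sub>R e)\<bar> + \<bar>?L\<bar>" using elim True by simp
        finally have "ennreal \<kappa> \<le> ennreal (\<bar>G (x + h *\<^sub>R e)\<bar> + \<bar>?L\<bar>)" by (rule ennreal_leI)
        also have "\<dots> = ennreal \<bar>G (x + h *\<^sub>R e)\<bar> + ennreal \<bar>?L\<bar>" by simp
        also have "ennreal \<bar>?L\<bar> \<le> (\<integral>\<^sup>+r. ennreal \<bar>indicator {0..h} r * H (x + r *\<^sub>R e)\<bar> \<partial>lborel)"
          by (rule norm_integral_le_nn_integral)
        also have "\<dots> \<le> ?gH x"
          using h by (intro nn_integral_mono) (auto simp: I_def indicator_def)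
        finally show ?thesis using True by (simp add: add_left_mono)
      qed simp
    qed
    then have "(\<integral>\<^sup>+x. ennreal \<kappa> * (indicator A x * 1) \<partial>lborel) \<le>
        (\<integral>\<^sup>+x. indicator A x * ennreal \<bar>G (x + h *\<^sub>R e)\<bar> + indicator A x * ?gH x \<partial>lborel)"
      by (rule nn_integral_mono_AE)
    also have "\<dots> = (\<integral>\<^sup>+x. indicator A x * ennreal \<bar>G (x + h *\<^sub>R e)\<bar> \<partial>lborel) + (\<integral>\<^sup>+x. indicator A x * ?gH x \<partial>lborel)"
      by (rule nn_integral_add) measurable
    finally show ?thesis by (simp add: nn_integral_cmult)
  qed
  have gH: "(\<integral>\<^sup>+x. indicator A x * ?gH x \<partial>lborel) = \<Theta> (\<lambda>x. ennreal \<bar>H x\<bar>)"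
  proof -
    have "(\<integral>\<^sup>+x. indicator A x * ?gH x \<partial>lborel) =
        (\<integral>\<^sup>+x. \<integral>\<^sup>+r. I r * (indicator A x * ennreal \<bar>H (x + r *\<^sub>R e)\<bar>) \<partial>lborel \<partial>lborel)"
      by (simp add: nn_integral_cmult[symmetric] mult.left_commute)
    also have "\<dots> = (\<integral>\<^sup>+r. \<integral>\<^sup>+x. I r * (indicator A x * ennreal \<bar>H (x + r *\<^sub>R e)\<bar>) \<partial>lborel \<partial>lborel)"
      using lborel_pair.Fubini[of "\<lambda>(r, x). I r * (indicator A x * ennreal \<bar>H (x + r *\<^sub>R e)\<bar>)"] by simp
    also have "\<dots> = \<Theta> (\<lambda>x. ennreal \<bar>H x\<bar>)" unfolding \<Theta>_def by (simp add: nn_integral_cmult)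
    finally show ?thesis .
  qed
  have I\<delta>: "(\<integral>\<^sup>+h. I h \<partial>lborel) = ennreal \<delta>" using \<delta> by (simp add: I_def)
  have "ennreal \<kappa> * \<Theta> (\<lambda>_. 1) = (\<integral>\<^sup>+h. I h * (ennreal \<kappa> * (\<integral>\<^sup>+x. indicator A x * 1 \<partial>lborel)) \<partial>lborel)"
    unfolding \<Theta>_def by (simp add: nn_integral_cmult[symmetric] mult.left_commute)
  also have "\<dots> \<le> (\<integral>\<^sup>+h. I h * (\<integral>\<^sup>+x. indicator A x * ennreal \<bar>G (x + h *\<^sub>R e)\<bar> \<partial>lborel) +
      I h * \<Theta> (\<lambda>x. ennreal \<bar>H x\<bar>) \<partial>lborel)"
    using step unfolding gH distrib_left[symmetric]
    by (intro nn_integral_mono) (auto simp: I_def indicator_def)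
  also have "\<dots> = \<Theta> (\<lambda>x. ennreal \<bar>G x\<bar>) + ennreal \<delta> * \<Theta> (\<lambda>x. ennreal \<bar>H x\<bar>)"
    by (subst nn_integral_add) (auto simp: nn_integral_multc I\<delta> \<Theta>_def)
  also have "\<dots> \<le> ennreal \<eta> * (\<integral>\<^sup>+x. ennreal \<bar>G x\<bar> \<partial>lborel) + ennreal \<delta> * (ennreal \<eta> * (\<integral>\<^sup>+x. ennreal \<bar>H x\<bar> \<partial>lborel))"
    by (intro add_mono mult_left_mono upper) auto
  finally have "ennreal \<kappa> * \<Theta> (\<lambda>_. 1) \<le> ennreal \<eta> * ((\<integral>\<^sup>+x. ennreal \<bar>G x\<bar> \<partial>lborel) + ennreal \<delta> * (\<integral>\<^sup>+x. ennreal \<bar>H x\<bar> \<partial>lborel))"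
    by (simp add: distrib_left mult.left_commute)
  moreover have "ennreal \<eta> * (ennreal \<kappa> * emeasure lborel Q) \<le> ennreal \<kappa> * \<Theta> (\<lambda>_. 1)"
    using mult_left_mono[OF lower, of "ennreal \<kappa>"] by (simp add: mult.left_commute)
  \<comment> \<open>Both sides carry the factor \<open>\<eta>\<close>. After cancelling it, the
    thickness of the strip has disappeared from the inequality.\<close>
  ultimately have "ennreal \<eta> * (ennreal \<kappa> * emeasure lborel Q) \<le>
      ennreal \<eta> * ((\<integral>\<^sup>+x. ennreal \<bar>G x\<bar> \<partial>lborel) + ennreal \<delta> * (\<integral>\<^sup>+x. ennreal \<bar>H x\<bar> \<partial>lborel))"
    by (rule order_trans[rotated])
  then show ?thesis
    using \<eta> unfolding Q_def by (subst (asm) ennreal_mult_le_mult_iff) auto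
qed

lemma sum_Basis_space: "(\<Sum>b\<in>(Basis::space set). f b) = (\<Sum>k\<in>UNIV. f (axis k 1))"
proof -
  have b: "(Basis::space set) = (\<lambda>i. axis i 1) ` UNIV" unfolding Basis_vec_def Basis_real_def by blast
  have "inj (\<lambda>i::3. axis i (1::real))" by (simp add: inj_def axis_eq_axis)
  then show ?thesis unfolding b by (simp add: sum.reindex)
qed

lemma L2_on_const:
  assumes "S \<in> lmeasurable" shows "L2_on (lebesgue_on S) (\<lambda>_. c)"
proof -
  interpret finite_measure "lebesgue_on S" by (rule finite_measure_lebesgue_on[OF assms])
  show ?thesis by (simp add: L2_on_def)
qed

lemma L2_on_integrable:
  assumes "S \<in> lmeasurable" "L2_on (lebesgue_on S) f"
  shows "integrable (lebesgue_on S) f"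
    and "(LINT x|lebesgue_on S. \<bar>f x\<bar>) \<le> l2 (lebesgue_on S) f * l2 (lebesgue_on S) (\<lambda>_. 1)"
proof -
  have a: "L2_on (lebesgue_on S) (\<lambda>x. \<bar>f x\<bar>)" using assms(2) by (auto simp: L2_on_def)
  show "integrable (lebesgue_on S) f"
    using L2_on_mult[OF assms(2) L2_on_const[OF assms(1), of 1]] by simp
  have "l2 (lebesgue_on S) (\<lambda>x. \<bar>f x\<bar>) = l2 (lebesgue_on S) f" by (simp add: l2_def)
  then show "(LINT x|lebesgue_on S. \<bar>f x\<bar>) \<le> l2 (lebesgue_on S) f * l2 (lebesgue_on S) (\<lambda>_. 1)"
    using ip_le[OF a L2_on_const[OF assms(1), of 1]] by (simp add: ip_def)
qed

text \<open>The abstract inequality with H the directional derivative along \<open>e\<close>, a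
  combination of the three weak derivatives. Boundedness of \<open>S\<close> lets L2 norms control
  L1 norms, at the price of the norm of the constant 1.\<close>

lemma strip_inequality_sobolev:
  fixes \<sigma> :: "space \<Rightarrow> real" and Z :: "space set"
  assumes S: "open S" "bounded S" and G: "G \<in> sobolev 1 S" "continuous_on S G"
    and \<sigma>: "continuous_on UNIV \<sigma>" "\<And>x h. \<sigma> (x + h *\<^sub>R e) = \<sigma> x + h"
    and Z: "open Z" "\<And>x h. x + h *\<^sub>R e \<in> Z \<longleftrightarrow> x \<in> Z"
    and W: "{x\<in>Z. 0 < \<sigma> x \<and> \<sigma> x < 2 * \<delta>} \<subseteq> S"
    and \<eta>: "0 < \<eta>" "\<eta> \<le> \<delta> / 2"
    and \<kappa>: "\<And>x. x \<in> Z \<Longrightarrow> 0 < \<sigma> x \<Longrightarrow> \<sigma> x < \<eta> \<Longrightarrow> \<kappa> \<le> \<bar>G x\<bar>" "0 \<le> \<kappa>"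
  shows "ennreal \<kappa> * emeasure lborel {x\<in>Z. \<delta> / 2 \<le> \<sigma> x \<and> \<sigma> x \<le> \<delta>} \<le>
    ennreal ((l2 (lebesgue_on S) G + \<delta> * (\<Sum>k\<in>UNIV. \<bar>e $ k\<bar> * l2 (lebesgue_on S) (weak_deriv S (mi k 1) G))) *
      l2 (lebesgue_on S) (\<lambda>_. 1))"
proof -
  let ?M = "lebesgue_on S"
  have \<delta>: "0 < \<delta>" using \<eta> by simp
  have lm: "S \<in> lmeasurable" using S by (simp add: bounded_set_imp_lmeasurable)
  have Sb: "S \<in> sets borel" using S by simp
  let ?D = "\<lambda>k. weak_deriv S (mi k 1) G"
  have D: "is_weak_deriv S (mi k 1) G (?D k)" "L2_on ?M (?D k)" for k
    using sobolev_weak_deriv[OF S(1) G(1), of "mi k 1"] by auto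
  define g where "g = (\<lambda>x. indicator S x * G x)"
  have gb[measurable]: "g \<in> borel_measurable borel" unfolding g_def
    using borel_measurable_continuous_on_indicator[OF Sb G(2)] by simp
  have gi: "integrable lborel g"
  proof (subst lebesgue_on_lborel(1)[OF Sb gb, symmetric])
    have "integrable ?M G" by (rule L2_on_integrable(1)[OF lm sobolev_L2[OF G(1)]])
    then show "integrable ?M g"
      by (rule Bochner_Integration.integrable_cong[THEN iffD1, rotated -1]) (auto simp: g_def)
  qed (simp add: g_def)
  define h0 where "h0 = (\<lambda>x. \<Sum>k\<in>UNIV. e $ k * ?D k x)"
  have Lh0: "L2_on ?M h0" unfolding h0_def by (intro L2_on_sum L2_on_scale D)
  obtain h where h: "h \<in> borel_measurable borel" "\<And>x. x \<notin> S \<Longrightarrow> h x = 0" "AE x in ?M. h0 x = h x"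
  proof -
    have "h0 \<in> borel_measurable ?M" using Lh0 by (simp add: L2_on_def)
    then show thesis by (rule borel_representative[OF Sb]) (rule that)
  qed
  note [measurable] = h(1)
  have hM: "h \<in> borel_measurable ?M" by (rule borel_measurable_lebesgue_onI[OF h(1)])
  have hi: "integrable lborel h"
    using integrable_cong_AE_imp[OF L2_on_integrable(1)[OF lm Lh0] hM h(3)] lebesgue_on_lborel(1)[OF Sb h(1,2)]
    by simp
  have weak: "(LINT x|lborel. g x * frechet_derivative \<psi> (at x) e) = - (LINT x|lborel. h x * \<psi> x)"
    if \<psi>: "test_function S \<psi>" for \<psi>
  proof -
    have sm: "smooth \<psi>" by (rule test_function_smooth[OF \<psi>])
    note [measurable] = smooth_measurable[OF sm] smooth_measurable[OF smooth_frechet[OF sm]]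
    have ax: "axis k 1 \<in> (Basis :: space set)" for k by (simp add: axis_in_Basis_iff)
    have i1: "integrable ?M (\<lambda>x. G x * partial (axis k 1) \<psi> x)" "integrable ?M (\<lambda>x. ?D k x * \<psi> x)" for k
      using D(1)[of k] by (auto simp: is_weak_deriv_def intro!: test_function_mult_integrable[OF S(1)] test_function_partial \<psi> ax)
    have "(LINT x|lborel. g x * frechet_derivative \<psi> (at x) e) = (LINT x|?M. g x * frechet_derivative \<psi> (at x) e)"
      by (rule lebesgue_on_lborel(2)[OF Sb, symmetric]) (measurable, simp add: g_def)
    also have "\<dots> = (LINT x|?M. (\<Sum>k\<in>UNIV. e $ k * (G x * partial (axis k 1) \<psi> x)))"
      by (intro Bochner_Integration.integral_cong refl)
        (simp add: g_def frechet_derivative_eq_sum_partial[OF smooth_differentiable[OF sm]] sum_Basis_space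
          inner_axis sum_distrib_left mult.left_commute)
    also have "\<dots> = (\<Sum>k\<in>UNIV. e $ k * (LINT x|?M. G x * partial (axis k 1) \<psi> x))"
      using i1 by (simp add: Bochner_Integration.integral_sum)
    also have "\<dots> = (\<Sum>k\<in>UNIV. e $ k * - (LINT x|?M. ?D k x * \<psi> x))"
      using D(1) \<psi> by (simp add: is_weak_deriv_def partials_mi)
    also have "\<dots> = - (LINT x|?M. (\<Sum>k\<in>UNIV. e $ k * (?D k x * \<psi> x)))"
      using i1 by (simp add: Bochner_Integration.integral_sum sum_negf)
    also have "(LINT x|?M. (\<Sum>k\<in>UNIV. e $ k * (?D k x * \<psi> x))) = (LINT x|?M. h0 x * \<psi> x)"
      by (simp add: h0_def sum_distrib_right mult.assoc)
    also have "\<dots> = (LINT x|?M. h x * \<psi> x)"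
    proof (rule integral_cong_AE)
      show "AE x in ?M. h0 x * \<psi> x = h x * \<psi> x" using h(3) by eventually_elim simp
      have "\<psi> \<in> borel_measurable ?M" by (rule borel_measurable_lebesgue_onI[OF smooth_measurable[OF sm]])
      then show "(\<lambda>x. h0 x * \<psi> x) \<in> borel_measurable ?M" "(\<lambda>x. h x * \<psi> x) \<in> borel_measurable ?M"
        using Lh0 hM by (auto simp: L2_on_def)
    qed
    also have "\<dots> = (LINT x|lborel. h x * \<psi> x)"
      by (rule lebesgue_on_lborel(2)[OF Sb]) (auto simp: h)
    finally show ?thesis .
  qed
  have \<kappa>': "\<kappa> \<le> \<bar>g x\<bar>" if "x \<in> Z" "0 < \<sigma> x" "\<sigma> x < \<eta>" for x
    using \<kappa>(1)[OF that] W that \<eta> by (auto simp: g_def indicator_def)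
  have nn: "(\<integral>\<^sup>+x. ennreal \<bar>f x\<bar> \<partial>lborel) = ennreal (LINT x|?M. \<bar>f x\<bar>)"
    if "integrable lborel f" "\<And>x. x \<notin> S \<Longrightarrow> f x = 0" for f
    using that lebesgue_on_lborel(2)[OF Sb, of "\<lambda>x. \<bar>f x\<bar>"] by (simp add: nn_integral_eq_integral)
  have 1: "(LINT x|?M. \<bar>g x\<bar>) \<le> l2 ?M G * l2 ?M (\<lambda>_. 1)"
  proof -
    have "(LINT x|?M. \<bar>g x\<bar>) = (LINT x|?M. \<bar>G x\<bar>)"
      by (intro Bochner_Integration.integral_cong) (auto simp: g_def)
    then show ?thesis using L2_on_integrable(2)[OF lm sobolev_L2[OF G(1)]] by simp
  qed
  have 2: "(LINT x|?M. \<bar>h x\<bar>) \<le> (\<Sum>k\<in>UNIV. \<bar>e $ k\<bar> * l2 ?M (?D k)) * l2 ?M (\<lambda>_. 1)"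
  proof -
    have "(LINT x|?M. \<bar>h x\<bar>) = (LINT x|?M. \<bar>h0 x\<bar>)"
    proof (rule integral_cong_AE)
      show "AE x in ?M. \<bar>h x\<bar> = \<bar>h0 x\<bar>" using h(3) by eventually_elim simp
    qed (use Lh0 hM in \<open>auto simp: L2_on_def\<close>)
    also have "\<dots> \<le> l2 ?M h0 * l2 ?M (\<lambda>_. 1)" by (rule L2_on_integrable(2)[OF lm Lh0])
    also have "l2 ?M h0 \<le> (\<Sum>k\<in>UNIV. l2 ?M (\<lambda>x. e $ k * ?D k x))"
      unfolding h0_def by (intro l2_sum L2_on_scale D)
    finally show ?thesis by (simp add: l2_scale mult_right_mono)
  qed
  have "ennreal \<kappa> * emeasure lborel {x\<in>Z. \<delta> / 2 \<le> \<sigma> x \<and> \<sigma> x \<le> \<delta>} \<le>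
    (\<integral>\<^sup>+x. ennreal \<bar>g x\<bar> \<partial>lborel) + ennreal \<delta> * (\<integral>\<^sup>+x. ennreal \<bar>h x\<bar> \<partial>lborel)"
    by (rule strip_inequality[OF gi hi weak \<sigma> Z W \<eta> \<kappa>' \<kappa>(2)])
  also have "\<dots> = ennreal ((LINT x|?M. \<bar>g x\<bar>) + \<delta> * (LINT x|?M. \<bar>h x\<bar>))"
  proof -
    have "g x = 0" if "x \<notin> S" for x using that by (simp add: g_def)
    then show ?thesis using \<delta> by (simp add: nn[OF gi] nn[OF hi h(2)] ennreal_mult)
  qed
  also have "\<dots> \<le> ennreal (l2 ?M G * l2 ?M (\<lambda>_. 1) + \<delta> * ((\<Sum>k\<in>UNIV. \<bar>e $ k\<bar> * l2 ?M (?D k)) * l2 ?M (\<lambda>_. 1)))"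
    using \<delta> by (intro ennreal_leI add_mono mult_left_mono 1 2) auto
  finally show ?thesis by (simp add: algebra_simps)
qed

text \<open>If \<open>g p\<close> were nonzero, the common boundary value would be bounded below
  near \<open>p\<close>, and by uniform continuity each \<open>G n\<close> would be bounded below by
  \<open>\<kappa>\<close> on a strip above the graph. The strip may become thinner as
  \<open>n\<close> grows, but the strip inequality ignores its thickness: a fixed positive quantity
  would be bounded by terms tending to zero.\<close>

lemma trace_zero:
  fixes g :: "space \<Rightarrow> real"
  assumes \<Omega>: "open \<Omega>" "lipschitz_boundary \<Omega>" and S: "open S" "bounded S" "closure \<Omega> \<subseteq> S"
    and p: "p \<in> frontier \<Omega>" and g: "continuous_on S g"
    and G: "\<And>n::nat. continuous_on S (G n)" "\<And>n. G n \<in> sobolev 1 S"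
      "\<And>n x. x \<in> frontier \<Omega> \<Longrightarrow> G n x = g x"
    and lim: "(\<lambda>n. l2 (lebesgue_on S) (G n)) \<longlonglongrightarrow> 0"
      "\<And>k. (\<lambda>n. l2 (lebesgue_on S) (weak_deriv S (mi k 1) (G n))) \<longlonglongrightarrow> 0"
  shows "g p = 0"
proof (rule ccontr)
  assume gp: "g p \<noteq> 0"
  obtain Q \<gamma> L r where Q: "orthogonal_transformation (Q :: space \<Rightarrow> space)"
    and \<gamma>: "L-lipschitz_on UNIV (\<gamma> :: real^2 \<Rightarrow> real)" and r: "0 < r"
    and loc: "\<Omega> \<inter> ball p r = {x \<in> ball p r. \<gamma> (vector [Q x $ 1, Q x $ 2]) < Q x $ 3}"
    using bspec[OF \<Omega>(2)[unfolded lipschitz_boundary_def] p] by (elim exE conjE) (rule that; assumption)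
  have lQ: "linear Q" using Q by (simp add: orthogonal_transformation_def)
  \<comment> \<open>The direction that is vertical in the rotated coordinates; moving along it
    changes the third coordinate at unit rate and leaves the graph parameters fixed.\<close>
  obtain e where e: "Q e = axis 3 1"
    using orthogonal_transformation_surj[OF Q] by (metis surjD)
  have Qe: "Q (x + h *\<^sub>R e) = Q x + h *\<^sub>R axis 3 1" for x h
    using lQ by (simp add: linear_add linear_scale e)
  define P where "P = (\<lambda>x. Q x $ 1 *\<^sub>R axis 1 1 + Q x $ 2 *\<^sub>R axis 2 1 :: real^2)"
  have P: "vector [Q x $ 1, Q x $ 2] = P x" for x
    by (simp add: P_def vec_eq_iff forall_2 axis_def)
  \<comment> \<open>Height above the Lipschitz graph. Inside the ball, \<open>\<Omega>\<close> is
    where it is positive.\<close>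
  define \<sigma> where "\<sigma> = (\<lambda>x. Q x $ 3 - \<gamma> (P x))"
  have contQ: "continuous_on UNIV Q" using lQ by (simp add: linear_continuous_on linear_conv_bounded_linear)
  have contP: "continuous_on UNIV P" unfolding P_def
    by (intro continuous_intros contQ)
  have cont\<sigma>: "continuous_on UNIV \<sigma>" unfolding \<sigma>_def
    by (intro continuous_intros contQ continuous_on_compose2[OF lipschitz_on_continuous_on[OF \<gamma>] contP]) auto
  have \<sigma>e: "\<sigma> (x + h *\<^sub>R e) = \<sigma> x + h" for x h
    by (simp add: \<sigma>_def P_def Qe axis_def)
  have loc': "x \<in> \<Omega> \<longleftrightarrow> 0 < \<sigma> x" if "x \<in> ball p r" for x
    using loc that by (auto simp: \<sigma>_def P set_eq_iff)
  have intO: "interior \<Omega> = \<Omega>" using \<Omega>(1) by (rule interior_open)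
  have front: "x \<in> frontier \<Omega>" if x: "x \<in> ball p r" "\<sigma> x = 0" for x
  proof -
    have "x \<notin> \<Omega>" using loc'[OF x(1)] x(2) by simp
    moreover have "x \<in> closure \<Omega>"
    proof (rule closure_approachable[THEN iffD2], intro allI impI)
      fix d :: real assume d: "0 < d"
      obtain d' where d': "0 < d'" "ball x d' \<subseteq> ball p r" using x(1) openE[OF open_ball] by blast
      define h where "h = min d d' / (2 * (norm e + 1))"
      have h: "0 < h" using d d'(1) by (simp add: h_def add_nonneg_pos)
      have "h * norm e < min d d'"
      proof -
        have "h * norm e \<le> h * (norm e + 1)" using h by simp
        also have "\<dots> = min d d' / 2"
        proof -
          have "norm e + 1 \<noteq> 0" using norm_ge_zero[of e] by linarith
          then show ?thesis by (simp add: h_def field_simps)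
        qed
        also have "\<dots> < min d d'"
        proof -
          have *: "c / 2 < c" if "0 < c" for c :: real using that by simp
          show ?thesis by (rule *) (use d d'(1) in simp)
        qed
        finally show ?thesis .
      qed
      then have dist: "dist (x + h *\<^sub>R e) x < min d d'" using h by (simp add: dist_norm)
      then have "x + h *\<^sub>R e \<in> ball p r" using d'(2) by (auto simp: dist_commute)
      then have "x + h *\<^sub>R e \<in> \<Omega>" using loc' h x(2) by (simp add: \<sigma>e)
      then show "\<exists>y\<in>\<Omega>. dist y x < d" using dist by auto
    qed
    ultimately show ?thesis by (simp add: frontier_def intO)
  qed
  have pO: "p \<notin> \<Omega>" "p \<in> closure \<Omega>" using p by (auto simp: frontier_def intO)
  have pS: "p \<in> S" using pO S(3) by blast
  have \<sigma>p: "\<sigma> p = 0"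
  proof (rule antisym)
    show "\<sigma> p \<le> 0" using loc'[of p] r pO by simp
    show "0 \<le> \<sigma> p"
    proof (rule ccontr)
      assume "\<not> 0 \<le> \<sigma> p"
      have "open (\<sigma> -` {..<0})" by (rule open_vimage[OF _ cont\<sigma>]) simp
      then have "open (ball p r \<inter> (\<sigma> -` {..<0}))" by auto
      moreover have "p \<in> ball p r \<inter> (\<sigma> -` {..<0})" using \<open>\<not> 0 \<le> \<sigma> p\<close> r by simp
      moreover have "(ball p r \<inter> (\<sigma> -` {..<0})) \<inter> \<Omega> = {}" using loc' by force
      ultimately show False using pO(2) open_Int_closure_eq_empty by blast
    qed
  qed
  \<comment> \<open>One third leaves room for 2 \<open>\<kappa>\<close> as a lower bound of |g| near
    \<open>p\<close>, and for one \<open>\<kappa>\<close> lost when moving off the graph.\<close>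
  define \<kappa> where "\<kappa> = \<bar>g p\<bar> / 3"
  have \<kappa>: "0 < \<kappa>" using gp by (simp add: \<kappa>_def)
  obtain \<rho>0 where \<rho>0: "0 < \<rho>0" "ball p \<rho>0 \<subseteq> S" "ball p \<rho>0 \<subseteq> ball p r" "\<And>x. x \<in> ball p \<rho>0 \<Longrightarrow> 2 * \<kappa> < \<bar>g x\<bar>"
  proof -
    have op: "open (S \<inter> (\<lambda>x. \<bar>g x\<bar>) -` {2 * \<kappa><..})"
      by (intro continuous_open_preimage S(1) continuous_intros g)
    have op2: "open (ball p r \<inter> (S \<inter> (\<lambda>x. \<bar>g x\<bar>) -` {2 * \<kappa><..}))" using op by auto
    have "p \<in> ball p r \<inter> (S \<inter> (\<lambda>x. \<bar>g x\<bar>) -` {2 * \<kappa><..})" using pS r gp by (auto simp: \<kappa>_def)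
    then obtain d where "0 < d" "ball p d \<subseteq> ball p r \<inter> (S \<inter> (\<lambda>x. \<bar>g x\<bar>) -` {2 * \<kappa><..})"
      using openE[OF op2] by metis
    then show thesis by (intro that[of d]) auto
  qed
  have L0: "0 \<le> L" using lipschitz_on_nonneg[OF \<gamma>] .
  \<comment> \<open>Chosen so that the cylinder of half-width \<open>\<rho>\<close> and height 2
    \<open>\<rho>\<close> above the graph fits into the ball of radius \<open>\<rho>0\<close>: its
    points are within 4 \<open>\<rho>\<close> + 2 L \<open>\<rho>\<close> of \<open>p\<close>, the L
    term coming from the variation of the graph.\<close>
  define \<rho> where "\<rho> = \<rho>0 / (8 * (1 + L))"
  have \<rho>: "0 < \<rho>" "4 * \<rho> + 2 * L * \<rho> < \<rho>0"
  proof -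
    show "0 < \<rho>" using \<rho>0(1) L0 by (simp add: \<rho>_def)
    have "4 * \<rho> + 2 * L * \<rho> \<le> 4 * (1 + L) * \<rho>" using L0 \<open>0 < \<rho>\<close> by (simp add: algebra_simps)
    also have "\<dots> = \<rho>0 / 2" using L0 by (simp add: \<rho>_def field_simps)
    also have "\<dots> < \<rho>0" using \<rho>0(1) by simp
    finally show "4 * \<rho> + 2 * L * \<rho> < \<rho>0" .
  qed
  let ?C = "\<lambda>x. \<bar>Q x $ 1 - Q p $ 1\<bar> \<le> \<rho> \<and> \<bar>Q x $ 2 - Q p $ 2\<bar> \<le> \<rho>"
  have near: "x \<in> ball p \<rho>0" if x: "?C x" "0 \<le> \<sigma> x" "\<sigma> x \<le> 2 * \<rho>" for x
  proof -
    have "dist (P x) (P p) \<le> (\<Sum>i\<in>UNIV. \<bar>(P x - P p) $ i\<bar>)"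
      unfolding dist_norm by (rule norm_le_l1_cart)
    also have "\<dots> \<le> 2 * \<rho>" using x(1) by (simp add: sum_2 P_def axis_def)
    finally have "L * dist (P x) (P p) \<le> L * (2 * \<rho>)" using L0 by (intro mult_left_mono) auto
    then have "\<bar>\<gamma> (P x) - \<gamma> (P p)\<bar> \<le> 2 * L * \<rho>"
      using lipschitz_onD[OF \<gamma>, of "P x" "P p"] by (simp add: dist_real_def)
    moreover have "Q x $ 3 - Q p $ 3 = \<sigma> x - \<sigma> p + (\<gamma> (P x) - \<gamma> (P p))" by (simp add: \<sigma>_def)
    ultimately have 3: "\<bar>Q x $ 3 - Q p $ 3\<bar> \<le> 2 * \<rho> + 2 * L * \<rho>" using x(2,3) \<sigma>p by linarith
    have "dist p x = norm (Q x - Q p)"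
      using orthogonal_transformation_norm[OF Q, of "x - p"] lQ by (simp add: dist_norm norm_minus_commute linear_diff)
    also have "\<dots> \<le> (\<Sum>i\<in>UNIV. \<bar>(Q x - Q p) $ i\<bar>)" by (rule norm_le_l1_cart)
    also have "\<dots> \<le> 4 * \<rho> + 2 * L * \<rho>" using x(1) 3 by (simp add: sum_3)
    finally show ?thesis using \<rho>(2) by simp
  qed
  define Z where "Z = {x. \<bar>Q x $ 1 - Q p $ 1\<bar> < \<rho> \<and> \<bar>Q x $ 2 - Q p $ 2\<bar> < \<rho>}"
  have Zo: "open Z" unfolding Z_def
    by (intro open_Collect_conj open_Collect_less continuous_intros contQ)
  have Ze: "x + h *\<^sub>R e \<in> Z \<longleftrightarrow> x \<in> Z" for x h by (simp add: Z_def Qe axis_def)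
  have WS: "{x\<in>Z. 0 < \<sigma> x \<and> \<sigma> x < 2 * \<rho>} \<subseteq> S"
    using near \<rho>0(2) by (force simp: Z_def)
  define m0 where "m0 = emeasure lborel {x\<in>Z. \<rho> / 2 \<le> \<sigma> x \<and> \<sigma> x \<le> \<rho>}"
  have m0: "m0 \<noteq> 0"
  proof
    assume "m0 = 0"
    let ?O = "{x\<in>Z. \<rho> / 2 < \<sigma> x \<and> \<sigma> x < \<rho>}"
    have [measurable]: "\<sigma> \<in> borel_measurable borel" "Z \<in> sets borel"
      using cont\<sigma> Zo by (auto intro: borel_measurable_continuous_onI)
    have "emeasure lborel ?O \<le> m0" unfolding m0_def by (intro emeasure_mono) auto
    then have "?O \<in> null_sets lborel" using \<open>m0 = 0\<close> by (auto simp: null_sets_def)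
    then have "negligible ?O" by (simp add: negligible_iff_null_sets null_sets_completionI)
    moreover have "open ?O"
      unfolding Z_def mem_Collect_eq
      by (intro open_Collect_conj open_Collect_less continuous_intros contQ cont\<sigma>)
    \<comment> \<open>A point with height strictly between \<open>\<rho> / 2\<close> and
      \<open>\<rho>\<close>, so the open layer is nonempty and has positive measure.\<close>
    moreover have "p + (3 * \<rho> / 4) *\<^sub>R e \<in> ?O"
      using \<rho>(1) \<sigma>p Ze[of p] by (simp add: \<sigma>e) (simp add: Z_def)
    ultimately show False using open_not_negligible by blast
  qed
  have key: "ennreal \<kappa> * m0 \<le> ennreal ((l2 (lebesgue_on S) (G n) +
      \<rho> * (\<Sum>k\<in>UNIV. \<bar>e $ k\<bar> * l2 (lebesgue_on S) (weak_deriv S (mi k 1) (G n)))) * l2 (lebesgue_on S) (\<lambda>_. 1))" for n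
  proof -
    define K where "K = {x. ?C x \<and> 0 \<le> \<sigma> x \<and> \<sigma> x \<le> \<rho>}"
    have KB: "K \<subseteq> ball p \<rho>0" using near \<rho>(1) by (force simp: K_def)
    have "closed K" unfolding K_def
      by (intro closed_Collect_conj closed_Collect_le continuous_intros contQ cont\<sigma>)
    moreover have "bounded K" using KB bounded_subset bounded_ball by blast
    ultimately have "compact K" by (simp add: compact_eq_bounded_closed)
    moreover have "continuous_on K (G n)"
      using continuous_on_subset[OF G(1)] KB \<rho>0(2) by blast
    ultimately have "uniformly_continuous_on K (G n)" by (rule compact_uniformly_continuous[rotated])
    then obtain d where d: "0 < d" "\<And>x y. x \<in> K \<Longrightarrow> y \<in> K \<Longrightarrow> dist y x < d \<Longrightarrow> dist (G n y) (G n x) < \<kappa>"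
      using \<kappa> unfolding uniformly_continuous_on_def by metis
    \<comment> \<open>The thickness depends on \<open>n\<close> through the modulus of continuity
      \<open>d\<close> of \<open>G n\<close>; \<open>m0\<close> and the constants on the right do
      not.\<close>
    define \<eta> where "\<eta> = min (d / (norm e + 1)) (\<rho> / 2)"
    have ne: "0 < norm e + 1" by (simp add: add_nonneg_pos)
    have \<eta>: "0 < \<eta>" "\<eta> \<le> \<rho> / 2" "\<eta> * norm e < d"
    proof -
      show "0 < \<eta>" using d(1) \<rho>(1) ne by (simp add: \<eta>_def)
      show "\<eta> \<le> \<rho> / 2" unfolding \<eta>_def by (rule min.cobounded2)
      have "\<eta> * norm e < \<eta> * (norm e + 1)" using \<open>0 < \<eta>\<close> by (intro mult_strict_left_mono) auto
      also have "\<dots> \<le> d / (norm e + 1) * (norm e + 1)" using ne by (intro mult_right_mono) (auto simp: \<eta>_def)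
      finally show "\<eta> * norm e < d" using ne by simp
    qed
    have low: "\<kappa> \<le> \<bar>G n x\<bar>" if x: "x \<in> Z" "0 < \<sigma> x" "\<sigma> x < \<eta>" for x
    proof -
      \<comment> \<open>The foot of \<open>x\<close> on the graph along \<open>e\<close>. It lies on
        the frontier of \<open>\<Omega>\<close>, where \<open>G n\<close> equals
        \<open>g\<close>.\<close>
      define y where "y = x + (- \<sigma> x) *\<^sub>R e"
      have \<sigma>y: "\<sigma> y = 0" unfolding y_def \<sigma>e by simp
      have yZ: "y \<in> Z" unfolding y_def Ze by (rule x(1))
      have xK: "x \<in> K" "y \<in> K" using x yZ \<eta> \<sigma>y \<rho>(1) by (auto simp: K_def Z_def)
      have "dist x y = \<sigma> x * norm e" using x(2) by (simp add: y_def dist_norm)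
      also have "\<dots> \<le> \<eta> * norm e" using x(3) by (intro mult_right_mono) auto
      also have "\<dots> < d" by (rule \<eta>(3))
      finally have "dist (G n x) (G n y) < \<kappa>" using d(2)[OF xK(2,1)] by simp
      moreover have "G n y = g y"
        using G(3) front \<sigma>y xK(2) KB \<rho>0(3) by blast
      moreover have "2 * \<kappa> < \<bar>g y\<bar>" using \<rho>0(4) xK(2) KB by blast
      ultimately show ?thesis by (simp add: dist_real_def)
    qed
    show ?thesis unfolding m0_def
      by (rule strip_inequality_sobolev[OF S(1,2) G(2,1) cont\<sigma> \<sigma>e Zo Ze WS \<eta>(1,2) low less_imp_le[OF \<kappa>]])
  qed
  have "(\<lambda>n. (l2 (lebesgue_on S) (G n) +
      \<rho> * (\<Sum>k\<in>UNIV. \<bar>e $ k\<bar> * l2 (lebesgue_on S) (weak_deriv S (mi k 1) (G n)))) * l2 (lebesgue_on S) (\<lambda>_. 1))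
      \<longlonglongrightarrow> (0 + \<rho> * (\<Sum>k\<in>(UNIV :: 3 set). \<bar>e $ k\<bar> * 0)) * l2 (lebesgue_on S) (\<lambda>_. 1)"
    by (intro tendsto_intros lim)
  then have "(\<lambda>n. ennreal ((l2 (lebesgue_on S) (G n) +
      \<rho> * (\<Sum>k\<in>UNIV. \<bar>e $ k\<bar> * l2 (lebesgue_on S) (weak_deriv S (mi k 1) (G n)))) * l2 (lebesgue_on S) (\<lambda>_. 1)))
      \<longlonglongrightarrow> ennreal 0"
    by (intro tendsto_ennrealI) simp
  then have "ennreal \<kappa> * m0 \<le> ennreal 0" by (rule LIMSEQ_le_const) (use key in auto)
  then show False using \<kappa> m0 by simp
qed

section \<open>A weak form of \<open>y'' = k\<close>\<close>

lemma continuous_AE_eq: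
  fixes f g :: "'a::euclidean_space \<Rightarrow> real"
  assumes V: "open V" "continuous_on V f" "continuous_on V g" and ae: "AE x in lborel. x \<in> V \<longrightarrow> f x = g x"
    and x: "x \<in> V"
  shows "f x = g x"
proof (rule ccontr)
  assume ne: "f x \<noteq> g x"
  let ?O = "V \<inter> (\<lambda>x. f x - g x) -` (- {0})"
  have o: "open ?O" by (intro continuous_open_preimage V continuous_intros)
  have "AE x in lborel. x \<notin> ?O" using ae by eventually_elim auto
  then have "?O \<in> null_sets lborel" using o by (subst AE_iff_null_sets) auto
  then have "negligible ?O" by (simp add: negligible_iff_null_sets null_sets_completionI)
  moreover have "x \<in> ?O" using x ne by simp
  ultimately show False using open_not_negligible[OF o] by blast
qed

lemma continuous_integrable_indicator:
  fixes f :: "real \<Rightarrow> real"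
  assumes "continuous_on {a..b} f" shows "integrable lborel (\<lambda>t. indicator {a..b} t * f t)"
  using borel_integrable_compact[OF compact_Icc assms] by simp

lemma partial_1: "smooth (f :: real \<Rightarrow> real) \<Longrightarrow> (f has_real_derivative partial 1 f x) (at x within X)"
proof (rule has_field_derivative_at_within)
  assume f: "smooth f"
  have "frechet_derivative f (at x) v = partial 1 f x * v" for v
    using linear_cmul[OF has_derivative_linear[OF has_derivative_smooth[OF f]], of x v 1]
    by (simp add: partial_def mult.commute)
  then have "frechet_derivative f (at x) = (*) (partial 1 f x)" by auto
  then show "(f has_real_derivative partial 1 f x) (at x)"
    using has_derivative_smooth[OF f, of x] by (simp add: has_field_derivative_def)
qed

text \<open>One integration by parts shows that \<open>K\<close> is the weak derivative of
  \<open>B\<close>. Then \<open>weak_ftc\<close> gives the increments of \<open>B\<close> as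
  integrals of \<open>K\<close> almost everywhere, and everywhere by continuity; so \<open>B\<close>
  differs from a primitive of \<open>K\<close> by a constant and is differentiable in the classical
  sense.\<close>

lemma weak_second_derivative:
  fixes A B K :: "real \<Rightarrow> real"
  assumes cont: "continuous_on {a..b} B" "continuous_on {a..b} K"
    and A: "\<And>t. t \<in> {a..b} \<Longrightarrow> (A has_real_derivative B t) (at t within {a..b})"
    and weak: "\<And>\<eta>. test_function {a<..<b} \<eta> \<Longrightarrow>
      (LINT t|lborel. indicator {a..b} t * (A t * partial 1 (partial 1 \<eta>) t)) =
      (LINT t|lborel. indicator {a..b} t * (K t * \<eta> t))"
    and t: "t \<in> {a<..<b}"
  shows "(B has_real_derivative K t) (at t)"
proof -
  have ab: "a < b" using t by simp
  have contA: "continuous_on {a..b} A" using A by (rule DERIV_continuous_on)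
  define G where "G = (\<lambda>t. indicator {a..b} t * B t)"
  define H where "H = (\<lambda>t. indicator {a..b} t * K t)"
  have GH: "integrable lborel G" "integrable lborel H"
    unfolding G_def H_def by (intro continuous_integrable_indicator cont)+
  have w: "(LINT t|lborel. G t * frechet_derivative \<eta> (at t) 1) = - (LINT t|lborel. H t * \<eta> t)"
    if \<eta>: "test_function {a<..<b} \<eta>" for \<eta>
  proof -
    have s: "smooth \<eta>" "smooth (partial 1 \<eta>)" "smooth (partial 1 (partial 1 \<eta>))"
      using test_function_smooth[OF \<eta>] by (auto intro!: smooth_partial)
    have c1: "continuous_on {a..b} (\<lambda>t. A t * partial 1 (partial 1 \<eta>) t)" "continuous_on {a..b} (\<lambda>t. B t * partial 1 \<eta> t)"
      by (intro continuous_on_mult contA cont smooth_continuous s)+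
    have "(LINT t|lborel. indicator {a..b} t *\<^sub>R (A t * partial 1 (partial 1 \<eta>) t + B t * partial 1 \<eta> t)) =
        A b * partial 1 \<eta> b - A a * partial 1 \<eta> a"
    proof (rule integral_FTC_atLeastAtMost)
      fix x assume x: "a \<le> x" "x \<le> b"
      show "((\<lambda>t. A t * partial 1 \<eta> t) has_vector_derivative A x * partial 1 (partial 1 \<eta>) x + B x * partial 1 \<eta> x) (at x within {a..b})"
        using DERIV_mult[OF A partial_1[OF s(2)], of x] x
        by (simp add: has_real_derivative_iff_has_vector_derivative[symmetric] mult.commute add.commute)
    qed (use ab c1 in \<open>auto intro!: continuous_on_add\<close>)
    moreover have "partial 1 \<eta> b = 0" "partial 1 \<eta> a = 0"
      using test_function_partial[OF \<eta>, of 1] by (auto elim!: test_functionE)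
    ultimately have "(LINT t|lborel. indicator {a..b} t * (A t * partial 1 (partial 1 \<eta>) t) +
        indicator {a..b} t * (B t * partial 1 \<eta> t)) = 0" by (simp add: distrib_left)
    then have "(LINT t|lborel. indicator {a..b} t * (B t * partial 1 \<eta> t)) =
        - (LINT t|lborel. indicator {a..b} t * (A t * partial 1 (partial 1 \<eta>) t))"
      using continuous_integrable_indicator[OF c1(1)] continuous_integrable_indicator[OF c1(2)] by simp
    also have "\<dots> = - (LINT t|lborel. indicator {a..b} t * (K t * \<eta> t))" using weak[OF \<eta>] by simp
    finally show ?thesis by (simp add: G_def H_def partial_def mult.assoc)
  qed
  define \<Phi> where "\<Phi> = (\<lambda>x. integral {a..x} K)"
  have \<Phi>: "(\<Phi> has_real_derivative K x) (at x within {a..b})" if "x \<in> {a..b}" for x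
    unfolding \<Phi>_def by (rule integral_has_real_derivative[OF cont(2) that])
  have cont\<Phi>: "continuous_on {a..b} \<Phi>" using \<Phi> by (rule DERIV_continuous_on)
  define D where "D = (\<lambda>x. B x - \<Phi> x)"
  have contD: "continuous_on {a..b} D" unfolding D_def by (intro continuous_intros cont cont\<Phi>)
  \<comment> \<open>Translation invariance of \<open>D\<close> under every admissible
    \<open>h\<close> says that \<open>D\<close> is constant. The domain is shortened by
    \<open>h\<close> to keep x + h inside the interval.\<close>
  have shift: "D (x + h) = D x" if h: "0 \<le> h" and x: "x \<in> {a<..<b - h}" for x h
  proof (rule continuous_AE_eq[of "{a<..<b - h}" "\<lambda>x. D (x + h)" D])
    show "continuous_on {a<..<b - h} (\<lambda>x. D (x + h))"
      by (rule continuous_on_compose2[OF contD]) (use h in \<open>auto intro!: continuous_intros\<close>)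
    show "continuous_on {a<..<b - h} D" by (rule continuous_on_subset[OF contD]) (use h in auto)
    have "AE x in lborel. x \<in> {a<..<b - h} \<longrightarrow>
        G (x + h *\<^sub>R 1) - G x = (LINT r|lborel. indicator {0..h} r * H (x + r *\<^sub>R 1))"
      by (rule weak_ftc[OF GH w]) (use h in auto)
    then show "AE x in lborel. x \<in> {a<..<b - h} \<longrightarrow> D (x + h) = D x"
    proof eventually_elim
      case (elim x)
      show ?case
      proof
        assume x: "x \<in> {a<..<b - h}"
        have "(LINT r|lborel. indicator {0..h} r * H (x + r)) = (LINT r|lborel. indicator {0..h} r *\<^sub>R K (x + r))"
          using x by (intro Bochner_Integration.integral_cong) (auto simp: H_def indicator_def)
        also have "\<dots> = \<Phi> (x + h) - \<Phi> (x + 0)"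
        proof (rule integral_FTC_atLeastAtMost[OF h])
          show "continuous_on {0..h} (\<lambda>r. K (x + r))"
          proof (rule continuous_on_compose2[OF cont(2)])
            show "(+) x ` {0..h} \<subseteq> {a..b}" using x by auto
          qed (intro continuous_intros)
          fix r assume r: "0 \<le> r" "r \<le> h"
          have i: "x + r \<in> interior {a..b}" using x r by (simp add: interior_atLeastAtMost_real)
          have "x + r \<in> {a..b}" using x r by simp
          from \<Phi>[OF this] have "(\<Phi> has_real_derivative K (x + r)) (at (x + r))"
            unfolding at_within_interior[OF i] .
          then have "((\<lambda>r. \<Phi> (x + r)) has_real_derivative K (x + r)) (at r)"
            using DERIV_shift[of \<Phi> "K (x + r)" r x] by (simp add: add.commute)
          then show "((\<lambda>r. \<Phi> (x + r)) has_vector_derivative K (x + r)) (at r within {0..h})"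
            unfolding has_real_derivative_iff_has_vector_derivative by (rule has_vector_derivative_at_within)
        qed
        finally show "D (x + h) = D x" using elim x h by (simp add: D_def G_def)
      qed
    qed
  qed (use x in auto)
  have const: "D y = D t" if "y \<in> {a<..<b}" for y
  proof (cases "y \<le> t")
    case True
    then show ?thesis using shift[of "t - y" y] t that by simp
  next
    case False
    then show ?thesis using shift[of "y - t" t] t that by simp
  qed
  have i: "t \<in> interior {a..b}" using t by (simp add: interior_atLeastAtMost_real)
  have "t \<in> {a..b}" using t by simp
  from \<Phi>[OF this] have "(\<Phi> has_real_derivative K t) (at t)"
    unfolding at_within_interior[OF i] .
  then have "((\<lambda>y. \<Phi> y + D t) has_real_derivative K t) (at t)" by (auto intro!: derivative_eq_intros)
  then show ?thesis
    by (rule has_field_derivative_transform_within_open[of _ _ _ "{a<..<b}"])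
      (use t const in \<open>auto simp: D_def algebra_simps\<close>)
qed

section \<open>Curves in \<open>L\<^sup>2\<close>\<close>

text \<open>Continuity relative to \<open>I\<close>, so that one notion serves the closed interval,
  where the initial values live, and the open one, where the equation and the zero boundary values
  are available.\<close>

definition L2_cont :: "'a measure \<Rightarrow> real set \<Rightarrow> (real \<Rightarrow> 'a \<Rightarrow> real) \<Rightarrow> bool" where
  "L2_cont M I f \<longleftrightarrow> (\<forall>t\<in>I. L2_on M (f t) \<and> ((\<lambda>s. l2 M (\<lambda>x. f s x - f t x)) \<longlongrightarrow> 0) (at t within I))"

definition L2_deriv :: "'a measure \<Rightarrow> real set \<Rightarrow> (real \<Rightarrow> 'a \<Rightarrow> real) \<Rightarrow> (real \<Rightarrow> 'a \<Rightarrow> real) \<Rightarrow> bool" where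
  "L2_deriv M I f f' \<longleftrightarrow> (\<forall>t\<in>I. L2_on M (f t) \<and> L2_on M (f' t) \<and>
     ((\<lambda>s. l2 M (\<lambda>x. (f s x - f t x) / (s - t) - f' t x)) \<longlongrightarrow> 0) (at t within I))"

lemma eventually_at_within_mem: "\<forall>\<^sub>F s in at t within I. s \<in> I"
  by (simp add: eventually_at_filter)

lemma eventually_at_within_mem_neq: "\<forall>\<^sub>F s in at t within I. s \<in> I \<and> s \<noteq> t"
  by (simp add: eventually_at_filter)

lemma L2_cont_L2: "L2_cont M I f \<Longrightarrow> t \<in> I \<Longrightarrow> L2_on M (f t)"
  by (simp add: L2_cont_def)

lemma L2_cont_subset: "L2_cont M I f \<Longrightarrow> J \<subseteq> I \<Longrightarrow> L2_cont M J f"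
  unfolding L2_cont_def by (meson subsetD tendsto_within_subset)

lemma L2_cont_ip:
  assumes f: "L2_cont M I f" and g: "L2_cont M I g"
  shows "continuous_on I (\<lambda>t. ip M (f t) (g t))"
  unfolding continuous_on_def
proof
  fix t assume t: "t \<in> I"
  show "((\<lambda>s. ip M (f s) (g s)) \<longlongrightarrow> ip M (f t) (g t)) (at t within I)"
    by (rule tendsto_ip)
      (use f g t in \<open>auto simp: L2_cont_def intro: eventually_mono[OF eventually_at_within_mem]\<close>)
qed

lemma L2_cont_const: "L2_on M g \<Longrightarrow> L2_cont M I (\<lambda>t. g)"
  by (simp add: L2_cont_def l2_def)

lemma L2_cont_l2_sq: "L2_cont M I f \<Longrightarrow> continuous_on I (\<lambda>t. (l2 M (f t))\<^sup>2)"
  using L2_cont_ip[of M I f f] by (simp add: ip_self)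

lemma L2_cont_cong:
  assumes f: "L2_cont M I f" and ae: "\<And>t. t \<in> I \<Longrightarrow> AE x in M. f t x = g t x" and g: "\<And>t. t \<in> I \<Longrightarrow> L2_on M (g t)"
  shows "L2_cont M I g"
  unfolding L2_cont_def
proof (intro ballI conjI)
  fix t assume t: "t \<in> I"
  show "((\<lambda>s. l2 M (\<lambda>x. g s x - g t x)) \<longlongrightarrow> 0) (at t within I)"
  proof (rule Lim_transform_eventually)
    show "((\<lambda>s. l2 M (\<lambda>x. f s x - f t x)) \<longlongrightarrow> 0) (at t within I)" using f t by (simp add: L2_cont_def)
    show "\<forall>\<^sub>F s in at t within I. l2 M (\<lambda>x. f s x - f t x) = l2 M (\<lambda>x. g s x - g t x)"
      using eventually_at_within_mem
    proof eventually_elim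
      case (elim s)
      have "AE x in M. f s x - f t x = g s x - g t x"
        using ae[OF elim] ae[OF t] by eventually_elim simp
      then show ?case
        using f elim t g by (intro l2_cong L2_on_diff) (auto simp: L2_cont_def)
    qed
  qed
qed (rule g)

lemma L2_cont_lincomb:
  assumes f: "L2_cont M I f" and g: "L2_cont M I g"
  shows "L2_cont M I (\<lambda>t x. a * f t x + b * g t x)"
  unfolding L2_cont_def
proof (intro ballI conjI)
  fix t assume t: "t \<in> I"
  note L = L2_cont_L2[OF f] L2_cont_L2[OF g]
  show "L2_on M (\<lambda>x. a * f t x + b * g t x)" by (intro L2_on_add L2_on_scale L t)
  show "((\<lambda>s. l2 M (\<lambda>x. a * f s x + b * g s x - (a * f t x + b * g t x))) \<longlongrightarrow> 0) (at t within I)"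
  proof (rule Lim_null_comparison)
    show "\<forall>\<^sub>F s in at t within I. norm (l2 M (\<lambda>x. a * f s x + b * g s x - (a * f t x + b * g t x))) \<le>
        \<bar>a\<bar> * l2 M (\<lambda>x. f s x - f t x) + \<bar>b\<bar> * l2 M (\<lambda>x. g s x - g t x)"
      using eventually_at_within_mem
    proof eventually_elim
      case (elim s)
      have "l2 M (\<lambda>x. a * (f s x - f t x) + b * (g s x - g t x)) \<le> l2 M (\<lambda>x. a * (f s x - f t x)) + l2 M (\<lambda>x. b * (g s x - g t x))"
        by (intro l2_triangle L2_on_scale L2_on_diff L t elim)
      moreover have "(\<lambda>x. a * (f s x - f t x) + b * (g s x - g t x)) = (\<lambda>x. a * f s x + b * g s x - (a * f t x + b * g t x))"
        by (simp add: fun_eq_iff algebra_simps)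
      ultimately show ?case by (simp only: l2_scale real_norm_def abs_of_nonneg[OF l2_nonneg])
    qed
    show "((\<lambda>s. \<bar>a\<bar> * l2 M (\<lambda>x. f s x - f t x) + \<bar>b\<bar> * l2 M (\<lambda>x. g s x - g t x)) \<longlongrightarrow> 0) (at t within I)"
      using tendsto_add[OF tendsto_mult_left[of _ 0] tendsto_mult_left[of _ 0]] f g t by (fastforce simp: L2_cont_def)
  qed
qed

lemma L2_cont_sum:
  assumes "\<And>i. i \<in> J \<Longrightarrow> L2_cont M I (f i)" shows "L2_cont M I (\<lambda>t x. \<Sum>i\<in>J. f i t x)"
  using assms
proof (induction J rule: infinite_finite_induct)
  case (insert i J)
  then show ?case using L2_cont_lincomb[of M I "f i" "\<lambda>t x. \<Sum>i\<in>J. f i t x" 1 1] by simp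
qed (simp_all add: L2_cont_const L2_on_0)

lemma L2_cont_bounded_mult:
  assumes f: "L2_cont M I f" and g: "g \<in> borel_measurable M" "\<And>x. x \<in> space M \<Longrightarrow> \<bar>g x\<bar> \<le> B" "0 \<le> B"
  shows "L2_cont M I (\<lambda>t x. g x * f t x)"
  unfolding L2_cont_def
proof (intro ballI conjI)
  fix t assume t: "t \<in> I"
  note L = L2_cont_L2[OF f]
  show "L2_on M (\<lambda>x. g x * f t x)" by (rule L2_on_bounded_mult[OF L[OF t] g(1,2)])
  show "((\<lambda>s. l2 M (\<lambda>x. g x * f s x - g x * f t x)) \<longlongrightarrow> 0) (at t within I)"
  proof (rule Lim_null_comparison)
    show "\<forall>\<^sub>F s in at t within I. norm (l2 M (\<lambda>x. g x * f s x - g x * f t x)) \<le> B * l2 M (\<lambda>x. f s x - f t x)"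
      using eventually_at_within_mem
    proof eventually_elim
      case (elim s)
      show ?case using l2_bounded_mult[OF L2_on_diff[OF L[OF elim] L[OF t]] g] by (simp add: right_diff_distrib)
    qed
    show "((\<lambda>s. B * l2 M (\<lambda>x. f s x - f t x)) \<longlongrightarrow> 0) (at t within I)"
      using f t tendsto_mult_left[of _ 0] by (fastforce simp: L2_cont_def)
  qed
qed

lemma L2_deriv_subset: "L2_deriv M I f f' \<Longrightarrow> J \<subseteq> I \<Longrightarrow> L2_deriv M J f f'"
  unfolding L2_deriv_def by (meson subsetD tendsto_within_subset)

lemma L2_deriv_lincomb:
  assumes f: "L2_deriv M I f f'" and g: "L2_deriv M I g g'"
  shows "L2_deriv M I (\<lambda>t x. a * f t x + b * g t x) (\<lambda>t x. a * f' t x + b * g' t x)"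
  unfolding L2_deriv_def
proof (intro ballI conjI)
  fix t assume t: "t \<in> I"
  have L: "L2_on M (f t)" "L2_on M (g t)" "L2_on M (f' t)" "L2_on M (g' t)" if "t \<in> I" for t
    using f g that by (auto simp: L2_deriv_def)
  show "L2_on M (\<lambda>x. a * f t x + b * g t x)" "L2_on M (\<lambda>x. a * f' t x + b * g' t x)"
    by (intro L2_on_add L2_on_scale L t)+
  let ?q = "\<lambda>f f' s x. (f s x - f t x) / (s - t) - f' t x"
  show "((\<lambda>s. l2 M (\<lambda>x. (a * f s x + b * g s x - (a * f t x + b * g t x)) / (s - t) - (a * f' t x + b * g' t x))) \<longlongrightarrow> 0) (at t within I)"
  proof (rule Lim_null_comparison)
    show "\<forall>\<^sub>F s in at t within I. norm (l2 M (\<lambda>x. (a * f s x + b * g s x - (a * f t x + b * g t x)) / (s - t) - (a * f' t x + b * g' t x))) \<le>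
        \<bar>a\<bar> * l2 M (?q f f' s) + \<bar>b\<bar> * l2 M (?q g g' s)"
      using eventually_at_within_mem
    proof eventually_elim
      case (elim s)
      have Lq: "L2_on M (?q f f' s)" "L2_on M (?q g g' s)"
        using L2_on_diff[OF L2_on_scale[OF L2_on_diff[OF L(1)[OF elim] L(1)[OF t]], of "1 / (s - t)"] L(3)[OF t]]
          L2_on_diff[OF L2_on_scale[OF L2_on_diff[OF L(2)[OF elim] L(2)[OF t]], of "1 / (s - t)"] L(4)[OF t]]
        by simp_all
      have "(\<lambda>x. (a * f s x + b * g s x - (a * f t x + b * g t x)) / (s - t) - (a * f' t x + b * g' t x)) =
          (\<lambda>x. a * ?q f f' s x + b * ?q g g' s x)"
        by (simp add: fun_eq_iff algebra_simps diff_divide_distrib add_divide_distrib)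
      moreover have "l2 M (\<lambda>x. a * ?q f f' s x + b * ?q g g' s x) \<le> l2 M (\<lambda>x. a * ?q f f' s x) + l2 M (\<lambda>x. b * ?q g g' s x)"
        by (intro l2_triangle L2_on_scale Lq)
      ultimately show ?case by (simp add: l2_scale)
    qed
    show "((\<lambda>s. \<bar>a\<bar> * l2 M (?q f f' s) + \<bar>b\<bar> * l2 M (?q g g' s)) \<longlongrightarrow> 0) (at t within I)"
      using tendsto_add[OF tendsto_mult_left[of _ 0] tendsto_mult_left[of _ 0]] f g t by (fastforce simp: L2_deriv_def)
  qed
qed

lemma L2_deriv_cong:
  assumes f: "L2_deriv M I f f'" and ae: "\<And>t. t \<in> I \<Longrightarrow> AE x in M. f t x = g t x"
    "\<And>t. t \<in> I \<Longrightarrow> AE x in M. f' t x = g' t x"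
    and g: "\<And>t. t \<in> I \<Longrightarrow> L2_on M (g t)" "\<And>t. t \<in> I \<Longrightarrow> L2_on M (g' t)"
  shows "L2_deriv M I g g'"
  unfolding L2_deriv_def
proof (intro ballI conjI)
  fix t assume t: "t \<in> I"
  have L: "L2_on M (f t)" "L2_on M (f' t)" if "t \<in> I" for t using f that by (auto simp: L2_deriv_def)
  have Lq: "L2_on M (\<lambda>x. (f s x - f t x) / (s - t) - f' t x)"
    if "L2_on M (f s)" "L2_on M (f t)" "L2_on M (f' t)" for f f' s
    using L2_on_diff[OF L2_on_scale[OF L2_on_diff[OF that(1,2)], of "1 / (s - t)"] that(3)] by simp
  show "((\<lambda>s. l2 M (\<lambda>x. (g s x - g t x) / (s - t) - g' t x)) \<longlongrightarrow> 0) (at t within I)"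
  proof (rule Lim_transform_eventually)
    show "((\<lambda>s. l2 M (\<lambda>x. (f s x - f t x) / (s - t) - f' t x)) \<longlongrightarrow> 0) (at t within I)" using f t by (simp add: L2_deriv_def)
    show "\<forall>\<^sub>F s in at t within I. l2 M (\<lambda>x. (f s x - f t x) / (s - t) - f' t x) = l2 M (\<lambda>x. (g s x - g t x) / (s - t) - g' t x)"
      using eventually_at_within_mem
    proof eventually_elim
      case (elim s)
      have "AE x in M. (f s x - f t x) / (s - t) - f' t x = (g s x - g t x) / (s - t) - g' t x"
        using ae(1)[OF elim] ae(1)[OF t] ae(2)[OF t] by eventually_elim simp
      then show ?case by (intro l2_cong Lq L g t elim)
    qed
  qed
qed (use g in auto)

lemma L2_deriv_ip:
  assumes f: "L2_deriv M I f f'" and t: "t \<in> I" and \<xi>: "L2_on M \<xi>"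
  shows "((\<lambda>t. ip M (f t) \<xi>) has_real_derivative ip M (f' t) \<xi>) (at t within I)"
  unfolding has_field_derivative_iff
proof (rule Lim_transform_eventually)
  have L: "L2_on M (f t)" "L2_on M (f' t)" if "t \<in> I" for t using f that by (auto simp: L2_deriv_def)
  have Lq: "L2_on M (\<lambda>x. (f s x - f t x) / (s - t))" if "s \<in> I" for s
    using L2_on_scale[OF L2_on_diff[OF L(1)[OF that] L(1)[OF t]], of "1 / (s - t)"] by simp
  show "((\<lambda>s. ip M (\<lambda>x. (f s x - f t x) / (s - t)) \<xi>) \<longlongrightarrow> ip M (f' t) \<xi>) (at t within I)"
    by (rule tendsto_ip[OF L(2)[OF t] \<xi>])
      (use f t \<xi> Lq in \<open>auto simp: L2_deriv_def l2_def intro: eventually_mono[OF eventually_at_within_mem]\<close>)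
  show "\<forall>\<^sub>F s in at t within I. ip M (\<lambda>x. (f s x - f t x) / (s - t)) \<xi> = (ip M (f s) \<xi> - ip M (f t) \<xi>) / (s - t)"
    using eventually_at_within_mem
  proof eventually_elim
    case (elim s)
    show ?case using ip_diff[OF L(1)[OF elim] L(1)[OF t] \<xi>] ip_scale[of M "1 / (s - t)" "\<lambda>x. f s x - f t x" \<xi>]
      by simp
  qed
qed

lemma ip_diff_squares:
  assumes "L2_on M f" "L2_on M g"
  shows "ip M (\<lambda>x. f x - g x) (\<lambda>x. f x + g x) = (l2 M f)\<^sup>2 - (l2 M g)\<^sup>2"
proof -
  have "ip M (\<lambda>x. f x - g x) (\<lambda>x. f x + g x) = (LINT x|M. (f x)\<^sup>2 - (g x)\<^sup>2)"
    unfolding ip_def by (intro Bochner_Integration.integral_cong) (auto simp: power2_eq_square algebra_simps)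
  also have "\<dots> = (l2 M f)\<^sup>2 - (l2 M g)\<^sup>2" using assms by (simp add: L2_on_def l2_sq)
  finally show ?thesis .
qed

text \<open>A difference of squared norms is the inner product of the difference with the sum, so
  the quotient converges as an inner product of two convergent factors.\<close>

lemma L2_deriv_l2_sq:
  assumes f: "L2_deriv M I f f'" "L2_cont M I f" and t: "t \<in> I"
  shows "((\<lambda>t. (l2 M (f t))\<^sup>2) has_real_derivative 2 * ip M (f t) (f' t)) (at t within I)"
  unfolding has_field_derivative_iff
proof (rule Lim_transform_eventually)
  have L: "L2_on M (f t)" "L2_on M (f' t)" if "t \<in> I" for t using f that by (auto simp: L2_deriv_def)
  have Lq: "L2_on M (\<lambda>x. (f s x - f t x) / (s - t))" if "s \<in> I" for s
    using L2_on_scale[OF L2_on_diff[OF L(1)[OF that] L(1)[OF t]], of "1 / (s - t)"] by simp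
  have e: "(\<lambda>x. f s x + f t x - (f t x + f t x)) = (\<lambda>x. f s x - f t x)" for s by auto
  have Ls: "L2_on M (\<lambda>x. f s x + f t x)" if "s \<in> I" for s by (intro L2_on_add L that t)
  have "((\<lambda>s. ip M (\<lambda>x. (f s x - f t x) / (s - t)) (\<lambda>x. f s x + f t x)) \<longlongrightarrow> ip M (f' t) (\<lambda>x. f t x + f t x)) (at t within I)"
    by (rule tendsto_ip[OF L(2)[OF t] L2_on_add[OF L(1)[OF t] L(1)[OF t]]])
      (use f t Lq Ls in \<open>auto simp: L2_deriv_def L2_cont_def e intro: eventually_mono[OF eventually_at_within_mem]\<close>)
  moreover have "ip M (f' t) (\<lambda>x. f t x + f t x) = 2 * ip M (f t) (f' t)"
    using ip_add[OF L(1)[OF t] L(1)[OF t] L(2)[OF t]] by (simp add: ip_commute)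
  ultimately show "((\<lambda>s. ip M (\<lambda>x. (f s x - f t x) / (s - t)) (\<lambda>x. f s x + f t x)) \<longlongrightarrow> 2 * ip M (f t) (f' t)) (at t within I)"
    by simp
  show "\<forall>\<^sub>F s in at t within I. ip M (\<lambda>x. (f s x - f t x) / (s - t)) (\<lambda>x. f s x + f t x) = ((l2 M (f s))\<^sup>2 - (l2 M (f t))\<^sup>2) / (s - t)"
    using eventually_at_within_mem
  proof eventually_elim
    case (elim s)
    show ?case using ip_diff_squares[OF L(1)[OF elim] L(1)[OF t]]
        ip_scale[of M "1 / (s - t)" "\<lambda>x. f s x - f t x" "\<lambda>x. f s x + f t x"] by simp
  qed
qed

section \<open>The energy identity\<close>

text \<open>The L2 closure of the test functions, the set of directions to which estimates proved
  for test functions extend. It has to contain the velocities divided by the squared sound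
  speed.\<close>

definition test_closure :: "space set \<Rightarrow> (space \<Rightarrow> real) set" where
  "test_closure S = {f. L2_on (lebesgue_on S) f \<and>
     (\<forall>e>0. \<exists>\<phi>. test_function S \<phi> \<and> l2 (lebesgue_on S) (\<lambda>x. \<phi> x - f x) < e)}"

lemma H10_test_closure: "z \<in> H10 S \<Longrightarrow> z \<in> test_closure S"
proof -
  assume z: "z \<in> H10 S"
  then obtain \<phi> where \<phi>: "\<And>n::nat. test_function S (\<phi> n)" "(\<lambda>n. l2 (lebesgue_on S) (\<lambda>x. \<phi> n x - z x)) \<longlonglongrightarrow> 0"
    by (auto simp: H10_def)
  have "\<exists>\<phi>. test_function S \<phi> \<and> l2 (lebesgue_on S) (\<lambda>x. \<phi> x - z x) < e" if "e > 0" for e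
  proof -
    have "\<forall>\<^sub>F n in sequentially. l2 (lebesgue_on S) (\<lambda>x. \<phi> n x - z x) < e" by (rule order_tendstoD(2)[OF \<phi>(2) that])
    then show ?thesis using \<phi>(1) by (auto simp: eventually_sequentially)
  qed
  then show ?thesis using sobolev_L2[OF H10_sobolev[OF z]] by (simp add: test_closure_def)
qed

lemma test_closure_closed:
  assumes S: "open S" and f: "L2_on (lebesgue_on S) f"
    and app: "\<And>e. e > 0 \<Longrightarrow> \<exists>g\<in>test_closure S. l2 (lebesgue_on S) (\<lambda>x. g x - f x) < e"
  shows "f \<in> test_closure S"
proof -
  have "\<exists>\<phi>. test_function S \<phi> \<and> l2 (lebesgue_on S) (\<lambda>x. \<phi> x - f x) < e" if "e > 0" for e
  proof -
    have e2: "e / 2 > 0" using that by simp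
    obtain g where g: "g \<in> test_closure S" "l2 (lebesgue_on S) (\<lambda>x. g x - f x) < e / 2"
      using app[OF e2] by blast
    obtain \<phi> where \<phi>: "test_function S \<phi>" "l2 (lebesgue_on S) (\<lambda>x. \<phi> x - g x) < e / 2"
      using g(1) e2 unfolding test_closure_def by blast
    have "l2 (lebesgue_on S) (\<lambda>x. (\<phi> x - g x) + (g x - f x)) \<le> l2 (lebesgue_on S) (\<lambda>x. \<phi> x - g x) + l2 (lebesgue_on S) (\<lambda>x. g x - f x)"
      using g(1) by (intro l2_triangle L2_on_diff f L2_on_test_function[OF S \<phi>(1)]) (auto simp: test_closure_def)
    then have "l2 (lebesgue_on S) (\<lambda>x. \<phi> x - f x) < e" using \<phi>(2) g(2) by simp
    then show ?thesis using \<phi>(1) by blast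
  qed
  then show ?thesis using f by (simp add: test_closure_def)
qed

text \<open>A merely continuous weight is absorbed by approximating it uniformly by polynomials.\<close>

lemma test_closure_mult:
  assumes S: "open S" "bounded S" and q: "continuous_on (closure S) q" and f: "f \<in> test_closure S"
  shows "(\<lambda>x. q x * f x) \<in> test_closure S"
proof -
  let ?M = "lebesgue_on S"
  have K: "compact (closure S)" using S(2) by simp
  obtain B where B: "\<And>x. x \<in> closure S \<Longrightarrow> \<bar>q x\<bar> \<le> B"
    using compact_imp_bounded[OF compact_continuous_image[OF q K]] by (auto simp: bounded_iff)
  have q_le: "\<bar>q x\<bar> \<le> \<bar>B\<bar>" if "x \<in> S" for x using B[of x] closure_subset that by force
  have qm: "q \<in> borel_measurable ?M"
    using continuous_on_subset[OF q closure_subset] S(1) by (simp add: continuous_imp_measurable_on_sets_lebesgue)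
  have Lf: "L2_on ?M f" using f by (simp add: test_closure_def)
  have Lqf: "L2_on ?M (\<lambda>x. q x * f x)" by (rule L2_on_bounded_mult[OF Lf qm, of "\<bar>B\<bar>"]) (use q_le in auto)
  have "\<exists>\<phi>. test_function S \<phi> \<and> l2 ?M (\<lambda>x. \<phi> x - q x * f x) < e" if e: "e > 0" for e
  proof -
    \<comment> \<open>The bound 1 keeps the approximating polynomial below
      \<open>\<bar>B\<bar> + 1\<close>, independently of e; the other bound makes the error against
      \<open>f\<close> at most e/2.\<close>
    define d where "d = min 1 (e / (2 * (l2 ?M f + 1)))"
    have pos: "0 < l2 ?M f + 1" by (simp add: add_nonneg_pos)
    have d: "0 < d" "d \<le> 1" using e pos by (auto simp: d_def)
    have d2: "d * l2 ?M f \<le> e / 2"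
    proof -
      have "d * l2 ?M f \<le> (e / (2 * (l2 ?M f + 1))) * (l2 ?M f + 1)"
        using d e pos by (intro mult_mono) (auto simp: d_def)
      also have "\<dots> = e / 2" using pos by (simp add: field_simps)
      finally show ?thesis .
    qed
    obtain p where p: "real_polynomial_function p" "\<And>x. x \<in> closure S \<Longrightarrow> \<bar>q x - p x\<bar> < d"
      using Stone_Weierstrass_real_polynomial_function[OF K q d(1)] by metis
    have sm: "smooth p" by (rule polynomial_smooth[OF p(1)])
    have pm: "p \<in> borel_measurable ?M" by (rule borel_measurable_lebesgue_onI[OF smooth_measurable[OF sm]])
    have p_le: "\<bar>p x\<bar> \<le> \<bar>B\<bar> + 1" if "x \<in> S" for x
    proof -
      have "\<bar>q x - p x\<bar> < d" using p(2) closure_subset that by blast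
      then show ?thesis using q_le[OF that] d(2) by linarith
    qed
    have eB: "e / (2 * (\<bar>B\<bar> + 1)) > 0" using e by (intro divide_pos_pos) auto
    obtain \<phi> where \<phi>: "test_function S \<phi>" "l2 ?M (\<lambda>x. \<phi> x - f x) < e / (2 * (\<bar>B\<bar> + 1))"
      using f eB unfolding test_closure_def by blast
    have pq: "\<bar>p x - q x\<bar> \<le> d" if "x \<in> space ?M" for x
    proof -
      have "x \<in> closure S" using that closure_subset[of S] by auto
      then show "\<bar>p x - q x\<bar> \<le> d" using p(2)[of x] by (simp add: abs_minus_commute)
    qed
    have pqm: "(\<lambda>x. p x - q x) \<in> borel_measurable ?M" using pm qm by simp
    have L\<phi>: "L2_on ?M (\<lambda>x. \<phi> x - f x)" by (intro L2_on_diff Lf L2_on_test_function[OF S(1) \<phi>(1)])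
    have 1: "l2 ?M (\<lambda>x. p x * (\<phi> x - f x)) \<le> (\<bar>B\<bar> + 1) * l2 ?M (\<lambda>x. \<phi> x - f x)"
      by (rule l2_bounded_mult[OF L\<phi> pm]) (use p_le in auto)
    have 2: "l2 ?M (\<lambda>x. (p x - q x) * f x) \<le> d * l2 ?M f"
      by (rule l2_bounded_mult[OF Lf pqm pq]) (use d in auto)
    have L1: "L2_on ?M (\<lambda>x. p x * (\<phi> x - f x))"
      by (rule L2_on_bounded_mult[OF L\<phi> pm, of "\<bar>B\<bar> + 1"]) (use p_le in auto)
    have L2: "L2_on ?M (\<lambda>x. (p x - q x) * f x)"
      by (rule L2_on_bounded_mult[OF Lf pqm pq])
    have "l2 ?M (\<lambda>x. p x * \<phi> x - q x * f x) = l2 ?M (\<lambda>x. p x * (\<phi> x - f x) + (p x - q x) * f x)"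
      by (simp add: algebra_simps)
    also have "\<dots> \<le> l2 ?M (\<lambda>x. p x * (\<phi> x - f x)) + l2 ?M (\<lambda>x. (p x - q x) * f x)" by (rule l2_triangle[OF L1 L2])
    also have "\<dots> \<le> (\<bar>B\<bar> + 1) * l2 ?M (\<lambda>x. \<phi> x - f x) + d * l2 ?M f" using 1 2 by simp
    also have "\<dots> < e"
    proof -
      have "(\<bar>B\<bar> + 1) * l2 ?M (\<lambda>x. \<phi> x - f x) < (\<bar>B\<bar> + 1) * (e / (2 * (\<bar>B\<bar> + 1)))"
        by (intro mult_strict_left_mono \<phi>(2)) simp
      also have "\<dots> = e / 2" by (simp add: field_simps)
      finally show ?thesis using d2 by linarith
    qed
    finally show ?thesis using test_function_mult[OF \<phi>(1) sm] by blast
  qed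
  then show ?thesis using Lqf by (simp add: test_closure_def)
qed

lemma test_closure_add:
  assumes S: "open S" and f: "f \<in> test_closure S" and g: "g \<in> test_closure S"
  shows "(\<lambda>x. f x + g x) \<in> test_closure S"
proof -
  let ?M = "lebesgue_on S"
  have L: "L2_on ?M f" "L2_on ?M g" using f g by (auto simp: test_closure_def)
  have "\<exists>\<phi>. test_function S \<phi> \<and> l2 ?M (\<lambda>x. \<phi> x - (f x + g x)) < e" if "e > 0" for e
  proof -
    have e2: "e / 2 > 0" using that by simp
    obtain \<phi> where \<phi>: "test_function S \<phi>" "l2 ?M (\<lambda>x. \<phi> x - f x) < e / 2"
      using f e2 unfolding test_closure_def by blast
    obtain \<psi> where \<psi>: "test_function S \<psi>" "l2 ?M (\<lambda>x. \<psi> x - g x) < e / 2"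
      using g e2 unfolding test_closure_def by blast
    have "l2 ?M (\<lambda>x. (\<phi> x - f x) + (\<psi> x - g x)) \<le> l2 ?M (\<lambda>x. \<phi> x - f x) + l2 ?M (\<lambda>x. \<psi> x - g x)"
      by (intro l2_triangle L2_on_diff L L2_on_test_function[OF S] \<phi> \<psi>)
    also have "\<dots> < e" using \<phi> \<psi> by simp
    finally have "l2 ?M (\<lambda>x. \<phi> x + \<psi> x - (f x + g x)) < e" by (simp add: algebra_simps)
    then show ?thesis using test_function_add[OF \<phi>(1) \<psi>(1)] by blast
  qed
  then show ?thesis using L by (simp add: test_closure_def L2_on_add)
qed

lemma ip_sum:
  assumes "\<And>i. i \<in> I \<Longrightarrow> L2_on M (f i)" "L2_on M h"
  shows "ip M (\<lambda>x. \<Sum>i\<in>I. f i x) h = (\<Sum>i\<in>I. ip M (f i) h)"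
  using assms
proof (induction I rule: infinite_finite_induct)
  case (insert i I)
  then show ?case using ip_add[of M "f i" "\<lambda>x. \<Sum>i\<in>I. f i x" h] by (simp add: L2_on_sum)
qed (simp_all add: ip_def)

lemma green_laplacian:
  assumes S: "open S" and v: "v \<in> sobolev 2 S" and z: "z \<in> H10 S"
  shows "(\<Sum>k\<in>UNIV. ip (lebesgue_on S) (weak_deriv S (mi k 1) v) (weak_deriv S (mi k 1) z)) =
    - ip (lebesgue_on S) (weak_laplacian S v) z"
proof -
  have "ip (lebesgue_on S) (weak_laplacian S v) z = (\<Sum>k\<in>UNIV. ip (lebesgue_on S) (weak_deriv S (mi k 2) v) z)"
    unfolding weak_laplacian_def[abs_def]
    by (rule ip_sum) (use sobolev_weak_deriv(2)[OF S v] sobolev_L2[OF H10_sobolev[OF z]] in auto)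
  then show ?thesis using green[OF S v z] by (simp add: sum_negf)
qed

text \<open>One scalar equation v'' - c^2 Lap v = N, abstracted from the system. The second time
  derivative occurs only weakly, tested with products of a space and a time function. All statements
  live on the open interval, where the zero boundary values are known.\<close>

locale wave_component =
  fixes S :: "space set" and c :: "space \<Rightarrow> real" and T :: real
    and v v' N :: "real \<Rightarrow> space \<Rightarrow> real"
  assumes S: "open S" "bounded S"
    and c: "continuous_on (closure S) c" "\<And>x. x \<in> closure S \<Longrightarrow> 0 < c x"
    and v: "\<And>t. t \<in> {0<..<T} \<Longrightarrow> v t \<in> H10 S" "\<And>t. t \<in> {0<..<T} \<Longrightarrow> v t \<in> sobolev 2 S"
    and v_cont: "L2_cont (lebesgue_on S) {0<..<T} v" "L2_deriv (lebesgue_on S) {0<..<T} v v'"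
    and dv_cont: "\<And>k. L2_cont (lebesgue_on S) {0<..<T} (\<lambda>t. weak_deriv S (mi k 1) (v t))"
      "\<And>k. L2_deriv (lebesgue_on S) {0<..<T} (\<lambda>t. weak_deriv S (mi k 1) (v t)) (\<lambda>t. weak_deriv S (mi k 1) (v' t))"
    and v'_cont: "L2_cont (lebesgue_on S) {0<..<T} v'"
    and lap_cont: "L2_cont (lebesgue_on S) {0<..<T} (\<lambda>t. weak_laplacian S (v t))"
    and N_cont: "L2_cont (lebesgue_on S) {0<..<T} N"
    and weak: "\<And>\<xi> \<eta>. test_function S \<xi> \<Longrightarrow> test_function {0<..<T} \<eta> \<Longrightarrow>
      (LINT t|lebesgue_on {0..T}. ip (lebesgue_on S) (v t) \<xi> * partial 1 (partial 1 \<eta>) t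
         - ip (lebesgue_on S) (\<lambda>x. (c x)\<^sup>2 * weak_laplacian S (v t) x) \<xi> * \<eta> t) =
      (LINT t|lebesgue_on {0..T}. ip (lebesgue_on S) (N t) \<xi> * \<eta> t)"
begin

abbreviation "M \<equiv> lebesgue_on S"
abbreviation "I \<equiv> {0<..<T}"

text \<open>The value the equation prescribes for the second time derivative; it is a continuous
  curve in L2.\<close>

definition k :: "real \<Rightarrow> space \<Rightarrow> real" where
  "k t x = (c x)\<^sup>2 * weak_laplacian S (v t) x + N t x"

lemma c_bounds: obtains c0 C0 where "0 < c0" "c0 \<le> C0" "\<And>x. x \<in> S \<Longrightarrow> c0 \<le> c x \<and> c x \<le> C0"
proof -
  have K: "compact (closure S)" using S(2) by simp
  show thesis
  proof (cases "S = {}")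
    case True
    then show thesis using that[of 1 1] by simp
  next
    case False
    then have ne: "closure S \<noteq> {}" by simp
    obtain a where a: "a \<in> closure S" "\<And>x. x \<in> closure S \<Longrightarrow> c a \<le> c x"
      using continuous_attains_inf[OF K ne c(1)] by blast
    obtain b where b: "b \<in> closure S" "\<And>x. x \<in> closure S \<Longrightarrow> c x \<le> c b"
      using continuous_attains_sup[OF K ne c(1)] by blast
    show thesis using that[of "c a" "c b"] a b c(2) closure_subset[of S] by blast
  qed
qed

lemma c_measurable: "c \<in> borel_measurable M"
  using continuous_on_subset[OF c(1) closure_subset] S(1)
  by (simp add: continuous_imp_measurable_on_sets_lebesgue)

text \<open>A positive continuous \<open>c\<close> on the compact closure has positive bounds, so
  these multipliers are bounded and preserve continuity in L2.\<close>

lemma L2_weights: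
  assumes f: "L2_cont M J f"
  shows "L2_cont M J (\<lambda>t x. (c x)\<^sup>2 * f t x)" "L2_cont M J (\<lambda>t x. f t x / c x)"
    "L2_cont M J (\<lambda>t x. f t x / (c x)\<^sup>2)"
proof -
  obtain c0 C0 where b: "0 < c0" "c0 \<le> C0" "\<And>x. x \<in> S \<Longrightarrow> c0 \<le> c x \<and> c x \<le> C0"
    using c_bounds by metis
  note [measurable] = c_measurable
  have pos: "0 < c x" if "x \<in> S" for x using b(1) b(3)[OF that] by linarith
  show "L2_cont M J (\<lambda>t x. (c x)\<^sup>2 * f t x)"
  proof (rule L2_cont_bounded_mult[OF f, of _ "C0\<^sup>2"])
    fix x assume "x \<in> space M"
    then have x: "x \<in> S" by simp
    show "\<bar>(c x)\<^sup>2\<bar> \<le> C0\<^sup>2" using b(3)[OF x] pos[OF x] by (simp add: power_mono)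
  qed simp_all
  have "L2_cont M J (\<lambda>t x. (1 / c x) * f t x)"
  proof (rule L2_cont_bounded_mult[OF f, of _ "1 / c0"])
    fix x assume "x \<in> space M"
    then have x: "x \<in> S" by simp
    show "\<bar>1 / c x\<bar> \<le> 1 / c0" using b(1) b(3)[OF x] pos[OF x] by (simp add: frac_le)
  qed (use b(1) in simp_all)
  then show 1: "L2_cont M J (\<lambda>t x. f t x / c x)" by simp
  have "L2_cont M J (\<lambda>t x. (1 / (c x)\<^sup>2) * f t x)"
  proof (rule L2_cont_bounded_mult[OF f, of _ "1 / c0\<^sup>2"])
    fix x assume "x \<in> space M"
    then have x: "x \<in> S" by simp
    have "c0\<^sup>2 \<le> (c x)\<^sup>2" using b(1) b(3)[OF x] by (intro power_mono) auto
    then show "\<bar>1 / (c x)\<^sup>2\<bar> \<le> 1 / c0\<^sup>2" using b(1) pos[OF x] by (simp add: frac_le)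
  qed simp_all
  then show "L2_cont M J (\<lambda>t x. f t x / (c x)\<^sup>2)" by simp
qed

lemma L2_weight:
  assumes f: "L2_on M f" shows "L2_on M (\<lambda>x. f x / c x)" "L2_on M (\<lambda>x. f x / (c x)\<^sup>2)" "L2_on M (\<lambda>x. (c x)\<^sup>2 * f x)"
  using L2_weights[OF L2_cont_const[OF f, of "{0}"]] by (auto simp: L2_cont_def)

lemma k_cont: "L2_cont M I k"
  using L2_cont_lincomb[OF L2_weights(1)[OF lap_cont] N_cont, of 1 1] by (simp add: k_def[abs_def])

text \<open>With the space function fixed, the weak equation becomes an ordinary differential
  equation for inner products, to which \<open>weak_second_derivative\<close> applies.\<close>

lemma velocity_derivative:
  assumes t: "t \<in> I" and \<xi>: "test_function S \<xi>"
  shows "((\<lambda>t. ip M (v' t) \<xi>) has_real_derivative ip M (k t) \<xi>) (at t)"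
proof -
  \<comment> \<open>A compact subinterval of the open time interval with \<open>t\<close> inside, on
    which all inner products are continuous up to the end points.\<close>
  define a where "a = t / 2"
  define b where "b = (t + T) / 2"
  have ab: "0 < a" "a < t" "t < b" "b < T" using t by (auto simp: a_def b_def)
  have sub: "{a..b} \<subseteq> I" using ab by auto
  have L\<xi>: "L2_on M \<xi>" by (rule L2_on_test_function[OF S(1) \<xi>])
  note cst = L2_cont_const[OF L\<xi>]
  let ?A = "\<lambda>t. ip M (v t) \<xi>" and ?L = "\<lambda>t. ip M (\<lambda>x. (c x)\<^sup>2 * weak_laplacian S (v t) x) \<xi>"
    and ?N = "\<lambda>t. ip M (N t) \<xi>"
  have contA: "continuous_on {a..b} ?A" and contL: "continuous_on {a..b} ?L" and contN: "continuous_on {a..b} ?N"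
    by (intro continuous_on_subset[OF L2_cont_ip[OF _ cst] sub] v_cont N_cont L2_weights(1)[OF lap_cont])+
  have kk: "ip M (k t) \<xi> = ?L t + ?N t" if "t \<in> I" for t
    unfolding k_def[abs_def]
    using ip_add[OF L2_cont_L2[OF L2_weights(1)[OF lap_cont] that] L2_cont_L2[OF N_cont that] L\<xi>] .
  show ?thesis
  proof (rule weak_second_derivative[of a b _ _ ?A])
    show "continuous_on {a..b} (\<lambda>t. ip M (v' t) \<xi>)"
      by (rule continuous_on_subset[OF L2_cont_ip[OF v'_cont cst] sub])
    show "continuous_on {a..b} (\<lambda>t. ip M (k t) \<xi>)"
      by (rule continuous_on_subset[OF L2_cont_ip[OF k_cont cst] sub])
    show "(?A has_real_derivative ip M (v' t) \<xi>) (at t within {a..b})" if "t \<in> {a..b}" for t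
      using L2_deriv_ip[OF v_cont(2) _ L\<xi>, of t] sub that DERIV_subset by blast
    show "t \<in> {a<..<b}" using ab by simp
    fix \<eta> assume \<eta>: "test_function {a<..<b} \<eta>"
    have s: "smooth \<eta>" "smooth (partial 1 (partial 1 \<eta>))"
      using test_function_smooth[OF \<eta>] by (auto intro!: smooth_partial)
    have z: "\<eta> r = 0" "partial 1 (partial 1 \<eta>) r = 0" if "r \<notin> {a<..<b}" for r
    proof -
      have "test_function {a<..<b} (partial 1 (partial 1 \<eta>))"
        by (intro test_function_partial \<eta>) auto
      then show "\<eta> r = 0" "partial 1 (partial 1 \<eta>) r = 0" using \<eta> that by (meson subsetD test_functionE)+
    qed
    have c1: "continuous_on {a..b} (\<lambda>t. ?A t * partial 1 (partial 1 \<eta>) t)" "continuous_on {a..b} (\<lambda>t. ?L t * \<eta> t)"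
      "continuous_on {a..b} (\<lambda>t. ?N t * \<eta> t)"
      by (intro continuous_on_mult contA contL contN smooth_continuous s)+
    note i1 = continuous_integrable_indicator[OF c1(1)] continuous_integrable_indicator[OF c1(2)]
      continuous_integrable_indicator[OF c1(3)]
    have tr: "(LINT t|lebesgue_on {0..T}. f t) = (LINT t|lborel. indicator {a..b} t * f t)"
      if i: "integrable lborel (\<lambda>t. indicator {a..b} t * f t)" and f0: "\<And>t. t \<notin> {a<..<b} \<Longrightarrow> f t = 0" for f :: "real \<Rightarrow> real"
    proof -
      have e: "f = (\<lambda>t. indicator {a..b} t * f t)"
      proof
        fix t show "f t = indicator {a..b} t * f t" using f0[of t]
          by (cases "t \<in> {a<..<b}") (auto simp: indicator_def)
      qed
      have "f \<in> borel_measurable borel" by (subst e) (use i in auto)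
      then have "(LINT t|lebesgue_on {0..T}. f t) = (LINT t|lborel. f t)"
        using ab by (intro lebesgue_on_lborel(2)) (auto intro!: f0)
      also have "\<dots> = (LINT t|lborel. indicator {a..b} t * f t)" by (subst e) (rule refl)
      finally show ?thesis .
    qed
    have "test_function I \<eta>" by (rule test_function_mono[OF \<eta>]) (use ab in auto)
    note w = weak[OF \<xi> this]
    have "(LINT t|lborel. indicator {a..b} t * (?A t * partial 1 (partial 1 \<eta>) t - ?L t * \<eta> t)) =
        (LINT t|lborel. indicator {a..b} t * (?N t * \<eta> t))"
    proof -
      have "integrable lborel (\<lambda>t. indicator {a..b} t * (?A t * partial 1 (partial 1 \<eta>) t - ?L t * \<eta> t))"
        using i1(1,2) by (simp add: right_diff_distrib)
      then have e1: "(LINT t|lebesgue_on {0..T}. ?A t * partial 1 (partial 1 \<eta>) t - ?L t * \<eta> t) =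
          (LINT t|lborel. indicator {a..b} t * (?A t * partial 1 (partial 1 \<eta>) t - ?L t * \<eta> t))"
        by (rule tr) (simp only: z not_False_eq_True mult_zero_right diff_self)
      have e2: "(LINT t|lebesgue_on {0..T}. ?N t * \<eta> t) = (LINT t|lborel. indicator {a..b} t * (?N t * \<eta> t))"
        by (rule tr[OF i1(3)]) (simp only: z not_False_eq_True mult_zero_right)
      show ?thesis using w unfolding e1 e2 .
    qed
    then have "(LINT t|lborel. indicator {a..b} t * (?A t * partial 1 (partial 1 \<eta>) t)) =
        (LINT t|lborel. indicator {a..b} t * (?L t * \<eta> t)) + (LINT t|lborel. indicator {a..b} t * (?N t * \<eta> t))"
      using i1 by (simp add: right_diff_distrib)
    also have "\<dots> = (LINT t|lborel. indicator {a..b} t * (?L t * \<eta> t) + indicator {a..b} t * (?N t * \<eta> t))"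
      using i1 by simp
    also have "\<dots> = (LINT t|lborel. indicator {a..b} t * (ip M (k t) \<xi> * \<eta> t))"
      using kk sub by (intro Bochner_Integration.integral_cong) (auto simp: indicator_def algebra_simps)
    finally show "(LINT t|lborel. indicator {a..b} t * (?A t * partial 1 (partial 1 \<eta>) t)) =
        (LINT t|lborel. indicator {a..b} t * (ip M (k t) \<xi> * \<eta> t))" .
  qed
qed

text \<open>The mean value theorem for the tested velocity minus its linear prediction bounds the
  error by the oscillation \<open>\<omega>\<close> of \<open>k\<close> between \<open>s\<close> and
  \<open>t\<close>. The bound depends on the direction only through its norm, hence it extends to
  \<open>test_closure\<close> and may be applied to a direction that itself depends on
  \<open>s\<close>.\<close>

lemma velocity_increment:
  assumes s: "s \<in> I" "t \<in> I" "s \<noteq> t"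
    and \<omega>: "\<And>r. min s t \<le> r \<Longrightarrow> r \<le> max s t \<Longrightarrow> l2 M (\<lambda>x. k r x - k t x) \<le> \<omega>"
    and \<xi>: "\<xi> \<in> test_closure S"
  shows "\<bar>ip M (\<lambda>x. v' s x - v' t x) \<xi> - (s - t) * ip M (k t) \<xi>\<bar> \<le> \<bar>s - t\<bar> * (\<omega> * l2 M \<xi>)"
proof -
  note Lk = L2_cont_L2[OF k_cont] and Lv = L2_cont_L2[OF v'_cont]
  have Ldv: "L2_on M (\<lambda>x. v' s x - v' t x)" by (intro L2_on_diff Lv s)
  have test: "\<bar>ip M (\<lambda>x. v' s x - v' t x) \<phi> - (s - t) * ip M (k t) \<phi>\<bar> \<le> \<bar>s - t\<bar> * (\<omega> * l2 M \<phi>)"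
    if \<phi>: "test_function S \<phi>" for \<phi>
  proof -
    have L\<phi>: "L2_on M \<phi>" by (rule L2_on_test_function[OF S(1) \<phi>])
    let ?f = "\<lambda>r. ip M (v' r) \<phi> - r * ip M (k t) \<phi>"
    have der: "(?f has_real_derivative ip M (k r) \<phi> - ip M (k t) \<phi>) (at r)" if "min s t \<le> r" "r \<le> max s t" for r
    proof -
      have "r \<in> I" using that s by (auto simp: min_def max_def split: if_splits)
      then show ?thesis by (auto intro!: derivative_eq_intros velocity_derivative \<phi>)
    qed
    have lt: "min s t < max s t" using s(3) by (auto simp: min_def max_def)
    obtain r where r: "min s t < r" "r < max s t"
      "?f (max s t) - ?f (min s t) = (max s t - min s t) * (ip M (k r) \<phi> - ip M (k t) \<phi>)"
      using MVT2[OF lt der] by blast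
    have rI: "r \<in> I" using r(1,2) s by (auto simp: min_def max_def split: if_splits)
    have 1: "\<bar>?f s - ?f t\<bar> = \<bar>?f (max s t) - ?f (min s t)\<bar>" by (auto simp: min_def max_def)
    have 2: "\<bar>?f (max s t) - ?f (min s t)\<bar> = \<bar>s - t\<bar> * \<bar>ip M (k r) \<phi> - ip M (k t) \<phi>\<bar>"
      unfolding r(3) abs_mult by (auto simp: min_def max_def)
    have 3: "ip M (k r) \<phi> - ip M (k t) \<phi> = ip M (\<lambda>x. k r x - k t x) \<phi>"
      using ip_diff[OF Lk[OF rI] Lk[OF s(2)] L\<phi>] by simp
    have 4: "\<bar>ip M (\<lambda>x. k r x - k t x) \<phi>\<bar> \<le> l2 M (\<lambda>x. k r x - k t x) * l2 M \<phi>"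
      by (rule ip_le[OF L2_on_diff[OF Lk[OF rI] Lk[OF s(2)]] L\<phi>])
    have "l2 M (\<lambda>x. k r x - k t x) \<le> \<omega>" by (rule \<omega>) (use r in auto)
    then have 5: "l2 M (\<lambda>x. k r x - k t x) * l2 M \<phi> \<le> \<omega> * l2 M \<phi>" by (rule mult_right_mono) simp
    have "\<bar>?f s - ?f t\<bar> \<le> \<bar>s - t\<bar> * (\<omega> * l2 M \<phi>)"
      unfolding 1 2 3 by (rule mult_left_mono[OF order_trans[OF 4 5]]) simp
    moreover have "?f s - ?f t = ip M (\<lambda>x. v' s x - v' t x) \<phi> - (s - t) * ip M (k t) \<phi>"
      using ip_diff[OF Lv[OF s(1)] Lv[OF s(2)] L\<phi>] by (simp add: algebra_simps)
    ultimately show ?thesis by simp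
  qed
  have L\<xi>: "L2_on M \<xi>" using \<xi> by (simp add: test_closure_def)
  have "\<exists>\<phi>. test_function S \<phi> \<and> l2 M (\<lambda>x. \<phi> x - \<xi> x) < inverse (real (Suc n))" for n
    using \<xi> by (simp add: test_closure_def)
  then obtain \<phi> where \<phi>: "\<And>n. test_function S (\<phi> n)" "\<And>n. l2 M (\<lambda>x. \<phi> n x - \<xi> x) < inverse (real (Suc n))"
    by metis
  have lim: "(\<lambda>n. l2 M (\<lambda>x. \<phi> n x - \<xi> x)) \<longlonglongrightarrow> 0"
    by (rule tendsto_sandwich[OF _ _ tendsto_const LIMSEQ_inverse_real_of_nat])
      (use \<phi>(2) in \<open>auto intro!: always_eventually less_imp_le\<close>)
  have L\<phi>: "L2_on M (\<phi> n)" for n by (rule L2_on_test_function[OF S(1) \<phi>(1)])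
  have zero: "(\<lambda>n. l2 M (\<lambda>x. f x - f x)) \<longlonglongrightarrow> 0" for f by (simp add: l2_def)
  have ipl: "(\<lambda>n. ip M f (\<phi> n)) \<longlonglongrightarrow> ip M f \<xi>" if "L2_on M f" for f
    by (rule tendsto_ip[OF that L\<xi> _ _ zero lim]) (use that L\<phi> in auto)
  have l2l: "(\<lambda>n. l2 M (\<phi> n)) \<longlonglongrightarrow> l2 M \<xi>"
    by (rule LIM_zero_cancel, rule Lim_null_comparison[OF _ lim]) (use l2_dist[OF L\<phi> L\<xi>] in auto)
  show ?thesis
  proof (rule LIMSEQ_le)
    show "(\<lambda>n. \<bar>ip M (\<lambda>x. v' s x - v' t x) (\<phi> n) - (s - t) * ip M (k t) (\<phi> n)\<bar>) \<longlonglongrightarrow>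
        \<bar>ip M (\<lambda>x. v' s x - v' t x) \<xi> - (s - t) * ip M (k t) \<xi>\<bar>"
      by (intro tendsto_intros ipl Ldv Lk s)
    show "(\<lambda>n. \<bar>s - t\<bar> * (\<omega> * l2 M (\<phi> n))) \<longlonglongrightarrow> \<bar>s - t\<bar> * (\<omega> * l2 M \<xi>)"
      by (intro tendsto_intros l2l)
  qed (use test[OF \<phi>(1)] in auto)
qed

lemma quotient_H10:
  assumes "s \<in> I" "t \<in> I" shows "(\<lambda>x. (v s x - v t x) / (s - t)) \<in> H10 S"
  using H10_lincomb[OF S(1) v(1)[OF assms(1)] v(1)[OF assms(2)], of "1 / (s - t)" "- 1 / (s - t)"]
  by (simp add: diff_divide_distrib)

lemma at_within_I_neq_bot: "t \<in> I \<Longrightarrow> at t within I \<noteq> bot"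
  using at_within_open[of t I] by simp

text \<open>The velocity is the L2 limit of difference quotients, which belong to \<open>H10\<close>
  and hence to the closed set \<open>test_closure\<close>.\<close>

lemma velocity_test_closure:
  assumes t: "t \<in> I" shows "v' t \<in> test_closure S"
proof (rule test_closure_closed[OF S(1) L2_cont_L2[OF v'_cont t]])
  fix e :: real assume e: "0 < e"
  have "((\<lambda>s. l2 M (\<lambda>x. (v s x - v t x) / (s - t) - v' t x)) \<longlongrightarrow> 0) (at t within I)"
    using v_cont(2) t by (simp add: L2_deriv_def)
  from order_tendstoD(2)[OF this e] eventually_at_within_mem[of I t]
  have "\<forall>\<^sub>F s in at t within I. s \<in> I \<and> l2 M (\<lambda>x. (v s x - v t x) / (s - t) - v' t x) < e"
    by eventually_elim simp
  then obtain s where "s \<in> I" "l2 M (\<lambda>x. (v s x - v t x) / (s - t) - v' t x) < e"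
    using eventually_happens'[OF at_within_I_neq_bot[OF t]] by blast
  then show "\<exists>g\<in>test_closure S. l2 M (\<lambda>x. g x - v' t x) < e"
    using H10_test_closure[OF quotient_H10[OF \<open>s \<in> I\<close> t]]
    by (intro bexI[of _ "\<lambda>x. (v s x - v t x) / (s - t)"])
qed

text \<open>Membership of the velocity in \<open>H10\<close> is not at hand, so Green's identity is
  applied to the difference quotients, which do belong to it. Both sides converge, the gradients by
  \<open>dv_cont\<close>.\<close>

lemma green_velocity:
  assumes t: "t \<in> I"
  shows "(\<Sum>j\<in>UNIV. ip M (weak_deriv S (mi j 1) (v t)) (weak_deriv S (mi j 1) (v' t))) =
    - ip M (weak_laplacian S (v t)) (v' t)"
proof -
  let ?z = "\<lambda>s x. (v s x - v t x) / (s - t)"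
  have Ldv: "L2_on M (weak_deriv S (mi j 1) (v t))" if "t \<in> I" for t j
    using L2_cont_L2[OF dv_cont(1) that] .
  have zero: "((\<lambda>n. l2 M (\<lambda>x. f x - f x)) \<longlongrightarrow> 0) F" for f F by (simp add: l2_def)
  have eq: "(\<Sum>j\<in>UNIV. ip M (weak_deriv S (mi j 1) (v t)) (\<lambda>x. (weak_deriv S (mi j 1) (v s) x - weak_deriv S (mi j 1) (v t) x) / (s - t)))
     = - ip M (weak_laplacian S (v t)) (?z s)" if s: "s \<in> I" for s
  proof -
    have sob: "v r \<in> sobolev 1 S" if "r \<in> I" for r using H10_sobolev[OF v(1)[OF that]] .
    have "ip M (weak_deriv S (mi j 1) (v t)) (\<lambda>x. (weak_deriv S (mi j 1) (v s) x - weak_deriv S (mi j 1) (v t) x) / (s - t))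
        = ip M (weak_deriv S (mi j 1) (v t)) (weak_deriv S (mi j 1) (?z s))" for j
    proof (rule ip_cong)
      show "AE x in M. (weak_deriv S (mi j 1) (v s) x - weak_deriv S (mi j 1) (v t) x) / (s - t) = weak_deriv S (mi j 1) (?z s) x"
      proof -
        have z: "(\<lambda>x. 1 / (s - t) * v s x + - 1 / (s - t) * v t x) = ?z s"
          by (simp add: fun_eq_iff diff_divide_distrib)
        have "AE x in M. weak_deriv S (mi j 1) (?z s) x =
            1 / (s - t) * weak_deriv S (mi j 1) (v s) x + - 1 / (s - t) * weak_deriv S (mi j 1) (v t) x"
          unfolding z[symmetric] by (rule weak_deriv_lincomb[OF S(1) sob[OF s] sob[OF t]]) simp
        then show ?thesis
        proof eventually_elim
          case (elim x)
          show ?case unfolding elim by (simp add: diff_divide_distrib)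
        qed
      qed
      show "L2_on M (\<lambda>x. (weak_deriv S (mi j 1) (v s) x - weak_deriv S (mi j 1) (v t) x) / (s - t))"
        using L2_on_scale[OF L2_on_diff[OF Ldv[OF s] Ldv[OF t]], of "1 / (s - t)"] by simp
      show "L2_on M (weak_deriv S (mi j 1) (?z s))"
        by (rule sobolev_weak_deriv(2)[OF S(1) H10_sobolev[OF quotient_H10[OF s t]]]) simp
    qed (use Ldv[OF t] in auto)
    then show ?thesis using green_laplacian[OF S(1) v(2)[OF t] quotient_H10[OF s t]] by simp
  qed
  have L: "L2_on M (v t)" "L2_on M (v' t)" if "t \<in> I" for t using v_cont(2) that by (auto simp: L2_deriv_def)
  have Lz: "L2_on M (?z s)" if "s \<in> I" for s using sobolev_L2[OF H10_sobolev[OF quotient_H10[OF that t]]] .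
  have Lq: "L2_on M (\<lambda>x. (weak_deriv S (mi j 1) (v s) x - weak_deriv S (mi j 1) (v t) x) / (s - t))" if "s \<in> I" for j s
    using L2_on_scale[OF L2_on_diff[OF Ldv[OF that] Ldv[OF t]], of "1 / (s - t)"] by simp
  have Ldv': "L2_on M (weak_deriv S (mi j 1) (v' t))" for j using dv_cont(2) t by (auto simp: L2_deriv_def)
  have Llap: "L2_on M (weak_laplacian S (v t))" using L2_cont_L2[OF lap_cont t] .
  have 1: "((\<lambda>s. \<Sum>j\<in>UNIV. ip M (weak_deriv S (mi j 1) (v t)) (\<lambda>x. (weak_deriv S (mi j 1) (v s) x - weak_deriv S (mi j 1) (v t) x) / (s - t)))
      \<longlongrightarrow> (\<Sum>j\<in>UNIV. ip M (weak_deriv S (mi j 1) (v t)) (weak_deriv S (mi j 1) (v' t)))) (at t within I)"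
  proof (intro tendsto_sum)
    fix j
    show "((\<lambda>s. ip M (weak_deriv S (mi j 1) (v t)) (\<lambda>x. (weak_deriv S (mi j 1) (v s) x - weak_deriv S (mi j 1) (v t) x) / (s - t)))
      \<longlongrightarrow> ip M (weak_deriv S (mi j 1) (v t)) (weak_deriv S (mi j 1) (v' t))) (at t within I)"
      by (rule tendsto_ip[OF Ldv[OF t] Ldv' _ _ zero])
        (use Ldv[OF t] Lq dv_cont(2)[of j] t in \<open>auto simp: L2_deriv_def intro: eventually_mono[OF eventually_at_within_mem]\<close>)
  qed
  have 2: "((\<lambda>s. - ip M (weak_laplacian S (v t)) (?z s)) \<longlongrightarrow> - ip M (weak_laplacian S (v t)) (v' t)) (at t within I)"
    by (intro tendsto_minus, rule tendsto_ip[OF Llap L(2)[OF t] _ _ zero])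
      (use Llap Lz v_cont(2) t in \<open>auto simp: L2_deriv_def intro: eventually_mono[OF eventually_at_within_mem]\<close>)
  have 3: "((\<lambda>s. - ip M (weak_laplacian S (v t)) (?z s)) \<longlongrightarrow>
      (\<Sum>j\<in>UNIV. ip M (weak_deriv S (mi j 1) (v t)) (weak_deriv S (mi j 1) (v' t)))) (at t within I)"
    by (rule Lim_transform_eventually[OF 1]) (use eq in \<open>auto intro: eventually_mono[OF eventually_at_within_mem]\<close>)
  show ?thesis by (rule tendsto_unique[OF at_within_I_neq_bot[OF t] 3 2])
qed

text \<open>The increment of the squared weighted norm is the velocity increment tested against the
  sum of the two velocities over c^2. That direction moves with \<open>s\<close>, and so the uniform
  estimate \<open>velocity_increment\<close> is required instead of a derivative in a fixed
  direction.\<close>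

lemma kinetic_derivative:
  assumes t: "t \<in> I"
  shows "((\<lambda>t. (l2 M (\<lambda>x. v' t x / c x))\<^sup>2) has_real_derivative 2 * ip M (k t) (\<lambda>x. v' t x / (c x)\<^sup>2)) (at t within I)"
proof -
  note Lk = L2_cont_L2[OF k_cont] and Lv = L2_cont_L2[OF v'_cont]
  define X where "X = (\<lambda>s x. (v' s x + v' t x) / (c x)\<^sup>2)"
  have Xc: "L2_cont M I X"
  proof -
    have "L2_cont M I (\<lambda>s x. 1 * v' s x + 1 * v' t x)"
      by (intro L2_cont_lincomb v'_cont L2_cont_const Lv t)
    from L2_weights(3)[OF this] show ?thesis by (simp add: X_def)
  qed
  have Xt: "X s \<in> test_closure S" if s: "s \<in> I" for s
  proof -
    have "continuous_on (closure S) (\<lambda>x. 1 / (c x)\<^sup>2)"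
    proof (intro continuous_intros c)
      show "\<forall>x\<in>closure S. (c x)\<^sup>2 \<noteq> 0" using c(2) by force
    qed
    from test_closure_mult[OF S this test_closure_add[OF S(1) velocity_test_closure[OF s] velocity_test_closure[OF t]]]
    show ?thesis by (simp add: X_def)
  qed
  let ?p = "\<lambda>t. (l2 M (\<lambda>x. v' t x / c x))\<^sup>2"
  have p: "?p s - ?p t = ip M (\<lambda>x. v' s x - v' t x) (X s)" if s: "s \<in> I" for s
  proof -
    have "?p s - ?p t = ip M (\<lambda>x. v' s x / c x - v' t x / c x) (\<lambda>x. v' s x / c x + v' t x / c x)"
      by (rule ip_diff_squares[symmetric]; intro L2_weight(1) Lv s t)
    also have "\<dots> = ip M (\<lambda>x. v' s x - v' t x) (X s)"
      unfolding ip_def X_def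
      by (intro Bochner_Integration.integral_cong refl)
        (simp add: power2_eq_square flip: diff_divide_distrib add_divide_distrib)
    finally show ?thesis .
  qed
  have Q: "((\<lambda>s. ip M (k t) (X s)) \<longlongrightarrow> ip M (k t) (X t)) (at t within I)"
    using L2_cont_ip[OF L2_cont_const[OF Lk[OF t]] Xc] t by (simp add: continuous_on_def)
  have lX: "((\<lambda>s. (l2 M (X s))\<^sup>2) \<longlongrightarrow> (l2 M (X t))\<^sup>2) (at t within I)"
    using L2_cont_l2_sq[OF Xc] t by (simp add: continuous_on_def)
  have kt: "((\<lambda>s. l2 M (\<lambda>x. k s x - k t x)) \<longlongrightarrow> 0) (at t within I)"
    using k_cont t by (simp add: L2_cont_def)
  have R: "((\<lambda>s. (?p s - ?p t) / (s - t) - ip M (k t) (X s)) \<longlongrightarrow> 0) (at t within I)"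
  proof (rule tendstoI)
    fix e :: real assume e: "0 < e"
    \<comment> \<open>A bound for the norm of \<open>X s\<close> near \<open>t\<close>. Since B
      exceeds 1, a squared norm below B also gives a norm below B.\<close>
    define B where "B = (l2 M (X t))\<^sup>2 + 2"
    have "0 \<le> (l2 M (X t))\<^sup>2" by simp
    then have B: "1 < B" unfolding B_def by linarith
    define \<omega> where "\<omega> = e / (2 * B)"
    have \<omega>: "0 < \<omega>" using e B by (simp add: \<omega>_def)
    from order_tendstoD(2)[OF kt \<omega>] obtain d where d: "0 < d"
      "\<And>s. s \<in> I \<Longrightarrow> s \<noteq> t \<Longrightarrow> dist s t < d \<Longrightarrow> l2 M (\<lambda>x. k s x - k t x) < \<omega>"
      unfolding eventually_at by blast
    have l2B: "\<forall>\<^sub>F s in at t within I. (l2 M (X s))\<^sup>2 < B"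
      by (rule order_tendstoD(2)[OF lX]) (simp add: B_def)
    \<comment> \<open>With \<open>s\<close> this close, every time between \<open>s\<close> and
      \<open>t\<close> is as close, so the oscillation bound holds on the whole interval between
      them.\<close>
    have near: "\<forall>\<^sub>F s in at t within I. dist s t < d"
      unfolding eventually_at using d(1) by blast
    show "\<forall>\<^sub>F s in at t within I. dist ((?p s - ?p t) / (s - t) - ip M (k t) (X s)) 0 < e"
      using l2B near eventually_at_within_mem_neq
    proof eventually_elim
      case (elim s)
      then have s: "s \<in> I" "s \<noteq> t" by auto
      have w: "l2 M (\<lambda>x. k r x - k t x) \<le> \<omega>" if "min s t \<le> r" "r \<le> max s t" for r
      proof (cases "r = t")
        case True
        then show ?thesis using \<omega> by (simp add: l2_def)
      next
        case False
        have "r \<in> I" "dist r t < d" using that s t elim by (auto simp: min_def max_def dist_real_def split: if_splits)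
        then show ?thesis using d(2)[of r] False by simp
      qed
      have "l2 M (X s) \<le> B"
      proof (rule power2_le_imp_le)
        have "(l2 M (X s))\<^sup>2 \<le> B * 1" using elim by simp
        also have "\<dots> \<le> B * B" using B by (intro mult_left_mono) auto
        finally show "(l2 M (X s))\<^sup>2 \<le> B\<^sup>2" by (simp add: power2_eq_square)
      qed (use B in simp)
      have "\<bar>ip M (\<lambda>x. v' s x - v' t x) (X s) - (s - t) * ip M (k t) (X s)\<bar> \<le> \<bar>s - t\<bar> * (\<omega> * l2 M (X s))"
        by (rule velocity_increment[OF s(1) t s(2) w Xt[OF s(1)]])
      also have "\<dots> \<le> \<bar>s - t\<bar> * (\<omega> * B)"
        using \<open>l2 M (X s) \<le> B\<close> \<omega> by (intro mult_left_mono) auto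
      finally have "\<bar>(?p s - ?p t) - (s - t) * ip M (k t) (X s)\<bar> \<le> \<bar>s - t\<bar> * (e / 2)"
        using B by (simp add: p[OF s(1)] \<omega>_def)
      moreover have "(?p s - ?p t) / (s - t) - ip M (k t) (X s) = ((?p s - ?p t) - (s - t) * ip M (k t) (X s)) / (s - t)"
        using s(2) by (simp add: diff_divide_distrib)
      ultimately have "\<bar>(?p s - ?p t) / (s - t) - ip M (k t) (X s)\<bar> \<le> e / 2"
        using s(2) by (simp add: abs_divide pos_divide_le_eq mult.commute)
      then show ?case using e by (simp add: dist_real_def)
    qed
  qed
  have "((\<lambda>s. (?p s - ?p t) / (s - t)) \<longlongrightarrow> ip M (k t) (X t)) (at t within I)"
    using tendsto_add[OF R Q] by simp
  moreover have "ip M (k t) (X t) = 2 * ip M (k t) (\<lambda>x. v' t x / (c x)\<^sup>2)"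
  proof -
    have "X t = (\<lambda>x. 2 * (v' t x / (c x)\<^sup>2))" by (simp add: X_def fun_eq_iff)
    then show ?thesis using ip_scale[of M 2 "\<lambda>x. v' t x / (c x)\<^sup>2" "k t"] by (simp add: ip_commute)
  qed
  ultimately show ?thesis by (simp add: has_field_derivative_iff)
qed

text \<open>Dividing the velocity by \<open>c\<close> removes the variable coefficient from the
  Laplacian term, so that Green's identity cancels it against the gradient part. The zeroth-order
  term completes the H1 norm.\<close>

definition energy :: "real \<Rightarrow> real" where
  "energy t = h1_sq S (v t) + (l2 M (\<lambda>x. v' t x / c x))\<^sup>2"

lemma energy_derivative:
  assumes t: "t \<in> I"
  shows "(energy has_real_derivative
    2 * ip M (v t) (v' t) + 2 * ip M (\<lambda>x. N t x / c x) (\<lambda>x. v' t x / c x)) (at t)"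
proof -
  have pos: "c x \<noteq> 0" if "x \<in> S" for x using c(2)[of x] closure_subset[of S] that by force
  \<comment> \<open>The weight 1/c^2 leaves the bare Laplacian times the velocity, and splits
    symmetrically between source and velocity in the other term.\<close>
  have arith: "(a\<^sup>2 * l + n) * (w / a\<^sup>2) = l * w + (n / a) * (w / a)" if "a \<noteq> 0" for a l n w :: real
    using that by (simp add: distrib_right add_divide_distrib power2_eq_square)
  have L: "L2_on M (v' t)" "L2_on M (N t)" "L2_on M (weak_laplacian S (v t))"
    using L2_cont_L2[OF v'_cont t] L2_cont_L2[OF N_cont t] L2_cont_L2[OF lap_cont t] .
  have "ip M (k t) (\<lambda>x. v' t x / (c x)\<^sup>2) = (LINT x|M. weak_laplacian S (v t) x * v' t x + (N t x / c x) * (v' t x / c x))"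
    unfolding ip_def k_def
    by (intro Bochner_Integration.integral_cong refl arith pos) simp
  also have "\<dots> = ip M (weak_laplacian S (v t)) (v' t) + ip M (\<lambda>x. N t x / c x) (\<lambda>x. v' t x / c x)"
    unfolding ip_def
    by (rule Bochner_Integration.integral_add; intro L2_on_mult L L2_weight(1))
  finally have k: "ip M (k t) (\<lambda>x. v' t x / (c x)\<^sup>2) =
      ip M (weak_laplacian S (v t)) (v' t) + ip M (\<lambda>x. N t x / c x) (\<lambda>x. v' t x / c x)" .
  have "(energy has_real_derivative 2 * ip M (v t) (v' t) +
     (\<Sum>j\<in>UNIV. 2 * ip M (weak_deriv S (mi j 1) (v t)) (weak_deriv S (mi j 1) (v' t))) +
     2 * ip M (k t) (\<lambda>x. v' t x / (c x)\<^sup>2)) (at t within I)"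
    unfolding energy_def[abs_def] h1_sq_def
    by (intro DERIV_add DERIV_sum L2_deriv_l2_sq v_cont dv_cont kinetic_derivative t)
  then show ?thesis
    unfolding k sum_distrib_left[symmetric] green_velocity[OF t] at_within_open[OF t open_greaterThanLessThan]
    by (simp add: algebra_simps)
qed

end

section \<open>A bootstrap argument\<close>

text \<open>While E stays at most 1, the superlinear right side is at most C (3 E +
  \<open>\<kappa>\<close>^2), and a Gronwall argument bounds E by a number that \<open>small\<close>
  puts below 1. At a first time with E at least 1 this would be contradicted, so the bound persists
  on the whole interval.\<close>

lemma bootstrap:
  fixes E E' :: "real \<Rightarrow> real"
  assumes T: "0 < T" and C: "0 \<le> C" and \<kappa>: "0 \<le> \<kappa>"
    and cont: "continuous_on {0..T} E" and E: "E 0 = 0" "\<And>t. t \<in> {0..T} \<Longrightarrow> 0 \<le> E t"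
    and der: "\<And>t. t \<in> {0<..<T} \<Longrightarrow> (E has_real_derivative E' t) (at t)"
    and bound: "\<And>t. t \<in> {0<..<T} \<Longrightarrow> E' t \<le> C * (E t + (E t + \<kappa>) * sqrt (E t))"
    and small: "\<kappa>\<^sup>2 * (C * T * exp (3 * C * T)) < 1"
    and t: "t \<in> {0..T}"
  shows "E t \<le> \<kappa>\<^sup>2 * (C * T * exp (3 * C * T))"
proof -
  let ?B = "\<kappa>\<^sup>2 * (C * T * exp (3 * C * T))"
  have step: "E \<tau> \<le> ?B" if \<tau>: "0 < \<tau>" "\<tau> \<le> T" and le: "\<And>s. 0 < s \<Longrightarrow> s < \<tau> \<Longrightarrow> E s \<le> 1" for \<tau>
  proof -
    \<comment> \<open>Integrating factor for the rate 3 C. The subtracted linear term absorbs the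
      constant forcing, so that ?F cannot increase from its value 0 at time 0.\<close>
    let ?F = "\<lambda>s. exp (- (3 * C * s)) * E s - \<kappa>\<^sup>2 * C * s"
    let ?F' = "\<lambda>s. exp (- (3 * C * s)) * (E' s - 3 * C * E s) - \<kappa>\<^sup>2 * C"
    have "continuous_on {0..\<tau>} ?F"
      by (intro continuous_intros continuous_on_subset[OF cont]) (use \<tau> in auto)
    have "(?F has_real_derivative ?F' s) (at s)" if "0 < s" "s < \<tau>" for s
      using der[of s] that \<tau> by (auto intro!: derivative_eq_intros simp: algebra_simps)
    note dF = this
    have "\<exists>l z. 0 < z \<and> z < \<tau> \<and> (?F has_real_derivative l) (at z) \<and> ?F \<tau> - ?F 0 = (\<tau> - 0) * l"
    proof (rule MVT[OF \<tau>(1)])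
      show "continuous_on {0..\<tau>} ?F" by fact
      show "?F differentiable (at s)" if "0 < s" "s < \<tau>" for s
        using dF[OF that] real_differentiable_def by blast
    qed
    then obtain s where s: "0 < s" "s < \<tau>" "?F \<tau> - ?F 0 = (\<tau> - 0) * ?F' s"
      using dF DERIV_unique by blast
    have E0: "0 \<le> E s" using E(2) s \<tau> by simp
    have r: "sqrt (E s) \<le> 1" "0 \<le> sqrt (E s)" "(sqrt (E s))\<^sup>2 = E s" using le[OF s(1,2)] E0 by auto
    have "E s * sqrt (E s) \<le> E s" using E0 r by (intro mult_left_le) auto
    \<comment> \<open>This supplies the third E; the other two are E itself and E times its square
      root, which is at most E as long as E is at most 1.\<close>
    moreover have "\<kappa> * sqrt (E s) \<le> \<kappa>\<^sup>2 + E s"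
    proof -
      have "2 * \<kappa> * sqrt (E s) \<le> \<kappa>\<^sup>2 + E s" using sum_squares_bound[of \<kappa> "sqrt (E s)"] unfolding r(3) .
      moreover have "0 \<le> \<kappa> * sqrt (E s)" by (intro mult_nonneg_nonneg \<kappa> r)
      ultimately show ?thesis by linarith
    qed
    ultimately have "E s + (E s + \<kappa>) * sqrt (E s) \<le> 3 * E s + \<kappa>\<^sup>2" by (simp add: distrib_right)
    then have "C * (E s + (E s + \<kappa>) * sqrt (E s)) \<le> C * (3 * E s + \<kappa>\<^sup>2)" using C by (rule mult_left_mono)
    then have "E' s \<le> C * (3 * E s + \<kappa>\<^sup>2)" using bound[of s] s \<tau> by force
    then have "E' s - 3 * C * E s \<le> \<kappa>\<^sup>2 * C" by (simp add: algebra_simps)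
    then have "exp (- (3 * C * s)) * (E' s - 3 * C * E s) \<le> exp (- (3 * C * s)) * (\<kappa>\<^sup>2 * C)"
      by (intro mult_left_mono) auto
    also have "\<dots> \<le> 1 * (\<kappa>\<^sup>2 * C)" using C s(1) by (intro mult_right_mono) auto
    finally have "?F' s \<le> 0" by simp
    then have "?F \<tau> \<le> 0" using s(3) \<tau>(1) E(1) by (simp add: mult_nonneg_nonpos)
    then have "exp (3 * C * \<tau>) * (exp (- (3 * C * \<tau>)) * E \<tau>) \<le> exp (3 * C * \<tau>) * (\<kappa>\<^sup>2 * C * \<tau>)"
      by (intro mult_left_mono) auto
    then have "E \<tau> \<le> exp (3 * C * \<tau>) * (\<kappa>\<^sup>2 * C * \<tau>)"
      by (simp add: mult.assoc[symmetric] exp_add[symmetric])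
    also have "\<dots> \<le> exp (3 * C * T) * (\<kappa>\<^sup>2 * C * T)"
      using \<tau> C by (intro mult_mono) (auto intro!: mult_left_mono)
    finally show ?thesis by (simp add: mult_ac)
  qed
  have lt1: "E s < 1" if s: "s \<in> {0..T}" for s
  proof (rule ccontr)
    assume "\<not> E s < 1"
    \<comment> \<open>A closed set by continuity, hence it has a least element: the first time at
      which E reaches 1.\<close>
    define A where "A = {r\<in>{0..T}. 1 \<le> E r}"
    have "closed A"
    proof -
      have "A = {0..T} \<inter> E -` {1..}" by (auto simp: A_def)
      then show ?thesis using continuous_closed_preimage[OF cont, of "{1..}"] by simp
    qed
    moreover have "bounded A" by (rule bounded_subset[of "{0..T}"]) (auto simp: A_def)
    ultimately have "compact A" by (simp add: compact_eq_bounded_closed)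
    moreover have "A \<noteq> {}" using s \<open>\<not> E s < 1\<close> by (auto simp: A_def)
    ultimately obtain \<tau> where \<tau>: "\<tau> \<in> A" "\<And>r. r \<in> A \<Longrightarrow> \<tau> \<le> r" using compact_attains_inf[of A] by blast
    have "\<tau> \<noteq> 0" using \<tau>(1) E(1) by (auto simp: A_def)
    then have "0 < \<tau>" "\<tau> \<le> T" "1 \<le> E \<tau>" using \<tau>(1) by (auto simp: A_def)
    moreover have "E r \<le> 1" if "0 < r" "r < \<tau>" for r
      using \<tau>(2)[of r] that \<open>\<tau> \<le> T\<close> by (force simp: A_def)
    ultimately have "E \<tau> \<le> ?B" using step by blast
    then show False using small \<open>1 \<le> E \<tau>\<close> by linarith
  qed
  show ?thesis
  proof (cases "t = 0")
    case True
    then show ?thesis using E(1) C T by simp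
  next
    case False
    then show ?thesis using step[of t] t lt1 by (force intro: less_imp_le)
  qed
qed

section \<open>Curves in Sobolev spaces\<close>

lemma vsobolev_scale_diff:
  assumes S: "open S" and F: "F \<in> vsobolev m S" and G: "G \<in> vsobolev m S" and H: "H \<in> vsobolev m S"
  shows "(\<lambda>x. (F x - G x) /\<^sub>R r - H x) \<in> vsobolev m S"
  by (intro vsobolev_diff vsobolev_scale S F G H)

lemma continuous_in_time_L2_cont:
  assumes S: "open S" and u: "continuous_in_time m S T u" and m: "1 \<le> m"
  shows "L2_cont (lebesgue_on S) {0..T} (\<lambda>t x. u t x $ i)"
  unfolding L2_cont_def
proof (intro ballI conjI)
  fix t assume t: "t \<in> {0..T}"
  have us: "u s \<in> vsobolev m S" if "s \<in> {0..T}" for s using u that by (simp add: continuous_in_time_def)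
  show "L2_on (lebesgue_on S) (\<lambda>x. u t x $ i)" by (rule sobolev_L2[OF vsobolevD[OF us[OF t]]])
  show "((\<lambda>s. l2 (lebesgue_on S) (\<lambda>x. u s x $ i - u t x $ i)) \<longlongrightarrow> 0) (at t within {0..T})"
  proof (rule Lim_null_comparison)
    show "((\<lambda>s. vsobolev_norm m S (\<lambda>x. u s x - u t x)) \<longlongrightarrow> 0) (at t within {0..T})"
      using u t by (simp add: continuous_in_time_def)
    show "\<forall>\<^sub>F s in at t within {0..T}. norm (l2 (lebesgue_on S) (\<lambda>x. u s x $ i - u t x $ i)) \<le> vsobolev_norm m S (\<lambda>x. u s x - u t x)"
      using eventually_at_within_mem
    proof eventually_elim
      case (elim s)
      show ?case using l2_le_vsobolev_norm[OF S vsobolev_diff[OF S us[OF elim] us[OF t]] m, of i] by simp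
    qed
  qed
qed

lemma continuous_in_time_weak_deriv:
  assumes S: "open S" and u: "continuous_in_time m S T u" and \<alpha>: "1 \<le> mi_order \<alpha>" "mi_order \<alpha> \<le> m"
  shows "L2_cont (lebesgue_on S) {0..T} (\<lambda>t. weak_deriv S \<alpha> (\<lambda>x. u t x $ i))"
  unfolding L2_cont_def
proof (intro ballI conjI)
  fix t assume t: "t \<in> {0..T}"
  let ?M = "lebesgue_on S"
  have us: "u s \<in> vsobolev m S" if "s \<in> {0..T}" for s using u that by (simp add: continuous_in_time_def)
  have L: "L2_on ?M (weak_deriv S \<alpha> (\<lambda>x. u s x $ i))" if "s \<in> {0..T}" for s
    by (rule sobolev_weak_deriv(2)[OF S vsobolevD[OF us[OF that]] \<alpha>(2)])
  show "L2_on ?M (weak_deriv S \<alpha> (\<lambda>x. u t x $ i))" by (rule L[OF t])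
  show "((\<lambda>s. l2 ?M (\<lambda>x. weak_deriv S \<alpha> (\<lambda>x. u s x $ i) x - weak_deriv S \<alpha> (\<lambda>x. u t x $ i) x)) \<longlongrightarrow> 0) (at t within {0..T})"
  proof (rule Lim_null_comparison)
    show "((\<lambda>s. vsobolev_norm m S (\<lambda>x. u s x - u t x)) \<longlongrightarrow> 0) (at t within {0..T})"
      using u t by (simp add: continuous_in_time_def)
    show "\<forall>\<^sub>F s in at t within {0..T}. norm (l2 ?M (\<lambda>x. weak_deriv S \<alpha> (\<lambda>x. u s x $ i) x - weak_deriv S \<alpha> (\<lambda>x. u t x $ i) x)) \<le> vsobolev_norm m S (\<lambda>x. u s x - u t x)"
      using eventually_at_within_mem
    proof eventually_elim
      case (elim s)
      note d = vsobolev_diff[OF S us[OF elim] us[OF t]]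
      have "l2 ?M (\<lambda>x. weak_deriv S \<alpha> (\<lambda>x. u s x $ i) x - weak_deriv S \<alpha> (\<lambda>x. u t x $ i) x) =
          l2 ?M (weak_deriv S \<alpha> (\<lambda>x. (u s x - u t x) $ i))"
      proof (rule l2_cong)
        have "AE x in ?M. weak_deriv S \<alpha> (\<lambda>x. u s x $ i - u t x $ i) x =
            weak_deriv S \<alpha> (\<lambda>x. u s x $ i) x - weak_deriv S \<alpha> (\<lambda>x. u t x $ i) x"
          by (rule weak_deriv_diff[OF S vsobolevD[OF us[OF elim]] vsobolevD[OF us[OF t]] \<alpha>(2)])
        then show "AE x in ?M. weak_deriv S \<alpha> (\<lambda>x. u s x $ i) x - weak_deriv S \<alpha> (\<lambda>x. u t x $ i) x =
            weak_deriv S \<alpha> (\<lambda>x. (u s x - u t x) $ i) x"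
          unfolding vector_minus_component by eventually_elim simp
      qed (intro L2_on_diff L elim t sobolev_weak_deriv(2)[OF S vsobolevD[OF d] \<alpha>(2)])+
      then show ?case using l2_weak_deriv_le[OF S d \<alpha>, of i] by simp
    qed
  qed
qed

lemma is_time_derivative_L2_deriv:
  assumes S: "open S" and u: "\<And>t. t \<in> {0..T} \<Longrightarrow> u t \<in> vsobolev m S" "\<And>t. t \<in> {0..T} \<Longrightarrow> u' t \<in> vsobolev m S"
    and d: "is_time_derivative m S T u u'" and m: "1 \<le> m"
  shows "L2_deriv (lebesgue_on S) {0..T} (\<lambda>t x. u t x $ i) (\<lambda>t x. u' t x $ i)"
  unfolding L2_deriv_def
proof (intro ballI conjI)
  fix t assume t: "t \<in> {0..T}"
  let ?M = "lebesgue_on S"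
  show "L2_on ?M (\<lambda>x. u t x $ i)" "L2_on ?M (\<lambda>x. u' t x $ i)"
    by (rule sobolev_L2[OF vsobolevD[OF u(1)[OF t]]], rule sobolev_L2[OF vsobolevD[OF u(2)[OF t]]])
  show "((\<lambda>s. l2 ?M (\<lambda>x. (u s x $ i - u t x $ i) / (s - t) - u' t x $ i)) \<longlongrightarrow> 0) (at t within {0..T})"
  proof (rule Lim_null_comparison)
    show "((\<lambda>s. vsobolev_norm m S (\<lambda>x. (u s x - u t x) /\<^sub>R (s - t) - u' t x)) \<longlongrightarrow> 0) (at t within {0..T})"
      using d t by (simp add: is_time_derivative_def)
    show "\<forall>\<^sub>F s in at t within {0..T}. norm (l2 ?M (\<lambda>x. (u s x $ i - u t x $ i) / (s - t) - u' t x $ i)) \<le>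
        vsobolev_norm m S (\<lambda>x. (u s x - u t x) /\<^sub>R (s - t) - u' t x)"
      using eventually_at_within_mem
    proof eventually_elim
      case (elim s)
      have "(\<lambda>x. (u s x $ i - u t x $ i) / (s - t) - u' t x $ i) = (\<lambda>x. ((u s x - u t x) /\<^sub>R (s - t) - u' t x) $ i)"
        by (simp add: fun_eq_iff divide_inverse mult.commute)
      then show ?case
        using l2_le_vsobolev_norm[OF S vsobolev_scale_diff[OF S u(1)[OF elim] u(1)[OF t] u(2)[OF t], of "s - t"] m, of i]
        by (simp only: real_norm_def abs_of_nonneg[OF l2_nonneg])
    qed
  qed
qed

lemma is_time_derivative_weak_deriv:
  assumes S: "open S" and u: "\<And>t. t \<in> {0..T} \<Longrightarrow> u t \<in> vsobolev m S" "\<And>t. t \<in> {0..T} \<Longrightarrow> u' t \<in> vsobolev m S"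
    and d: "is_time_derivative m S T u u'" and \<alpha>: "1 \<le> mi_order \<alpha>" "mi_order \<alpha> \<le> m"
  shows "L2_deriv (lebesgue_on S) {0..T} (\<lambda>t. weak_deriv S \<alpha> (\<lambda>x. u t x $ i)) (\<lambda>t. weak_deriv S \<alpha> (\<lambda>x. u' t x $ i))"
  unfolding L2_deriv_def
proof (intro ballI conjI)
  fix t assume t: "t \<in> {0..T}"
  let ?M = "lebesgue_on S"
  have L: "L2_on ?M (weak_deriv S \<alpha> (\<lambda>x. u s x $ i))" "L2_on ?M (weak_deriv S \<alpha> (\<lambda>x. u' s x $ i))"
    if "s \<in> {0..T}" for s
    using sobolev_weak_deriv(2)[OF S vsobolevD[OF u(1)[OF that]] \<alpha>(2)]
      sobolev_weak_deriv(2)[OF S vsobolevD[OF u(2)[OF that]] \<alpha>(2)] by auto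
  show "L2_on ?M (weak_deriv S \<alpha> (\<lambda>x. u t x $ i))" "L2_on ?M (weak_deriv S \<alpha> (\<lambda>x. u' t x $ i))"
    using L[OF t] by auto
  let ?d = "\<lambda>s x. (weak_deriv S \<alpha> (\<lambda>x. u s x $ i) x - weak_deriv S \<alpha> (\<lambda>x. u t x $ i) x) / (s - t) -
    weak_deriv S \<alpha> (\<lambda>x. u' t x $ i) x"
  show "((\<lambda>s. l2 ?M (?d s)) \<longlongrightarrow> 0) (at t within {0..T})"
  proof (rule Lim_null_comparison)
    show "((\<lambda>s. vsobolev_norm m S (\<lambda>x. (u s x - u t x) /\<^sub>R (s - t) - u' t x)) \<longlongrightarrow> 0) (at t within {0..T})"
      using d t by (simp add: is_time_derivative_def)
    show "\<forall>\<^sub>F s in at t within {0..T}. norm (l2 ?M (?d s)) \<le> vsobolev_norm m S (\<lambda>x. (u s x - u t x) /\<^sub>R (s - t) - u' t x)"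
      using eventually_at_within_mem
    proof eventually_elim
      case (elim s)
      let ?q = "\<lambda>x. 1 / (s - t) * u s x $ i + - 1 / (s - t) * u t x $ i"
      note D = vsobolev_scale_diff[OF S u(1)[OF elim] u(1)[OF t] u(2)[OF t], of "s - t"]
      have q: "?q \<in> sobolev m S" by (intro sobolev_lincomb[OF S] vsobolevD u elim t)
      have e: "(\<lambda>x. ((u s x - u t x) /\<^sub>R (s - t) - u' t x) $ i) = (\<lambda>x. ?q x - u' t x $ i)"
        by (simp add: fun_eq_iff divide_inverse algebra_simps)
      have "l2 ?M (?d s) = l2 ?M (weak_deriv S \<alpha> (\<lambda>x. ((u s x - u t x) /\<^sub>R (s - t) - u' t x) $ i))"
      proof (rule l2_cong)
        have 1: "AE x in ?M. weak_deriv S \<alpha> ?q x =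
            1 / (s - t) * weak_deriv S \<alpha> (\<lambda>x. u s x $ i) x + - 1 / (s - t) * weak_deriv S \<alpha> (\<lambda>x. u t x $ i) x"
          by (rule weak_deriv_lincomb[OF S vsobolevD[OF u(1)[OF elim]] vsobolevD[OF u(1)[OF t]] \<alpha>(2)])
        have 2: "AE x in ?M. weak_deriv S \<alpha> (\<lambda>x. ?q x - u' t x $ i) x =
            weak_deriv S \<alpha> ?q x - weak_deriv S \<alpha> (\<lambda>x. u' t x $ i) x"
          by (rule weak_deriv_diff[OF S q vsobolevD[OF u(2)[OF t]] \<alpha>(2)])
        show "AE x in ?M. ?d s x = weak_deriv S \<alpha> (\<lambda>x. ((u s x - u t x) /\<^sub>R (s - t) - u' t x) $ i) x"
          unfolding e using 1 2
        proof eventually_elim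
          case (elim x)
          show ?case unfolding elim(2) elim(1) by (simp add: diff_divide_distrib)
        qed
        show "L2_on ?M (?d s)"
          using L2_on_diff[OF L2_on_scale[OF L2_on_diff[OF L(1)[OF elim] L(1)[OF t]], of "1 / (s - t)"] L(2)[OF t]]
          by simp
        show "L2_on ?M (weak_deriv S \<alpha> (\<lambda>x. ((u s x - u t x) /\<^sub>R (s - t) - u' t x) $ i))"
          by (rule sobolev_weak_deriv(2)[OF S vsobolevD[OF D] \<alpha>(2)])
      qed
      then show ?case using l2_weak_deriv_le[OF S D \<alpha>, of i] by simp
    qed
  qed
qed

text \<open>The function and its three first derivatives are each bounded by the norm, which gives
  the factor 4.\<close>

lemma h1_sq_le_vsobolev_norm:
  assumes S: "open S" and F: "F \<in> vsobolev m S" and m: "1 \<le> m"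
  shows "h1_sq S (\<lambda>x. F x $ i) \<le> 4 * (vsobolev_norm m S F)\<^sup>2"
proof -
  have "(l2 (lebesgue_on S) (\<lambda>x. F x $ i))\<^sup>2 \<le> (vsobolev_norm m S F)\<^sup>2"
    by (intro power_mono l2_le_vsobolev_norm S F m) simp
  moreover have "(\<Sum>k\<in>UNIV. (l2 (lebesgue_on S) (weak_deriv S (mi k 1) (\<lambda>x. F x $ i)))\<^sup>2) \<le> (\<Sum>k\<in>(UNIV :: 3 set). (vsobolev_norm m S F)\<^sup>2)"
    by (intro sum_mono power_mono l2_weak_deriv_le S F) (use m in simp_all)
  moreover have "(\<Sum>k\<in>(UNIV :: 3 set). (vsobolev_norm m S F)\<^sup>2) = 3 * (vsobolev_norm m S F)\<^sup>2" by simp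
  ultimately show ?thesis unfolding h1_sq_def by linarith
qed

lemma h1_sq_lincomb_le:
  assumes S: "open S" and f: "f \<in> sobolev 1 S" and g: "g \<in> sobolev 1 S"
  shows "h1_sq S (\<lambda>x. a * f x + b * g x) \<le> 2 * (a\<^sup>2 * h1_sq S f + b\<^sup>2 * h1_sq S g)"
proof -
  let ?M = "lebesgue_on S"
  have sq: "(l2 ?M h)\<^sup>2 \<le> 2 * (a\<^sup>2 * (l2 ?M p)\<^sup>2 + b\<^sup>2 * (l2 ?M q)\<^sup>2)"
    if ae: "AE x in ?M. h x = a * p x + b * q x" and L: "L2_on ?M h" "L2_on ?M p" "L2_on ?M q" for h p q
  proof -
    have "l2 ?M h = l2 ?M (\<lambda>x. a * p x + b * q x)" by (intro l2_cong ae L L2_on_add L2_on_scale)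
    also have "\<dots> \<le> l2 ?M (\<lambda>x. a * p x) + l2 ?M (\<lambda>x. b * q x)" by (intro l2_triangle L2_on_scale L)
    also have "\<dots> = \<bar>a\<bar> * l2 ?M p + \<bar>b\<bar> * l2 ?M q" by (simp add: l2_scale)
    finally have "(l2 ?M h)\<^sup>2 \<le> (\<bar>a\<bar> * l2 ?M p + \<bar>b\<bar> * l2 ?M q)\<^sup>2" by (intro power_mono) auto
    also have "\<dots> \<le> 2 * ((\<bar>a\<bar> * l2 ?M p)\<^sup>2 + (\<bar>b\<bar> * l2 ?M q)\<^sup>2)"
      using sum_squares_bound[of "\<bar>a\<bar> * l2 ?M p" "\<bar>b\<bar> * l2 ?M q"] by (simp add: power2_sum)
    finally show ?thesis by (simp add: power_mult_distrib)
  qed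
  have fg: "(\<lambda>x. a * f x + b * g x) \<in> sobolev 1 S" by (rule sobolev_lincomb[OF S f g])
  have 1: "(l2 ?M (\<lambda>x. a * f x + b * g x))\<^sup>2 \<le> 2 * (a\<^sup>2 * (l2 ?M f)\<^sup>2 + b\<^sup>2 * (l2 ?M g)\<^sup>2)"
    by (rule sq) (auto intro: sobolev_L2 f g fg)
  have 2: "(l2 ?M (weak_deriv S (mi k 1) (\<lambda>x. a * f x + b * g x)))\<^sup>2 \<le>
      2 * (a\<^sup>2 * (l2 ?M (weak_deriv S (mi k 1) f))\<^sup>2 + b\<^sup>2 * (l2 ?M (weak_deriv S (mi k 1) g))\<^sup>2)" for k
  proof (rule sq)
    show "AE x in ?M. weak_deriv S (mi k 1) (\<lambda>x. a * f x + b * g x) x =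
        a * weak_deriv S (mi k 1) f x + b * weak_deriv S (mi k 1) g x"
      by (rule weak_deriv_lincomb[OF S f g]) simp
  qed (use sobolev_weak_deriv(2)[OF S, of _ 1 "mi k 1"] f g fg in auto)
  have "(\<Sum>k\<in>UNIV. (l2 ?M (weak_deriv S (mi k 1) (\<lambda>x. a * f x + b * g x)))\<^sup>2) \<le>
      (\<Sum>k\<in>UNIV. 2 * (a\<^sup>2 * (l2 ?M (weak_deriv S (mi k 1) f))\<^sup>2 + b\<^sup>2 * (l2 ?M (weak_deriv S (mi k 1) g))\<^sup>2))"
    by (intro sum_mono 2)
  then show ?thesis using 1 by (simp add: h1_sq_def sum.distrib sum_distrib_left[symmetric] algebra_simps)
qed

lemma h1_sq_continuous:
  assumes S: "open S" and u: "continuous_in_time m S T u" and m: "1 \<le> m"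
  shows "continuous_on {0..T} (\<lambda>t. h1_sq S (\<lambda>x. u t x $ i))"
  unfolding h1_sq_def
  by (intro continuous_intros L2_cont_l2_sq continuous_in_time_L2_cont[OF S u m]
      continuous_in_time_weak_deriv[OF S u]) (use m in simp_all)

lemma l2_mult:
  assumes f: "L2_on M f" "L2_on M (\<lambda>x. (f x)\<^sup>2)" and g: "L2_on M g" "L2_on M (\<lambda>x. (g x)\<^sup>2)"
  shows "L2_on M (\<lambda>x. f x * g x)" "(l2 M (\<lambda>x. f x * g x))\<^sup>2 \<le> l2 M (\<lambda>x. (f x)\<^sup>2) * l2 M (\<lambda>x. (g x)\<^sup>2)"
proof -
  show "L2_on M (\<lambda>x. f x * g x)"
    using f g L2_on_mult[OF f(2) g(2)] by (auto simp: L2_on_def power_mult_distrib)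
  show "(l2 M (\<lambda>x. f x * g x))\<^sup>2 \<le> l2 M (\<lambda>x. (f x)\<^sup>2) * l2 M (\<lambda>x. (g x)\<^sup>2)"
    using ip_le[OF f(2) g(2)] by (simp add: l2_sq ip_def power_mult_distrib)
qed

text \<open>The difference of squares is (a - b)(a + b), and each factor has square in L2 by the
  Sobolev inequality: the first tends to zero with the H1 distance, the second stays bounded. Zero
  boundary values restrict this to the open interval.\<close>

lemma L2_cont_square:
  assumes S: "open S" and u: "continuous_in_time m S T u" and m: "1 \<le> m"
    and z: "\<And>t. t \<in> {0<..<T} \<Longrightarrow> u t \<in> vsobolev_zero S"
  shows "L2_cont (lebesgue_on S) {0<..<T} (\<lambda>t x. (u t x $ i)\<^sup>2)"
  unfolding L2_cont_def
proof (intro ballI conjI)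
  let ?M = "lebesgue_on S" and ?f = "\<lambda>t x. u t x $ i"
  fix t assume t: "t \<in> {0<..<T}"
  have H: "?f s \<in> H10 S" if "s \<in> {0<..<T}" for s by (rule vsobolev_zero_H10[OF S z[OF that]])
  have us: "u s \<in> vsobolev m S" if "s \<in> {0..T}" for s using u that by (simp add: continuous_in_time_def)
  show "L2_on ?M (\<lambda>x. (?f t x)\<^sup>2)" by (rule H10_L4(1)[OF S H[OF t]])
  let ?n = "\<lambda>s. vsobolev_norm m S (\<lambda>x. u s x - u t x)"
  have n0: "(?n \<longlongrightarrow> 0) (at t within {0<..<T})"
  proof (rule tendsto_within_subset)
    show "(?n \<longlongrightarrow> 0) (at t within {0..T})" using u t by (simp add: continuous_in_time_def)
  qed auto
  have hc: "((\<lambda>s. h1_sq S (?f s)) \<longlongrightarrow> h1_sq S (?f t)) (at t within {0<..<T})"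
  proof (rule tendsto_within_subset)
    show "((\<lambda>s. h1_sq S (?f s)) \<longlongrightarrow> h1_sq S (?f t)) (at t within {0..T})"
      using h1_sq_continuous[OF S u m, of i] t by (simp add: continuous_on_def)
  qed auto
  show "((\<lambda>s. l2 ?M (\<lambda>x. (?f s x)\<^sup>2 - (?f t x)\<^sup>2)) \<longlongrightarrow> 0) (at t within {0<..<T})"
  proof (rule Lim_null_comparison)
    show "\<forall>\<^sub>F s in at t within {0<..<T}. norm (l2 ?M (\<lambda>x. (?f s x)\<^sup>2 - (?f t x)\<^sup>2)) \<le>
       sqrt ((8 * (4 * (?n s)\<^sup>2)) * (8 * (2 * (1\<^sup>2 * h1_sq S (?f s) + 1\<^sup>2 * h1_sq S (?f t)))))"
      using eventually_at_within_mem
    proof eventually_elim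
      case (elim s)
      have st: "s \<in> {0..T}" "t \<in> {0..T}" using elim t by auto
      have d: "(\<lambda>x. ?f s x - ?f t x) \<in> H10 S" using H10_lincomb[OF S H[OF elim] H[OF t], of 1 "-1"] by simp
      have p: "(\<lambda>x. ?f s x + ?f t x) \<in> H10 S" using H10_lincomb[OF S H[OF elim] H[OF t], of 1 1] by simp
      have hd: "h1_sq S (\<lambda>x. ?f s x - ?f t x) \<le> 4 * (?n s)\<^sup>2"
        using h1_sq_le_vsobolev_norm[OF S vsobolev_diff[OF S us[OF st(1)] us[OF st(2)]] m, of i] by simp
      have hp: "h1_sq S (\<lambda>x. ?f s x + ?f t x) \<le> 2 * (1\<^sup>2 * h1_sq S (?f s) + 1\<^sup>2 * h1_sq S (?f t))"
        using h1_sq_lincomb_le[OF S H10_sobolev[OF H[OF elim]] H10_sobolev[OF H[OF t]], of 1 1] by simp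
      have "(l2 ?M (\<lambda>x. (?f s x - ?f t x) * (?f s x + ?f t x)))\<^sup>2 \<le>
          l2 ?M (\<lambda>x. (?f s x - ?f t x)\<^sup>2) * l2 ?M (\<lambda>x. (?f s x + ?f t x)\<^sup>2)"
        by (rule l2_mult(2)[OF sobolev_L2[OF H10_sobolev[OF d]] H10_L4(1)[OF S d] sobolev_L2[OF H10_sobolev[OF p]] H10_L4(1)[OF S p]])
      also have "\<dots> \<le> (8 * (4 * (?n s)\<^sup>2)) * (8 * (2 * (1\<^sup>2 * h1_sq S (?f s) + 1\<^sup>2 * h1_sq S (?f t))))"
      proof (intro mult_mono)
        show "l2 ?M (\<lambda>x. (?f s x - ?f t x)\<^sup>2) \<le> 8 * (4 * (?n s)\<^sup>2)" using H10_L4(2)[OF S d] hd by linarith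
        show "l2 ?M (\<lambda>x. (?f s x + ?f t x)\<^sup>2) \<le> 8 * (2 * (1\<^sup>2 * h1_sq S (?f s) + 1\<^sup>2 * h1_sq S (?f t)))"
          using H10_L4(2)[OF S p] hp by linarith
      qed simp_all
      finally have "l2 ?M (\<lambda>x. (?f s x - ?f t x) * (?f s x + ?f t x)) \<le>
          sqrt ((8 * (4 * (?n s)\<^sup>2)) * (8 * (2 * (1\<^sup>2 * h1_sq S (?f s) + 1\<^sup>2 * h1_sq S (?f t)))))"
        by (rule real_le_rsqrt)
      moreover have "(\<lambda>x. (?f s x - ?f t x) * (?f s x + ?f t x)) = (\<lambda>x. (?f s x)\<^sup>2 - (?f t x)\<^sup>2)"
        by (simp add: fun_eq_iff power2_eq_square algebra_simps)
      ultimately show ?case by (simp only: real_norm_def abs_of_nonneg[OF l2_nonneg])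
    qed
    have "((\<lambda>s. sqrt ((8 * (4 * (?n s)\<^sup>2)) * (8 * (2 * (1\<^sup>2 * h1_sq S (?f s) + 1\<^sup>2 * h1_sq S (?f t)))))) \<longlongrightarrow>
        sqrt ((8 * (4 * 0\<^sup>2)) * (8 * (2 * (1\<^sup>2 * h1_sq S (?f t) + 1\<^sup>2 * h1_sq S (?f t)))))) (at t within {0<..<T})"
      by (intro tendsto_intros n0 hc)
    then show "((\<lambda>s. sqrt ((8 * (4 * (?n s)\<^sup>2)) * (8 * (2 * (1\<^sup>2 * h1_sq S (?f s) + 1\<^sup>2 * h1_sq S (?f t)))))) \<longlongrightarrow> 0) (at t within {0<..<T})"
      by simp
  qed
qed

section \<open>The weak formulation tested with products\<close>

text \<open>No regularity of \<open>h\<close> matters: a simple function takes finitely many values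
  on measurable sets.\<close>

lemma simple_function_measurable:
  fixes h :: "_ \<Rightarrow> real"
  assumes s: "simple_in_time m S T s"
  shows "(\<lambda>t. h (s t)) \<in> borel_measurable (lebesgue_on {0..T})"
proof (rule measurableI)
  fix A :: "real set" assume "A \<in> sets borel"
  let ?G = "{g \<in> s ` {0..T}. h g \<in> A}"
  have fin: "finite ?G" using s by (simp add: simple_in_time_def)
  have "(\<lambda>t. h (s t)) -` A \<inter> space (lebesgue_on {0..T}) = (\<Union>g\<in>?G. {t\<in>{0..T}. s t = g})" by auto
  moreover have "(\<Union>g\<in>?G. {t\<in>{0..T}. s t = g}) \<in> sets lebesgue"
    using s by (intro sets.finite_UN fin) (auto simp: simple_in_time_def)
  ultimately have "(\<lambda>t. h (s t)) -` A \<inter> space (lebesgue_on {0..T}) \<in> sets lebesgue" by simp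
  then show "(\<lambda>t. h (s t)) -` A \<inter> space (lebesgue_on {0..T}) \<in> sets (lebesgue_on {0..T})"
    by (subst sets_restrict_space_iff) auto
qed simp

text \<open>Measurability in time comes from the simple approximants: their inner products are
  measurable and converge for almost every time. Integrability follows from the square integrable
  norm on a finite interval.\<close>

lemma ip_L2_in_time_integrable:
  assumes S: "open S" and f: "L2_in_time m S T f" and m: "1 \<le> m" and \<xi>: "L2_on (lebesgue_on S) \<xi>"
  shows "integrable (lebesgue_on {0..T}) (\<lambda>t. ip (lebesgue_on S) (\<lambda>x. f t x $ i) \<xi>)"
proof -
  let ?M = "lebesgue_on S" and ?J = "lebesgue_on {0..T}"
  let ?F = "\<lambda>t. ip ?M (\<lambda>x. f t x $ i) \<xi>"
  have fS: "AE t in ?J. f t \<in> vsobolev m S" and i2: "integrable ?J (\<lambda>t. (vsobolev_norm m S (f t))\<^sup>2)"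
    using f by (auto simp: L2_in_time_def)
  obtain s where s: "\<And>n::nat. simple_in_time m S T (s n)"
    and lim: "AE t in ?J. (\<lambda>n. vsobolev_norm m S (\<lambda>x. s n t x - f t x)) \<longlonglongrightarrow> 0"
    using f by (auto simp: L2_in_time_def)
  have sm: "(\<lambda>t. ip ?M (\<lambda>x. s n t x $ i) \<xi>) \<in> borel_measurable ?J" for n
    using simple_function_measurable[OF s[of n], of "\<lambda>g. ip ?M (\<lambda>x. g x $ i) \<xi>"] by simp
  \<comment> \<open>\<open>lim\<close> is a measurable function of time even where the sequence
    diverges, so it can stand in for the inner product with \<open>f\<close> off a null set.\<close>
  have limm: "(\<lambda>t. lim (\<lambda>n. ip ?M (\<lambda>x. s n t x $ i) \<xi>)) \<in> borel_measurable ?J"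
    by (rule borel_measurable_lim_metric[OF sm])
  have meas: "?F \<in> borel_measurable ?J"
  proof (rule measurable_lebesgue_on_AE[OF _ limm])
    have "AE t in ?J. t \<in> {0..T}" by (rule AE_I2) simp
    then show "AE t in ?J. ?F t = lim (\<lambda>n. ip ?M (\<lambda>x. s n t x $ i) \<xi>)"
      using fS lim
    proof eventually_elim
      case (elim t)
      have st: "s n t \<in> vsobolev m S" for n using s elim(1) by (simp add: simple_in_time_def)
      have "(\<lambda>n. ip ?M (\<lambda>x. s n t x $ i) \<xi>) \<longlonglongrightarrow> ?F t"
      proof (rule LIM_zero_cancel, rule Lim_null_comparison)
        show "(\<lambda>n. vsobolev_norm m S (\<lambda>x. s n t x - f t x) * l2 ?M \<xi>) \<longlonglongrightarrow> 0"
          using tendsto_mult_right[OF elim(3), of "l2 ?M \<xi>"] by simp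
        show "\<forall>\<^sub>F n in sequentially. norm (ip ?M (\<lambda>x. s n t x $ i) \<xi> - ?F t) \<le> vsobolev_norm m S (\<lambda>x. s n t x - f t x) * l2 ?M \<xi>"
        proof (intro always_eventually allI)
          fix n
          have d: "(\<lambda>x. s n t x - f t x) \<in> vsobolev m S" by (rule vsobolev_diff[OF S st elim(2)])
          have L: "L2_on ?M (\<lambda>x. s n t x $ i)" "L2_on ?M (\<lambda>x. f t x $ i)"
            using sobolev_L2[OF vsobolevD[OF st]] sobolev_L2[OF vsobolevD[OF elim(2)]] by auto
          have "ip ?M (\<lambda>x. s n t x $ i) \<xi> - ?F t = ip ?M (\<lambda>x. s n t x $ i - f t x $ i) \<xi>"
            by (rule ip_diff[OF L \<xi>, symmetric])
          also have "\<bar>\<dots>\<bar> \<le> l2 ?M (\<lambda>x. s n t x $ i - f t x $ i) * l2 ?M \<xi>" by (rule ip_le[OF L2_on_diff[OF L] \<xi>])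
          also have "\<dots> \<le> vsobolev_norm m S (\<lambda>x. s n t x - f t x) * l2 ?M \<xi>"
            using l2_le_vsobolev_norm[OF S d m, of i] by (intro mult_right_mono) auto
          finally show "norm (ip ?M (\<lambda>x. s n t x $ i) \<xi> - ?F t) \<le> vsobolev_norm m S (\<lambda>x. s n t x - f t x) * l2 ?M \<xi>" by simp
        qed
      qed
      then show ?case by (simp add: limI)
    qed
  qed simp
  interpret finite_measure ?J by (rule finite_measure_lebesgue_on) simp
  show ?thesis
  proof (rule Bochner_Integration.integrable_bound[OF _ meas])
    show "integrable ?J (\<lambda>t. (1 + (vsobolev_norm m S (f t))\<^sup>2) * l2 ?M \<xi>)" using i2 by simp
    show "AE t in ?J. norm (?F t) \<le> norm ((1 + (vsobolev_norm m S (f t))\<^sup>2) * l2 ?M \<xi>)"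
      using fS
    proof eventually_elim
      case (elim t)
      have "\<bar>?F t\<bar> \<le> l2 ?M (\<lambda>x. f t x $ i) * l2 ?M \<xi>" by (rule ip_le[OF sobolev_L2[OF vsobolevD[OF elim]] \<xi>])
      also have "\<dots> \<le> (1 + (vsobolev_norm m S (f t))\<^sup>2) * l2 ?M \<xi>"
      proof (intro mult_right_mono)
        have "n \<le> 1 + n\<^sup>2" for n :: real using sum_squares_bound[of 1 n] zero_le_power2[of n] by (simp, smt (verit) zero_le_power2)
        then show "l2 ?M (\<lambda>x. f t x $ i) \<le> 1 + (vsobolev_norm m S (f t))\<^sup>2"
          using l2_le_vsobolev_norm[OF S elim m, of i] by (meson order_trans)
      qed simp
      finally show ?case by simp
    qed
  qed
qed

lemma continuous_mult_test_integrable: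
  assumes g: "continuous_on {0<..<T} g" and \<eta>: "test_function {0<..<T} (\<eta> :: real \<Rightarrow> real)"
  shows "integrable (lebesgue_on {0..T}) (\<lambda>t. g t * \<eta> t)"
proof -
  obtain K where K: "smooth \<eta>" "compact K" "K \<subseteq> {0<..<T}" "\<And>t. t \<notin> K \<Longrightarrow> \<eta> t = 0"
    using \<eta> by (metis test_functionE)
  have "continuous_on K (\<lambda>t. g t * \<eta> t)"
    by (intro continuous_on_mult continuous_on_subset[OF g K(3)] smooth_continuous K(1))
  then have i: "integrable lborel (\<lambda>t. indicator K t *\<^sub>R (g t * \<eta> t))" by (rule borel_integrable_compact[OF K(2)])
  have e: "(\<lambda>t. indicator K t *\<^sub>R (g t * \<eta> t)) = (\<lambda>t. g t * \<eta> t)"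
    using K(4) by (auto simp: fun_eq_iff indicator_def)
  have i': "integrable lborel (\<lambda>t. g t * \<eta> t)" using i unfolding e .
  show ?thesis
  proof (subst lebesgue_on_lborel(1))
    show "g t * \<eta> t = 0" if "t \<notin> {0..T}" for t using that K(3) K(4)[of t] by force
  qed (use i' in auto)
qed

lemma bounded_continuous_mult_integrable:
  assumes "integrable (lebesgue_on {0..T}) f" and \<eta>: "test_function X (\<eta> :: real \<Rightarrow> real)"
  shows "integrable (lebesgue_on {0..T}) (\<lambda>t. f t * \<eta> t)"
proof -
  obtain B where "\<And>t. \<bar>\<eta> t\<bar> \<le> B" using test_function_bounded[OF \<eta>] by metis
  then show ?thesis
    by (rule integrable_bounded_mult[OF assms(1) borel_measurable_lebesgue_onI[OF smooth_measurable[OF test_function_smooth[OF \<eta>]]]])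
qed

lemma partial_product:
  fixes \<eta> :: "real \<Rightarrow> real" and \<xi> :: "'a::euclidean_space \<Rightarrow> real"
  assumes \<eta>: "smooth \<eta>"
    and \<xi>: "smooth \<xi>"
  shows "partial (1, 0) (\<lambda>z. \<eta> (fst z) * \<xi> (snd z)) = (\<lambda>z. partial 1 \<eta> (fst z) * \<xi> (snd z))"
proof
  fix z :: "real \<times> 'a"
  have 1: "((\<lambda>z. \<eta> (fst z)) has_derivative (\<lambda>v. frechet_derivative \<eta> (at (fst z)) (fst v))) (at z)"
    by (rule has_derivative_compose[OF has_derivative_fst[OF has_derivative_ident] has_derivative_smooth[OF \<eta>]])
  have 2: "((\<lambda>z. \<xi> (snd z)) has_derivative (\<lambda>v. frechet_derivative \<xi> (at (snd z)) (snd v))) (at z)"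
    by (rule has_derivative_compose[OF has_derivative_snd[OF has_derivative_ident] has_derivative_smooth[OF \<xi>]])
  have "frechet_derivative \<xi> (at (snd z)) 0 = 0"
    using has_derivative_linear[OF has_derivative_smooth[OF \<xi>]] linear_0 by blast
  then show "partial (1, 0) (\<lambda>z. \<eta> (fst z) * \<xi> (snd z)) z = partial 1 \<eta> (fst z) * \<xi> (snd z)"
    using partial_eq[OF has_derivative_mult[OF 1 2], of "(1, 0)"] by (simp add: partial_def)
qed

lemma weak_laplacian_cont:
  assumes S: "open S" and u: "continuous_in_time 3 S T u"
  shows "L2_cont (lebesgue_on S) {0..T} (\<lambda>t. weak_laplacian S (\<lambda>y. u t y $ i))"
  unfolding weak_laplacian_def[abs_def]
  by (intro L2_cont_sum continuous_in_time_weak_deriv[OF S u]) auto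

text \<open>The weak equation for a product test function, rewritten with inner products in space.
  Continuity of the nonlinear term is asked on the open interval only, which suffices because
  \<open>\<eta>\<close> has compact support there; at the remaining times plain integrability lets
  the space integral be split.\<close>

lemma solution_tested:
  assumes S: "open S" and sol: "is_solution N c S T (b0, b1, f) u" and f: "L2_in_time 2 S T f"
    and c: "\<And>g. L2_cont (lebesgue_on S) {0..T} g \<Longrightarrow> L2_cont (lebesgue_on S) {0..T} (\<lambda>t x. (c i x)\<^sup>2 * g t x)"
    and N: "\<And>t. t \<in> {0..T} \<Longrightarrow> integrable (lebesgue_on S) (\<lambda>x. N (u t x) * \<xi> x)"
      "continuous_on {0<..<T} (\<lambda>t. ip (lebesgue_on S) (\<lambda>x. N (u t x)) \<xi>)"
    and \<xi>: "test_function S \<xi>" and \<eta>: "test_function {0<..<T} \<eta>"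
  shows "(LINT t|lebesgue_on {0..T}. ip (lebesgue_on S) (\<lambda>x. u t x $ i) \<xi> * partial 1 (partial 1 \<eta>) t
       - ip (lebesgue_on S) (\<lambda>x. (c i x)\<^sup>2 * weak_laplacian S (\<lambda>y. u t y $ i) x) \<xi> * \<eta> t) =
     (LINT t|lebesgue_on {0..T}. ip (lebesgue_on S) (\<lambda>x. N (u t x)) \<xi> * \<eta> t) +
     (LINT t|lebesgue_on {0..T}. ip (lebesgue_on S) (\<lambda>x. f t x $ i) \<xi> * \<eta> t)"
proof -
  let ?M = "lebesgue_on S" and ?J = "lebesgue_on {0..T}"
  let ?\<phi> = "\<lambda>z. \<eta> (fst z) * \<xi> (snd z)"
  have sm: "smooth \<eta>" "smooth \<xi>" "smooth (partial 1 \<eta>)"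
    using test_function_smooth[OF \<eta>] test_function_smooth[OF \<xi>] by (auto intro: smooth_partial)
  have L\<xi>: "L2_on ?M \<xi>" by (rule L2_on_test_function[OF S \<xi>])
  have u: "continuous_in_time 3 S T u" using sol by (simp add: is_solution_def)
  have p2: "partial (1, 0) (partial (1, 0) ?\<phi>) (t, x) = partial 1 (partial 1 \<eta>) t * \<xi> x" for t x
    by (simp add: partial_product sm)
  have Lu: "L2_on ?M (\<lambda>x. u t x $ i)" if "t \<in> {0..T}" for t
    using L2_cont_L2[OF continuous_in_time_L2_cont[OF S u] that] by simp
  have Ll: "L2_on ?M (\<lambda>x. (c i x)\<^sup>2 * weak_laplacian S (\<lambda>y. u t y $ i) x)" if "t \<in> {0..T}" for t
    using L2_cont_L2[OF c[OF weak_laplacian_cont[OF S u]] that] .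
  have "(LINT t|?J. LINT x|?M. u t x $ i * partial (1, 0) (partial (1, 0) ?\<phi>) (t, x)
           - (c i x)\<^sup>2 * weak_laplacian S (\<lambda>y. u t y $ i) x * ?\<phi> (t, x)) =
        (LINT t|?J. LINT x|?M. (N (u t x) + f t x $ i) * ?\<phi> (t, x))"
    using sol test_function_times[OF \<eta> \<xi>] unfolding is_solution_def by blast
  moreover have "(LINT x|?M. u t x $ i * partial (1, 0) (partial (1, 0) ?\<phi>) (t, x)
           - (c i x)\<^sup>2 * weak_laplacian S (\<lambda>y. u t y $ i) x * ?\<phi> (t, x)) =
      ip ?M (\<lambda>x. u t x $ i) \<xi> * partial 1 (partial 1 \<eta>) t
       - ip ?M (\<lambda>x. (c i x)\<^sup>2 * weak_laplacian S (\<lambda>y. u t y $ i) x) \<xi> * \<eta> t" if t: "t \<in> {0..T}" for t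
  proof -
    have "(LINT x|?M. u t x $ i * partial (1, 0) (partial (1, 0) ?\<phi>) (t, x)
           - (c i x)\<^sup>2 * weak_laplacian S (\<lambda>y. u t y $ i) x * ?\<phi> (t, x)) =
        (LINT x|?M. (u t x $ i * \<xi> x) * partial 1 (partial 1 \<eta>) t - ((c i x)\<^sup>2 * weak_laplacian S (\<lambda>y. u t y $ i) x * \<xi> x) * \<eta> t)"
      unfolding p2 by (simp add: mult_ac)
    also have "\<dots> = (LINT x|?M. (u t x $ i * \<xi> x) * partial 1 (partial 1 \<eta>) t) -
        (LINT x|?M. ((c i x)\<^sup>2 * weak_laplacian S (\<lambda>y. u t y $ i) x * \<xi> x) * \<eta> t)"
      using L2_on_mult[OF Lu[OF t] L\<xi>] L2_on_mult[OF Ll[OF t] L\<xi>]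
      by (intro Bochner_Integration.integral_diff) auto
    finally show ?thesis by (simp add: ip_def)
  qed
  then have "(LINT t|?J. LINT x|?M. u t x $ i * partial (1, 0) (partial (1, 0) ?\<phi>) (t, x)
           - (c i x)\<^sup>2 * weak_laplacian S (\<lambda>y. u t y $ i) x * ?\<phi> (t, x)) =
      (LINT t|?J. ip ?M (\<lambda>x. u t x $ i) \<xi> * partial 1 (partial 1 \<eta>) t
       - ip ?M (\<lambda>x. (c i x)\<^sup>2 * weak_laplacian S (\<lambda>y. u t y $ i) x) \<xi> * \<eta> t)"
    by (intro Bochner_Integration.integral_cong refl) simp
  moreover have "(LINT t|?J. LINT x|?M. (N (u t x) + f t x $ i) * ?\<phi> (t, x)) =
      (LINT t|?J. ip ?M (\<lambda>x. N (u t x)) \<xi> * \<eta> t + ip ?M (\<lambda>x. f t x $ i) \<xi> * \<eta> t)"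
  proof -
    \<comment> \<open>The splitting holds for almost every time only, since \<open>f t\<close> is a
      Sobolev function only for almost every \<open>t\<close>. Measurability of the unsplit side is
      then inherited by completeness.\<close>
    have ae: "AE t in ?J. (LINT x|?M. (N (u t x) + f t x $ i) * ?\<phi> (t, x)) =
        ip ?M (\<lambda>x. N (u t x)) \<xi> * \<eta> t + ip ?M (\<lambda>x. f t x $ i) \<xi> * \<eta> t"
    proof -
      have 1: "AE t in ?J. f t \<in> vsobolev 2 S" using f by (simp add: L2_in_time_def)
      have 2: "AE t in ?J. t \<in> {0..T}" by (rule AE_I2) simp
      show ?thesis using 1 2
      proof eventually_elim
        case (elim t)
        have "(LINT x|?M. (N (u t x) + f t x $ i) * ?\<phi> (t, x)) =
            (LINT x|?M. (N (u t x) * \<xi> x) * \<eta> t + (f t x $ i * \<xi> x) * \<eta> t)"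
          by (simp add: algebra_simps)
        also have "\<dots> = (LINT x|?M. (N (u t x) * \<xi> x) * \<eta> t) + (LINT x|?M. (f t x $ i * \<xi> x) * \<eta> t)"
          using N(1)[OF elim(2)] L2_on_mult[OF sobolev_L2[OF vsobolevD[OF elim(1)]] L\<xi>, of i]
          by (intro Bochner_Integration.integral_add) auto
        finally show ?case by (simp add: ip_def)
      qed
    qed
    have m: "(\<lambda>t. ip ?M (\<lambda>x. N (u t x)) \<xi> * \<eta> t + ip ?M (\<lambda>x. f t x $ i) \<xi> * \<eta> t) \<in> borel_measurable ?J"
      using borel_measurable_integrable[OF continuous_mult_test_integrable[OF N(2) \<eta>]]
        borel_measurable_integrable[OF bounded_continuous_mult_integrable[OF ip_L2_in_time_integrable[OF S f _ L\<xi>, of i] \<eta>]]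
      by simp
    show ?thesis
      by (rule integral_cong_AE[OF measurable_lebesgue_on_AE[OF _ m ae] m ae]) simp
  qed
  moreover have "(LINT t|?J. ip ?M (\<lambda>x. N (u t x)) \<xi> * \<eta> t + ip ?M (\<lambda>x. f t x $ i) \<xi> * \<eta> t) =
      (LINT t|?J. ip ?M (\<lambda>x. N (u t x)) \<xi> * \<eta> t) + (LINT t|?J. ip ?M (\<lambda>x. f t x $ i) \<xi> * \<eta> t)"
    using continuous_mult_test_integrable[OF N(2) \<eta>]
      bounded_continuous_mult_integrable[OF ip_L2_in_time_integrable[OF S f _ L\<xi>, of i] \<eta>]
    by (intro Bochner_Integration.integral_add) auto
  ultimately show ?thesis by simp
qed

section \<open>Scaling the data\<close>

lemma sobolev_norm_sq_scale:
  assumes S: "open S" and f: "f \<in> sobolev m S"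
  shows "sobolev_norm_sq m S (\<lambda>x. a * f x) = a\<^sup>2 * sobolev_norm_sq m S f"
proof -
  let ?M = "lebesgue_on S"
  have "(LINT x|?M. (weak_deriv S \<alpha> (\<lambda>x. a * f x) x)\<^sup>2 + (a * f x)\<^sup>2) =
      a\<^sup>2 * (LINT x|?M. (weak_deriv S \<alpha> f x)\<^sup>2 + (f x)\<^sup>2)" if \<alpha>: "mi_order \<alpha> \<le> m" for \<alpha>
  proof -
    note L = sobolev_weak_deriv(2)[OF S f \<alpha>] sobolev_weak_deriv(2)[OF S sobolev_scale[OF S f, of a] \<alpha>] sobolev_L2[OF f]
    have "(LINT x|?M. (weak_deriv S \<alpha> (\<lambda>x. a * f x) x)\<^sup>2 + (a * f x)\<^sup>2) =
        (LINT x|?M. a\<^sup>2 * ((weak_deriv S \<alpha> f x)\<^sup>2 + (f x)\<^sup>2))"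
    proof (rule integral_cong_AE)
      show "AE x in ?M. (weak_deriv S \<alpha> (\<lambda>x. a * f x) x)\<^sup>2 + (a * f x)\<^sup>2 = a\<^sup>2 * ((weak_deriv S \<alpha> f x)\<^sup>2 + (f x)\<^sup>2)"
        using weak_deriv_scale[OF S f \<alpha>, of a]
      proof eventually_elim
        case (elim x)
        show ?case unfolding elim by (simp add: power_mult_distrib distrib_left)
      qed
    qed (use L in \<open>auto simp: L2_on_def\<close>)
    then show ?thesis by simp
  qed
  then show ?thesis unfolding sobolev_norm_sq_def sum_distrib_left by (intro sum.cong) auto
qed

lemma vsobolev_norm_scale:
  assumes S: "open S" and F: "F \<in> vsobolev m S"
  shows "vsobolev_norm m S (\<lambda>x. a *\<^sub>R F x) = \<bar>a\<bar> * vsobolev_norm m S F"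
  unfolding vsobolev_norm_def
  using sobolev_norm_sq_scale[OF S vsobolevD[OF F], of a]
  by (simp add: sum_distrib_left[symmetric] real_sqrt_mult)

text \<open>For a nonzero factor the level sets of the scaled function are level sets of the
  original one.\<close>

lemma simple_in_time_scale:
  assumes S: "open S" and s: "simple_in_time m S T s" and a: "a \<noteq> 0"
  shows "simple_in_time m S T (\<lambda>t x. a *\<^sub>R s t x)"
  unfolding simple_in_time_def
proof (intro conjI ballI allI)
  have "(\<lambda>t x. a *\<^sub>R s t x) ` {0..T} = (\<lambda>g x. a *\<^sub>R g x) ` (s ` {0..T})" by auto
  then show "finite ((\<lambda>t x. a *\<^sub>R s t x) ` {0..T})" using s by (simp add: simple_in_time_def)
  show "(\<lambda>x. a *\<^sub>R s t x) \<in> vsobolev m S" if "t \<in> {0..T}" for t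
    using s that by (intro vsobolev_scale S) (simp add: simple_in_time_def)
  fix g
  have "(\<lambda>x. a *\<^sub>R h x) = g \<longleftrightarrow> h = (\<lambda>x. inverse a *\<^sub>R g x)" for h :: "space \<Rightarrow> real^3"
  proof
    assume g: "(\<lambda>x. a *\<^sub>R h x) = g"
    show "h = (\<lambda>x. inverse a *\<^sub>R g x)" unfolding g[symmetric] using a by simp
  qed (use a in simp)
  then have "{t \<in> {0..T}. (\<lambda>x. a *\<^sub>R s t x) = g} = {t \<in> {0..T}. s t = (\<lambda>x. inverse a *\<^sub>R g x)}" by auto
  then show "{t \<in> {0..T}. (\<lambda>x. a *\<^sub>R s t x) = g} \<in> sets lebesgue" using s by (simp add: simple_in_time_def)
qed

lemma L2_in_time_scale:
  assumes S: "open S" and f: "L2_in_time m S T f" and a: "a \<noteq> 0"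
  shows "L2_in_time m S T (\<lambda>t x. a *\<^sub>R f t x)"
    and "L2_in_time_norm m S T (\<lambda>t x. a *\<^sub>R f t x) = \<bar>a\<bar> * L2_in_time_norm m S T f"
proof -
  let ?J = "lebesgue_on {0..T}"
  have fS: "AE t in ?J. f t \<in> vsobolev m S" and i2: "integrable ?J (\<lambda>t. (vsobolev_norm m S (f t))\<^sup>2)"
    using f by (auto simp: L2_in_time_def)
  obtain s where s: "\<And>n::nat. simple_in_time m S T (s n)"
    and lim: "AE t in ?J. (\<lambda>n. vsobolev_norm m S (\<lambda>x. s n t x - f t x)) \<longlonglongrightarrow> 0"
    using f by (auto simp: L2_in_time_def)
  have J: "AE t in ?J. t \<in> {0..T}" by (rule AE_I2) simp
  have ae: "AE t in ?J. (vsobolev_norm m S (\<lambda>x. a *\<^sub>R f t x))\<^sup>2 = a\<^sup>2 * (vsobolev_norm m S (f t))\<^sup>2"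
    using fS by eventually_elim (simp add: vsobolev_norm_scale[OF S] power_mult_distrib)
  have m1: "(\<lambda>t. a\<^sup>2 * (vsobolev_norm m S (f t))\<^sup>2) \<in> borel_measurable ?J" using i2 by auto
  have m2: "(\<lambda>t. (vsobolev_norm m S (\<lambda>x. a *\<^sub>R f t x))\<^sup>2) \<in> borel_measurable ?J"
    by (rule measurable_lebesgue_on_AE[OF _ m1 ae]) simp
  have i3: "integrable ?J (\<lambda>t. (vsobolev_norm m S (\<lambda>x. a *\<^sub>R f t x))\<^sup>2)"
    by (rule integrable_cong_AE_imp[OF _ m2 AE_symmetric[OF ae]]) (use i2 in simp)
  have "AE t in ?J. (\<lambda>n. vsobolev_norm m S (\<lambda>x. a *\<^sub>R s n t x - a *\<^sub>R f t x)) \<longlonglongrightarrow> 0"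
    using fS lim J
  proof eventually_elim
    case (elim t)
    have "vsobolev_norm m S (\<lambda>x. a *\<^sub>R s n t x - a *\<^sub>R f t x) = \<bar>a\<bar> * vsobolev_norm m S (\<lambda>x. s n t x - f t x)" for n
    proof -
      have "(\<lambda>x. s n t x - f t x) \<in> vsobolev m S"
        using s elim by (intro vsobolev_diff S) (auto simp: simple_in_time_def)
      from vsobolev_norm_scale[OF S this, of a] show ?thesis by (simp add: scaleR_diff_right)
    qed
    then show ?case using tendsto_mult_left[OF elim(2), of "\<bar>a\<bar>"] by simp
  qed
  moreover have "AE t in ?J. (\<lambda>x. a *\<^sub>R f t x) \<in> vsobolev m S"
    using fS by eventually_elim (rule vsobolev_scale[OF S])
  ultimately show "L2_in_time m S T (\<lambda>t x. a *\<^sub>R f t x)"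
    using i3 simple_in_time_scale[OF S s a] unfolding L2_in_time_def
    by (intro conjI exI[of _ "\<lambda>n t x. a *\<^sub>R s n t x"] allI) auto
  have "(LINT t|?J. (vsobolev_norm m S (\<lambda>x. a *\<^sub>R f t x))\<^sup>2) = a\<^sup>2 * (LINT t|?J. (vsobolev_norm m S (f t))\<^sup>2)"
    using integral_cong_AE[OF m2 m1 ae] by simp
  then show "L2_in_time_norm m S T (\<lambda>t x. a *\<^sub>R f t x) = \<bar>a\<bar> * L2_in_time_norm m S T f"
    by (simp add: L2_in_time_norm_def real_sqrt_mult)
qed

lemma scale_data_ball:
  assumes S: "open S" and F: "F \<in> data_ball S T" and a: "0 < a" "a \<le> 1"
  shows "scale_data a F \<in> data_ball S T"
proof -
  obtain b0 b1 f where [simp]: "F = (b0, b1, f)" by (cases F) auto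
  have d: "b0 \<in> vsobolev 3 S" "b1 \<in> vsobolev 2 S" "L2_in_time 2 S T f" "data_norm S T (b0, b1, f) \<le> 1"
    using F by (auto simp: data_ball_def)
  have "data_norm S T (scale_data a F) = a * data_norm S T (b0, b1, f)"
    using a d L2_in_time_scale(2)[OF S d(3), of a]
    by (simp add: data_norm_def scale_data_def vsobolev_norm_scale[OF S] distrib_left)
  also have "\<dots> \<le> 1 * 1"
  proof (rule mult_mono)
    show "0 \<le> data_norm S T (b0, b1, f)" by (simp add: data_norm_def L2_in_time_norm_def)
  qed (use a d in auto)
  finally show ?thesis
    using a d L2_in_time_scale(1)[OF S d(3), of a] vsobolev_scale[OF S]
    by (simp add: data_ball_def scale_data_def)
qed

lemma scale_data_scale_data: "scale_data a (scale_data b F) = scale_data (a * b) F"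
  by (cases F) (simp add: scale_data_def)

lemma scale_data_1: "scale_data 1 F = F"
  by (cases F) (simp add: scale_data_def)

section \<open>The remainder of the first-order expansion\<close>

lemma vsobolev_mono: "F \<in> vsobolev m S \<Longrightarrow> n \<le> m \<Longrightarrow> F \<in> vsobolev n S"
  by (auto simp: vsobolev_def intro: sobolev_mono)

lemma weak_deriv_AE_0:
  assumes S: "open S" and f: "f \<in> sobolev m S" "AE x in lebesgue_on S. f x = 0" and \<alpha>: "mi_order \<alpha> \<le> m"
  shows "AE x in lebesgue_on S. weak_deriv S \<alpha> f x = 0"
proof -
  \<comment> \<open>Zero is written as a multiple of the derivative so that its local integrability
    comes from the scaling rule.\<close>
  have "AE x in lebesgue_on S. weak_deriv S \<alpha> f x = 0 * weak_deriv S \<alpha> f x"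
  proof (rule AE_eq_if_weakly_eq[OF S])
    note w = sobolev_weak_deriv(1)[OF S f(1) \<alpha>, unfolded is_weak_deriv_def]
    show l: "locally_integrable S (weak_deriv S \<alpha> f)" using w by simp
    show "locally_integrable S (\<lambda>x. 0 * weak_deriv S \<alpha> f x)" by (rule locally_integrable_scale[OF l])
    fix \<phi> assume \<phi>: "test_function S \<phi>"
    have "(LINT x|lebesgue_on S. f x * partials \<alpha> \<phi> x) = (LINT x|lebesgue_on S. 0)"
    proof (rule integral_cong_AE)
      show "(\<lambda>x. f x * partials \<alpha> \<phi> x) \<in> borel_measurable (lebesgue_on S)"
        using test_function_mult_integrable[OF S _ test_function_partials[OF \<phi>]] w by auto
      show "AE x in lebesgue_on S. f x * partials \<alpha> \<phi> x = 0" using f(2) by eventually_elim simp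
    qed simp
    then show "(LINT x|lebesgue_on S. weak_deriv S \<alpha> f x * \<phi> x) = (LINT x|lebesgue_on S. 0 * weak_deriv S \<alpha> f x * \<phi> x)"
      using w \<phi> by simp
  qed
  then show ?thesis by simp
qed

lemma l2_AE_0: "AE x in M. f x = 0 \<Longrightarrow> L2_on M f \<Longrightarrow> l2 M f = 0"
  using l2_cong[where f=f and f'="\<lambda>_. 0"] by (simp add: L2_on_0) (simp add: l2_def)

lemma quadratic_eq: "quadratic v = (\<Sum>j\<in>UNIV. (v $ j)\<^sup>2)"
  unfolding quadratic_def power2_norm_eq_inner inner_vec_def by (simp add: power2_eq_square)

text \<open>One linear and one nonlinear solution for proportional data, with uniform bounds
  \<open>c0\<close>, \<open>C0\<close> on the speeds and a bound \<open>K\<close> on the H1 size of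
  the linear solution. Nothing is assumed about the size of \<open>U\<close>.\<close>

locale expansion =
  fixes S :: "space set" and c :: "3 \<Rightarrow> space \<Rightarrow> real" and T c0 C0 \<epsilon> K :: real
    and b0 b1 :: "space \<Rightarrow> real^3" and f u U :: "real \<Rightarrow> space \<Rightarrow> real^3"
  assumes S: "open S" "bounded S"
    and c: "\<And>i. continuous_on (closure S) (c i)"
    and c0: "0 < c0" "\<And>i x. x \<in> closure S \<Longrightarrow> c0 \<le> c i x" "\<And>i x. x \<in> closure S \<Longrightarrow> c i x \<le> C0" "0 \<le> C0"
    and T: "0 < T"
    and f: "L2_in_time 2 S T f"
    and lin: "is_solution no_nonlinearity c S T (b0, b1, f) u"
    and non: "is_solution quadratic c S T (scale_data \<epsilon> (b0, b1, f)) U"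
    and \<epsilon>: "0 < \<epsilon>"
    and K: "\<And>t. t \<in> {0..T} \<Longrightarrow> (\<Sum>j\<in>UNIV. h1_sq S (\<lambda>x. u t x $ j)) \<le> K" "0 \<le> K"
begin

abbreviation "M \<equiv> lebesgue_on S"

definition w where "w i t x = U t x $ i - \<epsilon> * u t x $ i"

lemma u_cont: "continuous_in_time 3 S T u" and U_cont: "continuous_in_time 3 S T U"
  using lin non by (auto simp: is_solution_def scale_data_def)

lemma u_vsobolev: "t \<in> {0..T} \<Longrightarrow> u t \<in> vsobolev 3 S" and U_vsobolev: "t \<in> {0..T} \<Longrightarrow> U t \<in> vsobolev 3 S"
  using u_cont U_cont by (auto simp: continuous_in_time_def)

lemma u_zero: "t \<in> {0<..<T} \<Longrightarrow> u t \<in> vsobolev_zero S" and U_zero: "t \<in> {0<..<T} \<Longrightarrow> U t \<in> vsobolev_zero S"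
  using lin non by (auto simp: is_solution_def scale_data_def)

lemma w_eq: "w i t = (\<lambda>x. 1 * U t x $ i + (- \<epsilon>) * u t x $ i)"
  by (simp add: w_def fun_eq_iff)

lemma w_sobolev: "t \<in> {0..T} \<Longrightarrow> w i t \<in> sobolev 3 S"
  unfolding w_eq by (intro sobolev_lincomb S vsobolevD u_vsobolev U_vsobolev)

lemma w_H10: "t \<in> {0<..<T} \<Longrightarrow> w i t \<in> H10 S"
  unfolding w_eq by (intro H10_lincomb S vsobolev_zero_H10 u_zero U_zero)

lemma w_weak_deriv:
  assumes "t \<in> {0..T}" "mi_order \<alpha> \<le> 3"
  shows "AE x in M. 1 * weak_deriv S \<alpha> (\<lambda>x. U t x $ i) x + (- \<epsilon>) * weak_deriv S \<alpha> (\<lambda>x. u t x $ i) x = weak_deriv S \<alpha> (w i t) x"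
  unfolding w_eq
  using weak_deriv_lincomb[OF S(1) vsobolevD[OF U_vsobolev[OF assms(1)], of i] vsobolevD[OF u_vsobolev[OF assms(1)], of i] assms(2), of 1 "- \<epsilon>"]
  by eventually_elim simp

lemma w_L2_cont: "L2_cont M {0..T} (w i)"
  unfolding w_eq[abs_def]
  by (intro L2_cont_lincomb continuous_in_time_L2_cont[OF S(1) u_cont] continuous_in_time_L2_cont[OF S(1) U_cont])
    simp_all

lemma w_weak_deriv_cont:
  assumes "1 \<le> mi_order \<alpha>" "mi_order \<alpha> \<le> 3"
  shows "L2_cont M {0..T} (\<lambda>t. weak_deriv S \<alpha> (w i t))"
proof (rule L2_cont_cong)
  show "L2_cont M {0..T} (\<lambda>t x. 1 * weak_deriv S \<alpha> (\<lambda>x. U t x $ i) x + (- \<epsilon>) * weak_deriv S \<alpha> (\<lambda>x. u t x $ i) x)"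
    by (intro L2_cont_lincomb continuous_in_time_weak_deriv[OF S(1) u_cont]
        continuous_in_time_weak_deriv[OF S(1) U_cont] assms)
qed (intro w_weak_deriv assms sobolev_weak_deriv(2)[OF S(1) w_sobolev]; assumption)+

lemma w_laplacian_cont: "L2_cont M {0..T} (\<lambda>t. weak_laplacian S (w i t))"
  unfolding weak_laplacian_def[abs_def] by (intro L2_cont_sum w_weak_deriv_cont) auto

lemma weight: "L2_cont M J g \<Longrightarrow> L2_cont M J (\<lambda>t x. (c i x)\<^sup>2 * g t x)"
proof (rule L2_cont_bounded_mult[of _ _ _ _ "C0\<^sup>2"])
  have "c i \<in> borel_measurable M"
    using continuous_on_subset[OF c closure_subset] S(1) by (simp add: continuous_imp_measurable_on_sets_lebesgue)
  then show "(\<lambda>x. (c i x)\<^sup>2) \<in> borel_measurable M" by simp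
  fix x assume "x \<in> space M"
  then have "x \<in> closure S" using closure_subset[of S] by auto
  then show "\<bar>(c i x)\<^sup>2\<bar> \<le> C0\<^sup>2" using c0(1) c0(2)[of x i] c0(3)[of x i] by (simp add: power_mono)
qed simp_all

lemma N_cont: "L2_cont M {0<..<T} (\<lambda>t x. quadratic (U t x))"
  unfolding quadratic_eq by (intro L2_cont_sum L2_cont_square[OF S(1) U_cont _ U_zero]) simp_all

text \<open>The equation for \<open>U\<close> minus the amplitude times the equation for
  \<open>u\<close>, tested with the same product. The contributions of \<open>f\<close> are equal
  after scaling and cancel, leaving the quadratic term as the only source.\<close>

lemma w_weak:
  assumes \<xi>: "test_function S \<xi>" and \<eta>: "test_function {0<..<T} \<eta>"
  shows "(LINT t|lebesgue_on {0..T}. ip M (w i t) \<xi> * partial 1 (partial 1 \<eta>) t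
         - ip M (\<lambda>x. (c i x)\<^sup>2 * weak_laplacian S (w i t) x) \<xi> * \<eta> t) =
      (LINT t|lebesgue_on {0..T}. ip M (\<lambda>x. quadratic (U t x)) \<xi> * \<eta> t)"
proof -
  let ?J = "lebesgue_on {0..T}"
  have L\<xi>: "L2_on M \<xi>" by (rule L2_on_test_function[OF S(1) \<xi>])
  have sm\<xi>: "\<xi> \<in> borel_measurable M" using L\<xi> by (simp add: L2_on_def)
  obtain B where B: "\<And>x. \<bar>\<xi> x\<bar> \<le> B" using test_function_bounded[OF \<xi>] by metis
  have \<eta>2: "test_function {0<..<T} (partial 1 (partial 1 \<eta>))" by (intro test_function_partial \<eta>) auto
  define W where "W = (\<lambda>v t. ip M (\<lambda>x. v t x $ i) \<xi> * partial 1 (partial 1 \<eta>) t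
       - ip M (\<lambda>x. (c i x)\<^sup>2 * weak_laplacian S (\<lambda>y. v t y $ i) x) \<xi> * \<eta> t)"
  define IF where "IF = (LINT t|?J. ip M (\<lambda>x. f t x $ i) \<xi> * \<eta> t)"
  have "integrable M (\<lambda>x. quadratic (U t x) * \<xi> x)" if t: "t \<in> {0..T}" for t
  proof (rule integrable_bounded_mult[OF _ sm\<xi> B])
    show "integrable M (\<lambda>x. quadratic (U t x))" unfolding quadratic_eq
      using sobolev_L2[OF vsobolevD[OF U_vsobolev[OF t]]] by (simp add: L2_on_def)
  qed
  moreover have "continuous_on {0<..<T} (\<lambda>t. ip M (\<lambda>x. quadratic (U t x)) \<xi>)"
    by (rule L2_cont_ip[OF N_cont L2_cont_const[OF L\<xi>]])
  moreover have "is_solution quadratic c S T (\<lambda>x. \<epsilon> *\<^sub>R b0 x, \<lambda>x. \<epsilon> *\<^sub>R b1 x, \<lambda>t x. \<epsilon> *\<^sub>R f t x) U"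
    using non by (simp add: scale_data_def)
  ultimately have "(LINT t|?J. W U t) = (LINT t|?J. ip M (\<lambda>x. quadratic (U t x)) \<xi> * \<eta> t) +
     (LINT t|?J. ip M (\<lambda>x. (\<epsilon> *\<^sub>R f t x) $ i) \<xi> * \<eta> t)"
    unfolding W_def using \<epsilon>
    by (intro solution_tested[OF S(1) _ L2_in_time_scale(1)[OF S(1) f] weight _ _ \<xi> \<eta>]) auto
  also have "(LINT t|?J. ip M (\<lambda>x. (\<epsilon> *\<^sub>R f t x) $ i) \<xi> * \<eta> t) = \<epsilon> * IF"
    by (simp add: IF_def ip_scale mult.assoc)
  finally have WU: "(LINT t|?J. W U t) = (LINT t|?J. ip M (\<lambda>x. quadratic (U t x)) \<xi> * \<eta> t) + \<epsilon> * IF" .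
  have "(LINT t|?J. W u t) = (LINT t|?J. ip M (\<lambda>x. no_nonlinearity (u t x)) \<xi> * \<eta> t) + IF"
    unfolding W_def IF_def
    by (rule solution_tested[OF S(1) lin f weight _ _ \<xi> \<eta>]) (simp_all add: no_nonlinearity_def ip_def)
  then have Wu: "(LINT t|?J. W u t) = IF" by (simp add: no_nonlinearity_def ip_def)
  have iW: "integrable ?J (W v)" if v: "continuous_in_time 3 S T v" for v
  proof -
    have "continuous_on {0<..<T} (\<lambda>t. ip M (\<lambda>x. v t x $ i) \<xi>)"
      by (rule continuous_on_subset[OF L2_cont_ip[OF continuous_in_time_L2_cont[OF S(1) v] L2_cont_const[OF L\<xi>]]]) auto
    moreover have "continuous_on {0<..<T} (\<lambda>t. ip M (\<lambda>x. (c i x)\<^sup>2 * weak_laplacian S (\<lambda>y. v t y $ i) x) \<xi>)"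
      by (rule continuous_on_subset[OF L2_cont_ip[OF weight[OF weak_laplacian_cont[OF S(1) v]] L2_cont_const[OF L\<xi>]]]) auto
    ultimately show ?thesis unfolding W_def
      by (intro Bochner_Integration.integrable_diff continuous_mult_test_integrable \<eta> \<eta>2)
  qed
  have eq: "ip M (w i t) \<xi> * partial 1 (partial 1 \<eta>) t - ip M (\<lambda>x. (c i x)\<^sup>2 * weak_laplacian S (w i t) x) \<xi> * \<eta> t =
      W U t - \<epsilon> * W u t" if t: "t \<in> {0..T}" for t
  proof -
    have Lu: "L2_on M (\<lambda>x. u t x $ i)" "L2_on M (\<lambda>x. U t x $ i)"
      using sobolev_L2[OF vsobolevD[OF u_vsobolev[OF t]]] sobolev_L2[OF vsobolevD[OF U_vsobolev[OF t]]] by auto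
    have 1: "ip M (w i t) \<xi> = ip M (\<lambda>x. U t x $ i) \<xi> - \<epsilon> * ip M (\<lambda>x. u t x $ i) \<xi>"
      using ip_diff[OF Lu(2) L2_on_scale[OF Lu(1), of \<epsilon>] L\<xi>] by (simp add: w_def[abs_def] ip_scale)
    let ?lu = "\<lambda>x. (c i x)\<^sup>2 * weak_laplacian S (\<lambda>y. u t y $ i) x"
      and ?lU = "\<lambda>x. (c i x)\<^sup>2 * weak_laplacian S (\<lambda>y. U t y $ i) x"
    have Ll: "L2_on M ?lu" "L2_on M ?lU" "L2_on M (\<lambda>x. (c i x)\<^sup>2 * weak_laplacian S (w i t) x)"
      using L2_cont_L2[OF weight[OF weak_laplacian_cont[OF S(1) u_cont]] t]
        L2_cont_L2[OF weight[OF weak_laplacian_cont[OF S(1) U_cont]] t]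
        L2_cont_L2[OF weight[OF w_laplacian_cont] t] by auto
    have "AE x in M. \<forall>k\<in>UNIV. 1 * weak_deriv S (mi k 2) (\<lambda>x. U t x $ i) x + (- \<epsilon>) * weak_deriv S (mi k 2) (\<lambda>x. u t x $ i) x = weak_deriv S (mi k 2) (w i t) x"
      by (rule eventually_ball_finite) (use w_weak_deriv[OF t] in auto)
    then have "AE x in M. (c i x)\<^sup>2 * weak_laplacian S (w i t) x = ?lU x - \<epsilon> * ?lu x"
    proof eventually_elim
      case (elim x)
      have "weak_laplacian S (w i t) x = (\<Sum>k\<in>UNIV. 1 * weak_deriv S (mi k 2) (\<lambda>x. U t x $ i) x + (- \<epsilon>) * weak_deriv S (mi k 2) (\<lambda>x. u t x $ i) x)"
        unfolding weak_laplacian_def using elim by (intro sum.cong) auto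
      also have "\<dots> = weak_laplacian S (\<lambda>y. U t y $ i) x - \<epsilon> * weak_laplacian S (\<lambda>y. u t y $ i) x"
        by (simp add: weak_laplacian_def sum_subtractf sum_distrib_left)
      finally have lap: "weak_laplacian S (w i t) x =
          weak_laplacian S (\<lambda>y. U t y $ i) x - \<epsilon> * weak_laplacian S (\<lambda>y. u t y $ i) x" .
      show ?case unfolding lap by (simp add: algebra_simps)
    qed
    then have "ip M (\<lambda>x. (c i x)\<^sup>2 * weak_laplacian S (w i t) x) \<xi> = ip M (\<lambda>x. ?lU x - \<epsilon> * ?lu x) \<xi>"
      by (intro ip_cong Ll L\<xi> L2_on_diff L2_on_scale) simp_all
    also have "\<dots> = ip M ?lU \<xi> - \<epsilon> * ip M ?lu \<xi>"
      using ip_diff[OF Ll(2) L2_on_scale[OF Ll(1), of \<epsilon>] L\<xi>] ip_scale[of M \<epsilon> ?lu \<xi>] by simp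
    finally have 2: "ip M (\<lambda>x. (c i x)\<^sup>2 * weak_laplacian S (w i t) x) \<xi> = ip M ?lU \<xi> - \<epsilon> * ip M ?lu \<xi>" .
    show ?thesis unfolding 1 2 W_def by (simp add: algebra_simps)
  qed
  have "(LINT t|?J. ip M (w i t) \<xi> * partial 1 (partial 1 \<eta>) t - ip M (\<lambda>x. (c i x)\<^sup>2 * weak_laplacian S (w i t) x) \<xi> * \<eta> t)
      = (LINT t|?J. W U t - \<epsilon> * W u t)"
    by (rule Bochner_Integration.integral_cong[OF refl]) (simp add: eq)
  also have "\<dots> = (LINT t|?J. W U t) - \<epsilon> * (LINT t|?J. W u t)"
    using iW[OF U_cont] iW[OF u_cont] by simp
  also have "\<dots> = (LINT t|?J. ip M (\<lambda>x. quadratic (U t x)) \<xi> * \<eta> t)" by (simp add: WU Wu)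
  finally show ?thesis .
qed

text \<open>Each component of \<open>U\<close> is that of \<open>w\<close> plus the scaled linear
  one. The factor 16 is 8 from the Sobolev inequality times 2 from splitting the squared H1 norm of
  a sum.\<close>

lemma quadratic_bound:
  assumes t: "t \<in> {0<..<T}"
  shows "L2_on M (\<lambda>x. quadratic (U t x))"
    "l2 M (\<lambda>x. quadratic (U t x)) \<le> 16 * ((\<Sum>j\<in>UNIV. h1_sq S (w j t)) + \<epsilon>\<^sup>2 * K)"
proof -
  show "L2_on M (\<lambda>x. quadratic (U t x))" by (rule L2_cont_L2[OF N_cont t])
  have t': "t \<in> {0..T}" using t by simp
  have H: "(\<lambda>x. U t x $ j) \<in> H10 S" for j by (rule vsobolev_zero_H10[OF S(1) U_zero[OF t]])
  have "l2 M (\<lambda>x. quadratic (U t x)) \<le> (\<Sum>j\<in>UNIV. l2 M (\<lambda>x. (U t x $ j)\<^sup>2))"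
    unfolding quadratic_eq by (rule l2_sum) (rule H10_L4(1)[OF S(1) H])
  also have "\<dots> \<le> (\<Sum>j\<in>UNIV. 16 * (h1_sq S (w j t) + \<epsilon>\<^sup>2 * h1_sq S (\<lambda>x. u t x $ j)))"
  proof (rule sum_mono)
    fix j
    have "l2 M (\<lambda>x. (U t x $ j)\<^sup>2) \<le> 8 * h1_sq S (\<lambda>x. U t x $ j)" by (rule H10_L4(2)[OF S(1) H])
    also have "h1_sq S (\<lambda>x. U t x $ j) = h1_sq S (\<lambda>x. 1 * w j t x + \<epsilon> * u t x $ j)" by (simp add: w_def)
    also have "\<dots> \<le> 2 * (1\<^sup>2 * h1_sq S (w j t) + \<epsilon>\<^sup>2 * h1_sq S (\<lambda>x. u t x $ j))"
      by (rule h1_sq_lincomb_le[OF S(1) sobolev_mono[OF w_sobolev[OF t']] sobolev_mono[OF vsobolevD[OF u_vsobolev[OF t']]]]) simp_all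
    finally show "l2 M (\<lambda>x. (U t x $ j)\<^sup>2) \<le> 16 * (h1_sq S (w j t) + \<epsilon>\<^sup>2 * h1_sq S (\<lambda>x. u t x $ j))" by simp
  qed
  also have "\<dots> = 16 * ((\<Sum>j\<in>UNIV. h1_sq S (w j t)) + \<epsilon>\<^sup>2 * (\<Sum>j\<in>UNIV. h1_sq S (\<lambda>x. u t x $ j)))"
    by (simp add: sum.distrib sum_distrib_left distrib_left)
  also have "\<dots> \<le> 16 * ((\<Sum>j\<in>UNIV. h1_sq S (w j t)) + \<epsilon>\<^sup>2 * K)"
    using K(1)[OF t'] by (simp add: mult_left_mono)
  finally show "l2 M (\<lambda>x. quadratic (U t x)) \<le> 16 * ((\<Sum>j\<in>UNIV. h1_sq S (w j t)) + \<epsilon>\<^sup>2 * K)" .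
qed

text \<open>The bootstrap with \<open>\<epsilon>\<close>^2 K as its parameter. In C each of the
  three components contributes 2 C0 from the zeroth-order term of the energy and 2 * 16 / c0 from
  the quadratic source.\<close>

lemma remainder_bound:
  defines "C \<equiv> 6 * C0 + 96 / c0"
  assumes small: "(\<epsilon>\<^sup>2 * K)\<^sup>2 * (C * T * exp (3 * C * T)) < 1" and t: "t \<in> {0..T}"
  shows "h1_sq S (w i t) \<le> (\<epsilon>\<^sup>2 * K)\<^sup>2 * (C * T * exp (3 * C * T))"
proof -
  have C: "0 \<le> C" using c0 by (simp add: C_def)
  have sub: "{0<..<T} \<subseteq> {0..T}" by auto
  obtain u' where u': "is_time_derivative 2 S T u u'" "continuous_in_time 2 S T u'" "AE x in M. u' 0 x = b1 x"
    using lin by (auto simp: is_solution_def)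
  obtain U' where U': "is_time_derivative 2 S T U U'" "continuous_in_time 2 S T U'" "AE x in M. U' 0 x = \<epsilon> *\<^sub>R b1 x"
    using non by (auto simp: is_solution_def scale_data_def)
  have init: "AE x in M. u 0 x = b0 x" "AE x in M. U 0 x = \<epsilon> *\<^sub>R b0 x"
    using lin non by (auto simp: is_solution_def scale_data_def)
  have us': "u' t \<in> vsobolev 2 S" and Us': "U' t \<in> vsobolev 2 S" if "t \<in> {0..T}" for t
    using u'(2) U'(2) that by (auto simp: continuous_in_time_def)
  have us2: "u t \<in> vsobolev 2 S" and Us2: "U t \<in> vsobolev 2 S" if "t \<in> {0..T}" for t
    using vsobolev_mono[OF u_vsobolev[OF that]] vsobolev_mono[OF U_vsobolev[OF that]] by auto
  define w' where "w' = (\<lambda>i t x. 1 * U' t x $ i + (- \<epsilon>) * u' t x $ i)"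
  have w'_sob: "w' i t \<in> sobolev 2 S" if "t \<in> {0..T}" for i t
    unfolding w'_def by (intro sobolev_lincomb S vsobolevD us' Us' that)
  have w'_cont: "L2_cont M {0..T} (w' i)" for i
    unfolding w'_def
    by (intro L2_cont_lincomb continuous_in_time_L2_cont[OF S(1) u'(2)] continuous_in_time_L2_cont[OF S(1) U'(2)])
      simp_all
  have w_der: "L2_deriv M {0..T} (w i) (w' i)" for i
    unfolding w_eq[abs_def] w'_def
    by (intro L2_deriv_lincomb is_time_derivative_L2_deriv[OF S(1), where m=2] us2 Us2 us' Us' u' U') simp_all
  have dw_der: "L2_deriv M {0..T} (\<lambda>t. weak_deriv S (mi k 1) (w i t)) (\<lambda>t. weak_deriv S (mi k 1) (w' i t))" for i k
  proof (rule L2_deriv_cong)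
    show "L2_deriv M {0..T} (\<lambda>t x. 1 * weak_deriv S (mi k 1) (\<lambda>x. U t x $ i) x + (- \<epsilon>) * weak_deriv S (mi k 1) (\<lambda>x. u t x $ i) x)
       (\<lambda>t x. 1 * weak_deriv S (mi k 1) (\<lambda>x. U' t x $ i) x + (- \<epsilon>) * weak_deriv S (mi k 1) (\<lambda>x. u' t x $ i) x)"
      by (intro L2_deriv_lincomb is_time_derivative_weak_deriv[OF S(1), where m=2] us2 Us2 us' Us' u' U') simp_all
    fix t assume t: "t \<in> {0..T}"
    show "AE x in M. 1 * weak_deriv S (mi k 1) (\<lambda>x. U t x $ i) x + (- \<epsilon>) * weak_deriv S (mi k 1) (\<lambda>x. u t x $ i) x = weak_deriv S (mi k 1) (w i t) x"
      by (rule w_weak_deriv[OF t]) simp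
    have "AE x in M. weak_deriv S (mi k 1) (w' i t) x = 1 * weak_deriv S (mi k 1) (\<lambda>x. U' t x $ i) x + (- \<epsilon>) * weak_deriv S (mi k 1) (\<lambda>x. u' t x $ i) x"
      unfolding w'_def by (rule weak_deriv_lincomb[OF S(1) vsobolevD[OF Us'[OF t]] vsobolevD[OF us'[OF t]]]) simp
    then show "AE x in M. 1 * weak_deriv S (mi k 1) (\<lambda>x. U' t x $ i) x + (- \<epsilon>) * weak_deriv S (mi k 1) (\<lambda>x. u' t x $ i) x = weak_deriv S (mi k 1) (w' i t) x"
      by eventually_elim simp
    show "L2_on M (weak_deriv S (mi k 1) (w i t))" "L2_on M (weak_deriv S (mi k 1) (w' i t))"
      using sobolev_weak_deriv(2)[OF S(1) w_sobolev[OF t]] sobolev_weak_deriv(2)[OF S(1) w'_sob[OF t]] by auto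
  qed
  \<comment> \<open>Every component of the remainder solves a scalar wave equation with its own
    speed, all of them with the same source.\<close>
  have wave: "wave_component S (c i) T (w i) (w' i) (\<lambda>t x. quadratic (U t x))" for i
  proof (rule wave_component.intro)
    show "0 < c i x" if "x \<in> closure S" for x using c0(1) c0(2)[OF that, of i] by linarith
    show "w i t \<in> sobolev 2 S" if "t \<in> {0<..<T}" for t
      using sobolev_mono[OF w_sobolev[of t i]] that by simp
    show "L2_cont M {0<..<T} (\<lambda>t. weak_deriv S (mi k 1) (w i t))" for k
      by (rule L2_cont_subset[OF w_weak_deriv_cont sub]) simp_all
  qed (intro S c w_H10 L2_cont_subset[OF w_L2_cont sub] L2_deriv_subset[OF w_der sub] L2_deriv_subset[OF dw_der sub]
      L2_cont_subset[OF w'_cont sub] L2_cont_subset[OF w_laplacian_cont sub] N_cont w_weak; assumption)+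
  let ?e = "\<lambda>i t. h1_sq S (w i t) + (l2 M (\<lambda>x. w' i t x / c i x))\<^sup>2"
  \<comment> \<open>The source couples the components, so the estimate closes only for the sum of
    the three energies.\<close>
  define E where "E = (\<lambda>t. \<Sum>i\<in>UNIV. ?e i t)"
  have e0: "0 \<le> ?e i t" for i t by (simp add: h1_sq_nonneg)
  have eE: "?e i t \<le> E t" for i t unfolding E_def by (rule member_le_sum) (use e0 in auto)
  have E0: "0 \<le> E t" for t using order_trans[OF e0 eE] .
  have "continuous_on {0..T} E"
    unfolding E_def h1_sq_def
    by (intro continuous_intros L2_cont_l2_sq w_L2_cont w_weak_deriv_cont wave_component.L2_weights(2)[OF wave] w'_cont) simp_all
  moreover have "E 0 = 0"
  proof -
    have T0: "0 \<in> {0..T}" using T by simp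
    \<comment> \<open>The data of \<open>U\<close> are exactly the scaled data of \<open>u\<close>,
      so the remainder starts from zero position and zero velocity.\<close>
    have w0: "AE x in M. w i 0 x = 0" for i using init by eventually_elim (simp add: w_def)
    have w'0: "AE x in M. w' i 0 x / c i x = 0" for i using u'(3) U'(3) by eventually_elim (simp add: w'_def)
    have "l2 M (w i 0) = 0" for i by (rule l2_AE_0[OF w0 sobolev_L2[OF w_sobolev[OF T0]]])
    moreover have "l2 M (weak_deriv S (mi k 1) (w i 0)) = 0" for i k
      by (rule l2_AE_0[OF weak_deriv_AE_0[OF S(1) w_sobolev[OF T0] w0] sobolev_weak_deriv(2)[OF S(1) w_sobolev[OF T0]]]) simp_all
    moreover have "l2 M (\<lambda>x. w' i 0 x / c i x) = 0" for i
      by (rule l2_AE_0[OF w'0 wave_component.L2_weight(1)[OF wave L2_cont_L2[OF w'_cont T0]]])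
    ultimately show ?thesis by (simp add: E_def h1_sq_def)
  qed
  moreover define E' where "E' = (\<lambda>t. \<Sum>i\<in>UNIV. 2 * ip M (w i t) (w' i t) +
      2 * ip M (\<lambda>x. quadratic (U t x) / c i x) (\<lambda>x. w' i t x / c i x))"
  have "(E has_real_derivative E' t) (at t)" if t: "t \<in> {0<..<T}" for t
  proof -
    have "(?e i has_real_derivative 2 * ip M (w i t) (w' i t) +
      2 * ip M (\<lambda>x. quadratic (U t x) / c i x) (\<lambda>x. w' i t x / c i x)) (at t)" for i
      using wave_component.energy_derivative[OF wave t, of i] unfolding wave_component.energy_def[OF wave, abs_def] .
    then show ?thesis unfolding E_def E'_def by (intro DERIV_sum)
  qed
  moreover have "E' t \<le> C * (E t + (E t + \<epsilon>\<^sup>2 * K) * sqrt (E t))" if t: "t \<in> {0<..<T}" for t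
  proof -
    have t': "t \<in> {0..T}" using t by simp
    let ?N = "\<lambda>x. quadratic (U t x)"
    have LN: "L2_on M ?N" by (rule quadratic_bound(1)[OF t])
    have "(\<Sum>j\<in>UNIV. h1_sq S (w j t)) \<le> E t" unfolding E_def by (intro sum_mono) simp
    then have N: "l2 M ?N \<le> 16 * (E t + \<epsilon>\<^sup>2 * K)"
      by (intro order_trans[OF quadratic_bound(2)[OF t]]) simp
    have term_le: "2 * ip M (w i t) (w' i t) + 2 * ip M (\<lambda>x. ?N x / c i x) (\<lambda>x. w' i t x / c i x) \<le>
        2 * C0 * E t + (32 / c0) * ((E t + \<epsilon>\<^sup>2 * K) * sqrt (E t))" for i
    proof -
      have cS: "c0 \<le> c i x" "c i x \<le> C0" "0 < c i x" if "x \<in> S" for x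
      proof -
        have "x \<in> closure S" using that closure_subset by blast
        then show "c0 \<le> c i x" "c i x \<le> C0" "0 < c i x" using c0(1) c0(2)[of x i] c0(3)[of x i] by auto
      qed
      have cm: "c i \<in> borel_measurable M" by (rule wave_component.c_measurable[OF wave])
      have Lw: "L2_on M (w i t)" and Lw': "L2_on M (w' i t)"
        using L2_cont_L2[OF w_L2_cont t'] L2_cont_L2[OF w'_cont t'] by auto
      have Lwc: "L2_on M (\<lambda>x. w' i t x / c i x)" and LNc: "L2_on M (\<lambda>x. ?N x / c i x)"
        by (intro wave_component.L2_weight(1)[OF wave] Lw' LN)+
      have le_E: "(l2 M (w i t))\<^sup>2 \<le> E t" "(l2 M (\<lambda>x. w' i t x / c i x))\<^sup>2 \<le> E t"
      proof -
        have "(l2 M (w i t))\<^sup>2 \<le> ?e i t" "(l2 M (\<lambda>x. w' i t x / c i x))\<^sup>2 \<le> ?e i t"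
          using h1_sq_nonneg[of S "w i t"] by (simp_all add: h1_sq_def sum_nonneg)
        then show "(l2 M (w i t))\<^sup>2 \<le> E t" "(l2 M (\<lambda>x. w' i t x / c i x))\<^sup>2 \<le> E t"
          using eE[of i t] by (meson order_trans)+
      qed
      have r: "l2 M (w i t) \<le> sqrt (E t)" "l2 M (\<lambda>x. w' i t x / c i x) \<le> sqrt (E t)"
        using le_E by (auto intro: real_le_rsqrt)
      \<comment> \<open>The energy contains the velocity divided by the speed; the upper bound
        \<open>C0\<close> recovers the velocity itself.\<close>
      have "l2 M (w' i t) = l2 M (\<lambda>x. c i x * (w' i t x / c i x))"
      proof (rule l2_cong)
        show "AE x in M. w' i t x = c i x * (w' i t x / c i x)"
          by (rule AE_I2) (use cS(3) in force)
        show "L2_on M (\<lambda>x. c i x * (w' i t x / c i x))"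
          by (rule L2_on_bounded_mult[OF Lwc cm, of C0]) (use cS in \<open>auto simp: abs_of_pos\<close>)
      qed (rule Lw')
      also have "\<dots> \<le> C0 * l2 M (\<lambda>x. w' i t x / c i x)"
        by (rule l2_bounded_mult[OF Lwc cm _ c0(4)]) (use cS in \<open>auto simp: abs_of_pos\<close>)
      finally have lw': "l2 M (w' i t) \<le> C0 * sqrt (E t)"
        using r(2) c0(4) by (meson mult_left_mono order_trans)
      have 1: "ip M (w i t) (w' i t) \<le> C0 * E t"
      proof -
        have "ip M (w i t) (w' i t) \<le> l2 M (w i t) * l2 M (w' i t)" using ip_le[OF Lw Lw'] by simp
        also have "\<dots> \<le> sqrt (E t) * (C0 * sqrt (E t))" by (intro mult_mono r lw') (use E0[of t] in auto)
        also have "\<dots> = C0 * E t" using E0[of t] by (simp add: mult.left_commute)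
        finally show ?thesis .
      qed
      have "l2 M (\<lambda>x. (1 / c i x) * ?N x) \<le> (1 / c0) * l2 M ?N"
      proof (rule l2_bounded_mult[OF LN])
        show "\<bar>1 / c i x\<bar> \<le> 1 / c0" if "x \<in> space M" for x
          using cS[of x] that c0(1) by (simp add: abs_of_pos frac_le)
      qed (use cm c0(1) in auto)
      then have lN: "l2 M (\<lambda>x. ?N x / c i x) \<le> (1 / c0) * (16 * (E t + \<epsilon>\<^sup>2 * K))"
      proof -
        have "(1 / c0) * l2 M ?N \<le> (1 / c0) * (16 * (E t + \<epsilon>\<^sup>2 * K))"
          using N c0(1) by (intro mult_left_mono) auto
        then show ?thesis using \<open>l2 M (\<lambda>x. (1 / c i x) * ?N x) \<le> _\<close> by simp
      qed
      have 2: "ip M (\<lambda>x. ?N x / c i x) (\<lambda>x. w' i t x / c i x) \<le> (16 / c0) * ((E t + \<epsilon>\<^sup>2 * K) * sqrt (E t))"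
      proof -
        have "ip M (\<lambda>x. ?N x / c i x) (\<lambda>x. w' i t x / c i x) \<le> l2 M (\<lambda>x. ?N x / c i x) * l2 M (\<lambda>x. w' i t x / c i x)"
          using ip_le[OF LNc Lwc] by simp
        also have "\<dots> \<le> ((1 / c0) * (16 * (E t + \<epsilon>\<^sup>2 * K))) * sqrt (E t)"
          by (intro mult_mono r lN) (use E0[of t] c0(1) K(2) in auto)
        finally show ?thesis by (simp add: algebra_simps)
      qed
      show ?thesis using 1 2 by simp
    qed
    have "E' t \<le> (\<Sum>i\<in>(UNIV::3 set). 2 * C0 * E t + (32 / c0) * ((E t + \<epsilon>\<^sup>2 * K) * sqrt (E t)))"
      unfolding E'_def by (intro sum_mono term_le)
    also have "\<dots> = 6 * C0 * E t + (96 / c0) * ((E t + \<epsilon>\<^sup>2 * K) * sqrt (E t))" by simp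
    also have "\<dots> \<le> C * E t + C * ((E t + \<epsilon>\<^sup>2 * K) * sqrt (E t))"
      by (intro add_mono mult_right_mono) (use c0 E0[of t] K(2) in \<open>auto simp: C_def\<close>)
    finally show ?thesis by (simp add: distrib_left)
  qed
  ultimately have "E t \<le> (\<epsilon>\<^sup>2 * K)\<^sup>2 * (C * T * exp (3 * C * T))"
    using E0 K(2) by (intro bootstrap[OF T C _ _ _ _ _ _ small t]) auto
  moreover have "h1_sq S (w i t) \<le> E t" using eE[of i t] zero_le_power2[of "l2 M (\<lambda>x. w' i t x / c i x)"] by linarith
  ultimately show ?thesis by linarith
qed

end

section \<open>From the remainder estimate to the boundary traces\<close>

lemma sound_speed_bounds:
  assumes S: "bounded S" "S \<noteq> {}" and c: "\<And>i::3. extended_sound_speed 3 m0 m1 \<Omega> (c i)"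
  obtains c0 C0 where "\<And>i. continuous_on (closure S) (c i)" "0 < c0" "0 \<le> C0"
    "\<And>i x. x \<in> closure S \<Longrightarrow> c0 \<le> c i x" "\<And>i x. x \<in> closure S \<Longrightarrow> c i x \<le> C0"
proof -
  have pos: "0 < c i x" for i x using c by (simp add: extended_sound_speed_def)
  \<comment> \<open>The class bounds \<open>m0\<close> and \<open>m1\<close> hold on the closure of
    \<open>\<Omega>\<close> only. On the larger set, bounds come from continuity and positivity of
    the extended speed; continuity of \<open>c\<close> is that of the square root of its
    square.\<close>
  have cont: "continuous_on (closure S) (c i)" for i
  proof -
    have "C_k_on (Suc 2) UNIV (\<lambda>x. (c i x)\<^sup>2)" using c[of i] by (simp add: extended_sound_speed_def eval_nat_numeral)
    then have "continuous_on UNIV (\<lambda>x. (c i x)\<^sup>2)"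
      unfolding C_k_on.simps by (blast intro: differentiable_imp_continuous_on)
    then have 1: "continuous_on UNIV (\<lambda>x. sqrt ((c i x)\<^sup>2))" by (rule continuous_on_real_sqrt)
    have 2: "(\<lambda>x. sqrt ((c i x)\<^sup>2)) = c i"
    proof
      fix x show "sqrt ((c i x)\<^sup>2) = c i x" using pos[of i x] by simp
    qed
    show ?thesis using continuous_on_subset[OF 1 subset_UNIV] unfolding 2 .
  qed
  have K: "compact (closure S)" "closure S \<noteq> {}" using S by auto
  have "\<exists>a. a \<in> closure S \<and> (\<forall>x\<in>closure S. c i a \<le> c i x)" for i
    using continuous_attains_inf[OF K cont[of i]] by blast
  then obtain a where a: "\<And>i x. x \<in> closure S \<Longrightarrow> c i (a i) \<le> c i x" by metis
  have "\<exists>b. b \<in> closure S \<and> (\<forall>x\<in>closure S. c i x \<le> c i b)" for i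
    using continuous_attains_sup[OF K cont[of i]] by blast
  then obtain b where b: "\<And>i x. x \<in> closure S \<Longrightarrow> c i x \<le> c i (b i)" by metis
  let ?A = "range (\<lambda>i. c i (a i))" and ?B = "range (\<lambda>i. c i (b i))"
  show thesis
  proof (rule that[of "Min ?A" "Max ?B"])
    show "0 < Min ?A" using pos by (subst Min_gr_iff) auto
    show "0 \<le> Max ?B" using pos by (subst Max_ge_iff) (auto intro: less_imp_le)
    show "Min ?A \<le> c i x" if "x \<in> closure S" for i x
      by (rule order_trans[OF Min_le a[OF that]]) auto
    show "c i x \<le> Max ?B" if "x \<in> closure S" for i x
      by (rule order_trans[OF b[OF that] Max_ge]) auto
  qed (rule cont)
qed

text \<open>The constants come from the speeds, the time and the linear solution, hence are the same
  for all amplitudes. This uniformity permits dividing the remainder by the amplitude and letting it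
  tend to zero.\<close>

lemma first_order_expansion:
  assumes S: "open S" "bounded S" "S \<noteq> {}" and c: "\<And>i. extended_sound_speed 3 m0 m1 \<Omega> (c i)"
    and T: "0 < T" and f: "L2_in_time 2 S T f"
    and lin: "is_solution no_nonlinearity c S T (b0, b1, f) u"
    and non: "\<And>\<epsilon>. 0 < \<epsilon> \<Longrightarrow> \<epsilon> < \<epsilon>1 \<Longrightarrow> is_solution quadratic c S T (scale_data \<epsilon> (b0, b1, f)) (U \<epsilon>)"
  obtains A e0 where "0 < e0" "0 \<le> A"
    "\<And>\<epsilon> t i. 0 < \<epsilon> \<Longrightarrow> \<epsilon> < e0 \<Longrightarrow> \<epsilon> < \<epsilon>1 \<Longrightarrow> t \<in> {0..T} \<Longrightarrow>
      h1_sq S (\<lambda>x. U \<epsilon> t x $ i - \<epsilon> * u t x $ i) \<le> A * \<epsilon> ^ 4"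
proof -
  obtain c0 C0 where cc: "\<And>i. continuous_on (closure S) (c i)" "0 < c0" "0 \<le> C0"
    "\<And>i x. x \<in> closure S \<Longrightarrow> c0 \<le> c i x" "\<And>i x. x \<in> closure S \<Longrightarrow> c i x \<le> C0"
    using sound_speed_bounds[where c=c, OF S(2,3) c] by metis
  have u: "continuous_in_time 3 S T u" using lin by (simp add: is_solution_def)
  have "continuous_on {0..T} (\<lambda>t. \<Sum>j\<in>UNIV. h1_sq S (\<lambda>x. u t x $ j))"
    by (intro continuous_on_sum h1_sq_continuous[OF S(1) u]) simp
  then have "bounded ((\<lambda>t. \<Sum>j\<in>UNIV. h1_sq S (\<lambda>x. u t x $ j)) ` {0..T})"
    by (intro compact_imp_bounded compact_continuous_image) auto
  then have "\<exists>K. \<forall>t\<in>{0..T}. \<bar>\<Sum>j\<in>UNIV. h1_sq S (\<lambda>x. u t x $ j)\<bar> \<le> K"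
    unfolding bounded_iff by (simp only: ball_simps real_norm_def)
  then obtain K where K: "\<And>t. t \<in> {0..T} \<Longrightarrow> \<bar>\<Sum>j\<in>UNIV. h1_sq S (\<lambda>x. u t x $ j)\<bar> \<le> K"
    by blast
  have K0: "0 \<le> K" using K[of 0] T abs_ge_zero by (meson atLeastAtMost_iff less_imp_le order_refl order_trans)
  define C where "C = 6 * C0 + 96 / c0"
  define A where "A = K\<^sup>2 * (C * T * exp (3 * C * T))"
  have "0 \<le> C" using cc by (simp add: C_def)
  then have A0: "0 \<le> A" using T by (simp add: A_def)
  have eq: "(\<epsilon>\<^sup>2 * K)\<^sup>2 * (C * T * exp (3 * C * T)) = A * \<epsilon> ^ 4" for \<epsilon>
    by (simp add: A_def power_mult_distrib mult_ac flip: power_mult)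
  show thesis
  \<comment> \<open>Below this threshold the fourth power of the amplitude is at most the amplitude,
    and A times it is less than 1, which is the smallness the bootstrap demands.\<close>
  proof (rule that[of "min 1 (1 / (A + 1))" A])
    show "0 < min 1 (1 / (A + 1))" using A0 by simp
    fix \<epsilon> t i assume e: "0 < \<epsilon>" "\<epsilon> < min 1 (1 / (A + 1))" "\<epsilon> < \<epsilon>1" and t: "t \<in> {0..T}"
    have ex: "expansion S c T c0 C0 \<epsilon> K b0 b1 f u (U \<epsilon>)"
    proof (rule expansion.intro)
      show "(\<Sum>j\<in>UNIV. h1_sq S (\<lambda>x. u t x $ j)) \<le> K" if "t \<in> {0..T}" for t
        using K[OF that] by simp
    qed (intro S cc T f lin non e K0; assumption)+
    have "\<epsilon> ^ 4 \<le> \<epsilon> ^ 1" using e by (intro power_decreasing) auto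
    then have "A * \<epsilon> ^ 4 \<le> A * \<epsilon>" using A0 by (simp add: mult_left_mono)
    also have "\<dots> \<le> (A + 1) * \<epsilon>" using e(1) by simp
    also have "\<dots> < 1" using e(2) A0 by (simp add: pos_less_divide_eq mult.commute)
    finally have small: "(\<epsilon>\<^sup>2 * K)\<^sup>2 * (C * T * exp (3 * C * T)) < 1" unfolding eq .
    show "h1_sq S (\<lambda>x. U \<epsilon> t x $ i - \<epsilon> * u t x $ i) \<le> A * \<epsilon> ^ 4"
      using expansion.remainder_bound[OF ex small[unfolded C_def] t, of i]
      unfolding eq[unfolded C_def] expansion.w_def[OF ex, abs_def] .
  qed (rule A0)
qed

lemma l2_le_sqrt_h1_sq:
  "l2 (lebesgue_on S) z \<le> sqrt (h1_sq S z)" "l2 (lebesgue_on S) (weak_deriv S (mi k 1) z) \<le> sqrt (h1_sq S z)"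
proof -
  have s: "0 \<le> (\<Sum>k\<in>UNIV. (l2 (lebesgue_on S) (weak_deriv S (mi k 1) z))\<^sup>2)"
    "(l2 (lebesgue_on S) (weak_deriv S (mi k 1) z))\<^sup>2 \<le> (\<Sum>k\<in>UNIV. (l2 (lebesgue_on S) (weak_deriv S (mi k 1) z))\<^sup>2)"
    by (auto intro: sum_nonneg member_le_sum)
  show "l2 (lebesgue_on S) z \<le> sqrt (h1_sq S z)"
    using s(1) by (intro real_le_rsqrt) (simp add: h1_sq_def)
  show "l2 (lebesgue_on S) (weak_deriv S (mi k 1) z) \<le> sqrt (h1_sq S z)"
    by (rule real_le_rsqrt) (use s(2) zero_le_power2[of "l2 (lebesgue_on S) z"] in \<open>unfold h1_sq_def, linarith\<close>)
qed

text \<open>On the frontier the nonlinear solutions cancel, so the difference of the remainders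
  divided by the amplitude equals the difference of the linear solutions there, for every amplitude.
  Its squared H1 norm is of order amplitude^4 over amplitude^2, so a sequence of amplitudes tending
  to zero feeds \<open>trace_zero\<close>.\<close>

lemma linear_traces_agree:
  assumes \<Omega>: "open \<Omega>" "lipschitz_boundary \<Omega>" and S: "open S" "bounded S" "closure \<Omega> \<subseteq> S"
    and c1: "\<And>i. extended_sound_speed 3 m0 m1 \<Omega> (c1 i)" and c2: "\<And>i. extended_sound_speed 3 m0 m1 \<Omega> (c2 i)"
    and T: "0 < T" and \<epsilon>1: "0 < \<epsilon>1" and f: "L2_in_time 2 S T f"
    and lin: "is_solution no_nonlinearity c1 S T (b0, b1, f) u1" "is_solution no_nonlinearity c2 S T (b0, b1, f) u2"
    and non1: "\<And>\<epsilon>. 0 < \<epsilon> \<Longrightarrow> \<epsilon> < \<epsilon>1 \<Longrightarrow> is_solution quadratic c1 S T (scale_data \<epsilon> (b0, b1, f)) (U1 \<epsilon>)"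
    and non2: "\<And>\<epsilon>. 0 < \<epsilon> \<Longrightarrow> \<epsilon> < \<epsilon>1 \<Longrightarrow> is_solution quadratic c2 S T (scale_data \<epsilon> (b0, b1, f)) (U2 \<epsilon>)"
    and agree: "\<And>\<epsilon> x. 0 < \<epsilon> \<Longrightarrow> \<epsilon> < \<epsilon>1 \<Longrightarrow> x \<in> frontier \<Omega> \<Longrightarrow> U1 \<epsilon> t x = U2 \<epsilon> t x"
    and t: "t \<in> {0..T}" and p: "p \<in> frontier \<Omega>"
  shows "u1 t p = u2 t p"
proof -
  let ?M = "lebesgue_on S"
  have "p \<in> S" using p S(3) by (auto simp: frontier_def)
  then have ne: "S \<noteq> {}" by auto
  obtain A1 e1 where A1: "0 < e1" "0 \<le> A1"
    "\<And>\<epsilon> i. 0 < \<epsilon> \<Longrightarrow> \<epsilon> < e1 \<Longrightarrow> \<epsilon> < \<epsilon>1 \<Longrightarrow>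
      h1_sq S (\<lambda>x. U1 \<epsilon> t x $ i - \<epsilon> * u1 t x $ i) \<le> A1 * \<epsilon> ^ 4"
  proof -
    show thesis
      by (rule first_order_expansion[OF S(1,2) ne c1 T f lin(1) non1], assumption, assumption, rule that)
        (use t in auto)
  qed
  obtain A2 e2 where A2: "0 < e2" "0 \<le> A2"
    "\<And>\<epsilon> i. 0 < \<epsilon> \<Longrightarrow> \<epsilon> < e2 \<Longrightarrow> \<epsilon> < \<epsilon>1 \<Longrightarrow>
      h1_sq S (\<lambda>x. U2 \<epsilon> t x $ i - \<epsilon> * u2 t x $ i) \<le> A2 * \<epsilon> ^ 4"
  proof -
    show thesis
      by (rule first_order_expansion[OF S(1,2) ne c2 T f lin(2) non2], assumption, assumption, rule that)
        (use t in auto)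
  qed
  define d where "d = min \<epsilon>1 (min e1 e2)"
  \<comment> \<open>The double successor makes the factor strictly less than 1 already at n = 0, so
    that every amplitude lies strictly below all three thresholds.\<close>
  define e where "e = (\<lambda>n. d * inverse (real (Suc (Suc n))))"
  have d: "0 < d" using \<epsilon>1 A1 A2 by (simp add: d_def)
  have e: "0 < e n" "e n < \<epsilon>1" "e n < e1" "e n < e2" for n
  proof -
    show "0 < e n" using d by (simp add: e_def)
    have "inverse (real (Suc (Suc n))) < 1" by (simp add: inverse_eq_divide)
    then have "e n < d * 1" unfolding e_def using d by (intro mult_strict_left_mono)
    then show "e n < \<epsilon>1" "e n < e1" "e n < e2" by (auto simp: d_def)
  qed
  have e_lim: "e \<longlonglongrightarrow> 0"
    using tendsto_mult_left[OF LIMSEQ_Suc[OF LIMSEQ_inverse_real_of_nat], of d] by (simp add: e_def)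
  have vs: "v t \<in> vsobolev 3 S" "continuous_on S (v t)" if "is_solution N c S T F v" for N c F v
    using that t by (auto simp: is_solution_def continuous_in_time_def split: prod.splits)
  have "u1 t p $ i = u2 t p $ i" for i
  proof -
    define w1 where "w1 = (\<lambda>n x. U1 (e n) t x $ i - e n * u1 t x $ i)"
    define w2 where "w2 = (\<lambda>n x. U2 (e n) t x $ i - e n * u2 t x $ i)"
    \<comment> \<open>The signs are chosen so that, once the nonlinear values cancel, what remains
      on the frontier is u1 - u2.\<close>
    define G where "G = (\<lambda>n x. - (1 / e n) * w1 n x + (1 / e n) * w2 n x)"
    note v = vs[OF lin(1)] vs[OF lin(2)] vs[OF non1[OF e(1,2)]] vs[OF non2[OF e(1,2)]]
    have w_sob: "w1 n \<in> sobolev 1 S" "w2 n \<in> sobolev 1 S" for n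
    proof -
      have "w1 n \<in> sobolev 3 S" "w2 n \<in> sobolev 3 S"
        unfolding w1_def w2_def by (intro sobolev_diff sobolev_scale S vsobolevD v)+
      then show "w1 n \<in> sobolev 1 S" "w2 n \<in> sobolev 1 S" by (auto intro: sobolev_mono)
    qed
    have w_cont: "continuous_on S (w1 n)" "continuous_on S (w2 n)" for n
      unfolding w1_def w2_def by (intro continuous_intros v)+
    have bound: "h1_sq S (G n) \<le> 2 * (A1 + A2) * (e n)\<^sup>2" for n
    proof -
      have "h1_sq S (G n) \<le> 2 * ((- (1 / e n))\<^sup>2 * h1_sq S (w1 n) + (1 / e n)\<^sup>2 * h1_sq S (w2 n))"
        unfolding G_def by (rule h1_sq_lincomb_le[OF S(1) w_sob])
      also have "\<dots> \<le> 2 * ((- (1 / e n))\<^sup>2 * (A1 * e n ^ 4) + (1 / e n)\<^sup>2 * (A2 * e n ^ 4))"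
        unfolding w1_def w2_def
        by (intro mult_left_mono add_mono A1(3) A2(3) e) simp_all
      also have "\<dots> = 2 * (A1 + A2) * (e n)\<^sup>2"
        using e(1)[of n] by (simp add: field_simps power2_eq_square power4_eq_xxxx)
      finally show ?thesis .
    qed
    have "(\<lambda>n. sqrt (2 * (A1 + A2) * (e n)\<^sup>2)) \<longlonglongrightarrow> sqrt (2 * (A1 + A2) * 0\<^sup>2)"
      by (intro tendsto_intros e_lim)
    then have lim: "(\<lambda>n. sqrt (2 * (A1 + A2) * (e n)\<^sup>2)) \<longlonglongrightarrow> 0" by simp
    have small: "l2 ?M (G n) \<le> sqrt (2 * (A1 + A2) * (e n)\<^sup>2)"
      "l2 ?M (weak_deriv S (mi k 1) (G n)) \<le> sqrt (2 * (A1 + A2) * (e n)\<^sup>2)" for n k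
      using l2_le_sqrt_h1_sq(1)[where S=S and z="G n"] l2_le_sqrt_h1_sq(2)[where S=S and z="G n" and k=k]
        real_sqrt_le_mono[OF bound[of n]]
      by (meson order_trans)+
    have "(\<lambda>x. u1 t x $ i - u2 t x $ i) p = 0"
    proof (rule trace_zero[OF \<Omega> S p, where G=G])
      show "continuous_on S (\<lambda>x. u1 t x $ i - u2 t x $ i)" by (intro continuous_intros v)
      show "continuous_on S (G n)" for n unfolding G_def by (intro continuous_intros w_cont)
      show "G n \<in> sobolev 1 S" for n unfolding G_def by (rule sobolev_lincomb[OF S(1) w_sob])
      show "G n x = u1 t x $ i - u2 t x $ i" if "x \<in> frontier \<Omega>" for n x
        using agree[OF e(1,2) that, of n] e(1)[of n] by (simp add: G_def w1_def w2_def field_simps)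
      show "(\<lambda>n. l2 ?M (G n)) \<longlonglongrightarrow> 0"
        by (rule tendsto_sandwich[OF _ _ tendsto_const lim]) (use small(1) in auto)
      show "(\<lambda>n. l2 ?M (weak_deriv S (mi k 1) (G n))) \<longlonglongrightarrow> 0" for k
        by (rule tendsto_sandwich[OF _ _ tendsto_const lim]) (use small(2) in auto)
    qed
    then show ?thesis by simp
  qed
  then show ?thesis by (simp add: vec_eq_iff)
qed

text \<open>A time below the supremum lies below some admissible \<open>\<tau>\<close>, and
  admissibility of \<open>\<tau>\<close> includes well-posedness for all shorter positive
  times.\<close>

lemma well_posed_below_existence_time:
  assumes "ereal T < existence_time c S D \<epsilon>" "0 < T"
  shows "well_posed quadratic c S D \<epsilon> T"
proof -
  obtain \<tau> where "ereal T < ereal \<tau>" "\<forall>T. 0 < T \<and> T \<le> \<tau> \<longrightarrow> well_posed quadratic c S D \<epsilon> T"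
    using assms(1) unfolding existence_time_def less_Sup_iff by auto
  then show ?thesis using assms(2) by simp
qed

text \<open>Well-posedness is given at the amplitude \<open>\<epsilon>1\<close> only. Smaller
  amplitudes are reached by shrinking the profile by \<open>\<epsilon> / \<epsilon>1\<close>, which
  stays in \<open>D\<close> and in the unit ball.\<close>

lemma solution_exists:
  assumes S: "open S" and wp: "well_posed quadratic c S D \<epsilon>1 T" and F: "F \<in> D" "F \<in> data_ball S T"
    and D: "\<And>F a. F \<in> D \<Longrightarrow> 0 < a \<Longrightarrow> a \<le> 1 \<Longrightarrow> scale_data a F \<in> D" and \<epsilon>: "0 < \<epsilon>" "\<epsilon> < \<epsilon>1"
  shows "is_solution quadratic c S T (scale_data \<epsilon> F) (SOME u. is_solution quadratic c S T (scale_data \<epsilon> F) u)"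
proof -
  define a where "a = \<epsilon> / \<epsilon>1"
  have a: "0 < a" "a \<le> 1" "\<epsilon>1 * a = \<epsilon>" using \<epsilon> by (auto simp: a_def)
  have "scale_data a F \<in> D \<inter> data_ball S T" using D[OF F(1) a(1,2)] scale_data_ball[OF S F(2) a(1,2)] by blast
  then have "uniquely_solvable quadratic c S T (scale_data \<epsilon>1 (scale_data a F))"
    using wp unfolding well_posed_def by blast
  then show ?thesis unfolding uniquely_solvable_def scale_data_scale_data a(3) by (metis someI_ex)
qed

theorem theorem1:
  fixes \<Omega> \<Omega>' :: "space set"
    and m0 m1 \<epsilon>1 T :: real
    and c1 c2 :: "3 \<Rightarrow> space \<Rightarrow> real"
    and D :: "data set"
  assumes "bounded_domain \<Omega>" and "lipschitz_boundary \<Omega>"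
    and "bounded_domain \<Omega>'" and "closure \<Omega> \<subseteq> \<Omega>'"
    and "0 < m0" and "m0 \<le> m1"
    and "\<forall>i. extended_sound_speed 3 m0 m1 \<Omega> (c1 i)"
    and "\<forall>i. extended_sound_speed 3 m0 m1 \<Omega> (c2 i)"
    and "c1 \<noteq> c2"
    and "\<forall>F\<in>D. \<forall>a. 0 < a \<and> a \<le> 1 \<longrightarrow> scale_data a F \<in> D"
    and "0 < \<epsilon>1" and "\<epsilon>1 < 1" and "0 < T"
    and "ereal T < existence_time c1 \<Omega>' D \<epsilon>1"
    and "ereal T < existence_time c2 \<Omega>' D \<epsilon>1"
    and "well_posed no_nonlinearity c1 \<Omega>' D 1 T"
    and "well_posed no_nonlinearity c2 \<Omega>' D 1 T"
    and "\<forall>\<epsilon>\<in>{0<..<\<epsilon>1}. \<forall>F1\<in>D \<inter> data_ball \<Omega>' T.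
           nonlinear_map c1 \<Omega> \<Omega>' T (scale_data \<epsilon> F1) = nonlinear_map c2 \<Omega> \<Omega>' T (scale_data \<epsilon> F1)"
  shows "\<forall>F1\<in>D \<inter> data_ball \<Omega>' T.
           linear_map c1 \<Omega> \<Omega>' T F1 = linear_map c2 \<Omega> \<Omega>' T F1"
proof (intro ballI)
  fix F1 assume F1: "F1 \<in> D \<inter> data_ball \<Omega>' T"
  obtain b0 b1 f where F: "F1 = (b0, b1, f)" by (cases F1) auto
  have S: "open \<Omega>'" "bounded \<Omega>'" "open \<Omega>" using assms(1,3) by (auto simp: bounded_domain_def)
  have f: "L2_in_time 2 \<Omega>' T f" using F1 by (auto simp: F data_ball_def)
  define u where "u = (\<lambda>c. SOME u. is_solution no_nonlinearity c \<Omega>' T F1 u)"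
  define U where "U = (\<lambda>c \<epsilon>. SOME u. is_solution quadratic c \<Omega>' T (scale_data \<epsilon> F1) u)"
  have u: "is_solution no_nonlinearity c \<Omega>' T (b0, b1, f) (u c)" if "well_posed no_nonlinearity c \<Omega>' D 1 T" for c
  proof -
    \<comment> \<open>Linear well-posedness is hypothesised at amplitude 1, where scaling is the
      identity.\<close>
    have "uniquely_solvable no_nonlinearity c \<Omega>' T (scale_data 1 F1)"
      using that F1 unfolding well_posed_def by blast
    then show ?thesis unfolding uniquely_solvable_def scale_data_1 u_def F by (metis someI_ex)
  qed
  have U: "is_solution quadratic c \<Omega>' T (scale_data \<epsilon> (b0, b1, f)) (U c \<epsilon>)"
    if "ereal T < existence_time c \<Omega>' D \<epsilon>1" "0 < \<epsilon>" "\<epsilon> < \<epsilon>1" for c \<epsilon>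
    unfolding U_def F[symmetric]
    by (rule solution_exists[OF S(1) well_posed_below_existence_time[OF that(1) assms(13)] _ _ _ that(2,3)])
      (use F1 assms(10) in auto)
  have agree: "U c1 \<epsilon> t x = U c2 \<epsilon> t x"
    if "0 < \<epsilon>" "\<epsilon> < \<epsilon>1" "x \<in> frontier \<Omega>" "t \<in> {0..T}" for \<epsilon> t x
  proof -
    \<comment> \<open>The maps are restrictions of the very solutions selected by
      \<open>SOME\<close> in the definition of \<open>U\<close>, so equality of the maps can be read
      off pointwise.\<close>
    have "nonlinear_map c1 \<Omega> \<Omega>' T (scale_data \<epsilon> F1) = nonlinear_map c2 \<Omega> \<Omega>' T (scale_data \<epsilon> F1)"
      using assms(18) F1 that by simp
    from fun_cong[OF this, of "(t, x)"] show ?thesis using that by (simp add: source_to_solution_def U_def)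
  qed
  show "linear_map c1 \<Omega> \<Omega>' T F1 = linear_map c2 \<Omega> \<Omega>' T F1"
    unfolding source_to_solution_def
  proof (rule restrict_ext, clarify)
    fix t x assume "t \<in> {0..T}" "x \<in> frontier \<Omega>"
    then show "(SOME u. is_solution no_nonlinearity c1 \<Omega>' T F1 u) t x = (SOME u. is_solution no_nonlinearity c2 \<Omega>' T F1 u) t x"
      using linear_traces_agree[OF S(3) assms(2) S(1,2) assms(4) _ _ assms(13,11) f
          u[OF assms(16)] u[OF assms(17)] U[OF assms(14)] U[OF assms(15)] agree] assms(7,8)
      unfolding u_def by blast
  qed
qed

end
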